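(* Let $(X,\mathsf d,\mathfrak m)$ be a metric measure space and $f,g\in\mathrm{BV}(X)\cap C_b(X)$. Then $fg\in\mathrm{BV}(X)$ and $$\mathrm D(fg)=f\,\mathrm Dg+g\,\mathrm Df.$$ In particular, $|\mathrm D(fg)|\le|f||\mathrm Dg|+|g||\mathrm Df|$ as measures.
   Context: **Local vector measures.** A normed $C_b(X)$-module is a normed space $(\mathcal V,\|\cdot\|)$ that is algebraically a module over $C_b(X)$ (bounded continuous functions) with $\|\sum_if_iv_i\|\le\max_i\|f_i\|_\infty\max_i\|v_i\|$ for finitely many $v_i\in\mathcal V$ and $f_i\in C_b(X)$ with pairwise disjoint supports. For $A$ open, $\|v\|_{|A}:=\sup\{\|fv\|:f\in C_b(X),\operatorname{supp}f\subseteq A,\|f\|_\infty\le1\}$. A local vector measure on $\mathcal V$ is a map $\mathsf N$ from the Borel sets of $X$ to the dual $(\mathcal V',\|\cdot\|')$, $\sigma$-additive with respect to norm convergence, with $\mathsf N(A)(v)=0$ whenever $A$ is open and $\|v\|_{|A}=0$. Its total variation is $|\mathsf N|(E):=\sup_\pi\sum_{A\in\pi}\|\mathsf N(A)\|'$, over finite Borel partitions $\pi$ of $E$. For $h:X\to\mathbb R$ bounded Borel, $h\mathsf N$ is the local vector measure $h\mathsf N(A):=\int_Ah\,\mathrm d\mathsf N$ (Bartle integral: $\sum_ic_i\mathsf N(A\cap A_i)$ for $h=\sum_ic_i\chi_{A_i}$ simple, extended by uniform limits). **Metric measure spaces and Sobolev functions.** A metric measure space is a triple $(X,\mathsf d,\mathfrak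 m)$ with $(X,\mathsf d)$ complete separable and $\mathfrak m$ a nonnegative Borel measure finite on balls with full support. With $\mathrm{lip}(f)(x):=\limsup_{y\to x}|f(y)-f(x)|/\mathsf d(y,x)$ (0 at isolated points), the Cheeger energy of $f\in L^2(\mathfrak m)$ is $\mathrm{Ch}(f):=\frac12\inf\{\liminf_k\int\mathrm{lip}(f_k)^2\mathrm d\mathfrak m:f_k\in\mathrm{LIP}_b(X)\cap L^2(\mathfrak m),f_k\to f\text{ in }L^2(\mathfrak m)\}$; $W^{1,2}(X):=\{\mathrm{Ch}<\infty\}$. For $f\in W^{1,2}(X)$, the minimal relaxed slope $|\mathrm df|\in L^2(\mathfrak m)$ satisfies $\mathrm{Ch}(f)=\frac12\int|\mathrm df|^2\mathrm d\mathfrak m$. **(Co)tangent modules** (Gigli). An $L^2$-normed $L^\infty$-module is a Banach space that is a module over $L^\infty(\mathfrak m)$ with a pointwise norm $|\cdot|$ valued in nonnegative $L^2(\mathfrak m)$ functions, $\|v\|=\||v|\|_{L^2}$, $|fv|=|f||v|$. There is a unique couple $(L^2(T^*X),\mathrm d)$ with $L^2(T^*X)$ an $L^2$-normed $L^\infty$-module and $\mathrm d:W^{1,2}(X)\to L^2(T^*X)$ linear such that the pointwise norm of $\mathrm df$ is the minimal relaxed slope and $L^\infty$-linear combinations of differentials are dense. $L^2(TX)$ is its module dual ($L^\infty$-linear continuous maps to $L^1(\mathfrak m)$), $L^0(TX)$ the $L^0$-completion of $L^2(TX)$, and $L^\infty(TX):=\{v\in L^0(TX):|v|\in L^\infty(\mathfrak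 m)\}$, normed by $\||v|\|_{L^\infty(\mathfrak m)}$. **Divergence.** $v\in L^\infty(TX)$ belongs to $D(\mathrm{div}^\infty)$ if there is $g\in L^\infty(\mathfrak m)$ with $\int_X\mathrm df(v)\,\mathrm d\mathfrak m=-\int_Xfg\,\mathrm d\mathfrak m$ for every $f\in W^{1,2}(X)$ with bounded support; the unique such $g$ is denoted $\mathrm{div}\,v$. **BV functions and their differential.** For $f\in L^1(\mathfrak m)$ and $A\subseteq X$ open, $|\mathrm Df|(A):=\inf\{\liminf_k\int_A\mathrm{lip}(f_k)\,\mathrm d\mathfrak m:f_k\in\mathrm{LIP}_{loc}(A)\cap L^1(A,\mathfrak m),\ f_k\to f\text{ in }L^1(A,\mathfrak m)\}$, where $\mathrm{LIP}_{loc}(A)$ is the space of Borel functions that are Lipschitz in a neighbourhood of each point of $A$. $f\in\mathrm{BV}(X)$ if $|\mathrm Df|(X)<\infty$; then $|\mathrm Df|$ is the restriction to open sets of a finite Borel measure, denoted in the same way. Let $\mathcal V\subseteq L^\infty(TX)$ be the normed $C_b(X)$-module of $C_b(X)$-linear combinations of elements of $D(\mathrm{div}^\infty)$. For $f\in\mathrm{BV}(X)$, $\mathrm Df$ denotes the unique local vector measure on $\mathcal V$ with $\mathrm Df(X)(v)=-\int_Xf\,\mathrm{div}\,v\,\mathrm d\mathfrak m$ for every $v\in D(\mathrm{div}^\infty)$; its total variation is the measure $|\mathrm Df|$ just defined. *)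

theory Defs
  imports "HOL-Analysis.Analysis" "HOL-Probability.Essential_Supremum"
begin

section \<open>Normed modules over bounded continuous functions and local vector measures\<close>

text \<open>\<^const>\<open>bcontfun\<close> plays the role of \<open>C\<^sub>b(X)\<close>. A normed \<open>C\<^sub>b(X)\<close>-module is given by a linear
  subspace \<open>V\<close> of an ambient real vector space, a norm on \<open>V\<close> and an action of \<^const>\<open>bcontfun\<close>.\<close>

definition supp :: "('a::topological_space \<Rightarrow> real) \<Rightarrow> 'a set" where
  "supp f = closure {x. f x \<noteq> 0}"

definition sup_norm :: "('a \<Rightarrow> real) \<Rightarrow> real" where
  "sup_norm f = (SUP x. \<bar>f x\<bar>)"

locale normed_Cb_module =
  fixes V :: "'v::real_vector set" and nrm :: "'v \<Rightarrow> real"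
    and act :: "('a::topological_space \<Rightarrow> real) \<Rightarrow> 'v \<Rightarrow> 'v"
  assumes subspace_V: "subspace V"
    and nrm_nonneg: "v \<in> V \<Longrightarrow> 0 \<le> nrm v"
    and nrm_eq_0: "v \<in> V \<Longrightarrow> nrm v = 0 \<longleftrightarrow> v = 0"
    and nrm_triangle: "v \<in> V \<Longrightarrow> w \<in> V \<Longrightarrow> nrm (v + w) \<le> nrm v + nrm w"
    and nrm_scaleR: "v \<in> V \<Longrightarrow> nrm (c *\<^sub>R v) = \<bar>c\<bar> * nrm v"
    and act_closed: "f \<in> bcontfun \<Longrightarrow> v \<in> V \<Longrightarrow> act f v \<in> V"
    and act_add_left: "f \<in> bcontfun \<Longrightarrow> g \<in> bcontfun \<Longrightarrow> v \<in> V \<Longrightarrow>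
          act (\<lambda>x. f x + g x) v = act f v + act g v"
    and act_add_right: "f \<in> bcontfun \<Longrightarrow> v \<in> V \<Longrightarrow> w \<in> V \<Longrightarrow> act f (v + w) = act f v + act f w"
    and act_mult: "f \<in> bcontfun \<Longrightarrow> g \<in> bcontfun \<Longrightarrow> v \<in> V \<Longrightarrow>
          act (\<lambda>x. f x * g x) v = act f (act g v)"
    and act_const: "v \<in> V \<Longrightarrow> act (\<lambda>_. c) v = c *\<^sub>R v"
    and nrm_disjoint_sum: "\<lbrakk>finite I; I \<noteq> {}; \<And>i::nat. i \<in> I \<Longrightarrow> fs i \<in> bcontfun;
          \<And>i. i \<in> I \<Longrightarrow> vs i \<in> V; disjoint_family_on (\<lambda>i. supp (fs i)) I\<rbrakk> \<Longrightarrow>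
          nrm (\<Sum>i\<in>I. act (fs i) (vs i)) \<le> (MAX i\<in>I. sup_norm (fs i)) * (MAX i\<in>I. nrm (vs i))"

definition restr_norm ::
  "('v \<Rightarrow> real) \<Rightarrow> (('a::topological_space \<Rightarrow> real) \<Rightarrow> 'v \<Rightarrow> 'v) \<Rightarrow> 'a set \<Rightarrow> 'v \<Rightarrow> ennreal" where
  "restr_norm nrm act A v =
     (SUP f\<in>{f \<in> bcontfun. supp f \<subseteq> A \<and> sup_norm f \<le> 1}. ennreal (nrm (act f v)))"

definition dual_norm :: "'v set \<Rightarrow> ('v \<Rightarrow> real) \<Rightarrow> ('v \<Rightarrow> real) \<Rightarrow> ennreal" where
  "dual_norm V nrm \<phi> = (SUP v\<in>{v \<in> V. nrm v \<le> 1}. ennreal \<bar>\<phi> v\<bar>)"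

definition dual_space :: "'v::real_vector set \<Rightarrow> ('v \<Rightarrow> real) \<Rightarrow> ('v \<Rightarrow> real) set" where
  "dual_space V nrm = {\<phi>. (\<forall>v\<in>V. \<forall>w\<in>V. \<forall>a b. \<phi> (a *\<^sub>R v + b *\<^sub>R w) = a * \<phi> v + b * \<phi> w)
     \<and> dual_norm V nrm \<phi> < \<infinity> \<and> (\<forall>v. v \<notin> V \<longrightarrow> \<phi> v = 0)}"

text \<open>A map from the Borel sets to the dual of \<open>V\<close> is represented by a function that vanishes
  outside the Borel sets and outside \<open>V\<close>, so that equality of local vector measures is equality
  of functions.\<close>

definition local_vector_measure ::
  "'v::real_vector set \<Rightarrow> ('v \<Rightarrow> real) \<Rightarrow> (('a::topological_space \<Rightarrow> real) \<Rightarrow> 'v \<Rightarrow> 'v) \<Rightarrow>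
     ('a set \<Rightarrow> 'v \<Rightarrow> real) \<Rightarrow> bool" where
  "local_vector_measure V nrm act N \<longleftrightarrow>
     (\<forall>A\<in>sets borel. N A \<in> dual_space V nrm) \<and>
     (\<forall>A. A \<notin> sets borel \<longrightarrow> N A = (\<lambda>_. 0)) \<and>
     (\<forall>A. range A \<subseteq> sets borel \<longrightarrow> disjoint_family A \<longrightarrow>
        (\<lambda>n. dual_norm V nrm (\<lambda>v. N (\<Union>i. A i) v - (\<Sum>i<n. N (A i) v))) \<longlonglongrightarrow> 0) \<and>
     (\<forall>A. open A \<longrightarrow> (\<forall>v\<in>V. restr_norm nrm act A v = 0 \<longrightarrow> N A v = 0))"

definition total_variation ::
  "'v set \<Rightarrow> ('v \<Rightarrow> real) \<Rightarrow> ('a::topological_space set \<Rightarrow> 'v \<Rightarrow> real) \<Rightarrow> 'a set \<Rightarrow> ennreal" where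
  "total_variation V nrm N E =
     (SUP P\<in>{P. finite P \<and> P \<subseteq> sets borel \<and> partition_on E P}. \<Sum>A\<in>P. dual_norm V nrm (N A))"

definition total_variation_measure ::
  "'v set \<Rightarrow> ('v \<Rightarrow> real) \<Rightarrow> ('a::topological_space set \<Rightarrow> 'v \<Rightarrow> real) \<Rightarrow> 'a measure" where
  "total_variation_measure V nrm N = measure_of UNIV (sets borel) (total_variation V nrm N)"

text \<open>Bartle integral, evaluated at \<open>v\<close>: on simple functions it is the finite sum over the level
  sets, and it is extended by uniform limits.\<close>

definition simple_bartle_integral ::
  "('a set \<Rightarrow> 'v \<Rightarrow> real) \<Rightarrow> ('a \<Rightarrow> real) \<Rightarrow> 'a set \<Rightarrow> 'v \<Rightarrow> real" where
  "simple_bartle_integral N s A v = (\<Sum>c\<in>range s. c * N (A \<inter> s -` {c}) v)"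

definition bartle_integral ::
  "('a::topological_space set \<Rightarrow> 'v \<Rightarrow> real) \<Rightarrow> ('a \<Rightarrow> real) \<Rightarrow> 'a set \<Rightarrow> 'v \<Rightarrow> real" where
  "bartle_integral N h A v =
     (THE l. \<forall>s. (\<forall>n. simple_function borel (s n)) \<and> uniform_limit UNIV s h sequentially \<longrightarrow>
        (\<lambda>n. simple_bartle_integral N (s n) A v) \<longlonglongrightarrow> l)"

definition scale_lvm ::
  "('a::topological_space \<Rightarrow> real) \<Rightarrow> ('a set \<Rightarrow> 'v \<Rightarrow> real) \<Rightarrow> 'a set \<Rightarrow> 'v \<Rightarrow> real" where
  "scale_lvm h N A v = (if A \<in> sets borel then bartle_integral N h A v else 0)"

definition add_lvm ::
  "('a set \<Rightarrow> 'v \<Rightarrow> real) \<Rightarrow> ('a set \<Rightarrow> 'v \<Rightarrow> real) \<Rightarrow> 'a set \<Rightarrow> 'v \<Rightarrow> real" where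
  "add_lvm M N A v = M A v + N A v"

section \<open>Metric measure spaces, Sobolev and BV functions\<close>

locale metric_measure_space =
  fixes m :: "'a::polish_space measure"
  assumes sets_m: "sets m = sets borel"
    and finite_on_balls: "emeasure m (ball x r) < \<infinity>"
    and full_support: "open U \<Longrightarrow> U \<noteq> {} \<Longrightarrow> 0 < emeasure m U"

text \<open>Elements of \<open>L\<^sup>2\<close>, \<open>L\<^sup>\<infinity>\<close>, \<open>L\<^sup>1\<close> are represented by functions, identified
  when they agree almost everywhere.\<close>

definition L2 :: "'a measure \<Rightarrow> ('a \<Rightarrow> real) set" where
  "L2 m = {f \<in> borel_measurable m. integrable m (\<lambda>x. (f x)\<^sup>2)}"

definition Linf :: "'a measure \<Rightarrow> ('a \<Rightarrow> real) set" where
  "Linf m = {f \<in> borel_measurable m. \<exists>c. AE x in m. \<bar>f x\<bar> \<le> c}"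

definition L2_tendsto :: "'a measure \<Rightarrow> (nat \<Rightarrow> 'a \<Rightarrow> real) \<Rightarrow> ('a \<Rightarrow> real) \<Rightarrow> bool" where
  "L2_tendsto m u f \<longleftrightarrow> (\<lambda>k. \<integral>\<^sup>+x. ennreal ((u k x - f x)\<^sup>2) \<partial>m) \<longlonglongrightarrow> 0"

text \<open>At an isolated point the filter \<open>at x\<close> is \<open>bot\<close>, so the following limsup is 0.\<close>

definition lip :: "('a::metric_space \<Rightarrow> real) \<Rightarrow> 'a \<Rightarrow> ennreal" where
  "lip f x = Limsup (at x) (\<lambda>y. ennreal (\<bar>f y - f x\<bar> / dist y x))"

definition LIPb :: "('a::metric_space \<Rightarrow> real) set" where
  "LIPb = {f. bounded (range f) \<and> (\<exists>L. L-lipschitz_on UNIV f)}"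

definition Cheeger :: "'a::metric_space measure \<Rightarrow> ('a \<Rightarrow> real) \<Rightarrow> ennreal" where
  "Cheeger m f = ennreal (1/2) *
     Inf {liminf (\<lambda>k. \<integral>\<^sup>+x. (lip (u k) x)\<^sup>2 \<partial>m) | u. (\<forall>k. u k \<in> LIPb \<inter> L2 m) \<and> L2_tendsto m u f}"

definition W12 :: "'a::metric_space measure \<Rightarrow> ('a \<Rightarrow> real) set" where
  "W12 m = {f \<in> L2 m. Cheeger m f < \<infinity>}"

text \<open>Relaxed slopes in the sense of Ambrosio, Gigli and Savare: \<open>G\<close> is a relaxed slope of \<open>f\<close>
  if it dominates a weak \<open>L\<^sup>2\<close> limit of \<open>lip (u k)\<close> for some bounded Lipschitz \<open>u k\<close> converging
  to \<open>f\<close> in \<open>L\<^sup>2\<close>. The minimal one is smallest in the almost everywhere sense.\<close>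

definition relaxed_slope :: "'a::metric_space measure \<Rightarrow> ('a \<Rightarrow> real) \<Rightarrow> ('a \<Rightarrow> real) \<Rightarrow> bool" where
  "relaxed_slope m f G \<longleftrightarrow> G \<in> L2 m \<and>
     (\<exists>u G'. (\<forall>k. u k \<in> LIPb \<inter> L2 m \<and> (\<lambda>x. enn2real (lip (u k) x)) \<in> L2 m) \<and>
        L2_tendsto m u f \<and> G' \<in> L2 m \<and>
        (\<forall>h\<in>L2 m. (\<lambda>k. \<integral>x. enn2real (lip (u k) x) * h x \<partial>m) \<longlonglongrightarrow> (\<integral>x. G' x * h x \<partial>m)) \<and>
        (AE x in m. G' x \<le> G x))"

definition minimal_relaxed_slope ::
  "'a::metric_space measure \<Rightarrow> ('a \<Rightarrow> real) \<Rightarrow> ('a \<Rightarrow> real) \<Rightarrow> bool" where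
  "minimal_relaxed_slope m f G \<longleftrightarrow>
     relaxed_slope m f G \<and> (\<forall>G'. relaxed_slope m f G' \<longrightarrow> (AE x in m. G x \<le> G' x))"

definition LIPloc :: "'a::metric_space set \<Rightarrow> ('a \<Rightarrow> real) set" where
  "LIPloc A = {f \<in> borel_measurable borel. \<forall>x\<in>A. \<exists>r>0. \<exists>L. L-lipschitz_on (ball x r) f}"

text \<open>\<open>BV_var m f A\<close> is \<open>\<bar>Df\<bar>(A)\<close>, for open \<open>A\<close>.\<close>

definition BV_var :: "'a::metric_space measure \<Rightarrow> ('a \<Rightarrow> real) \<Rightarrow> 'a set \<Rightarrow> ennreal" where
  "BV_var m f A =
     Inf {liminf (\<lambda>k. \<integral>\<^sup>+x\<in>A. lip (u k) x \<partial>m) | u.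
            (\<forall>k. u k \<in> LIPloc A \<and> set_integrable m A (u k)) \<and>
            (\<lambda>k. \<integral>\<^sup>+x\<in>A. ennreal \<bar>u k x - f x\<bar> \<partial>m) \<longlonglongrightarrow> 0}"

definition BV :: "'a::metric_space measure \<Rightarrow> ('a \<Rightarrow> real) set" where
  "BV m = {f. integrable m f \<and> BV_var m f UNIV < \<infinity>}"

section \<open>Cotangent and tangent modules\<close>

text \<open>A module with a pointwise norm: a subspace of an ambient real vector space, an action of
  functions and a pointwise norm (determined up to almost everywhere equality). The ring \<open>R\<close>
  of scalars will be \<open>L\<^sup>\<infinity>\<close> or \<open>L\<^sup>0\<close>.\<close>

record ('a, 'v) pn_module =
  elems :: "'v set"
  fmul :: "('a \<Rightarrow> real) \<Rightarrow> 'v \<Rightarrow> 'v"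
  pnorm :: "'v \<Rightarrow> 'a \<Rightarrow> real"

locale pointwise_normed_module =
  fixes m :: "'a measure" and R :: "('a \<Rightarrow> real) set"
    and M :: "('a, 'v::real_vector) pn_module"
  assumes subspace_elems: "subspace (elems M)"
    and fmul_closed: "f \<in> R \<Longrightarrow> v \<in> elems M \<Longrightarrow> fmul M f v \<in> elems M"
    and fmul_AE_cong: "f \<in> R \<Longrightarrow> g \<in> R \<Longrightarrow> v \<in> elems M \<Longrightarrow> AE x in m. f x = g x \<Longrightarrow>
          fmul M f v = fmul M g v"
    and fmul_add_left: "f \<in> R \<Longrightarrow> g \<in> R \<Longrightarrow> v \<in> elems M \<Longrightarrow>
          fmul M (\<lambda>x. f x + g x) v = fmul M f v + fmul M g v"
    and fmul_add_right: "f \<in> R \<Longrightarrow> v \<in> elems M \<Longrightarrow> w \<in> elems M \<Longrightarrow>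
          fmul M f (v + w) = fmul M f v + fmul M f w"
    and fmul_mult: "f \<in> R \<Longrightarrow> g \<in> R \<Longrightarrow> v \<in> elems M \<Longrightarrow>
          fmul M (\<lambda>x. f x * g x) v = fmul M f (fmul M g v)"
    and fmul_const: "v \<in> elems M \<Longrightarrow> fmul M (\<lambda>_. c) v = c *\<^sub>R v"
    and pnorm_measurable: "v \<in> elems M \<Longrightarrow> pnorm M v \<in> borel_measurable m"
    and pnorm_nonneg: "v \<in> elems M \<Longrightarrow> AE x in m. 0 \<le> pnorm M v x"
    and pnorm_fmul: "f \<in> R \<Longrightarrow> v \<in> elems M \<Longrightarrow>
          AE x in m. pnorm M (fmul M f v) x = \<bar>f x\<bar> * pnorm M v x"

locale L2_normed_module = pointwise_normed_module m "Linf m" M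
  for m :: "'a measure" and M :: "('a, 'c::real_normed_vector) pn_module" +
  assumes complete_elems: "complete (elems M)"
    and pnorm_L2: "v \<in> elems M \<Longrightarrow> pnorm M v \<in> L2 m"
    and norm_eq: "v \<in> elems M \<Longrightarrow> norm v = sqrt (\<integral>x. (pnorm M v x)\<^sup>2 \<partial>m)"

text \<open>The couple \<open>(L\<^sup>2(T\<^sup>*X), d)\<close>. It is unique up to isomorphism, and any realization
  of it is allowed.\<close>

locale cotangent_module = L2_normed_module m T
  for m :: "'a::metric_space measure" and T :: "('a, 'c::real_normed_vector) pn_module" +
  fixes d :: "('a \<Rightarrow> real) \<Rightarrow> 'c"
  assumes d_elems: "f \<in> W12 m \<Longrightarrow> d f \<in> elems T"
    and d_AE_cong: "f \<in> W12 m \<Longrightarrow> g \<in> W12 m \<Longrightarrow> AE x in m. f x = g x \<Longrightarrow> d f = d g"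
    and d_linear: "f \<in> W12 m \<Longrightarrow> g \<in> W12 m \<Longrightarrow>
          d (\<lambda>x. a * f x + b * g x) = a *\<^sub>R d f + b *\<^sub>R d g"
    and pnorm_d: "f \<in> W12 m \<Longrightarrow> minimal_relaxed_slope m f (pnorm T (d f))"
    and d_dense: "\<omega> \<in> elems T \<Longrightarrow> 0 < e \<Longrightarrow>
          \<exists>(n::nat) a f. (\<forall>i<n. a i \<in> Linf m \<and> f i \<in> W12 m) \<and>
            norm (\<omega> - (\<Sum>i<n. fmul T (a i) (d (f i)))) < e"

text \<open>The module dual of \<open>T\<close>, i.e. \<open>L\<^sup>2(TX)\<close>: continuous \<open>L\<^sup>\<infinity>\<close>-linear maps to \<open>L\<^sup>1\<close>,
  again identified when they agree almost everywhere on each element of \<open>T\<close>.\<close>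

definition module_dual ::
  "'a measure \<Rightarrow> ('a, 'c::real_normed_vector) pn_module \<Rightarrow> ('c \<Rightarrow> 'a \<Rightarrow> real) set" where
  "module_dual m T = {X.
     (\<forall>\<omega>\<in>elems T. integrable m (X \<omega>)) \<and>
     (\<forall>\<omega>\<in>elems T. \<forall>\<eta>\<in>elems T. AE x in m. X (\<omega> + \<eta>) x = X \<omega> x + X \<eta> x) \<and>
     (\<forall>a\<in>Linf m. \<forall>\<omega>\<in>elems T. AE x in m. X (fmul T a \<omega>) x = a x * X \<omega> x) \<and>
     (\<exists>K. \<forall>\<omega>\<in>elems T. (\<integral>x. \<bar>X \<omega> x\<bar> \<partial>m) \<le> K * norm \<omega>)}"

text \<open>The pointwise norm of \<open>X\<close> in the module dual is the essential supremum of the family of all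
  \<open>\<bar>X(\<omega>)\<bar>\<close> with \<open>\<bar>\<omega>\<bar> \<le> 1\<close> almost everywhere.\<close>

definition is_dual_pnorm ::
  "'a measure \<Rightarrow> ('a, 'c) pn_module \<Rightarrow> ('c \<Rightarrow> 'a \<Rightarrow> real) \<Rightarrow> ('a \<Rightarrow> real) \<Rightarrow> bool" where
  "is_dual_pnorm m T X h \<longleftrightarrow>
     (let ub = (\<lambda>h. h \<in> borel_measurable m \<and>
           (\<forall>\<omega>\<in>elems T. (AE x in m. pnorm T \<omega> x \<le> 1) \<longrightarrow> (AE x in m. \<bar>X \<omega> x\<bar> \<le> h x)))
      in ub h \<and> (\<forall>h'. ub h' \<longrightarrow> (AE x in m. h x \<le> h' x)))"

text \<open>Convergence in \<open>L\<^sup>0\<close>: in measure on sets of finite measure.\<close>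

definition L0_tendsto :: "'a measure \<Rightarrow> (nat \<Rightarrow> 'a \<Rightarrow> real) \<Rightarrow> ('a \<Rightarrow> real) \<Rightarrow> bool" where
  "L0_tendsto m u f \<longleftrightarrow> (\<forall>E\<in>sets m. emeasure m E < \<infinity> \<longrightarrow>
     (\<forall>e>0. (\<lambda>n. emeasure m {x \<in> E. e < \<bar>u n x - f x\<bar>}) \<longlonglongrightarrow> 0))"

locale L0_normed_module = pointwise_normed_module m "borel_measurable m" M
  for m :: "'a measure" and M :: "('a, 'v::real_vector) pn_module" +
  assumes pnorm_eq_0: "v \<in> elems M \<Longrightarrow> AE x in m. pnorm M v x = 0 \<Longrightarrow> v = 0"
    and pnorm_triangle: "v \<in> elems M \<Longrightarrow> w \<in> elems M \<Longrightarrow>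
          AE x in m. pnorm M (v + w) x \<le> pnorm M v x + pnorm M w x"
    and L0_complete: "\<lbrakk>\<And>n. u n \<in> elems M;
          \<And>E e. E \<in> sets m \<Longrightarrow> emeasure m E < \<infinity> \<Longrightarrow> 0 < e \<Longrightarrow>
            \<exists>n0::nat. \<forall>i\<ge>n0. \<forall>j\<ge>n0. emeasure m {x \<in> E. e < pnorm M (u i - u j) x} < ennreal e\<rbrakk> \<Longrightarrow>
          \<exists>w\<in>elems M. L0_tendsto m (\<lambda>n. pnorm M (u n - w)) (\<lambda>_. 0)"

text \<open>\<open>(L, \<iota>)\<close> is the \<open>L\<^sup>0\<close>-completion \<open>L\<^sup>0(TX)\<close> of \<open>L\<^sup>2(TX)\<close>: \<open>L\<close> is complete
  and \<open>\<iota>\<close> is a linear map preserving the pointwise norm, with dense image.\<close>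

locale L0_tangent_module = L0_normed_module m L
  for m :: "'a measure" and T :: "('a, 'c::real_normed_vector) pn_module"
    and L :: "('a, 'v::real_vector) pn_module" +
  fixes \<iota> :: "('c \<Rightarrow> 'a \<Rightarrow> real) \<Rightarrow> 'v"
  assumes iota_elems: "X \<in> module_dual m T \<Longrightarrow> \<iota> X \<in> elems L"
    and iota_add: "X \<in> module_dual m T \<Longrightarrow> Y \<in> module_dual m T \<Longrightarrow>
          \<iota> (\<lambda>\<omega> x. X \<omega> x + Y \<omega> x) = \<iota> X + \<iota> Y"
    and iota_fmul: "a \<in> Linf m \<Longrightarrow> X \<in> module_dual m T \<Longrightarrow>
          \<iota> (\<lambda>\<omega> x. a x * X \<omega> x) = fmul L a (\<iota> X)"
    and pnorm_iota: "X \<in> module_dual m T \<Longrightarrow> is_dual_pnorm m T X (pnorm L (\<iota> X))"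
    and iota_dense: "v \<in> elems L \<Longrightarrow> \<exists>X. (\<forall>n. X n \<in> module_dual m T) \<and>
          L0_tendsto m (\<lambda>n. pnorm L (\<iota> (X n) - v)) (\<lambda>_. 0)"

text \<open>\<open>is_pairing m T L \<iota> \<omega> v h\<close>: the function \<open>h\<close> represents \<open>\<omega>(v)\<close>, the extension by continuity
  of \<open>X \<mapsto> X \<omega>\<close> from \<open>L\<^sup>2(TX)\<close> to \<open>L\<^sup>0(TX)\<close>.\<close>

definition is_pairing ::
  "'a measure \<Rightarrow> ('a, 'c::real_normed_vector) pn_module \<Rightarrow> ('a, 'v::real_vector) pn_module \<Rightarrow>
     (('c \<Rightarrow> 'a \<Rightarrow> real) \<Rightarrow> 'v) \<Rightarrow> 'c \<Rightarrow> 'v \<Rightarrow> ('a \<Rightarrow> real) \<Rightarrow> bool" where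
  "is_pairing m T L \<iota> \<omega> v h \<longleftrightarrow> h \<in> borel_measurable m \<and>
     (\<exists>X. (\<forall>n. X n \<in> module_dual m T) \<and>
        L0_tendsto m (\<lambda>n. pnorm L (\<iota> (X n) - v)) (\<lambda>_. 0) \<and>
        L0_tendsto m (\<lambda>n. X n \<omega>) h)"

definition LinfTX :: "'a measure \<Rightarrow> ('a, 'v) pn_module \<Rightarrow> 'v set" where
  "LinfTX m L = {v \<in> elems L. pnorm L v \<in> Linf m}"

definition LinfTX_norm :: "'a measure \<Rightarrow> ('a, 'v) pn_module \<Rightarrow> 'v \<Rightarrow> real" where
  "LinfTX_norm m L v = real_of_ereal (esssup m (\<lambda>x. ereal \<bar>pnorm L v x\<bar>))"

section \<open>Divergence and the differential of a BV function\<close>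

definition is_divergence ::
  "'a::metric_space measure \<Rightarrow> ('a, 'c::real_normed_vector) pn_module \<Rightarrow> (('a \<Rightarrow> real) \<Rightarrow> 'c) \<Rightarrow>
     ('a, 'v::real_vector) pn_module \<Rightarrow> (('c \<Rightarrow> 'a \<Rightarrow> real) \<Rightarrow> 'v) \<Rightarrow>
     'v \<Rightarrow> ('a \<Rightarrow> real) \<Rightarrow> bool" where
  "is_divergence m T d L \<iota> v g \<longleftrightarrow> g \<in> Linf m \<and>
     (\<forall>f\<in>W12 m. (\<exists>B. bounded B \<and> (AE x in m. x \<notin> B \<longrightarrow> f x = 0)) \<longrightarrow>
        (\<exists>h. is_pairing m T L \<iota> (d f) v h \<and> integrable m h \<and>
             (\<integral>x. h x \<partial>m) = - (\<integral>x. f x * g x \<partial>m)))"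

definition Ddiv ::
  "'a::metric_space measure \<Rightarrow> ('a, 'c::real_normed_vector) pn_module \<Rightarrow> (('a \<Rightarrow> real) \<Rightarrow> 'c) \<Rightarrow>
     ('a, 'v::real_vector) pn_module \<Rightarrow> (('c \<Rightarrow> 'a \<Rightarrow> real) \<Rightarrow> 'v) \<Rightarrow> 'v set" where
  "Ddiv m T d L \<iota> = {v \<in> LinfTX m L. \<exists>g. is_divergence m T d L \<iota> v g}"

definition test_module ::
  "'a::metric_space measure \<Rightarrow> ('a, 'c::real_normed_vector) pn_module \<Rightarrow> (('a \<Rightarrow> real) \<Rightarrow> 'c) \<Rightarrow>
     ('a, 'v::real_vector) pn_module \<Rightarrow> (('c \<Rightarrow> 'a \<Rightarrow> real) \<Rightarrow> 'v) \<Rightarrow> 'v set" where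
  "test_module m T d L \<iota> = {w. \<exists>(n::nat) f v.
     (\<forall>i<n. f i \<in> bcontfun \<and> v i \<in> Ddiv m T d L \<iota>) \<and> w = (\<Sum>i<n. fmul L (f i) (v i))}"

text \<open>The test module is indeed a normed \<open>C\<^sub>b(X)\<close>-module.\<close>

lemma (in metric_measure_space) bcontfun_measurable:
  "f \<in> bcontfun \<Longrightarrow> f \<in> borel_measurable m" for f :: "'a \<Rightarrow> real"
  using borel_measurable_continuous_onI[of f] measurable_cong_sets[OF sets_m refl, of borel]
  by (auto simp: bcontfun_def)

lemma bcontfun_mult:
  "f \<in> bcontfun \<Longrightarrow> g \<in> bcontfun \<Longrightarrow> (\<lambda>x. f x * g x) \<in> bcontfun"
  for f g :: "'a::topological_space \<Rightarrow> real"
proof -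
  assume "f \<in> bcontfun" "g \<in> bcontfun"
  then obtain a b where c: "continuous_on UNIV f" "continuous_on UNIV g"
    and ab: "\<And>x. \<bar>f x\<bar> \<le> a" "\<And>x. \<bar>g x\<bar> \<le> b"
    by (auto simp: bcontfun_def bounded_iff)
  have "norm (f x * g x) \<le> a * b" for x
    using mult_mono[OF ab[of x]] order_trans[OF abs_ge_zero ab(1)[of x]] by (simp add: abs_mult)
  then show ?thesis
    using c by (intro bcontfun_normI continuous_intros) auto
qed

lemma abs_le_sup_norm: "f \<in> bcontfun \<Longrightarrow> \<bar>f x\<bar> \<le> sup_norm f"
  for f :: "'a::topological_space \<Rightarrow> real"
  unfolding sup_norm_def bcontfun_def
  by (intro cSUP_upper) (auto simp: bounded_iff bdd_above_def)

lemma sup_norm_nonneg: "f \<in> bcontfun \<Longrightarrow> 0 \<le> sup_norm f"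
  for f :: "'a::topological_space \<Rightarrow> real"
  using abs_le_sup_norm[of f undefined] by linarith

locale tangent_setting = metric_measure_space m + L0_tangent_module m T L \<iota>
  for m :: "'a::polish_space measure" and T :: "('a, 'c::real_normed_vector) pn_module"
    and L :: "('a, 'v::real_vector) pn_module" and \<iota>
begin

lemma space_nonzero: "emeasure m (space m) \<noteq> 0"
  using full_support[of UNIV] sets_eq_imp_space_eq[OF sets_m] by auto

lemma pnorm_0: "AE x in m. pnorm L 0 x = 0"
proof -
  have "0 \<in> elems L" using subspace_elems by (simp add: subspace_0)
  from pnorm_fmul[OF _ this, of "\<lambda>_. 0"] fmul_const[OF this, of 0] show ?thesis by simp
qed

lemma LinfTX_norm_AE:
  assumes "v \<in> LinfTX m L"
  shows "0 \<le> LinfTX_norm m L v" and "AE x in m. pnorm L v x \<le> LinfTX_norm m L v"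
proof -
  let ?e = "esssup m (\<lambda>x. ereal \<bar>pnorm L v x\<bar>)"
  have [measurable]: "pnorm L v \<in> borel_measurable m"
    using assms by (auto simp: LinfTX_def Linf_def)
  obtain c where "AE x in m. \<bar>pnorm L v x\<bar> \<le> c"
    using assms by (auto simp: LinfTX_def Linf_def)
  then have le: "?e \<le> ereal c" by (intro esssup_I) auto
  have "esssup m (\<lambda>x. 0) \<le> ?e" by (intro esssup_mono) auto
  then have ge: "0 \<le> ?e" by (simp add: esssup_const[OF space_nonzero])
  then have e: "?e = ereal (LinfTX_norm m L v)"
    using le unfolding LinfTX_norm_def by (cases ?e) auto
  then show "0 \<le> LinfTX_norm m L v" using ge by simp
  have "AE x in m. ereal \<bar>pnorm L v x\<bar> \<le> ?e" by (rule esssup_AE)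
  then show "AE x in m. pnorm L v x \<le> LinfTX_norm m L v"
    unfolding e by eventually_elim auto
qed

lemma LinfTX_norm_le:
  assumes "v \<in> LinfTX m L" "AE x in m. pnorm L v x \<le> c"
  shows "LinfTX_norm m L v \<le> c"
proof -
  let ?e = "esssup m (\<lambda>x. ereal \<bar>pnorm L v x\<bar>)"
  have v: "v \<in> elems L" using assms(1) by (auto simp: LinfTX_def)
  have [measurable]: "pnorm L v \<in> borel_measurable m" by (rule pnorm_measurable[OF v])
  have "AE x in m. ereal \<bar>pnorm L v x\<bar> \<le> ereal c"
    using assms(2) pnorm_nonneg[OF v] by eventually_elim auto
  then have le: "?e \<le> ereal c" by (intro esssup_I) auto
  have "esssup m (\<lambda>x. 0) \<le> ?e" by (intro esssup_mono) auto
  then have ge: "0 \<le> ?e" by (simp add: esssup_const[OF space_nonzero])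
  show ?thesis using le ge unfolding LinfTX_norm_def by (cases ?e) auto
qed

lemma LinfTX_I:
  assumes "v \<in> elems L" "AE x in m. pnorm L v x \<le> c"
  shows "v \<in> LinfTX m L"
proof -
  have "AE x in m. \<bar>pnorm L v x\<bar> \<le> c"
    using assms(2) pnorm_nonneg[OF assms(1)] by eventually_elim auto
  then show ?thesis using assms(1) pnorm_measurable by (auto simp: LinfTX_def Linf_def)
qed

lemma pnorm_sum:
  assumes "finite I" "\<And>i. i \<in> I \<Longrightarrow> w i \<in> elems L"
  shows "AE x in m. pnorm L (\<Sum>i\<in>I. w i) x \<le> (\<Sum>i\<in>I. pnorm L (w i) x)"
  using assms
proof (induction I rule: finite_induct)
  case empty
  then show ?case using pnorm_0 by (auto elim: eventually_mono)
next
  case (insert j I)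
  have "(\<Sum>i\<in>I. w i) \<in> elems L"
    using insert by (intro subspace_sum[OF subspace_elems]) auto
  from pnorm_triangle[OF _ this, of "w j"] insert
  have "AE x in m. pnorm L (w j + (\<Sum>i\<in>I. w i)) x \<le> pnorm L (w j) x + pnorm L (\<Sum>i\<in>I. w i) x"
    by simp
  moreover have "AE x in m. pnorm L (\<Sum>i\<in>I. w i) x \<le> (\<Sum>i\<in>I. pnorm L (w i) x)"
    using insert by simp
  ultimately show ?case
    unfolding sum.insert[OF insert(1,2)] by eventually_elim linarith
qed

lemma subspace_LinfTX: "subspace (LinfTX m L)"
proof (rule subspaceI)
  show "0 \<in> LinfTX m L"
    by (rule LinfTX_I[of _ 0])
      (use pnorm_0 subspace_0[OF subspace_elems] in \<open>auto elim: eventually_mono\<close>)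
next
  fix v w assume vw: "v \<in> LinfTX m L" "w \<in> LinfTX m L"
  then have e: "v \<in> elems L" "w \<in> elems L" by (auto simp: LinfTX_def)
  show "v + w \<in> LinfTX m L"
  proof (rule LinfTX_I)
    show "v + w \<in> elems L" using e subspace_add[OF subspace_elems] by auto
    show "AE x in m. pnorm L (v + w) x \<le> LinfTX_norm m L v + LinfTX_norm m L w"
      using pnorm_triangle[OF e] LinfTX_norm_AE(2)[OF vw(1)] LinfTX_norm_AE(2)[OF vw(2)]
      by eventually_elim auto
  qed
next
  fix c :: real and v assume v: "v \<in> LinfTX m L"
  then have e: "v \<in> elems L" by (auto simp: LinfTX_def)
  show "c *\<^sub>R v \<in> LinfTX m L"
  proof (rule LinfTX_I)
    show "c *\<^sub>R v \<in> elems L" using e subspace_scale[OF subspace_elems] by auto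
    show "AE x in m. pnorm L (c *\<^sub>R v) x \<le> \<bar>c\<bar> * LinfTX_norm m L v"
      using pnorm_fmul[OF _ e, of "\<lambda>_. c"] fmul_const[OF e, of c] LinfTX_norm_AE(2)[OF v]
      by (auto elim!: eventually_mono[rotated] eventually_elim2 simp: mult_left_mono)
  qed
qed

lemma fmul_LinfTX:
  assumes "f \<in> bcontfun" "v \<in> LinfTX m L"
  shows "fmul L f v \<in> LinfTX m L"
proof (rule LinfTX_I)
  have e: "v \<in> elems L" using assms by (auto simp: LinfTX_def)
  have f: "f \<in> borel_measurable m" by (rule bcontfun_measurable[OF assms(1)])
  show "fmul L f v \<in> elems L" using e f by (rule fmul_closed[rotated])
  show "AE x in m. pnorm L (fmul L f v) x \<le> sup_norm f * LinfTX_norm m L v"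
    using pnorm_fmul[OF f e] LinfTX_norm_AE(2)[OF assms(2)] pnorm_nonneg[OF e]
    by eventually_elim
      (auto intro!: mult_mono abs_le_sup_norm[OF assms(1)] sup_norm_nonneg[OF assms(1)])
qed

lemma Ddiv_LinfTX: "Ddiv m T d L \<iota> \<subseteq> LinfTX m L"
  by (auto simp: Ddiv_def)

lemma test_module_LinfTX: "test_module m T d L \<iota> \<subseteq> LinfTX m L"
  unfolding test_module_def
  using Ddiv_LinfTX by (auto intro!: subspace_sum[OF subspace_LinfTX] fmul_LinfTX)

lemma fmul_sum:
  assumes "f \<in> borel_measurable m" "finite I" "\<And>i. i \<in> I \<Longrightarrow> w i \<in> elems L"
  shows "fmul L f (\<Sum>i\<in>I. w i) = (\<Sum>i\<in>I. fmul L f (w i))"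
  using assms(2,3)
proof (induction I rule: finite_induct)
  case empty
  have 0: "0 \<in> elems L" using subspace_0[OF subspace_elems] .
  have "fmul L f (0 + 0) = fmul L f 0 + fmul L f 0" by (rule fmul_add_right[OF assms(1) 0 0])
  then show ?case by simp
next
  case (insert j I)
  have "(\<Sum>i\<in>I. w i) \<in> elems L"
    using insert by (intro subspace_sum[OF subspace_elems]) auto
  then show ?case using insert fmul_add_right[OF assms(1)] by simp
qed

lemma test_module_fmul:
  assumes "f \<in> bcontfun" "w \<in> test_module m T d L \<iota>"
  shows "fmul L f w \<in> test_module m T d L \<iota>"
proof -
  obtain n g v where w: "\<forall>i<n. g i \<in> bcontfun \<and> v i \<in> Ddiv m T d L \<iota>"
    "w = (\<Sum>i<n::nat. fmul L (g i) (v i))"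
    using assms(2) by (auto simp: test_module_def)
  have el: "v i \<in> elems L" "g i \<in> borel_measurable m" if "i < n" for i
    using w that Ddiv_LinfTX[of d] bcontfun_measurable by (auto simp: LinfTX_def)
  have "fmul L f w = (\<Sum>i<n. fmul L f (fmul L (g i) (v i)))"
    unfolding w(2) using el assms(1) by (intro fmul_sum fmul_closed) (auto intro: bcontfun_measurable)
  also have "\<dots> = (\<Sum>i<n. fmul L (\<lambda>x. f x * g i x) (v i))"
    using el bcontfun_measurable[OF assms(1)] by (intro sum.cong) (auto simp: fmul_mult)
  finally show ?thesis
    unfolding test_module_def using w(1) bcontfun_mult[OF assms(1)]
    by (auto intro!: exI[of _ n] exI[of _ "\<lambda>i x. f x * g i x"] exI[of _ v])
qed

lemma test_module_add:
  assumes "w \<in> test_module m T d L \<iota>" "w' \<in> test_module m T d L \<iota>"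
  shows "w + w' \<in> test_module m T d L \<iota>"
proof -
  obtain n g v where w: "\<forall>i<n. g i \<in> bcontfun \<and> v i \<in> Ddiv m T d L \<iota>"
    "w = (\<Sum>i<n::nat. fmul L (g i) (v i))"
    using assms(1) by (auto simp: test_module_def)
  obtain n' g' v' where w': "\<forall>i<n'. g' i \<in> bcontfun \<and> v' i \<in> Ddiv m T d L \<iota>"
    "w' = (\<Sum>i<n'::nat. fmul L (g' i) (v' i))"
    using assms(2) by (auto simp: test_module_def)
  let ?g = "\<lambda>i. if i < n then g i else g' (i - n)"
  let ?v = "\<lambda>i. if i < n then v i else v' (i - n)"
  have "(\<Sum>i<n+n'. fmul L (?g i) (?v i)) = (\<Sum>i<n. fmul L (g i) (v i)) +
      (\<Sum>i<n'. fmul L (g' i) (v' i))"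
    by (induction n') auto
  then show ?thesis
    unfolding test_module_def w(2) w'(2) using w(1) w'(1)
    by (intro CollectI exI[of _ "n+n'"] exI[of _ ?g] exI[of _ ?v]) auto
qed

theorem normed_Cb_module_test_module:
  "normed_Cb_module (test_module m T d L \<iota>) (LinfTX_norm m L) (fmul L)"
proof
  note tm = subsetD[OF test_module_LinfTX[of d]]
  have el: "v \<in> elems L" if "v \<in> test_module m T d L \<iota>" for v
    using tm[OF that] by (auto simp: LinfTX_def)
  note bm = bcontfun_measurable
  have scale: "c *\<^sub>R v \<in> test_module m T d L \<iota>" if "v \<in> test_module m T d L \<iota>" for c v
    using test_module_fmul[OF const_bcontfun[of c] that] fmul_const[OF el[OF that], of c] by simp
  have "0 \<in> test_module m T d L \<iota>"
    unfolding test_module_def by (auto intro!: exI[of _ "0::nat"])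
  then show sub: "subspace (test_module m T d L \<iota>)"
    by (rule subspaceI) (auto intro: scale test_module_add)
  show "0 \<le> LinfTX_norm m L v" if "v \<in> test_module m T d L \<iota>" for v
    by (rule LinfTX_norm_AE(1)[OF tm[OF that]])
  show "(LinfTX_norm m L v = 0) = (v = 0)" if v: "v \<in> test_module m T d L \<iota>" for v
  proof
    assume "LinfTX_norm m L v = 0"
    with LinfTX_norm_AE(2)[OF tm[OF v]] pnorm_nonneg[OF el[OF v]]
    have "AE x in m. pnorm L v x = 0" by (auto elim: eventually_elim2)
    then show "v = 0" by (rule pnorm_eq_0[OF el[OF v]])
  next
    assume "v = 0"
    then have "AE x in m. pnorm L v x \<le> 0" using pnorm_0 by (auto elim: eventually_mono)
    then show "LinfTX_norm m L v = 0"
      using LinfTX_norm_le[OF tm[OF v]] LinfTX_norm_AE(1)[OF tm[OF v]] by (auto intro: antisym)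
  qed
  show "LinfTX_norm m L (v + w) \<le> LinfTX_norm m L v + LinfTX_norm m L w"
    if vw: "v \<in> test_module m T d L \<iota>" "w \<in> test_module m T d L \<iota>" for v w
  proof (rule LinfTX_norm_le[OF tm[OF test_module_add[OF vw]]])
    show "AE x in m. pnorm L (v + w) x \<le> LinfTX_norm m L v + LinfTX_norm m L w"
      using pnorm_triangle[OF el[OF vw(1)] el[OF vw(2)]] LinfTX_norm_AE(2)[OF tm[OF vw(1)]]
        LinfTX_norm_AE(2)[OF tm[OF vw(2)]]
      by eventually_elim auto
  qed
  have sc: "LinfTX_norm m L (c *\<^sub>R v) \<le> \<bar>c\<bar> * LinfTX_norm m L v"
    if v: "v \<in> test_module m T d L \<iota>" for c v
  proof (rule LinfTX_norm_le[OF tm[OF scale[OF v]]])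
    have "AE x in m. pnorm L (c *\<^sub>R v) x = \<bar>c\<bar> * pnorm L v x"
      using pnorm_fmul[OF _ el[OF v], of "\<lambda>_. c"] fmul_const[OF el[OF v], of c] by simp
    then show "AE x in m. pnorm L (c *\<^sub>R v) x \<le> \<bar>c\<bar> * LinfTX_norm m L v"
      using LinfTX_norm_AE(2)[OF tm[OF v]] by eventually_elim (simp add: mult_left_mono)
  qed
  show "LinfTX_norm m L (c *\<^sub>R v) = \<bar>c\<bar> * LinfTX_norm m L v"
    if v: "v \<in> test_module m T d L \<iota>" for c v
  proof (cases "c = 0")
    case True
    then show ?thesis
      using sc[OF v, of c] LinfTX_norm_AE(1)[OF tm[OF scale[OF v]], of c] by simp
  next
    case False
    have "LinfTX_norm m L v \<le> \<bar>inverse c\<bar> * LinfTX_norm m L (c *\<^sub>R v)"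
      using sc[OF scale[OF v], of "inverse c" c] False by simp
    then have "\<bar>c\<bar> * LinfTX_norm m L v \<le> LinfTX_norm m L (c *\<^sub>R v)"
      using False by (simp add: field_simps abs_inverse)
    then show ?thesis using sc[OF v, of c] by simp
  qed
  show "fmul L f v \<in> test_module m T d L \<iota>" if "f \<in> bcontfun" "v \<in> test_module m T d L \<iota>" for f v
    using that by (rule test_module_fmul)
  show "fmul L (\<lambda>x. f x + g x) v = fmul L f v + fmul L g v"
    if "f \<in> bcontfun" "g \<in> bcontfun" "v \<in> test_module m T d L \<iota>" for f g v
    using that by (intro fmul_add_left bm el)
  show "fmul L f (v + w) = fmul L f v + fmul L f w"
    if "f \<in> bcontfun" "v \<in> test_module m T d L \<iota>" "w \<in> test_module m T d L \<iota>" for f v w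
    using that by (intro fmul_add_right bm el)
  show "fmul L (\<lambda>x. f x * g x) v = fmul L f (fmul L g v)"
    if "f \<in> bcontfun" "g \<in> bcontfun" "v \<in> test_module m T d L \<iota>" for f g v
    using that by (intro fmul_mult bm el)
  show "fmul L (\<lambda>_. c) v = c *\<^sub>R v" if "v \<in> test_module m T d L \<iota>" for c v
    using that by (intro fmul_const el)
  fix I :: "nat set" and f :: "nat \<Rightarrow> 'a \<Rightarrow> real" and v
  assume I: "finite I" "I \<noteq> {}" and f: "\<And>i. i \<in> I \<Longrightarrow> f i \<in> bcontfun"
    and v: "\<And>i. i \<in> I \<Longrightarrow> v i \<in> test_module m T d L \<iota>"
    and disj: "disjoint_family_on (\<lambda>i. supp (f i)) I"
  let ?F = "MAX i\<in>I. sup_norm (f i)" and ?W = "MAX i\<in>I. LinfTX_norm m L (v i)"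
  have F: "\<bar>f i x\<bar> \<le> ?F" if "i \<in> I" for i x
    using abs_le_sup_norm[OF f[OF that], of x] I that
    by (intro order_trans[OF _ Max_ge[of _ "sup_norm (f i)"]]) auto
  have W: "LinfTX_norm m L (v i) \<le> ?W" if "i \<in> I" for i using I that by simp
  have W0: "0 \<le> ?W" and F0: "0 \<le> ?F"
  proof -
    obtain i where i: "i \<in> I" using I by auto
    show "0 \<le> ?W" using W[OF i] LinfTX_norm_AE(1)[OF tm[OF v[OF i]]] by linarith
    show "0 \<le> ?F" using F[OF i, of undefined] by linarith
  qed
  have mem: "(\<Sum>i\<in>I. fmul L (f i) (v i)) \<in> LinfTX m L"
    using f v tm by (intro subspace_sum[OF subspace_LinfTX] fmul_LinfTX) auto
  show "LinfTX_norm m L (\<Sum>i\<in>I. fmul L (f i) (v i)) \<le> ?F * ?W"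
  proof (rule LinfTX_norm_le[OF mem])
    have "AE x in m. pnorm L (\<Sum>i\<in>I. fmul L (f i) (v i)) x \<le>
        (\<Sum>i\<in>I. pnorm L (fmul L (f i) (v i)) x)"
      using f v by (intro pnorm_sum I fmul_closed bm el) auto
    moreover have "AE x in m. \<forall>i\<in>I. pnorm L (fmul L (f i) (v i)) x = \<bar>f i x\<bar> * pnorm L (v i) x"
      using f v I by (intro AE_finite_allI pnorm_fmul bm el) auto
    moreover have "AE x in m. \<forall>i\<in>I. pnorm L (v i) x \<le> LinfTX_norm m L (v i)"
      using v I tm by (intro AE_finite_allI LinfTX_norm_AE(2)) auto
    ultimately show "AE x in m. pnorm L (\<Sum>i\<in>I. fmul L (f i) (v i)) x \<le> ?F * ?W"
    proof eventually_elim
      case (elim x)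
      have "(\<Sum>i\<in>I. pnorm L (fmul L (f i) (v i)) x) = (\<Sum>i\<in>I. \<bar>f i x\<bar> * pnorm L (v i) x)"
        using elim(2) by simp
      also have "\<dots> \<le> ?F * ?W"
      proof (cases "\<exists>j\<in>I. f j x \<noteq> 0")
        case True
        then obtain j where j: "j \<in> I" "f j x \<noteq> 0" by auto
        have "f i x = 0" if "i \<in> I" "i \<noteq> j" for i
        proof (rule ccontr)
          assume "f i x \<noteq> 0"
          then have "x \<in> supp (f i) \<inter> supp (f j)"
            using j(2) by (auto simp: supp_def intro!: subsetD[OF closure_subset])
          then show False using disj that j(1) by (auto simp: disjoint_family_on_def)
        qed
        then have "(\<Sum>i\<in>I. \<bar>f i x\<bar> * pnorm L (v i) x) = \<bar>f j x\<bar> * pnorm L (v j) x"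
          using I j(1) by (subst sum.remove[of _ j]) auto
        also have "\<dots> \<le> \<bar>f j x\<bar> * ?W"
        proof (rule mult_left_mono)
          show "pnorm L (v j) x \<le> ?W" using elim(3) j(1) W[OF j(1)] by fastforce
        qed simp
        also have "\<dots> \<le> ?F * ?W" by (rule mult_right_mono[OF F[OF j(1)] W0])
        finally show ?thesis .
      next
        case False
        then show ?thesis using W0 F0 by simp
      qed
      finally show ?case using elim(1) by linarith
    qed
  qed
qed

end

text \<open>For \<open>f\<close> in \<^const>\<open>BV\<close> exactly one \<open>N\<close> satisfies this; it is denoted \<open>Df\<close>.\<close>

definition is_BV_differential ::
  "'a::metric_space measure \<Rightarrow> ('a, 'c::real_normed_vector) pn_module \<Rightarrow> (('a \<Rightarrow> real) \<Rightarrow> 'c) \<Rightarrow>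
     ('a, 'v::real_vector) pn_module \<Rightarrow> (('c \<Rightarrow> 'a \<Rightarrow> real) \<Rightarrow> 'v) \<Rightarrow>
     ('a \<Rightarrow> real) \<Rightarrow> ('a set \<Rightarrow> 'v \<Rightarrow> real) \<Rightarrow> bool" where
  "is_BV_differential m T d L \<iota> f N \<longleftrightarrow>
     local_vector_measure (test_module m T d L \<iota>) (LinfTX_norm m L) (fmul L) N \<and>
     (\<forall>v\<in>Ddiv m T d L \<iota>. \<forall>g. is_divergence m T d L \<iota> v g \<longrightarrow>
        N UNIV v = - (\<integral>x. f x * g x \<partial>m))"

end

theory Submission
  imports Defs
begin

text \<open>
  Local vector measures satisfy \<open>\<bar>N\<bar>(E) = \<parallel>N(E)\<parallel>'\<close>, which turns the bound on \<open>\<bar>D(fg)\<bar>\<close> into the triangle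
  inequality for the dual norm, and \<open>N(A)(\<phi> v) = \<integral>\<^sub>A \<phi> dN(v)\<close> for \<open>\<phi>\<close> in \<open>C\<^sub>b\<close>. With the
  second fact it is enough to show \<open>\<integral> f dDg(v) + \<integral> g dDf(v) = - \<integral> f g div v\<close>, which by polarisation
  follows from the chain rule \<open>\<integral> f\<^sup>2 div v = - 2 \<integral> f dDf(v)\<close>.

  For the latter, let \<open>\<theta>\<^sub>k\<close> be Lipschitz with bounded support, summing to 1 up to a small error, such
  that \<open>f\<close> is close to a constant \<open>c\<^sub>k\<close> on the support of \<open>\<theta>\<^sub>k\<close>. The Leibniz rule gives
  \<open>div (\<theta>\<^sub>k v) = \<theta>\<^sub>k div v + d\<theta>\<^sub>k(v)\<close>, hence \<open>\<integral> f div (\<theta>\<^sub>k v) = - \<integral> \<theta>\<^sub>k dDf(v)\<close>. Expanding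
  \<open>f\<^sup>2 = 2 c\<^sub>k f - c\<^sub>k\<^sup>2 + (f - c\<^sub>k)\<^sup>2\<close> the first terms give a Riemann sum of \<open>- 2 \<integral> f dDf(v)\<close>, and the last
  one is controlled by approximating \<open>f\<close> with locally Lipschitz functions, because \<open>(f - c\<^sub>k)\<^sup>2\<close> is a
  function of \<open>f\<close> with small Lipschitz constant.\<close>

section \<open>Variation of set functions and integrals of signed measures\<close>

text \<open>The integral of \<open>f\<close> against \<open>Df(v)\<close> cannot be reached by
  inserting approximants: the \<open>u n\<close> converge to \<open>f\<close> merely in L1, and
  their differentials are controlled merely through the bound \<open>C\<close> on the integrals of
  \<open>lip (u n)\<close>. The second order expansion makes this bound sufficient. On the support
  of one \<open>\<theta> k\<close> the remainder is a function of \<open>f\<close> with Lipschitz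
  constant of order \<epsilon>, and since the \<open>\<theta> k\<close> add up to at most 1, the
  remainders of all pieces together cost order \<epsilon> times \<open>C\<close>, however many
  pieces there are. A second obstacle is that \<open>f\<close> need not be uniformly continuous and
  the space need not be locally compact, while the divergence is tested with Sobolev functions of
  bounded support. Hence each localisation starts from a Lipschitz cut-off whose slope has small
  integral for prescribed finite measures, and on whose support a pointwise regularity property
  holds at one uniform scale.\<close>

definition set_variation :: "('a::topological_space set \<Rightarrow> ennreal) \<Rightarrow> 'a set \<Rightarrow> ennreal" where
  "set_variation \<nu> E = (SUP P\<in>{P. finite P \<and> P \<subseteq> sets borel \<and> partition_on E P}. \<Sum>A\<in>P. \<nu> A)"

lemma total_variation_eq_set_variation:
  "total_variation V nrm N = set_variation (\<lambda>A. dual_norm V nrm (N A))"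
  by (auto simp: fun_eq_iff total_variation_def set_variation_def)

text \<open>Covers both set functions whose variation occurs: the absolute value of a real signed
  measure, and the dual norm of a local vector measure. Countable subadditivity makes sums over
  refined partitions at least as large.\<close>

locale subadditive_set_function =
  fixes \<nu> :: "'a::topological_space set \<Rightarrow> ennreal"
  assumes empty: "\<nu> {} = 0"
    and subadditive: "\<And>A :: nat \<Rightarrow> 'a set. range A \<subseteq> sets borel \<Longrightarrow> disjoint_family A \<Longrightarrow>
          \<nu> (\<Union>i. A i) \<le> (\<Sum>i. \<nu> (A i))"
begin

text \<open>\<open>partition_on\<close> forbids empty blocks and speaks of sets rather than
  families. Empty members have value 0 and may be dropped; on the remaining indices a disjoint
  family is injective.\<close>

lemma sum_le_set_variation:
  assumes "finite I" "\<And>i. i \<in> I \<Longrightarrow> B i \<in> sets borel" "disjoint_family_on B I" "(\<Union>i\<in>I. B i) = E"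
  shows "(\<Sum>i\<in>I. \<nu> (B i)) \<le> set_variation \<nu> E"
proof -
  let ?J = "{i\<in>I. B i \<noteq> {}}"
  have inj: "inj_on B ?J"
    using assms(3) by (auto simp: inj_on_def disjoint_family_on_def)
  have "(\<Sum>i\<in>I. \<nu> (B i)) = (\<Sum>i\<in>?J. \<nu> (B i))"
    using assms(1) by (intro sum.mono_neutral_right) (auto simp: empty)
  also have "\<dots> = (\<Sum>A\<in>B ` ?J. \<nu> A)" by (simp add: sum.reindex[OF inj])
  also have "\<dots> \<le> set_variation \<nu> E"
    unfolding set_variation_def
  proof (rule SUP_upper, safe)
    show "finite (B ` ?J)" using assms(1) by simp
    show "partition_on E (B ` ?J)"
      using assms(3,4) by (fastforce simp: partition_on_def disjoint_def disjoint_family_on_def)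
  qed (use assms(2) in auto)
  finally show ?thesis .
qed

lemma le_set_variation: "A \<in> sets borel \<Longrightarrow> \<nu> A \<le> set_variation \<nu> A"
  using sum_le_set_variation[of "{A}" "\<lambda>x. x" A] by (simp add: disjoint_family_on_def)

lemma set_variation_le:
  assumes "\<And>P. finite P \<Longrightarrow> P \<subseteq> sets borel \<Longrightarrow> disjoint P \<Longrightarrow> \<Union>P = E \<Longrightarrow> (\<Sum>A\<in>P. \<nu> A) \<le> c"
  shows "set_variation \<nu> E \<le> c"
  unfolding set_variation_def using assms by (intro SUP_least) (auto simp: partition_on_def)

lemma set_variation_empty: "set_variation \<nu> {} = 0"
proof -
  have "set_variation \<nu> {} \<le> 0"
  proof (rule set_variation_le)
    fix P :: "'a set set" assume "\<Union>P = {}"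
    then show "(\<Sum>A\<in>P. \<nu> A) \<le> 0" by (auto simp: empty intro!: sum.neutral)
  qed
  then show ?thesis by simp
qed

text \<open>Partitions of two disjoint sets combine to a partition of their union, and the two
  suprema are taken one after the other. \<open>F\<close> stays arbitrary in the induction so that
  the hypothesis applies to \<open>F - E j\<close>.\<close>

lemma set_variation_superadditive:
  assumes "finite I" "\<And>i. i \<in> I \<Longrightarrow> E i \<in> sets borel" "disjoint_family_on E I" "(\<Union>i\<in>I. E i) \<subseteq> F"
    "F \<in> sets borel"
  shows "(\<Sum>i\<in>I. set_variation \<nu> (E i)) \<le> set_variation \<nu> F"
  using assms
proof (induction I arbitrary: F rule: finite_induct)
  case (insert j I)
  have *: "set_variation \<nu> A + set_variation \<nu> B \<le> set_variation \<nu> F"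
    if AB: "A \<inter> B = {}" "A \<union> B = F" "A \<in> sets borel" "B \<in> sets borel" for A B
  proof -
    let ?PP = "\<lambda>A. {P. finite P \<and> P \<subseteq> sets borel \<and> partition_on A P}"
    have ne: "?PP A \<noteq> {}" if "A \<in> sets borel" for A :: "'a set"
    proof -
      have "(if A = {} then {} else {A}) \<in> ?PP A"
        using that by (auto simp: partition_on_def disjoint_def)
      then show ?thesis by blast
    qed
    have 1: "(\<Sum>A\<in>P. \<nu> A) + (\<Sum>A\<in>Q. \<nu> A) \<le> set_variation \<nu> F"
      if PQ: "P \<in> ?PP A" "Q \<in> ?PP B" for P Q
    proof -
      have d: "P \<inter> Q = {}"
      proof (rule ccontr)
        assume "P \<inter> Q \<noteq> {}"
        then obtain C where "C \<in> P" "C \<in> Q" by auto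
        then have "C \<subseteq> A \<inter> B" "C \<noteq> {}" using PQ by (auto simp: partition_on_def)
        then show False using AB by auto
      qed
      have "(\<Sum>A\<in>P. \<nu> A) + (\<Sum>A\<in>Q. \<nu> A) = (\<Sum>A\<in>P \<union> Q. \<nu> A)"
        using PQ d by (subst sum.union_disjoint) auto
      also have "\<dots> \<le> set_variation \<nu> F"
        unfolding set_variation_def
      proof (rule SUP_upper, safe)
        show "partition_on F (P \<union> Q)"
          using PQ AB(1) unfolding AB(2)[symmetric] partition_on_def by (auto intro!: disjoint_union)
      qed (use PQ in auto)
      finally show ?thesis .
    qed
    have 2: "set_variation \<nu> A + (\<Sum>A\<in>Q. \<nu> A) \<le> set_variation \<nu> F" if Q: "Q \<in> ?PP B" for Q
    proof -
      have "set_variation \<nu> A + (\<Sum>A\<in>Q. \<nu> A) = (SUP P\<in>?PP A. (\<Sum>A\<in>P. \<nu> A) + (\<Sum>A\<in>Q. \<nu> A))"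
        unfolding set_variation_def by (rule ennreal_SUP_add_left[symmetric, OF ne[OF AB(3)]])
      also have "\<dots> \<le> set_variation \<nu> F" using 1 Q by (intro SUP_least) auto
      finally show ?thesis .
    qed
    have "set_variation \<nu> A + set_variation \<nu> B = (SUP Q\<in>?PP B. set_variation \<nu> A + (\<Sum>A\<in>Q. \<nu> A))"
      unfolding set_variation_def[of \<nu> B] by (rule ennreal_SUP_add_right[OF ne[OF AB(4)]])
    also have "\<dots> \<le> set_variation \<nu> F" using 2 by (intro SUP_least) auto
    finally show ?thesis .
  qed
  have "(\<Sum>i\<in>I. set_variation \<nu> (E i)) \<le> set_variation \<nu> (F - E j)"
    using insert.prems insert.hyps by (intro insert.IH) (auto simp: disjoint_family_on_def)
  then have "(\<Sum>i\<in>insert j I. set_variation \<nu> (E i)) \<le> set_variation \<nu> (E j) + set_variation \<nu> (F - E j)"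
    using insert.hyps by (simp add: add_left_mono)
  also have "\<dots> \<le> set_variation \<nu> F"
    using insert.prems by (intro *) auto
  finally show ?case .
qed simp

text \<open>One inequality is superadditivity of the partial sums. For the other, a partition
  \<open>P\<close> of the union is cut along the sets \<open>E i\<close>: subadditivity bounds each
  block by its pieces, and the pieces inside \<open>E i\<close> partition
  \<open>E i\<close>.\<close>

lemma set_variation_countably_additive: "countably_additive (sets borel) (set_variation \<nu>)"
proof (rule countably_additiveI)
  fix E :: "nat \<Rightarrow> 'a set"
  assume E: "range E \<subseteq> sets borel" "disjoint_family E" "(\<Union>i. E i) \<in> sets borel"
  show "(\<Sum>i. set_variation \<nu> (E i)) = set_variation \<nu> (\<Union>i. E i)"
  proof (rule antisym)
    show "(\<Sum>i. set_variation \<nu> (E i)) \<le> set_variation \<nu> (\<Union>i. E i)"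
      unfolding suminf_eq_SUP
    proof (rule SUP_least)
      fix n show "(\<Sum>i<n. set_variation \<nu> (E i)) \<le> set_variation \<nu> (\<Union>i. E i)"
        using E by (intro set_variation_superadditive) (auto simp: disjoint_family_on_def)
    qed
    show "set_variation \<nu> (\<Union>i. E i) \<le> (\<Sum>i. set_variation \<nu> (E i))"
    proof (rule set_variation_le)
      fix P :: "'a set set" assume P: "finite P" "P \<subseteq> sets borel" "disjoint P" "\<Union>P = (\<Union>i. E i)"
      have "(\<Sum>A\<in>P. \<nu> A) \<le> (\<Sum>A\<in>P. \<Sum>i. \<nu> (A \<inter> E i))"
      proof (rule sum_mono)
        fix A assume A: "A \<in> P"
        then have "A = (\<Union>i. A \<inter> E i)" using P by auto
        then have "\<nu> A = \<nu> (\<Union>i. A \<inter> E i)" by simp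
        also have "\<dots> \<le> (\<Sum>i. \<nu> (A \<inter> E i))"
          using A P(2) E(1) by (intro subadditive disjoint_family_on_bisimulation[OF E(2)]) auto
        finally show "\<nu> A \<le> (\<Sum>i. \<nu> (A \<inter> E i))" .
      qed
      also have "\<dots> = (\<Sum>i. \<Sum>A\<in>P. \<nu> (A \<inter> E i))"
        by (rule suminf_sum[symmetric]) auto
      also have "\<dots> \<le> (\<Sum>i. set_variation \<nu> (E i))"
      proof (rule suminf_le)
        fix i
        show "(\<Sum>A\<in>P. \<nu> (A \<inter> E i)) \<le> set_variation \<nu> (E i)"
          using P E by (intro sum_le_set_variation) (auto simp: disjoint_family_on_def disjoint_def)
      qed auto
      finally show "(\<Sum>A\<in>P. \<nu> A) \<le> (\<Sum>i. set_variation \<nu> (E i))" .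
    qed
  qed
qed

definition variation_measure :: "'a measure" where
  "variation_measure = measure_of UNIV (sets borel) (set_variation \<nu>)"

lemma sets_variation_measure [measurable_cong, simp]: "sets variation_measure = sets borel"
  unfolding variation_measure_def by (metis sets.sets_measure_of_eq space_borel)

lemma space_variation_measure [simp]: "space variation_measure = UNIV"
  unfolding variation_measure_def by simp

lemma emeasure_variation_measure:
  "A \<in> sets borel \<Longrightarrow> emeasure variation_measure A = set_variation \<nu> A"
  by (rule emeasure_measure_of_sigma[of UNIV "sets borel" "set_variation \<nu>", folded variation_measure_def])
    (use sets.sigma_algebra_axioms[of borel] set_variation_empty set_variation_countably_additive
      in \<open>auto simp: positive_def\<close>)

end

section \<open>Real signed measures and finiteness of their variation\<close>

locale signed_measure =
  fixes \<mu> :: "'a::topological_space set \<Rightarrow> real"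
  assumes sums: "\<And>A :: nat \<Rightarrow> 'a set. range A \<subseteq> sets borel \<Longrightarrow> disjoint_family A \<Longrightarrow>
      (\<lambda>i. \<mu> (A i)) sums \<mu> (\<Union>i. A i)"
begin

lemma empty: "\<mu> {} = 0"
proof -
  have "(\<lambda>i::nat. \<mu> {}) sums \<mu> (\<Union>i::nat. {})" by (rule sums) (auto simp: disjoint_family_on_def)
  then have "(\<lambda>i::nat. \<mu> {}) \<longlonglongrightarrow> 0" by (intro summable_LIMSEQ_zero) (auto simp: sums_iff)
  then show ?thesis by (simp add: LIMSEQ_const_iff)
qed

text \<open>The finite family is enumerated and continued by \<open>{}\<close>, which turns it into
  an instance of countable additivity.\<close>

lemma finite_sum:
  assumes "finite I" "\<And>i. i \<in> I \<Longrightarrow> A i \<in> sets borel" "disjoint_family_on A I"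
  shows "\<mu> (\<Union>i\<in>I. A i) = (\<Sum>i\<in>I. \<mu> (A i))"
proof -
  obtain h :: "nat \<Rightarrow> _" where h: "bij_betw h {..<card I} I"
    using ex_bij_betw_nat_finite[OF assms(1)] by (auto simp: atLeast0LessThan)
  let ?B = "\<lambda>n. if n < card I then A (h n) else {}"
  have hI: "h n \<in> I" if "n < card I" for n using h that by (auto simp: bij_betw_def)
  have "(\<lambda>n. \<mu> (?B n)) sums \<mu> (\<Union>n. ?B n)"
  proof (rule sums)
    show "range ?B \<subseteq> sets borel" using assms(2) hI by auto
    show "disjoint_family ?B"
      using assms(3) hI h
      by (auto simp: disjoint_family_on_def bij_betw_def inj_on_def) (metis IntI empty_iff hI lessThan_iff)
  qed
  moreover have "(\<Union>n. ?B n) = (\<Union>i\<in>I. A i)"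
  proof -
    have "(\<Union>n. ?B n) = (\<Union>n\<in>{..<card I}. A (h n))" by (auto split: if_splits)
    also have "\<dots> = (\<Union>i\<in>h ` {..<card I}. A i)" by auto
    also have "h ` {..<card I} = I" using h by (simp add: bij_betw_def)
    finally show ?thesis .
  qed
  moreover have "(\<lambda>n. \<mu> (?B n)) sums (\<Sum>n<card I. \<mu> (?B n))"
    by (rule sums_finite) (auto simp: empty)
  moreover have "(\<Sum>n<card I. \<mu> (?B n)) = (\<Sum>i\<in>I. \<mu> (A i))"
    using h by (subst sum.reindex_bij_betw[OF h, symmetric]) auto
  ultimately show ?thesis by (metis sums_unique2)
qed

lemma diff: "A \<in> sets borel \<Longrightarrow> B \<in> sets borel \<Longrightarrow> A \<subseteq> B \<Longrightarrow> \<mu> (B - A) = \<mu> B - \<mu> A"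
proof -
  assume "A \<in> sets borel" "B \<in> sets borel" "A \<subseteq> B"
  then have "\<mu> (\<Union>b\<in>{True,False}. if b then A else B - A) = \<mu> A + \<mu> (B - A)"
    by (subst finite_sum) (auto simp: disjoint_family_on_def)
  moreover have "(\<Union>b\<in>{True,False}. if b then A else B - A) = B" using \<open>A \<subseteq> B\<close> by auto
  ultimately show "\<mu> (B - A) = \<mu> B - \<mu> A" by simp
qed

sublocale var: subadditive_set_function "\<lambda>A. ennreal \<bar>\<mu> A\<bar>"
proof
  show "ennreal \<bar>\<mu> {}\<bar> = 0" by (simp add: empty)
next
  fix A :: "nat \<Rightarrow> 'a set" assume "range A \<subseteq> sets borel" "disjoint_family A"
  from sums[OF this] have s: "(\<lambda>i. \<mu> (A i)) sums \<mu> (\<Union>i. A i)" .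
  show "ennreal \<bar>\<mu> (\<Union>i. A i)\<bar> \<le> (\<Sum>i. ennreal \<bar>\<mu> (A i)\<bar>)"
  proof (rule LIMSEQ_le)
    show "(\<lambda>n. ennreal \<bar>\<Sum>i<n. \<mu> (A i)\<bar>) \<longlonglongrightarrow> ennreal \<bar>\<mu> (\<Union>i. A i)\<bar>"
      using s by (intro tendsto_ennrealI tendsto_rabs) (simp add: sums_def)
    show "(\<lambda>n. \<Sum>i<n. ennreal \<bar>\<mu> (A i)\<bar>) \<longlonglongrightarrow> (\<Sum>i. ennreal \<bar>\<mu> (A i)\<bar>)"
      by (rule summable_LIMSEQ) simp
    show "\<exists>N. \<forall>n\<ge>N. ennreal \<bar>\<Sum>i<n. \<mu> (A i)\<bar> \<le> (\<Sum>i<n. ennreal \<bar>\<mu> (A i)\<bar>)"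
      by (auto intro!: exI[of _ 0] ennreal_leI sum_abs)
  qed
qed

abbreviation "tv \<equiv> set_variation (\<lambda>A. ennreal \<bar>\<mu> A\<bar>)"

text \<open>A partition with large total mass has a union of blocks of one sign with large mass, so one
  of that union and its complement carries infinite variation, and both have mass larger than 1.\<close>
lemma split_infinite:
  assumes E: "E \<in> sets borel" "tv E = \<infinity>"
  obtains A where "A \<in> sets borel" "A \<subseteq> E" "tv A = \<infinity>" "\<bar>\<mu> (E - A)\<bar> > 1"
proof -
  \<comment> \<open>If \<open>|\<mu> B|\<close> exceeds \<open>1 + |\<mu> E|\<close>, additivity
    leaves \<open>|\<mu> (E - B)| > 1\<close>. The factor 2 below ensures that the blocks of one
    sign alone exceed this threshold.\<close>
  let ?t = "1 + \<bar>\<mu> E\<bar>"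
  have "ennreal (2 * ?t) < tv E" using E by simp
  then obtain P where P: "finite P" "P \<subseteq> sets borel" "partition_on E P"
    "ennreal (2 * ?t) < (\<Sum>A\<in>P. ennreal \<bar>\<mu> A\<bar>)"
    unfolding set_variation_def by (auto simp: less_SUP_iff)
  let ?p = "{A\<in>P. \<mu> A \<ge> 0}" and ?n = "{A\<in>P. \<mu> A < 0}"
  have un: "\<mu> (\<Union>Q) = (\<Sum>A\<in>Q. \<mu> A)" if "Q \<subseteq> P" for Q
    using finite_sum[of Q "\<lambda>x. x"] P(1-3) that finite_subset[OF that P(1)]
    by (auto simp: partition_on_def disjoint_def disjoint_family_on_def subset_eq)
  have "ennreal (2 * ?t) < ennreal (\<Sum>A\<in>P. \<bar>\<mu> A\<bar>)" using P(4) by (simp add: sum_ennreal)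
  then have "2 * ?t < (\<Sum>A\<in>P. \<bar>\<mu> A\<bar>)" by (subst (asm) ennreal_less_iff) auto
  also have "\<dots> = (\<Sum>A\<in>?p \<union> ?n. \<bar>\<mu> A\<bar>)" by (intro sum.cong) auto
  also have "\<dots> = (\<Sum>A\<in>?p. \<bar>\<mu> A\<bar>) + (\<Sum>A\<in>?n. \<bar>\<mu> A\<bar>)"
    using P(1) by (intro sum.union_disjoint) auto
  also have "(\<Sum>A\<in>?p. \<bar>\<mu> A\<bar>) = \<bar>\<mu> (\<Union>?p)\<bar>" by (subst un) (auto intro!: abs_of_nonneg[symmetric] sum_nonneg)
  also have "(\<Sum>A\<in>?n. \<bar>\<mu> A\<bar>) = \<bar>\<mu> (\<Union>?n)\<bar>"
    by (subst un) (auto simp: sum_negf intro!: abs_of_nonpos[symmetric] sum_nonpos)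
  finally have "\<bar>\<mu> (\<Union>?p)\<bar> > ?t \<or> \<bar>\<mu> (\<Union>?n)\<bar> > ?t"
    by (smt (verit))
  then obtain Q where Q: "Q \<subseteq> P" "\<bar>\<mu> (\<Union>Q)\<bar> > ?t"
  proof
    assume "\<bar>\<mu> (\<Union>?p)\<bar> > ?t" then show thesis by (intro that[of ?p]) auto
  next
    assume "\<bar>\<mu> (\<Union>?n)\<bar> > ?t" then show thesis by (intro that[of ?n]) auto
  qed
  define B where "B = \<Union>Q"
  have B: "B \<in> sets borel" "B \<subseteq> E"
    using Q P unfolding B_def by (auto simp: partition_on_def intro!: sets.finite_Union dest: finite_subset)
  have BE: "\<bar>\<mu> B\<bar> > 1" "\<bar>\<mu> (E - B)\<bar> > 1" using Q(2) diff[OF B(1) E(1) B(2)] by (auto simp: B_def)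
  have "tv B + tv (E - B) = tv (B \<union> (E - B))"
    using var.emeasure_variation_measure B E plus_emeasure[of B var.variation_measure "E - B"]
    by simp
  then have "tv B = \<infinity> \<or> tv (E - B) = \<infinity>" using E B(2) by (auto simp: Un_absorb1)
  moreover have "E - (E - B) = B" using B by auto
  ultimately show ?thesis using that[of B] that[of "E - B"] B E BE by auto
qed

text \<open>Otherwise repeated splitting yields a decreasing sequence of sets of infinite variation
  whose successive differences all have mass larger than 1. These differences are disjoint, so their
  masses would form a convergent series whose terms do not tend to 0.\<close>

lemma finite_variation: "tv UNIV < \<infinity>"
proof (rule ccontr)
  assume "\<not> tv UNIV < \<infinity>"
  then have "tv UNIV = \<infinity>" by (metis infinity_ennreal_def less_top)
  let ?S = "{E. E \<in> sets borel \<and> tv E = \<infinity>}"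
  have step: "\<exists>A. A \<in> ?S \<and> A \<subseteq> E \<and> \<bar>\<mu> (E - A)\<bar> > 1" if "E \<in> ?S" for E
  proof -
    have "E \<in> sets borel" "tv E = \<infinity>" using that by auto
    then show ?thesis by (rule split_infinite) auto
  qed
  have "\<exists>F. \<forall>n. F n \<in> ?S \<and> (F (Suc n) \<subseteq> F n \<and> \<bar>\<mu> (F n - F (Suc n))\<bar> > 1)"
  proof (rule dependent_nat_choice)
    show "\<exists>x. x \<in> ?S" using \<open>tv UNIV = \<infinity>\<close> by (intro exI[of _ UNIV]) simp
  qed (rule step)
  then obtain F where F: "\<And>n. F n \<in> ?S" "\<And>n. F (Suc n) \<subseteq> F n" "\<And>n. \<bar>\<mu> (F n - F (Suc n))\<bar> > 1"
    by blast
  have dec: "m \<le> n \<Longrightarrow> F n \<subseteq> F m" for m n using F(2) by (rule lift_Suc_antimono_le)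
  have "(\<lambda>n. \<mu> (F n - F (Suc n))) sums \<mu> (\<Union>n. F n - F (Suc n))"
  proof (rule sums)
    show "disjoint_family (\<lambda>n. F n - F (Suc n))"
    proof -
      have "(F m - F (Suc m)) \<inter> (F n - F (Suc n)) = {}" if "m < n" for m n
        using dec[of "Suc m" n] that by auto
      then show ?thesis unfolding disjoint_family_on_def by (metis Int_commute linorder_neqE_nat)
    qed
  qed (use F(1) in auto)
  then have "(\<lambda>n. \<mu> (F n - F (Suc n))) \<longlonglongrightarrow> 0" by (intro summable_LIMSEQ_zero) (auto simp: sums_iff)
  then have "\<forall>\<^sub>F n in sequentially. \<bar>\<mu> (F n - F (Suc n))\<bar> < 1"
    by (auto dest!: tendstoD[of _ 0 sequentially 1] simp: dist_real_def)
  then obtain n where "\<bar>\<mu> (F n - F (Suc n))\<bar> < 1" by (auto simp: eventually_sequentially)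
  then show False using F(3)[of n] by simp
qed

sublocale var_measure: finite_measure var.variation_measure
  by (rule finite_measureI) (use finite_variation in \<open>simp add: var.emeasure_variation_measure\<close>)

lemma abs_le_variation: "A \<in> sets borel \<Longrightarrow> \<bar>\<mu> A\<bar> \<le> measure var.variation_measure A"
  using var.le_set_variation[of A] var.emeasure_variation_measure[of A]
    var_measure.emeasure_eq_measure[of A]
  by (metis ennreal_le_iff measure_nonneg)

end

section \<open>Inner regularity and uniform approximation by simple functions\<close>

lemma compact_inner_approximation:
  fixes M :: "'a::polish_space measure"
  assumes "finite_measure M" "sets M = sets borel" "B \<in> sets borel" "0 < e"
  obtains K where "compact K" "K \<subseteq> B" "measure M (B - K) < e"
proof -
  interpret finite_measure M by fact
  have *: "emeasure M B = (SUP K \<in> {K. K \<subseteq> B \<and> compact K}. emeasure M K)"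
    by (rule inner_regular) (use assms in auto)
  have "\<exists>K. K \<subseteq> B \<and> compact K \<and> measure M B - e < measure M K"
  \<comment> \<open>\<open>ennreal\<close> turns a negative level into 0, which the supremum need
    not exceed strictly; the empty set settles that case.\<close>
  proof (cases "measure M B - e < 0")
    case True
    then show ?thesis by (intro exI[of _ "{}"]) auto
  next
    case False
    then have "ennreal (measure M B - e) < emeasure M B"
      using assms(4) by (simp add: emeasure_eq_measure ennreal_less_iff)
    then obtain K where K: "K \<subseteq> B" "compact K" "ennreal (measure M B - e) < emeasure M K"
      unfolding * by (auto simp: less_SUP_iff)
    then have "measure M B - e < measure M K"
      using False by (simp add: emeasure_eq_measure ennreal_less_iff)
    with K show ?thesis by auto
  qed
  then obtain K where K: "K \<subseteq> B" "compact K" "measure M B - e < measure M K" by auto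
  moreover have "measure M (B - K) = measure M B - measure M K"
    using K assms(2,3) by (intro finite_measure_Diff) (auto intro!: borel_closed compact_imp_closed)
  ultimately show ?thesis by (intro that[of K]) auto
qed

text \<open>Serves two purposes: a uniform approximation of a bounded function by finitely many
  values, and, in the Leibniz rule for differentials, a pointwise approximation by rational
  numbers.\<close>

definition round_down :: "nat \<Rightarrow> ('a \<Rightarrow> real) \<Rightarrow> 'a \<Rightarrow> real" where
  "round_down n h x = of_int \<lfloor>real (Suc n) * h x\<rfloor> / real (Suc n)"

lemma round_down_bounds: "round_down n h x \<le> h x" "h x < round_down n h x + 1 / real (Suc n)"
proof -
  have "of_int \<lfloor>real (Suc n) * h x\<rfloor> \<le> real (Suc n) * h x"
    "real (Suc n) * h x < of_int \<lfloor>real (Suc n) * h x\<rfloor> + 1" by linarith+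
  then show "round_down n h x \<le> h x" "h x < round_down n h x + 1 / real (Suc n)"
    unfolding round_down_def by (simp_all add: field_simps del: of_nat_Suc)
qed

lemma abs_round_down_diff: "\<bar>round_down n h x - h x\<bar> \<le> 1 / real (Suc n)"
  using round_down_bounds[where n = n and h = h and x = x] by (simp add: abs_le_iff)

lemma round_down_measurable [measurable]:
  "h \<in> borel_measurable M \<Longrightarrow> round_down n h \<in> borel_measurable M"
  unfolding round_down_def[abs_def] by (intro borel_measurable_divide borel_measurable_const) measurable

lemma finite_range_round_down:
  assumes "\<And>x. \<bar>h x\<bar> \<le> c"
  shows "finite (range (round_down n h))"
proof -
  have "range (round_down n h) \<subseteq> (\<lambda>k. of_int k / real (Suc n)) ` {\<lfloor>- (real (Suc n) * c)\<rfloor>..\<lfloor>real (Suc n) * c\<rfloor>}"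
  proof
    fix y assume "y \<in> range (round_down n h)"
    then obtain x where y: "y = round_down n h x" by auto
    have "\<bar>real (Suc n) * h x\<bar> \<le> real (Suc n) * c"
      using assms[of x] by (simp add: abs_mult del: of_nat_Suc)
    then have "- (real (Suc n) * c) \<le> real (Suc n) * h x" "real (Suc n) * h x \<le> real (Suc n) * c"
      by linarith+
    then have "\<lfloor>real (Suc n) * h x\<rfloor> \<in> {\<lfloor>- (real (Suc n) * c)\<rfloor>..\<lfloor>real (Suc n) * c\<rfloor>}"
      by (auto intro!: floor_mono simp del: of_nat_Suc)
    then show "y \<in> (\<lambda>k. of_int k / real (Suc n)) ` {\<lfloor>- (real (Suc n) * c)\<rfloor>..\<lfloor>real (Suc n) * c\<rfloor>}"
      unfolding y round_down_def by blast
  qed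
  then show ?thesis by (rule finite_subset) simp
qed

lemma uniform_limit_round_down: "uniform_limit UNIV (\<lambda>n. round_down n h) h sequentially"
proof (rule uniform_limitI)
  fix e :: real assume "0 < e"
  then have "\<forall>\<^sub>F n in sequentially. 1 / real (Suc n) < e"
    using order_tendstoD(2)[OF LIMSEQ_inverse_real_of_nat, of e] by (simp add: inverse_eq_divide)
  then show "\<forall>\<^sub>F n in sequentially. \<forall>x\<in>UNIV. dist (round_down n h x) (h x) < e"
  proof eventually_elim
    case (elim n)
    then show ?case unfolding dist_real_def
      using abs_round_down_diff[of n h] by (blast intro: le_less_trans)
  qed
qed

lemma simple_function_borel_iff:
  fixes s :: "'a::topological_space \<Rightarrow> real"
  shows "simple_function borel s \<longleftrightarrow> finite (range s) \<and> s \<in> borel_measurable borel"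
  using simple_function_borel_measurable[of s borel] simple_functionD(1)[of borel s]
  by (auto intro: borel_measurable_simple_function)

lemma simple_function_round_down:
  fixes h :: "'a::topological_space \<Rightarrow> real"
  assumes "h \<in> borel_measurable borel" "\<And>x. \<bar>h x\<bar> \<le> c"
  shows "simple_function borel (round_down n h)"
  using assms finite_range_round_down[of h c] by (simp add: simple_function_borel_iff)

section \<open>Integration against a signed measure\<close>

context signed_measure
begin

text \<open>The sum of the variation and \<mu> is nonnegative, so \<mu> is the difference of two
  finite measures and its integral is a difference of two Lebesgue integrals.\<close>

definition pos_measure :: "'a measure" where
  "pos_measure = measure_of UNIV (sets borel) (\<lambda>A. ennreal (measure var.variation_measure A + \<mu> A))"

lemma sets_pos_measure [measurable_cong, simp]: "sets pos_measure = sets borel"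
  unfolding pos_measure_def by (metis sets.sets_measure_of_eq space_borel)

lemma space_pos_measure [simp]: "space pos_measure = UNIV"
  unfolding pos_measure_def by simp

lemma emeasure_pos_measure:
  assumes "A \<in> sets borel"
  shows "emeasure pos_measure A = ennreal (measure var.variation_measure A + \<mu> A)"
proof -
  let ?p = "\<lambda>A. measure var.variation_measure A + \<mu> A"
  have nn: "0 \<le> ?p A" if "A \<in> sets borel" for A
    using abs_le_variation[OF that] by linarith
  have "countably_additive (sets borel) (\<lambda>A. ennreal (?p A))"
  proof (rule countably_additiveI)
    fix A :: "nat \<Rightarrow> 'a set" assume A: "range A \<subseteq> sets borel" "disjoint_family A" "(\<Union>i. A i) \<in> sets borel"
    have "(\<lambda>i. ?p (A i)) sums ?p (\<Union>i. A i)"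
      using A by (intro sums_add sums var_measure.finite_measure_UNION) auto
    then have "(\<lambda>i. ennreal (?p (A i))) sums ennreal (?p (\<Union>i. A i))"
      using nn A by (subst sums_ennreal) auto
    then show "(\<Sum>i. ennreal (?p (A i))) = ennreal (?p (\<Union>i. A i))" by (rule sums_unique[symmetric])
  qed
  then show ?thesis
    using assms sets.sigma_algebra_axioms[of "borel :: 'a measure"]
    unfolding pos_measure_def
    by (intro emeasure_measure_of_sigma) (auto simp: positive_def empty)
qed

sublocale pos: finite_measure pos_measure
  by (rule finite_measureI) (simp add: emeasure_pos_measure)

lemma measure_pos_measure:
  assumes "A \<in> sets borel"
  shows "measure pos_measure A = measure var.variation_measure A + \<mu> A"
  using emeasure_pos_measure[OF assms] abs_le_variation[OF assms]
  by (simp add: measure_def)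

definition integral_signed :: "('a \<Rightarrow> real) \<Rightarrow> real" where
  "integral_signed h = (\<integral>x. h x \<partial>pos_measure) - (\<integral>x. h x \<partial>var.variation_measure)"

lemma bounded_integrable:
  fixes h :: "'a \<Rightarrow> real"
  assumes "h \<in> borel_measurable borel" "\<And>x. \<bar>h x\<bar> \<le> c"
  shows "integrable pos_measure h" "integrable var.variation_measure h"
proof -
  have 1: "h \<in> borel_measurable pos_measure" using assms(1) by simp
  have 2: "h \<in> borel_measurable var.variation_measure" using assms(1) by simp
  show "integrable pos_measure h"
    by (rule pos.integrable_const_bound[OF _ 1, of c]) (simp add: assms(2))
  show "integrable var.variation_measure h"
    by (rule var_measure.integrable_const_bound[OF _ 2, of c]) (simp add: assms(2))
qed

lemma integral_signed_add:
  assumes "h \<in> borel_measurable borel" "\<And>x. \<bar>h x\<bar> \<le> c" "k \<in> borel_measurable borel" "\<And>x. \<bar>k x\<bar> \<le> c'"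
  shows "integral_signed (\<lambda>x. h x + k x) = integral_signed h + integral_signed k"
  unfolding integral_signed_def using bounded_integrable[OF assms(1,2)] bounded_integrable[OF assms(3,4)]
  by simp

lemma integral_signed_diff:
  assumes "h \<in> borel_measurable borel" "\<And>x. \<bar>h x\<bar> \<le> c" "k \<in> borel_measurable borel" "\<And>x. \<bar>k x\<bar> \<le> c'"
  shows "integral_signed (\<lambda>x. h x - k x) = integral_signed h - integral_signed k"
  unfolding integral_signed_def using bounded_integrable[OF assms(1,2)] bounded_integrable[OF assms(3,4)]
  by simp

lemma integral_signed_sum:
  assumes "\<And>i. i \<in> I \<Longrightarrow> h i \<in> borel_measurable borel" "\<And>i x. i \<in> I \<Longrightarrow> \<bar>h i x\<bar> \<le> (c i :: real)"
  shows "integral_signed (\<lambda>x. \<Sum>i\<in>I. h i x) = (\<Sum>i\<in>I. integral_signed (h i))"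
  unfolding integral_signed_def
  by (subst (1 2) Bochner_Integration.integral_sum)
    (auto simp: sum_subtractf intro!: bounded_integrable assms)

lemma integral_signed_cmult: "integral_signed (\<lambda>x. c * h x) = c * integral_signed h"
  unfolding integral_signed_def by (simp add: algebra_simps)

lemma integral_signed_indicator: "A \<in> sets borel \<Longrightarrow> integral_signed (indicator A) = \<mu> A"
  unfolding integral_signed_def by (simp add: measure_pos_measure)

text \<open>The right-hand side is the expression that defines the Bartle integral of a simple
  function, so this is the bridge from vector measures to scalar integration.\<close>

lemma integral_signed_simple:
  assumes "simple_function borel s" "A \<in> sets borel"
  shows "integral_signed (\<lambda>x. indicator A x * s x) = (\<Sum>c\<in>range s. c * \<mu> (A \<inter> s -` {c}))"
proof -
  have s: "finite (range s)" "s \<in> borel_measurable borel"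
    using assms(1) by (auto simp: simple_function_borel_iff)
  have "(\<lambda>x. indicator A x * s x) = (\<lambda>x. \<Sum>c\<in>range s. c * indicator (A \<inter> s -` {c}) x)"
  proof
    fix x
    have "(\<Sum>c\<in>range s. c * indicator (A \<inter> s -` {c}) x) =
        (\<Sum>c\<in>range s. if c = s x then s x * indicator A x else 0)"
      by (intro sum.cong) (auto simp: indicator_def)
    then show "indicator A x * s x = (\<Sum>c\<in>range s. c * indicator (A \<inter> s -` {c}) x)"
      using s(1) by simp
  qed
  then have *: "integral_signed (\<lambda>x. indicator A x * s x) =
      integral_signed (\<lambda>x. \<Sum>c\<in>range s. c * indicator (A \<inter> s -` {c}) x)" by simp
  have B: "A \<inter> s -` {c} \<in> sets borel" for c
    using measurable_sets[OF s(2), of "{c}"] assms(2) by auto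
  have "integral_signed (\<lambda>x. indicator A x * s x) =
      (\<Sum>c\<in>range s. integral_signed (\<lambda>x. c * indicator (A \<inter> s -` {c}) x))"
    unfolding * using B
    by (intro integral_signed_sum[where c = "\<lambda>c. \<bar>c\<bar>"] borel_measurable_times
        borel_measurable_const borel_measurable_indicator) (auto simp: indicator_def)
  also have "\<dots> = (\<Sum>c\<in>range s. c * \<mu> (A \<inter> s -` {c}))"
    by (simp add: integral_signed_cmult integral_signed_indicator[OF B])
  finally show ?thesis .
qed

lemma abs_integral_signed_bound:
  assumes "h \<in> borel_measurable borel" "\<And>x. \<bar>h x\<bar> \<le> c"
  shows "\<bar>integral_signed h\<bar> \<le> c * (measure pos_measure UNIV + measure var.variation_measure UNIV)"
proof -
  have "\<bar>\<integral>x. h x \<partial>pos_measure\<bar> \<le> (\<integral>x. c \<partial>pos_measure)"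
    using bounded_integrable[OF assms] assms(2) by (intro integral_abs_bound[THEN order_trans] integral_mono) auto
  moreover have "\<bar>\<integral>x. h x \<partial>var.variation_measure\<bar> \<le> (\<integral>x. c \<partial>var.variation_measure)"
    using bounded_integrable[OF assms] assms(2) by (intro integral_abs_bound[THEN order_trans] integral_mono) auto
  ultimately show ?thesis unfolding integral_signed_def by (simp add: algebra_simps)
qed

lemma integral_signed_uniform_limit:
  assumes "\<And>n. s n \<in> borel_measurable borel" "\<And>n x. \<bar>s n x\<bar> \<le> b n"
    and "h \<in> borel_measurable borel" "\<And>x. \<bar>h x\<bar> \<le> c"
    and lim: "uniform_limit UNIV s h sequentially" and A: "A \<in> sets borel"
  shows "(\<lambda>n. integral_signed (\<lambda>x. indicator A x * s n x)) \<longlonglongrightarrow> integral_signed (\<lambda>x. indicator A x * h x)"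
proof (rule tendstoI)
  fix e :: real assume e: "0 < e"
  let ?C = "measure pos_measure UNIV + measure var.variation_measure UNIV"
  have C: "0 \<le> ?C" by simp
  \<comment> \<open>The summand 1 keeps the denominator positive when both masses vanish.\<close>
  define d where "d = e / (?C + 1)"
  have d: "0 < d" "d * ?C < e" using e C unfolding d_def by (auto simp: field_simps add_pos_nonneg intro!: divide_pos_pos)
  have "\<forall>\<^sub>F n in sequentially. \<forall>x\<in>UNIV. dist (s n x) (h x) < d"
    using lim d(1) by (rule uniform_limitD)
  then show "\<forall>\<^sub>F n in sequentially. dist (integral_signed (\<lambda>x. indicator A x * s n x))
      (integral_signed (\<lambda>x. indicator A x * h x)) < e"
  proof eventually_elim
    case (elim n)
    have ib: "\<bar>indicator A x * t\<bar> \<le> r" if "\<bar>t\<bar> \<le> r" for x t and r :: real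
      using that by (auto simp: indicator_def abs_mult)
    have m: "(\<lambda>x. indicator A x * s n x) \<in> borel_measurable borel"
      "(\<lambda>x. indicator A x * h x) \<in> borel_measurable borel" using A assms(1,3) by auto
    have "\<bar>integral_signed (\<lambda>x. indicator A x * s n x) - integral_signed (\<lambda>x. indicator A x * h x)\<bar>
        = \<bar>integral_signed (\<lambda>x. indicator A x * s n x - indicator A x * h x)\<bar>"
      by (subst integral_signed_diff[OF m(1) ib[OF assms(2)] m(2) ib[OF assms(4)]]) simp
    also have "\<dots> \<le> d * ?C"
    proof (rule abs_integral_signed_bound)
      show "\<bar>indicator A x * s n x - indicator A x * h x\<bar> \<le> d" for x
        using elim by (auto simp: indicator_def dist_real_def less_imp_le d(1))
    qed (use m in simp)
    finally show ?case using d(2) by (simp add: dist_real_def)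
  qed
qed

lemma integral_signed_simple_limit:
  assumes "\<And>n. simple_function borel (s n)" "uniform_limit UNIV s h sequentially"
    and "h \<in> borel_measurable borel" "\<And>x. \<bar>h x\<bar> \<le> c" "A \<in> sets borel"
  shows "(\<lambda>n. \<Sum>c\<in>range (s n). c * \<mu> (A \<inter> s n -` {c})) \<longlonglongrightarrow> integral_signed (\<lambda>x. indicator A x * h x)"
proof -
  have s: "finite (range (s n))" "s n \<in> borel_measurable borel" for n
    using assms(1) by (auto simp: simple_function_borel_iff)
  have "\<bar>s n x\<bar> \<le> Max (abs ` range (s n))" for n x using s(1) by (intro Max_ge) auto
  from integral_signed_uniform_limit[OF s(2) this assms(3,4,2,5)]
  show ?thesis by (simp add: integral_signed_simple[OF assms(1,5)])
qed

lemma integral_signed_dominated: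
  assumes "\<And>n. s n \<in> borel_measurable borel" "\<And>n x. \<bar>s n x\<bar> \<le> c" "h \<in> borel_measurable borel"
    "\<And>x. (\<lambda>n. s n x) \<longlonglongrightarrow> h x"
  shows "(\<lambda>n. integral_signed (s n)) \<longlonglongrightarrow> integral_signed h"
  unfolding integral_signed_def using assms
  by (intro tendsto_diff integral_dominated_convergence[where w = "\<lambda>_. c"]) auto

text \<open>Bounding the two integrals of the decomposition separately would involve the masses of
  both measures. Setwise domination by \<open>K * measure M\<close> is used instead on the level
  sets of simple approximations, and both sides then pass to the limit.\<close>

lemma abs_integral_signed_le:
  assumes "h \<in> borel_measurable borel" "\<And>x. \<bar>h x\<bar> \<le> c"
    and M: "finite_measure M" and sets_M [measurable_cong, simp]: "sets M = sets borel"
    and K: "\<And>A. A \<in> sets borel \<Longrightarrow> \<bar>\<mu> A\<bar> \<le> K * measure M A"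
  shows "\<bar>integral_signed h\<bar> \<le> K * (\<integral>x. \<bar>h x\<bar> \<partial>M)"
proof (rule LIMSEQ_le)
  interpret M: finite_measure M by fact
  let ?s = "\<lambda>n. round_down n h"
  have sf: "simple_function borel (?s n)" for n using assms(1,2) by (rule simple_function_round_down)
  show "(\<lambda>n. \<bar>\<Sum>c\<in>range (?s n). c * \<mu> (UNIV \<inter> ?s n -` {c})\<bar>) \<longlonglongrightarrow> \<bar>integral_signed h\<bar>"
    using integral_signed_simple_limit[OF sf uniform_limit_round_down assms(1,2), of UNIV]
    by (intro tendsto_rabs) simp
  have c1: "\<bar>?s n x\<bar> \<le> c + 1" for n x
  proof -
    have "1 / real (Suc n) \<le> 1" by simp
    then show ?thesis using abs_round_down_diff[of n h x] assms(2)[of x] by linarith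
  qed
  have [measurable]: "h \<in> borel_measurable borel" by fact
  have "(\<lambda>n. ?s n x) \<longlonglongrightarrow> h x" for x
    using uniform_limit_round_down[of h] by (rule tendsto_uniform_limitI) simp
  then show "(\<lambda>n. K * (\<integral>x. \<bar>?s n x\<bar> \<partial>M)) \<longlonglongrightarrow> K * (\<integral>x. \<bar>h x\<bar> \<partial>M)"
    using c1 by (intro tendsto_mult tendsto_const integral_dominated_convergence[where w = "\<lambda>_. c + 1"]) (auto intro!: tendsto_rabs)
  show "\<exists>N. \<forall>n\<ge>N. \<bar>\<Sum>c\<in>range (?s n). c * \<mu> (UNIV \<inter> ?s n -` {c})\<bar> \<le> K * (\<integral>x. \<bar>?s n x\<bar> \<partial>M)"
  proof (intro exI allI impI)
    fix n :: nat
    have fin: "finite (range (?s n))" using sf[of n] by (auto simp: simple_function_borel_iff)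
    have B: "?s n -` {c} \<in> sets borel" for c
      using measurable_sets[of "?s n" borel borel "{c}"] by auto
    have "\<bar>\<Sum>c\<in>range (?s n). c * \<mu> (UNIV \<inter> ?s n -` {c})\<bar> \<le> K * (\<Sum>c\<in>range (?s n). \<bar>c\<bar> * measure M (?s n -` {c}))"
      using K[OF B] unfolding sum_distrib_left mult.left_commute[of K]
      by (intro sum_abs[THEN order_trans] sum_mono) (auto simp: abs_mult intro!: mult_left_mono)
    also have "(\<Sum>c\<in>range (?s n). \<bar>c\<bar> * measure M (?s n -` {c})) = (\<Sum>c\<in>range (?s n). \<integral>x. \<bar>c\<bar> * indicator (?s n -` {c}) x \<partial>M)"
      using B by simp
    also have "\<dots> = (\<integral>x. (\<Sum>c\<in>range (?s n). \<bar>c\<bar> * indicator (?s n -` {c}) x) \<partial>M)"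
      using B by (intro Bochner_Integration.integral_sum[symmetric] M.integrable_const_bound[where B = "\<bar>_\<bar>"])
        (auto simp: indicator_def)
    also have "\<dots> = (\<integral>x. \<bar>?s n x\<bar> \<partial>M)"
    proof (rule Bochner_Integration.integral_cong)
      fix x
      have "(\<Sum>c\<in>range (?s n). \<bar>c\<bar> * indicator (?s n -` {c}) x) = (\<Sum>c\<in>range (?s n). if c = ?s n x then \<bar>c\<bar> else 0)"
        by (intro sum.cong) (auto simp: indicator_def)
      then show "(\<Sum>c\<in>range (?s n). \<bar>c\<bar> * indicator (?s n -` {c}) x) = \<bar>?s n x\<bar>" using fin by simp
    qed simp
    finally show "\<bar>\<Sum>c\<in>range (?s n). c * \<mu> (UNIV \<inter> ?s n -` {c})\<bar> \<le> K * (\<integral>x. \<bar>?s n x\<bar> \<partial>M)" .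
  qed
qed

text \<open>The open sets are an intersection-stable generator, and the sets with
  \<open>\<mu> (A \<inter> U) = 0\<close> form a Dynkin system. This extends locality, which is
  postulated for open sets, to Borel sets.\<close>

lemma zero_on_open_imp_zero:
  assumes U: "open U" and z: "\<And>B. open B \<Longrightarrow> B \<subseteq> U \<Longrightarrow> \<mu> B = 0"
    and A: "A \<in> sets borel" "A \<subseteq> U"
  shows "\<mu> A = 0"
proof -
  have "\<mu> (A \<inter> U) = 0"
  proof (rule sigma_sets_induct_disjoint[where G = "{S. open S}" and \<Omega> = UNIV and P = "\<lambda>A. \<mu> (A \<inter> U) = 0"])
    show "A \<in> sigma_sets UNIV {S. open S}" using A(1) by (simp add: borel_def)
    show "Int_stable {S. open S}" by (auto simp: Int_stable_def)
    show "\<mu> ({} \<inter> U) = 0" by (simp add: empty)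
    show "\<mu> (B \<inter> U) = 0" if "B \<in> {S. open S}" for B using that U by (intro z) auto
  next
    fix B assume "B \<in> sigma_sets UNIV {S. open S}" and 0: "\<mu> (B \<inter> U) = 0"
    then have B: "B \<in> sets borel" by (simp add: borel_def)
    have "(UNIV - B) \<inter> U = U - B \<inter> U" by auto
    then show "\<mu> ((UNIV - B) \<inter> U) = 0" using diff[of "B \<inter> U" U] B U z[of U] 0 by auto
  next
    fix B :: "nat \<Rightarrow> 'a set"
    assume B: "disjoint_family B" "range B \<subseteq> sigma_sets UNIV {S. open S}" "\<And>i. \<mu> (B i \<inter> U) = 0"
    then have "range B \<subseteq> sets borel" by (simp add: borel_def)
    then have "(\<lambda>i. \<mu> (B i \<inter> U)) sums \<mu> (\<Union>i. B i \<inter> U)"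
      using B U by (intro sums disjoint_family_on_bisimulation[OF B(1)]) auto
    moreover have "(\<Union>i. B i \<inter> U) = (\<Union>i. B i) \<inter> U" by auto
    ultimately show "\<mu> ((\<Union>i. B i) \<inter> U) = 0" using B(3) by (simp add: sums_iff)
  qed auto
  moreover have "A \<inter> U = A" using A by auto
  ultimately show ?thesis by simp
qed

end

section \<open>Local vector measures\<close>

context normed_Cb_module
begin

text \<open>This is the one-term case of \<open>nrm_disjoint_sum\<close>.\<close>

lemma nrm_act_le:
  assumes "f \<in> bcontfun" "\<And>x. \<bar>f x\<bar> \<le> c" "v \<in> V"
  shows "nrm (act f v) \<le> c * nrm v"
proof -
  have "nrm (\<Sum>i\<in>{0::nat}. act f v) \<le> (MAX i\<in>{0::nat}. sup_norm f) * (MAX i\<in>{0::nat}. nrm v)"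
    using assms by (intro nrm_disjoint_sum) (auto simp: disjoint_family_on_def)
  moreover have "sup_norm f \<le> c" unfolding sup_norm_def using assms(2) by (intro cSUP_least) auto
  ultimately show ?thesis
    using mult_right_mono[OF _ nrm_nonneg[OF assms(3)], of "sup_norm f" c] by simp
qed

lemma V_0: "0 \<in> V"
  and V_scale: "v \<in> V \<Longrightarrow> c *\<^sub>R v \<in> V"
  and V_sum: "(\<And>i. i \<in> I \<Longrightarrow> u i \<in> V) \<Longrightarrow> (\<Sum>i\<in>I. u i) \<in> V"
  using subspace_V by (auto intro: subspace_0 subspace_scale subspace_sum)

lemma nrm_0: "nrm 0 = 0"
  using nrm_eq_0[OF V_0] by simp

lemma abs_le_dual_norm:
  assumes \<phi>: "\<phi> \<in> dual_space V nrm" and v: "v \<in> V"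
  shows "\<bar>\<phi> v\<bar> \<le> enn2real (dual_norm V nrm \<phi>) * nrm v"
proof (cases "nrm v = 0")
  case True
  then have "v = 0" using nrm_eq_0[OF v] by simp
  moreover have "\<phi> (0 *\<^sub>R v + 0 *\<^sub>R v) = 0 * \<phi> v + 0 * \<phi> v"
    using \<phi> v unfolding dual_space_def by blast
  ultimately show ?thesis using True by simp
next
  case False
  with nrm_nonneg[OF v] have pos: "0 < nrm v" by simp
  have fin: "dual_norm V nrm \<phi> < \<infinity>" using \<phi> by (auto simp: dual_space_def)
  define w where "w = (1 / nrm v) *\<^sub>R v"
  have w: "w \<in> V" "nrm w \<le> 1" using v pos by (auto simp: w_def V_scale nrm_scaleR)
  have "\<phi> ((1 / nrm v) *\<^sub>R v + 0 *\<^sub>R v) = (1 / nrm v) * \<phi> v + 0 * \<phi> v"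
    using \<phi> v unfolding dual_space_def by blast
  then have "\<phi> w = \<phi> v / nrm v" by (simp add: w_def)
  moreover have "ennreal \<bar>\<phi> w\<bar> \<le> dual_norm V nrm \<phi>"
    unfolding dual_norm_def using w by (intro SUP_upper) auto
  then have "\<bar>\<phi> w\<bar> \<le> enn2real (dual_norm V nrm \<phi>)"
    using fin by (metis enn2real_ennreal enn2real_mono abs_ge_zero infinity_ennreal_def)
  ultimately have "\<bar>\<phi> v\<bar> / nrm v \<le> enn2real (dual_norm V nrm \<phi>)" using pos by simp
  then show ?thesis using pos by (simp add: pos_divide_le_eq)
qed

lemma dual_norm_le:
  assumes "\<And>v. v \<in> V \<Longrightarrow> nrm v \<le> 1 \<Longrightarrow> \<bar>\<phi> v\<bar> \<le> c"
  shows "dual_norm V nrm \<phi> \<le> ennreal c"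
  unfolding dual_norm_def using assms by (intro SUP_least ennreal_leI) auto

end

section \<open>Locality and variation of a local vector measure\<close>

locale local_vector_measure_on = normed_Cb_module V nrm act
  for V :: "'v::real_vector set" and nrm :: "'v \<Rightarrow> real"
    and act :: "('a::polish_space \<Rightarrow> real) \<Rightarrow> 'v \<Rightarrow> 'v" +
  fixes N :: "'a set \<Rightarrow> 'v \<Rightarrow> real"
  assumes lvm: "local_vector_measure V nrm act N"
begin

lemma N_dual: "A \<in> sets borel \<Longrightarrow> N A \<in> dual_space V nrm"
  and N_not_borel: "A \<notin> sets borel \<Longrightarrow> N A v = 0"
  and N_sigma: "range B \<subseteq> sets borel \<Longrightarrow> disjoint_family B \<Longrightarrow>
        (\<lambda>n. dual_norm V nrm (\<lambda>v. N (\<Union>i. B i) v - (\<Sum>i<n. N (B i) v))) \<longlonglongrightarrow> 0"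
  and N_local: "open A \<Longrightarrow> v \<in> V \<Longrightarrow> restr_norm nrm act A v = 0 \<Longrightarrow> N A v = 0"
  using lvm unfolding local_vector_measure_def by auto

lemma N_not_V: "v \<notin> V \<Longrightarrow> N A v = 0"
  using N_dual[of A] N_not_borel[of A] by (cases "A \<in> sets borel") (auto simp: dual_space_def)

lemma N_linear: "v \<in> V \<Longrightarrow> w \<in> V \<Longrightarrow> N A (a *\<^sub>R v + b *\<^sub>R w) = a * N A v + b * N A w"
  using N_dual[of A] N_not_borel[of A] by (cases "A \<in> sets borel") (auto simp: dual_space_def)

lemma N_add: "v \<in> V \<Longrightarrow> w \<in> V \<Longrightarrow> N A (v + w) = N A v + N A w"
  and N_scale: "v \<in> V \<Longrightarrow> N A (c *\<^sub>R v) = c * N A v"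
  and N_0: "N A 0 = 0"
  using N_linear[of v w A 1 1] N_linear[of v v A c 0]
    N_linear[OF V_0 V_0, of A 0 0] by simp_all

lemma N_sum: "finite I \<Longrightarrow> (\<And>i. i \<in> I \<Longrightarrow> u i \<in> V) \<Longrightarrow> N A (\<Sum>i\<in>I. u i) = (\<Sum>i\<in>I. N A (u i))"
  by (induction I rule: finite_induct) (auto simp: N_0 N_add V_sum)

definition N_norm :: "'a set \<Rightarrow> real" where
  "N_norm A = enn2real (dual_norm V nrm (N A))"

lemma dual_norm_N: "dual_norm V nrm (N A) = ennreal (N_norm A)"
proof -
  have "dual_norm V nrm (N A) < \<infinity>"
  proof (cases "A \<in> sets borel")
    case True
    then show ?thesis using N_dual[OF True] by (auto simp: dual_space_def)
  next
    case False
    then show ?thesis using dual_norm_le[of "N A" 0] N_not_borel[OF False] by (simp add: order_le_less_trans)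
  qed
  then show ?thesis unfolding N_norm_def by simp
qed

lemma N_norm_nonneg: "0 \<le> N_norm A"
  by (simp add: N_norm_def)

lemma abs_N_le: "v \<in> V \<Longrightarrow> \<bar>N A v\<bar> \<le> N_norm A * nrm v"
proof (cases "A \<in> sets borel")
  case True
  then show "v \<in> V \<Longrightarrow> ?thesis" using abs_le_dual_norm[OF N_dual[OF True]] by (simp add: N_norm_def)
next
  case False
  then show "v \<in> V \<Longrightarrow> ?thesis" using N_not_borel[OF False] N_norm_nonneg nrm_nonneg by simp
qed

lemma signed_measure_N: "signed_measure (\<lambda>A. N A v)"
proof (unfold_locales)
  fix A :: "nat \<Rightarrow> 'a set" assume A: "range A \<subseteq> sets borel" "disjoint_family A"
  show "(\<lambda>i. N (A i) v) sums N (\<Union>i. A i) v"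
  proof (cases "v \<in> V")
    case False
    then show ?thesis by (simp add: N_not_V)
  next
    case True
    let ?\<phi> = "\<lambda>n v. N (\<Union>i. A i) v - (\<Sum>i<n. N (A i) v)"
    have lin: "?\<phi> n (a *\<^sub>R v + b *\<^sub>R w) = a * ?\<phi> n v + b * ?\<phi> n w" if "v \<in> V" "w \<in> V" for n a b v w
      using that by (simp add: N_linear sum.distrib sum_distrib_left algebra_simps)
    have lim: "(\<lambda>n. dual_norm V nrm (?\<phi> n)) \<longlonglongrightarrow> 0" by (rule N_sigma[OF A])
    \<comment> \<open>The dual norm of a remainder is an extended number. Once it is finite the
      remainder belongs to the dual space, and its value at \<open>v\<close> is bounded by its
      norm.\<close>
    then have "\<forall>\<^sub>F n in sequentially. dual_norm V nrm (?\<phi> n) < \<infinity>"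
      by (intro order_tendstoD(2)[OF lim]) simp
    then have ev: "\<forall>\<^sub>F n in sequentially. norm (?\<phi> n v) \<le> enn2real (dual_norm V nrm (?\<phi> n)) * nrm v"
    proof eventually_elim
      case (elim n)
      then have "?\<phi> n \<in> dual_space V nrm"
        unfolding dual_space_def using lin by (auto simp: N_not_V)
      then show ?case using abs_le_dual_norm[OF _ True, of "?\<phi> n"] by simp
    qed
    have "(\<lambda>n. enn2real (dual_norm V nrm (?\<phi> n)) * nrm v) \<longlonglongrightarrow> 0 * nrm v"
      using tendsto_enn2real[where l = 0, OF lim[folded ennreal_0]] by (intro tendsto_mult_right) simp
    then have "(\<lambda>n. ?\<phi> n v) \<longlonglongrightarrow> 0"
      using ev by (intro Lim_null_comparison[of "\<lambda>n. ?\<phi> n v"]) auto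
    then have "(\<lambda>n. N (\<Union>i. A i) v - ?\<phi> n v) \<longlonglongrightarrow> N (\<Union>i. A i) v - 0"
      by (intro tendsto_intros)
    then show ?thesis by (simp add: sums_def)
  qed
qed

sublocale sm: signed_measure "\<lambda>A. N A v" for v
  by (rule signed_measure_N)

text \<open>Continuity from above in norm: the differences \<open>B i - B (Suc i)\<close> are
  disjoint with union \<open>B 0\<close>, and the n-th remainder of the corresponding series is
  \<open>N (B n)\<close>.\<close>

lemma dual_norm_decreasing:
  assumes B: "range B \<subseteq> sets borel" "decseq B" "(\<Inter>i. B i) = {}"
  shows "(\<lambda>n. N_norm (B n)) \<longlonglongrightarrow> 0"
proof -
  define A where "A i = B i - B (Suc i)" for i
  have dec: "B n \<subseteq> B m" if "m \<le> n" for m n using B(2) that by (auto simp: decseq_def)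
  have A: "range A \<subseteq> sets borel" "disjoint_family A"
  proof -
    show "range A \<subseteq> sets borel" using B(1) by (auto simp: A_def)
    have "A m \<inter> A n = {}" if "m < n" for m n using dec[of "Suc m" n] that by (auto simp: A_def)
    then show "disjoint_family A" unfolding disjoint_family_on_def by (metis Int_commute linorder_neqE_nat)
  qed
  have un: "(\<Union>i<n. A i) = B 0 - B n" for n
  proof (induction n)
    case (Suc n)
    have "(\<Union>i<Suc n. A i) = (\<Union>i<n. A i) \<union> A n" by (auto simp: lessThan_Suc)
    then show ?case using Suc dec[of 0 n] dec[of n "Suc n"] by (auto simp: A_def)
  qed simp
  have "(\<Union>i. A i) = B 0"
  proof -
    have "(\<Union>i. A i) = (\<Union>n. \<Union>i<n. A i)" by (auto intro: lessI)
    also have "\<dots> = B 0 - (\<Inter>n. B n)" unfolding un by auto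
    finally show ?thesis using B(3) by simp
  qed
  moreover have "N (B 0) v - (\<Sum>i<n. N (A i) v) = N (B n) v" for n v
  proof -
    have "(\<Sum>i<n. N (A i) v) = N (\<Union>i<n. A i) v"
      using A by (intro sm.finite_sum[symmetric]) (auto simp: disjoint_family_on_def)
    also have "\<dots> = N (B 0) v - N (B n) v" unfolding un using B(1) dec[of 0 n] by (intro sm.diff) auto
    finally show ?thesis by simp
  qed
  ultimately have "(\<lambda>n. dual_norm V nrm (\<lambda>v. N (B n) v)) \<longlonglongrightarrow> 0" using N_sigma[OF A] by simp
  from tendsto_enn2real[where l = 0, OF this[folded ennreal_0]] show ?thesis by (simp add: N_norm_def)
qed

text \<open>If \<open>f - g\<close> vanishes on the open set \<open>A\<close>, every multiplier
  supported in an open subset of \<open>A\<close> annihilates \<open>act (f - g) v\<close>, so its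
  restricted norm there is 0. Locality gives the claim on open subsets, and
  \<open>zero_on_open_imp_zero\<close> on Borel subsets.\<close>

lemma N_act_cong:
  assumes "f \<in> bcontfun" "g \<in> bcontfun" "v \<in> V" "open A" "\<And>x. x \<in> A \<Longrightarrow> f x = g x"
    and B: "B \<in> sets borel" "B \<subseteq> A"
  shows "N B (act f v) = N B (act g v)"
proof -
  let ?h = "\<lambda>x. f x - g x"
  have h: "?h \<in> bcontfun" using assms(1,2) by (rule minus_cont)
  have hv: "act ?h v \<in> V" by (rule act_closed[OF h assms(3)])
  have zero: "N B (act ?h v) = 0"
  proof (rule sm.zero_on_open_imp_zero[OF assms(4) _ B])
    fix C assume C: "open C" "C \<subseteq> A"
    have "restr_norm nrm act C (act ?h v) \<le> 0"
      unfolding restr_norm_def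
    proof (rule SUP_least)
      fix k :: "'a \<Rightarrow> real" assume k: "k \<in> {f \<in> bcontfun. supp f \<subseteq> C \<and> sup_norm f \<le> 1}"
      have "(\<lambda>x. k x * ?h x) = (\<lambda>_. 0)"
      proof
        fix x show "k x * ?h x = 0"
        proof (cases "k x = 0")
          case False
          then have "x \<in> supp k" by (auto simp: supp_def intro!: subsetD[OF closure_subset])
          then show ?thesis using k C(2) assms(5) by auto
        qed simp
      qed
      then have "act k (act ?h v) = act (\<lambda>_. 0) v"
        using act_mult[of k ?h v] k h assms(3) by simp
      then show "ennreal (nrm (act k (act ?h v))) \<le> 0" using act_const[OF assms(3), of 0] by (simp add: nrm_0)
    qed
    then show "N C (act ?h v) = 0" using N_local[OF C(1) hv] by simp
  qed
  have "act (\<lambda>x. ?h x + g x) v = act ?h v + act g v" by (rule act_add_left[OF h assms(2,3)])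
  then have "act f v = act ?h v + act g v" by simp
  then show ?thesis using N_add[OF hv act_closed[OF assms(2,3)], of B] zero by simp
qed

text \<open>Approximate each \<open>B i\<close> from inside by a compact set \<open>K i\<close> and cut off \<open>w i\<close> near \<open>K i\<close>: the
  cut-offs have disjoint supports, so the sum of the resulting vectors still has norm at most \<open>r\<close>.\<close>
lemma abs_sum_N_le:
  fixes I :: "nat set"
  assumes I: "finite I" and B: "\<And>i. i \<in> I \<Longrightarrow> B i \<in> sets borel" "\<And>i. i \<in> I \<Longrightarrow> B i \<subseteq> R"
    and disj: "disjoint_family_on B I" and R: "R \<in> sets borel"
    and w: "\<And>i. i \<in> I \<Longrightarrow> w i \<in> V" "\<And>i. i \<in> I \<Longrightarrow> nrm (w i) \<le> r" and r: "0 \<le> r"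
  shows "\<bar>\<Sum>i\<in>I. N (B i) (w i)\<bar> \<le> r * N_norm R"
proof (rule field_le_epsilon)
  fix e :: real assume e: "0 < e"
  define e' where "e' = e / (real (card I) + 1)"
  have e': "0 < e'" using e by (simp add: e'_def add_nonneg_pos)
  have "\<exists>K. compact K \<and> K \<subseteq> B i \<and> measure (sm.var.variation_measure (w i)) (B i - K) < e'"
    if "i \<in> I" for i
    by (rule compact_inner_approximation[OF sm.var_measure.finite_measure_axioms[of "w i"] _ B(1)[OF that] e'])
      (rule sm.var.sets_variation_measure, blast)
  then obtain K where K: "\<And>i. i \<in> I \<Longrightarrow> compact (K i)" "\<And>i. i \<in> I \<Longrightarrow> K i \<subseteq> B i"
    "\<And>i. i \<in> I \<Longrightarrow> measure (sm.var.variation_measure (w i)) (B i - K i) < e'"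
    by metis
  have KB: "K i \<in> sets borel" if "i \<in> I" for i
    using K(1)[OF that] by (auto intro: borel_closed compact_imp_closed)
  have inner: "\<bar>N (B i) (w i) - N (K i) (w i)\<bar> \<le> e'" if i: "i \<in> I" for i
  proof -
    have "N (B i - K i) (w i) = N (B i) (w i) - N (K i) (w i)"
      by (rule sm.diff[OF KB[OF i] B(1)[OF i] K(2)[OF i]])
    moreover have "\<bar>N (B i - K i) (w i)\<bar> \<le> measure (sm.var.variation_measure (w i)) (B i - K i)"
      using B(1)[OF i] KB[OF i] by (intro sm.abs_le_variation) auto
    ultimately show ?thesis using K(3)[OF i] by linarith
  qed
  \<comment> \<open>The distance to the empty set is 0 by convention, so empty \<open>K i\<close>
    must be removed before cut-offs are built from distances.\<close>
  define J where "J = {i\<in>I. K i \<noteq> {}}"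
  have J: "finite J" "J \<subseteq> I" using I by (auto simp: J_def)
  have sumJ: "(\<Sum>i\<in>I. N (K i) (w i)) = (\<Sum>i\<in>J. N (K i) (w i))"
    using I by (intro sum.mono_neutral_right) (auto simp: J_def sm.empty)
  have main: "\<bar>\<Sum>i\<in>J. N (K i) (w i)\<bar> \<le> r * N_norm R"
  proof (cases "J = {}")
    case True
    then show ?thesis using r N_norm_nonneg by simp
  next
    case ne: False
    \<comment> \<open>The cut-off is 1 up to distance \<open>1 / Suc n\<close> from
      \<open>K i\<close> and 0 from distance \<open>2 / Suc n\<close> on. The plateau provides the
      open neighbourhood of \<open>K i\<close> on which \<open>N_act_cong\<close> replaces it by 1,
      and its support lies in the closed set \<open>W n i\<close>.\<close>
    define f where "f n i x = max 0 (min 1 (2 - real (Suc n) * infdist x (K i)))" for n i x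
    define W where "W n i = {x. real (Suc n) * infdist x (K i) \<le> 2}" for n i
    have f01: "0 \<le> f n i x" "f n i x \<le> 1" for n i x by (auto simp: f_def)
    have fb: "f n i \<in> bcontfun" for n i
      unfolding f_def using f01[of n i, unfolded f_def]
      by (intro bcontfun_normI[of _ 1] continuous_intros) (auto intro!: continuous_intros)
    have clW: "closed (W n i)" for n i
      unfolding W_def by (intro closed_Collect_le continuous_intros)
    have supW: "supp (f n i) \<subseteq> W n i" for n i
      unfolding supp_def
    proof (rule closure_minimal[OF _ clW], safe)
      fix x assume "f n i x \<noteq> 0" then show "x \<in> W n i"
        by (auto simp: f_def W_def max_def min_def split: if_splits)
    qed
    have sep: "\<forall>\<^sub>F n in sequentially. \<forall>i\<in>J. \<forall>j\<in>J. i \<noteq> j \<longrightarrow> W n i \<inter> W n j = {}"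
    proof (intro eventually_ball_finite ballI J(1))
      fix i j assume ij: "i \<in> J" "j \<in> J"
      show "\<forall>\<^sub>F n in sequentially. i \<noteq> j \<longrightarrow> W n i \<inter> W n j = {}"
      proof (cases "i = j")
        case False
        have c: "compact (K i)" "compact (K j)" "K i \<noteq> {}" "K j \<noteq> {}" using ij K(1) by (auto simp: J_def)
        have "K i \<inter> K j = {}"
          using ij K(2)[of i] K(2)[of j] disj False by (fastforce simp: J_def disjoint_family_on_def)
        then have pos: "0 < infdist x (K j)" if "x \<in> K i" for x
          using that in_closed_iff_infdist_zero[OF compact_imp_closed[OF c(2)] c(4), of x]
            infdist_nonneg[of x "K j"] by (auto simp: less_le)
        have "\<exists>x0\<in>K i. \<forall>x\<in>K i. infdist x0 (K j) \<le> infdist x (K j)"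
          by (intro continuous_attains_inf c(1,3) continuous_intros)
        then obtain x0 where x0: "x0 \<in> K i" "\<And>x. x \<in> K i \<Longrightarrow> infdist x0 (K j) \<le> infdist x (K j)" by blast
        \<comment> \<open>\<open>d\<close> is a positive lower bound for the distances from points
          of \<open>K i\<close> to \<open>K j\<close>. A point in both neighbourhoods would force
          \<open>d\<close> to be at most \<open>4 / Suc n\<close>.\<close>
        define d where "d = infdist x0 (K j)"
        have d: "0 < d" "\<And>x. x \<in> K i \<Longrightarrow> d \<le> infdist x (K j)"
          using pos[OF x0(1)] x0(2) unfolding d_def by blast+
        have "\<forall>\<^sub>F n in sequentially. inverse (real (Suc n)) < d / 4"
          using d(1) by (intro order_tendstoD(2)[OF LIMSEQ_inverse_real_of_nat]) simp
        then show ?thesis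
        proof eventually_elim
          case (elim n)
          have "False" if x: "x \<in> W n i" "x \<in> W n j" for x
          proof -
            have "d - infdist x (K j) \<le> dist x y" if "y \<in> K i" for y
              using d(2)[OF that] infdist_triangle[of y "K j" x] by (simp add: dist_commute)
            then have "d - infdist x (K j) \<le> infdist x (K i)"
              unfolding infdist_notempty[OF c(3)] by (intro cINF_greatest c(3))
            moreover have "infdist x (K i) \<le> 2 * inverse (real (Suc n))" "infdist x (K j) \<le> 2 * inverse (real (Suc n))"
              using x by (simp_all add: W_def field_simps del: of_nat_Suc)
            ultimately show False using elim by linarith
          qed
          then show ?case by auto
        qed
      qed simp
    qed
    \<comment> \<open>Testing the sum of all cut-off vectors on the whole of \<open>R\<close> costs
      \<open>r * N_norm R\<close>. Passing from \<open>R\<close> back to \<open>K i\<close> costs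
      only the part of \<open>W n i\<close> outside \<open>K i\<close>.\<close>
    have bound: "\<forall>\<^sub>F n in sequentially. \<bar>\<Sum>i\<in>J. N (K i) (w i)\<bar> \<le>
        r * N_norm R + (\<Sum>i\<in>J. r * N_norm (R \<inter> W n i - K i))"
      using sep
    proof eventually_elim
      case (elim n)
      have wJ: "w i \<in> V" "nrm (w i) \<le> r" if "i \<in> J" for i using w J(2) that by auto
      have aV: "act (f n i) (w i) \<in> V" if "i \<in> J" for i using act_closed[OF fb wJ(1)[OF that]] .
      have "nrm (\<Sum>i\<in>J. act (f n i) (w i)) \<le> (MAX i\<in>J. sup_norm (f n i)) * (MAX i\<in>J. nrm (w i))"
      proof (rule nrm_disjoint_sum[OF J(1) ne fb wJ(1)])
        show "disjoint_family_on (\<lambda>i. supp (f n i)) J"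
          using elim supW[of n] unfolding disjoint_family_on_def by (metis Int_mono bot.extremum_uniqueI)
      qed
      also have "\<dots> \<le> 1 * r"
      proof (rule mult_mono)
        show "(MAX i\<in>J. sup_norm (f n i)) \<le> 1"
          using J(1) ne f01 by (intro Max.boundedI) (auto simp: sup_norm_def intro!: cSUP_least)
        show "(MAX i\<in>J. nrm (w i)) \<le> r" using J(1) ne wJ(2) by (intro Max.boundedI) auto
        obtain i where "i \<in> J" using ne by auto
        then show "0 \<le> (MAX i\<in>J. nrm (w i))"
          using J(1) nrm_nonneg[OF wJ(1)] by (intro order_trans[OF _ Max_ge[of _ "nrm (w i)"]]) auto
      qed simp
      finally have nS: "nrm (\<Sum>i\<in>J. act (f n i) (w i)) \<le> r" by simp
      have "\<bar>N R (\<Sum>i\<in>J. act (f n i) (w i))\<bar> \<le> N_norm R * nrm (\<Sum>i\<in>J. act (f n i) (w i))"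
        by (intro abs_N_le V_sum aV)
      also have "\<dots> \<le> r * N_norm R"
        using mult_right_mono[OF nS N_norm_nonneg[of R]] by (simp add: mult.commute)
      finally have 1: "\<bar>\<Sum>i\<in>J. N R (act (f n i) (w i))\<bar> \<le> r * N_norm R"
        using N_sum[OF J(1) aV] by simp
      have 2: "\<bar>N (K i) (w i) - N R (act (f n i) (w i))\<bar> \<le> r * N_norm (R \<inter> W n i - K i)" if i: "i \<in> J" for i
      proof -
        let ?a = "act (f n i) (w i)"
        have iI: "i \<in> I" using i J(2) by auto
        have KW: "K i \<subseteq> W n i" "K i \<subseteq> R" using K(2)[OF iI] B(2)[OF iI] by (auto simp: W_def)
        have WB: "W n i \<in> sets borel" using clW by (rule borel_closed)
        have "N (R - R \<inter> W n i) ?a = N (R - R \<inter> W n i) (act (\<lambda>_. 0) (w i))"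
        proof (rule N_act_cong[OF fb _ wJ(1)[OF i], of _ "- W n i"])
          show "f n i x = 0" if "x \<in> - W n i" for x
            using that supW[of n i] closure_subset[of "{x. f n i x \<noteq> 0}"] by (auto simp: supp_def)
        qed (use clW R WB in \<open>auto intro: const_bcontfun\<close>)
        also have "\<dots> = 0" using act_const[OF wJ(1)[OF i], of 0] by (simp add: N_0)
        finally have a: "N R ?a = N (R \<inter> W n i) ?a" using sm.diff[of "R \<inter> W n i" R ?a] R WB by auto
        have b: "N (R \<inter> W n i) ?a = N (K i) ?a + N (R \<inter> W n i - K i) ?a"
          using sm.diff[of "K i" "R \<inter> W n i" ?a] R WB KB[OF iI] KW by auto
        have "N (K i) ?a = N (K i) (act (\<lambda>_. 1) (w i))"
        proof (rule N_act_cong[OF fb _ wJ(1)[OF i], of _ "{x. real (Suc n) * infdist x (K i) < 1}"])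
          show "open {x. real (Suc n) * infdist x (K i) < 1}"
            by (intro open_Collect_less continuous_intros)
        qed (use KB[OF iI] in \<open>auto simp: f_def intro: const_bcontfun\<close>)
        then have c: "N (K i) ?a = N (K i) (w i)" using act_const[OF wJ(1)[OF i], of 1] by simp
        have "\<bar>N (R \<inter> W n i - K i) ?a\<bar> \<le> N_norm (R \<inter> W n i - K i) * nrm ?a" by (rule abs_N_le[OF aV[OF i]])
        also have "\<dots> \<le> N_norm (R \<inter> W n i - K i) * r"
          using nrm_act_le[OF fb _ wJ(1)[OF i], of n i 1] f01 wJ(2)[OF i] N_norm_nonneg
          by (intro mult_left_mono) (auto intro: order_trans)
        finally show ?thesis using a b c by (simp add: mult.commute)
      qed
      have "\<bar>\<Sum>i\<in>J. N (K i) (w i)\<bar> = \<bar>(\<Sum>i\<in>J. N R (act (f n i) (w i))) +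
          (\<Sum>i\<in>J. N (K i) (w i) - N R (act (f n i) (w i)))\<bar>"
        by (simp add: sum_subtractf)
      also have "\<dots> \<le> r * N_norm R + (\<Sum>i\<in>J. r * N_norm (R \<inter> W n i - K i))"
        by (rule order_trans[OF abs_triangle_ineq add_mono[OF 1 order_trans[OF sum_abs sum_mono[OF 2]]]])
      finally show ?case .
    qed
    \<comment> \<open>\<open>K i\<close> is closed, so the sets \<open>W n i\<close> shrink to it
      and the error sets decrease to the empty set.\<close>
    have lim: "(\<lambda>n. N_norm (R \<inter> W n i - K i)) \<longlonglongrightarrow> 0" if i: "i \<in> J" for i
    proof (rule dual_norm_decreasing)
      have iI: "i \<in> I" using i J(2) by auto
      show "range (\<lambda>n. R \<inter> W n i - K i) \<subseteq> sets borel" using R clW KB[OF iI] by (auto intro: borel_closed)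
      show "decseq (\<lambda>n. R \<inter> W n i - K i)"
      proof (rule decseq_SucI)
        fix n
        have "real (Suc n) * infdist x (K i) \<le> real (Suc (Suc n)) * infdist x (K i)" for x
          by (intro mult_right_mono infdist_nonneg) auto
        then show "R \<inter> W (Suc n) i - K i \<subseteq> R \<inter> W n i - K i" by (auto simp: W_def intro: order_trans)
      qed
      have "x \<in> K i" if x: "\<And>n. x \<in> W n i" for x
      proof -
        have "infdist x (K i) \<le> 0"
        proof (rule LIMSEQ_le_const)
          show "(\<lambda>n. 2 * inverse (real (Suc n))) \<longlonglongrightarrow> 0"
            using tendsto_mult[OF tendsto_const LIMSEQ_inverse_real_of_nat, of 2] by simp
          show "\<exists>M. \<forall>n\<ge>M. infdist x (K i) \<le> 2 * inverse (real (Suc n))"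
            using x by (simp add: W_def field_simps del: of_nat_Suc)
        qed
        then show ?thesis
          using in_closed_iff_infdist_zero[of "K i" x] K(1)[OF iI] i infdist_nonneg[of x "K i"]
          by (auto simp: J_def compact_imp_closed)
      qed
      then show "(\<Inter>n. R \<inter> W n i - K i) = {}" by blast
    qed
    show ?thesis
    proof (rule tendsto_lowerbound[OF _ bound])
      have "(\<lambda>n. r * N_norm R + (\<Sum>i\<in>J. r * N_norm (R \<inter> W n i - K i))) \<longlonglongrightarrow> r * N_norm R + (\<Sum>i\<in>J. r * 0)"
        by (intro tendsto_intros lim)
      then show "(\<lambda>n. r * N_norm R + (\<Sum>i\<in>J. r * N_norm (R \<inter> W n i - K i))) \<longlonglongrightarrow> r * N_norm R" by simp
    qed simp
  qed
  have "\<bar>\<Sum>i\<in>I. N (B i) (w i)\<bar> = \<bar>(\<Sum>i\<in>I. N (K i) (w i)) + (\<Sum>i\<in>I. N (B i) (w i) - N (K i) (w i))\<bar>"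
    by (simp add: sum_subtractf)
  also have "\<dots> \<le> r * N_norm R + (\<Sum>i\<in>I. e')"
    by (rule order_trans[OF abs_triangle_ineq add_mono[OF main[folded sumJ] order_trans[OF sum_abs sum_mono[OF inner]]]])
  also have "(\<Sum>i\<in>I. e') \<le> e" using e by (simp add: e'_def field_simps)
  finally show "\<bar>\<Sum>i\<in>I. N (B i) (w i)\<bar> \<le> r * N_norm R + e" by simp
qed

text \<open>\<open>nrm_disjoint_sum\<close> speaks of index sets of natural numbers; a general
  finite index set is transported along an enumeration.\<close>

lemma abs_sum_N_le_finite:
  assumes I: "finite I" and B: "\<And>i. i \<in> I \<Longrightarrow> B i \<in> sets borel" "\<And>i. i \<in> I \<Longrightarrow> B i \<subseteq> R"
    and disj: "disjoint_family_on B I" and R: "R \<in> sets borel"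
    and w: "\<And>i. i \<in> I \<Longrightarrow> w i \<in> V" "\<And>i. i \<in> I \<Longrightarrow> nrm (w i) \<le> r" and r: "0 \<le> r"
  shows "\<bar>\<Sum>i\<in>I. N (B i) (w i)\<bar> \<le> r * N_norm R"
proof -
  obtain h :: "nat \<Rightarrow> _" where h: "bij_betw h {0..<card I} I"
    using ex_bij_betw_nat_finite[OF I] by auto
  have hI: "h n \<in> I" if "n \<in> {0..<card I}" for n using h that by (auto simp: bij_betw_def)
  have "(\<Sum>i\<in>I. N (B i) (w i)) = (\<Sum>n\<in>{0..<card I}. N (B (h n)) (w (h n)))"
    by (rule sum.reindex_bij_betw[OF h, symmetric])
  moreover have "disjoint_family_on (\<lambda>n. B (h n)) {0..<card I}"
    using disj hI h unfolding disjoint_family_on_def bij_betw_def inj_on_def by blast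
  ultimately show ?thesis
    using abs_sum_N_le[of "{0..<card I}" "\<lambda>n. B (h n)" R "\<lambda>n. w (h n)" r] assms hI by auto
qed

text \<open>Each block receives a unit vector that nearly attains its dual norm, with the sign
  chosen such that the value is not negative. All these vectors are tested at once on
  \<open>R\<close>, with total cost one times \<open>N_norm R\<close>.\<close>

lemma sum_N_norm_le:
  assumes P: "finite P" "P \<subseteq> sets borel" "disjoint P" "\<Union>P \<subseteq> R" "R \<in> sets borel"
  shows "(\<Sum>A\<in>P. N_norm A) \<le> N_norm R"
proof (rule field_le_epsilon)
  fix e :: real assume e: "0 < e"
  define e' where "e' = e / (real (card P) + 1)"
  have e': "0 < e'" using e by (simp add: e'_def add_nonneg_pos)
  have "\<exists>w\<in>V. nrm w \<le> 1 \<and> N_norm A - e' \<le> N A w" for A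
  proof (cases "N_norm A - e' < 0")
    case True
    then show ?thesis by (intro bexI[OF _ V_0]) (simp add: nrm_0 N_0)
  next
    case False
    then have "ennreal (N_norm A - e') < dual_norm V nrm (N A)"
      using e' unfolding dual_norm_N by (simp add: ennreal_less_iff)
    then obtain v where v: "v \<in> V" "nrm v \<le> 1" "ennreal (N_norm A - e') < ennreal \<bar>N A v\<bar>"
      unfolding dual_norm_def by (auto simp: less_SUP_iff)
    then have *: "N_norm A - e' < \<bar>N A v\<bar>" using False by (simp add: ennreal_less_iff)
    show ?thesis
    proof (cases "0 \<le> N A v")
      case True
      then show ?thesis using v * by (intro bexI[OF _ v(1)]) auto
    next
      case False
      then show ?thesis
        using v * N_scale[OF v(1), of A "-1"] nrm_scaleR[OF v(1), of "-1"]
        by (intro bexI[OF _ V_scale[OF v(1), of "-1"]]) auto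
    qed
  qed
  then obtain w where w: "\<And>A. w A \<in> V" "\<And>A. nrm (w A) \<le> 1" "\<And>A. N_norm A - e' \<le> N A (w A)" by metis
  have "(\<Sum>A\<in>P. N_norm A) \<le> (\<Sum>A\<in>P. N A (w A) + e')" using w(3) by (intro sum_mono) (simp add: algebra_simps)
  also have "\<dots> = (\<Sum>A\<in>P. N A (w A)) + real (card P) * e'" by (simp add: sum.distrib)
  also have "(\<Sum>A\<in>P. N A (w A)) \<le> 1 * N_norm R"
    using P w(1,2)
    by (intro order_trans[OF abs_ge_self abs_sum_N_le_finite]) (auto simp: disjoint_family_on_def disjoint_def)
  also have "real (card P) * e' \<le> e" using e by (simp add: e'_def field_simps)
  finally show "(\<Sum>A\<in>P. N_norm A) \<le> N_norm R + e" by simp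
qed

sublocale tv: subadditive_set_function "\<lambda>A. dual_norm V nrm (N A)"
proof
  have "dual_norm V nrm (N {}) \<le> ennreal 0" by (rule dual_norm_le) (simp add: sm.empty)
  then show "dual_norm V nrm (N {}) = 0" by simp
next
  fix A :: "nat \<Rightarrow> 'a set" assume A: "range A \<subseteq> sets borel" "disjoint_family A"
  show "dual_norm V nrm (N (\<Union>i. A i)) \<le> (\<Sum>i. dual_norm V nrm (N (A i)))"
    unfolding dual_norm_def[of V nrm "N (\<Union>i. A i)"]
  proof (rule SUP_least)
    fix v assume "v \<in> {v \<in> V. nrm v \<le> 1}"
    then have "ennreal \<bar>N (A i) v\<bar> \<le> dual_norm V nrm (N (A i))" for i
      unfolding dual_norm_def by (intro SUP_upper)
    then have "(\<Sum>i. ennreal \<bar>N (A i) v\<bar>) \<le> (\<Sum>i. dual_norm V nrm (N (A i)))" by (intro suminf_le) auto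
    then show "ennreal \<bar>N (\<Union>i. A i) v\<bar> \<le> (\<Sum>i. dual_norm V nrm (N (A i)))"
      using sm.var.subadditive[OF A, of v] by (rule order_trans[rotated])
  qed
qed

text \<open>A single block gives one inequality. The other says that no partition does better:
  vectors cut off to disjoint supports can be added without increasing the norm, so optimal vectors
  for the blocks combine into one vector.\<close>

lemma total_variation_N:
  assumes "A \<in> sets borel"
  shows "total_variation V nrm N A = ennreal (N_norm A)"
proof (rule antisym)
  show "total_variation V nrm N A \<le> ennreal (N_norm A)"
    unfolding total_variation_eq_set_variation
  proof (rule tv.set_variation_le)
    fix P :: "'a set set" assume "finite P" "P \<subseteq> sets borel" "disjoint P" "\<Union>P = A"
    then show "(\<Sum>A\<in>P. dual_norm V nrm (N A)) \<le> ennreal (N_norm A)"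
      using sum_N_norm_le[of P A] assms
      by (simp add: dual_norm_N sum_ennreal N_norm_nonneg ennreal_leI)
  qed
  show "ennreal (N_norm A) \<le> total_variation V nrm N A"
    using tv.le_set_variation[OF assms] by (simp add: total_variation_eq_set_variation dual_norm_N)
qed

abbreviation "N_var \<equiv> total_variation_measure V nrm N"

lemma N_var_eq: "N_var = tv.variation_measure"
  unfolding total_variation_measure_def tv.variation_measure_def total_variation_eq_set_variation ..

lemma sets_N_var [measurable_cong, simp]: "sets N_var = sets borel"
  and space_N_var [simp]: "space N_var = UNIV"
  by (simp_all add: N_var_eq)

lemma emeasure_N_var: "A \<in> sets borel \<Longrightarrow> emeasure N_var A = ennreal (N_norm A)"
  using total_variation_N[of A] tv.emeasure_variation_measure[of A]
  by (simp add: N_var_eq total_variation_eq_set_variation)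

sublocale tv_measure: finite_measure N_var
  by (rule finite_measureI) (simp add: emeasure_N_var)

lemma measure_N_var: "A \<in> sets borel \<Longrightarrow> measure N_var A = N_norm A"
  using emeasure_N_var by (simp add: measure_def N_norm_nonneg)

lemma abs_integral_N_le:
  assumes "h \<in> borel_measurable borel" "\<And>x. \<bar>h x\<bar> \<le> c" "v \<in> V"
  shows "\<bar>sm.integral_signed v h\<bar> \<le> nrm v * (\<integral>x. \<bar>h x\<bar> \<partial>N_var)"
proof (rule sm.abs_integral_signed_le[OF assms(1,2) tv_measure.finite_measure_axioms])
  show "\<bar>N A v\<bar> \<le> nrm v * measure N_var A" if "A \<in> sets borel" for A
    using abs_N_le[OF assms(3), of A] that by (simp add: measure_N_var mult.commute)
qed simp

text \<open>On a level set of \<open>round_down n \<phi>\<close> the function \<phi> stays within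
  \<delta> of its level \<open>c\<close>. By locality \<open>\<phi> - c\<close> may be replaced
  there by its truncation \<open>\<psi> c\<close>, which has norm at most \<delta> everywhere. The
  errors sit on disjoint sets, so \<open>abs_sum_N_le_finite\<close> adds them up to at most
  \<open>\<delta> * nrm v * N_norm A\<close>, independently of the number of levels.\<close>

lemma N_act:
  assumes \<phi>: "\<phi> \<in> bcontfun" and v: "v \<in> V" and A: "A \<in> sets borel"
  shows "N A (act \<phi> v) = sm.integral_signed v (\<lambda>x. indicator A x * \<phi> x)"
proof -
  have cont: "continuous_on UNIV \<phi>" using \<phi> by (auto simp: bcontfun_def)
  have meas [measurable]: "\<phi> \<in> borel_measurable borel" by (rule borel_measurable_continuous_onI[OF cont])
  have bd: "\<bar>\<phi> x\<bar> \<le> sup_norm \<phi>" for x by (rule abs_le_sup_norm[OF \<phi>])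
  let ?s = "\<lambda>n. round_down n \<phi>"
  have sf: "simple_function borel (?s n)" for n using meas bd by (rule simple_function_round_down)
  have close: "\<bar>N A (act \<phi> v) - (\<Sum>c\<in>range (?s n). c * N (A \<inter> ?s n -` {c}) v)\<bar> \<le>
      inverse (real (Suc n)) * nrm v * N_norm A" for n
  proof -
    define \<delta> where "\<delta> = inverse (real (Suc n))"
    have \<delta>: "0 < \<delta>" by (simp add: \<delta>_def)
    define B where "B c = A \<inter> ?s n -` {c}" for c
    define \<psi> where "\<psi> c x = max (- \<delta>) (min \<delta> (\<phi> x - c))" for c x
    have fin: "finite (range (?s n))" using sf[of n] by (auto simp: simple_function_borel_iff)
    have B: "B c \<in> sets borel" for c
      using measurable_sets[of "?s n" borel borel "{c}"] A by (auto simp: B_def)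
    have dB: "disjoint_family_on B (range (?s n))" by (auto simp: B_def disjoint_family_on_def)
    have \<psi>b: "\<bar>\<psi> c x\<bar> \<le> \<delta>" for c x using \<delta> by (auto simp: \<psi>_def)
    have \<psi>: "\<psi> c \<in> bcontfun" for c
      using \<psi>b[of c] unfolding \<psi>_def by (intro bcontfun_normI[of _ \<delta>] continuous_intros cont) auto
    have level: "N (B c) (act \<phi> v) - c * N (B c) v = N (B c) (act (\<psi> c) v)" for c
    proof -
      have \<psi>c: "(\<lambda>x. \<psi> c x + c) \<in> bcontfun" by (intro plus_cont \<psi> const_bcontfun)
      have "N (B c) (act \<phi> v) = N (B c) (act (\<lambda>x. \<psi> c x + c) v)"
      \<comment> \<open>The level set itself is half open,
        \<open>c \<le> \<phi> < c + \<delta>\<close>; the symmetric open strip around it is where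
        the truncation is inactive.\<close>
      proof (rule N_act_cong[OF \<phi> \<psi>c v, of "{x. c - \<delta> < \<phi> x} \<inter> {x. \<phi> x < c + \<delta>}"])
        show "open ({x. c - \<delta> < \<phi> x} \<inter> {x. \<phi> x < c + \<delta>})"
          by (intro open_Int open_Collect_less cont continuous_intros)
        show "B c \<subseteq> {x. c - \<delta> < \<phi> x} \<inter> {x. \<phi> x < c + \<delta>}"
        proof
          fix x assume "x \<in> B c"
          then have "c \<le> \<phi> x" "\<phi> x < c + \<delta>"
            using round_down_bounds[where n = n and h = \<phi> and x = x] by (auto simp: B_def \<delta>_def inverse_eq_divide)
          then show "x \<in> {x. c - \<delta> < \<phi> x} \<inter> {x. \<phi> x < c + \<delta>}" using \<delta> by simp
        qed
      qed (use B in \<open>auto simp: \<psi>_def\<close>)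
      also have "act (\<lambda>x. \<psi> c x + c) v = act (\<psi> c) v + c *\<^sub>R v"
        using act_add_left[OF \<psi> const_bcontfun v, of c c] act_const[OF v, of c] by simp
      finally show ?thesis using N_add[OF act_closed[OF \<psi> v] V_scale[OF v]] N_scale[OF v] by simp
    qed
    have "N A (act \<phi> v) = (\<Sum>c\<in>range (?s n). N (B c) (act \<phi> v))"
    proof -
      have "(\<Union>c\<in>range (?s n). B c) = A" by (auto simp: B_def)
      then show ?thesis using sm.finite_sum[OF fin B dB, of "act \<phi> v"] by simp
    qed
    then have "N A (act \<phi> v) - (\<Sum>c\<in>range (?s n). c * N (B c) v) = (\<Sum>c\<in>range (?s n). N (B c) (act (\<psi> c) v))"
      by (simp add: level[symmetric] sum_subtractf)
    moreover have "\<bar>\<Sum>c\<in>range (?s n). N (B c) (act (\<psi> c) v)\<bar> \<le> (\<delta> * nrm v) * N_norm A"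
      using \<delta> nrm_nonneg[OF v]
      by (intro abs_sum_N_le_finite fin B dB A act_closed \<psi> v nrm_act_le \<psi>b) (auto simp: B_def)
    ultimately show ?thesis by (simp add: B_def \<delta>_def)
  qed
  have "(\<lambda>n. inverse (real (Suc n)) * nrm v * N_norm A) \<longlonglongrightarrow> 0 * nrm v * N_norm A"
    by (intro tendsto_mult tendsto_const LIMSEQ_inverse_real_of_nat)
  then have lim0: "(\<lambda>n. inverse (real (Suc n)) * nrm v * N_norm A) \<longlonglongrightarrow> 0"
    by (simp only: mult_zero_left)
  have "(\<lambda>n. N A (act \<phi> v) - (\<Sum>c\<in>range (?s n). c * N (A \<inter> ?s n -` {c}) v)) \<longlonglongrightarrow> 0"
    by (rule Lim_null_comparison[OF always_eventually lim0], unfold real_norm_def) (intro allI close)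
  moreover have "(\<lambda>n. N A (act \<phi> v) - (\<Sum>c\<in>range (?s n). c * N (A \<inter> ?s n -` {c}) v)) \<longlonglongrightarrow>
      N A (act \<phi> v) - sm.integral_signed v (\<lambda>x. indicator A x * \<phi> x)"
    by (intro tendsto_diff tendsto_const sm.integral_signed_simple_limit[OF sf uniform_limit_round_down meas bd A])
  ultimately have "0 = N A (act \<phi> v) - sm.integral_signed v (\<lambda>x. indicator A x * \<phi> x)"
    by (rule LIMSEQ_unique)
  then show ?thesis by simp
qed

section \<open>Bartle integrals and products of a function with a local vector measure\<close>

lemma scale_lvm_eq:
  assumes h: "h \<in> borel_measurable borel" "\<And>x. \<bar>h x\<bar> \<le> c" and A: "A \<in> sets borel"
  shows "scale_lvm h N A v = sm.integral_signed v (\<lambda>x. indicator A x * h x)"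
proof -
  have "bartle_integral N h A v = sm.integral_signed v (\<lambda>x. indicator A x * h x)"
    unfolding bartle_integral_def simple_bartle_integral_def
  \<comment> \<open>The scalar integral is the limit along every admissible sequence.
    \<open>round_down\<close> shows that an admissible sequence exists, without which the limit
    would not be determined.\<close>
  proof (rule the_equality)
    show "\<forall>s. (\<forall>n. simple_function borel (s n)) \<and> uniform_limit UNIV s h sequentially \<longrightarrow>
        (\<lambda>n. \<Sum>c\<in>range (s n). c * N (A \<inter> s n -` {c}) v) \<longlonglongrightarrow> sm.integral_signed v (\<lambda>x. indicator A x * h x)"
      by (intro allI impI sm.integral_signed_simple_limit[OF _ _ h A]) auto
  next
    fix l assume l: "\<forall>s. (\<forall>n. simple_function borel (s n)) \<and> uniform_limit UNIV s h sequentially \<longrightarrow>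
        (\<lambda>n. \<Sum>c\<in>range (s n). c * N (A \<inter> s n -` {c}) v) \<longlonglongrightarrow> l"
    have sf: "simple_function borel (round_down n h)" for n using h by (rule simple_function_round_down)
    have "(\<lambda>n. \<Sum>c\<in>range (round_down n h). c * N (A \<inter> round_down n h -` {c}) v) \<longlonglongrightarrow> l"
      by (rule l[rule_format]) (use sf uniform_limit_round_down in simp)
    moreover have "(\<lambda>n. \<Sum>c\<in>range (round_down n h). c * N (A \<inter> round_down n h -` {c}) v) \<longlonglongrightarrow>
        sm.integral_signed v (\<lambda>x. indicator A x * h x)"
      by (rule sm.integral_signed_simple_limit[OF sf uniform_limit_round_down h A])
    ultimately show "l = sm.integral_signed v (\<lambda>x. indicator A x * h x)" by (rule LIMSEQ_unique)
  qed
  then show ?thesis using A by (simp add: scale_lvm_def)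
qed

lemma integral_N_eq_limit:
  assumes h: "h \<in> borel_measurable borel" "\<And>x. \<bar>h x\<bar> \<le> c"
  shows "(\<lambda>n. \<Sum>c\<in>range (round_down n h). c * N (round_down n h -` {c}) v) \<longlonglongrightarrow> sm.integral_signed v h"
  using sm.integral_signed_simple_limit[OF simple_function_round_down[OF h] uniform_limit_round_down h, of UNIV v]
  by simp

text \<open>For different vectors the scalar integrals refer to unrelated pairs of measures.
  Linearity is therefore checked on sums over level sets, where it is linearity of \<open>N\<close>,
  and carried to the limit.\<close>

lemma integral_N_linear:
  assumes h: "h \<in> borel_measurable borel" "\<And>x. \<bar>h x\<bar> \<le> c" and "v \<in> V" "w \<in> V"
  shows "sm.integral_signed (a *\<^sub>R v + b *\<^sub>R w) h = a * sm.integral_signed v h + b * sm.integral_signed w h"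
proof (rule LIMSEQ_unique[OF integral_N_eq_limit[OF h]])
  have "(\<lambda>n. a * (\<Sum>c\<in>range (round_down n h). c * N (round_down n h -` {c}) v) +
      b * (\<Sum>c\<in>range (round_down n h). c * N (round_down n h -` {c}) w)) \<longlonglongrightarrow>
      a * sm.integral_signed v h + b * sm.integral_signed w h"
    by (intro tendsto_intros integral_N_eq_limit[OF h])
  then show "(\<lambda>n. \<Sum>c\<in>range (round_down n h). c * N (round_down n h -` {c}) (a *\<^sub>R v + b *\<^sub>R w)) \<longlonglongrightarrow>
      a * sm.integral_signed v h + b * sm.integral_signed w h"
    using assms(3,4) by (simp add: N_linear sum_distrib_left sum.distrib algebra_simps)
qed

lemma integral_N_zero:
  assumes h: "h \<in> borel_measurable borel" "\<And>x. \<bar>h x\<bar> \<le> c" and A: "A \<in> sets borel"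
    and "\<And>B. B \<in> sets borel \<Longrightarrow> B \<subseteq> A \<Longrightarrow> N B v = 0"
  shows "sm.integral_signed v (\<lambda>x. indicator A x * h x) = 0"
proof (rule LIMSEQ_unique)
  show "(\<lambda>n. \<Sum>c\<in>range (round_down n h). c * N (A \<inter> round_down n h -` {c}) v) \<longlonglongrightarrow>
      sm.integral_signed v (\<lambda>x. indicator A x * h x)"
    by (rule sm.integral_signed_simple_limit[OF simple_function_round_down[OF h] uniform_limit_round_down h A])
  have "A \<inter> round_down n h -` {c} \<in> sets borel" for n c
    using measurable_sets[OF round_down_measurable[OF h(1)], of "{c}"] A by auto
  then show "(\<lambda>n. \<Sum>c\<in>range (round_down n h). c * N (A \<inter> round_down n h -` {c}) v) \<longlonglongrightarrow> 0"
    using assms(4) by simp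
qed

lemma dual_norm_scale_lvm_le:
  assumes h: "h \<in> borel_measurable borel" "\<And>x. \<bar>h x\<bar> \<le> c" and A: "A \<in> sets borel"
  shows "dual_norm V nrm (scale_lvm h N A) \<le> (\<integral>\<^sup>+x\<in>A. ennreal \<bar>h x\<bar> \<partial>N_var)"
proof -
  have [measurable]: "h \<in> borel_measurable borel" by fact
  have m: "(\<lambda>x. indicator A x * h x) \<in> borel_measurable borel" using A by auto
  have b: "\<bar>indicator A x * h x\<bar> \<le> c" for x
    using h(2)[of x] by (auto simp: indicator_def intro: order_trans[OF abs_ge_zero])
  have "dual_norm V nrm (scale_lvm h N A) \<le> ennreal (\<integral>x. \<bar>indicator A x * h x\<bar> \<partial>N_var)"
  proof (rule dual_norm_le)
    fix v assume v: "v \<in> V" "nrm v \<le> 1"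
    have "\<bar>sm.integral_signed v (\<lambda>x. indicator A x * h x)\<bar> \<le> nrm v * (\<integral>x. \<bar>indicator A x * h x\<bar> \<partial>N_var)"
      by (rule abs_integral_N_le[OF m b v(1)])
    also have "\<dots> \<le> 1 * (\<integral>x. \<bar>indicator A x * h x\<bar> \<partial>N_var)"
      using v(2) by (intro mult_right_mono) auto
    finally show "\<bar>scale_lvm h N A v\<bar> \<le> (\<integral>x. \<bar>indicator A x * h x\<bar> \<partial>N_var)"
      by (simp add: scale_lvm_eq[OF h A])
  qed
  also have "\<dots> = (\<integral>\<^sup>+x. ennreal \<bar>indicator A x * h x\<bar> \<partial>N_var)"
    using m b by (intro nn_integral_eq_integral[symmetric] tv_measure.integrable_const_bound[of _ c]) auto
  also have "\<dots> = (\<integral>\<^sup>+x\<in>A. ennreal \<bar>h x\<bar> \<partial>N_var)"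
    by (intro nn_integral_cong) (auto simp: indicator_def)
  finally show ?thesis .
qed

lemma local_vector_measure_scale:
  assumes h: "h \<in> borel_measurable borel" "\<And>x. \<bar>h x\<bar> \<le> c"
  shows "local_vector_measure V nrm act (scale_lvm h N)"
  unfolding local_vector_measure_def
proof (intro conjI allI impI ballI)
  have [measurable]: "h \<in> borel_measurable borel" by fact
  have m: "(\<lambda>x. indicator A x * h x) \<in> borel_measurable borel" if "A \<in> sets borel" for A using that by auto
  have b: "\<bar>indicator A x * h x\<bar> \<le> c" for x A
    using h(2)[of x] by (auto simp: indicator_def intro: order_trans[OF abs_ge_zero])
  have fin: "dual_norm V nrm (scale_lvm h N A) \<le> ennreal (c * N_norm A)" if A: "A \<in> sets borel" for A
  proof -
    have "dual_norm V nrm (scale_lvm h N A) \<le> (\<integral>\<^sup>+x\<in>A. ennreal \<bar>h x\<bar> \<partial>N_var)"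
      by (rule dual_norm_scale_lvm_le[OF h A])
    also have "\<dots> \<le> (\<integral>\<^sup>+x\<in>A. ennreal c \<partial>N_var)"
      using h(2) by (intro nn_integral_mono mult_right_mono ennreal_leI) auto
    also have "\<dots> = ennreal c * ennreal (N_norm A)"
      using A by (simp add: nn_integral_cmult_indicator emeasure_N_var)
    finally show ?thesis
      using N_norm_nonneg order_trans[OF abs_ge_zero h(2)] by (simp add: ennreal_mult)
  qed
  show "scale_lvm h N A \<in> dual_space V nrm" if A: "A \<in> sets borel" for A
    unfolding dual_space_def
  proof (intro CollectI conjI ballI allI impI)
    show "scale_lvm h N A (a *\<^sub>R v + b *\<^sub>R w) = a * scale_lvm h N A v + b * scale_lvm h N A w"
      if "v \<in> V" "w \<in> V" for v w a b
      unfolding scale_lvm_eq[OF h A] by (rule integral_N_linear[OF m[OF A] b that])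
    show "dual_norm V nrm (scale_lvm h N A) < \<infinity>" using fin[OF A] by (simp add: order_le_less_trans)
    show "scale_lvm h N A v = 0" if "v \<notin> V" for v
      unfolding scale_lvm_eq[OF h A] using N_not_V[OF that] by (intro integral_N_zero[OF h A]) auto
  qed
  show "scale_lvm h N A = (\<lambda>_. 0)" if "A \<notin> sets borel" for A
    using that by (simp add: scale_lvm_def fun_eq_iff)
  show "scale_lvm h N A v = 0" if A: "open A" and v: "v \<in> V" "restr_norm nrm act A v = 0" for A v
  proof -
    have "N B v = 0" if B: "B \<in> sets borel" "B \<subseteq> A" for B
    proof (rule sm.zero_on_open_imp_zero[OF A _ B])
      fix C assume C: "open C" "C \<subseteq> A"
      have "restr_norm nrm act C v \<le> restr_norm nrm act A v"
        unfolding restr_norm_def using C(2) by (intro SUP_subset_mono) auto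
      then show "N C v = 0" using v N_local[OF C(1) v(1)] by simp
    qed
    then show ?thesis
      using A by (subst scale_lvm_eq[OF h]) (auto intro!: integral_N_zero[OF h] borel_open)
  qed
  fix B :: "nat \<Rightarrow> 'a set" assume B: "range B \<subseteq> sets borel" "disjoint_family B"
  \<comment> \<open>The n-th remainder of the series for \<open>scale_lvm h N\<close> is its value
    on the tail union \<open>R n\<close>. Its norm is at most \<open>c * N_norm (R n)\<close>, and
    the tail unions decrease to the empty set.\<close>
  define R where "R n = (\<Union>i\<in>{n..}. B i)" for n
  have R: "R n \<in> sets borel" for n unfolding R_def using B(1) by (intro sets.countable_UN') auto
  have rest: "(\<lambda>v. scale_lvm h N (\<Union>i. B i) v - (\<Sum>i<n. scale_lvm h N (B i) v)) = scale_lvm h N (R n)" for n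
  proof
    fix v
    have Bi: "B i \<in> sets borel" for i using B(1) by auto
    have UB: "(\<Union>i. B i) \<in> sets borel" using B(1) by auto
    have "(\<lambda>x. indicator (\<Union>i. B i) x * h x) = (\<lambda>x. (\<Sum>i<n. indicator (B i) x * h x) + indicator (R n) x * h x)"
    proof
      fix x
      have "indicator (\<Union>i. B i) x = (indicator (\<Union>i<n. B i) x + indicator (R n) x :: real)"
      proof (subst indicator_add)
        show "(\<Union>i<n. B i) \<inter> R n = {}"
        proof (rule equals0I)
          fix x assume "x \<in> (\<Union>i<n. B i) \<inter> R n"
          then obtain i j where ij: "i < n" "x \<in> B i" "n \<le> j" "x \<in> B j" by (auto simp: R_def)
          then have "B i \<inter> B j = {}" using B(2) by (auto simp: disjoint_family_on_def)
          then show False using ij by auto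
        qed
        have "(\<Union>i. B i) = (\<Union>i<n. B i) \<union> R n"
        proof -
          have "UNIV = {..<n} \<union> {n..}" by auto
          then show ?thesis unfolding R_def by blast
        qed
        then show "indicator (\<Union>i. B i) x = (indicator ((\<Union>i<n. B i) \<union> R n) x :: real)" by simp
      qed
      also have "indicator (\<Union>i<n. B i) x = (\<Sum>i<n. indicator (B i) x :: real)"
        using B(2) by (intro indicator_UN_disjoint) (auto simp: disjoint_family_on_def)
      finally show "indicator (\<Union>i. B i) x * h x = (\<Sum>i<n. indicator (B i) x * h x) + indicator (R n) x * h x"
        by (simp add: algebra_simps sum_distrib_left)
    qed
    then have "sm.integral_signed v (\<lambda>x. indicator (\<Union>i. B i) x * h x) =
        sm.integral_signed v (\<lambda>x. \<Sum>i<n. indicator (B i) x * h x) + sm.integral_signed v (\<lambda>x. indicator (R n) x * h x)"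
      by (simp only:, intro sm.integral_signed_add[where c = "\<Sum>i<n. c" and c' = c]
          order_trans[OF sum_abs] sum_mono borel_measurable_sum m R Bi b)
    also have "sm.integral_signed v (\<lambda>x. \<Sum>i<n. indicator (B i) x * h x) =
        (\<Sum>i<n. sm.integral_signed v (\<lambda>x. indicator (B i) x * h x))"
      by (rule sm.integral_signed_sum[where c = "\<lambda>_. c"]) (use m[OF Bi] b in auto)
    finally show "scale_lvm h N (\<Union>i. B i) v - (\<Sum>i<n. scale_lvm h N (B i) v) = scale_lvm h N (R n) v"
      by (simp add: scale_lvm_eq[OF h UB] scale_lvm_eq[OF h Bi] scale_lvm_eq[OF h R])
  qed
  have "(\<lambda>n. N_norm (R n)) \<longlonglongrightarrow> 0"
  proof (rule dual_norm_decreasing)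
    show "decseq R" by (rule decseq_SucI) (auto simp: R_def intro: Suc_leD)
    show "(\<Inter>i. R i) = {}"
    proof (rule equals0I)
      fix x assume x: "x \<in> (\<Inter>i. R i)"
      then obtain i where i: "x \<in> B i" by (auto simp: R_def)
      from x have "x \<in> R (Suc i)" by blast
      then obtain j where "j \<ge> Suc i" "x \<in> B j" by (auto simp: R_def)
      moreover have "B i \<inter> B j = {}"
        using B(2) \<open>j \<ge> Suc i\<close> by (auto simp: disjoint_family_on_def)
      ultimately show False using i by auto
    qed
  qed (use R in auto)
  then have "(\<lambda>n. ennreal (c * N_norm (R n))) \<longlonglongrightarrow> ennreal (c * 0)" by (intro tendsto_intros)
  then have lim: "(\<lambda>n. ennreal (c * N_norm (R n))) \<longlonglongrightarrow> 0" by (simp only: mult_zero_right ennreal_0)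
  have "(\<lambda>n. dual_norm V nrm (scale_lvm h N (R n))) \<longlonglongrightarrow> 0"
  proof (rule tendsto_sandwich[OF _ _ tendsto_const lim])
    show "\<forall>\<^sub>F n in sequentially. dual_norm V nrm (scale_lvm h N (R n)) \<le> ennreal (c * N_norm (R n))"
      by (intro always_eventually allI fin R)
  qed simp
  then show "(\<lambda>n. dual_norm V nrm (\<lambda>v. scale_lvm h N (\<Union>i. B i) v - (\<Sum>i<n. scale_lvm h N (B i) v))) \<longlonglongrightarrow> 0"
    by (simp only: rest)
qed

end

section \<open>Local Lipschitz constants\<close>

text \<open>Together with \<open>lip_leD\<close> this trades the upper limit for eventual real
  inequalities with slack \<open>e\<close>, the form in which sums and products are
  estimated.\<close>

lemma lip_leI:
  assumes "\<And>e. 0 < e \<Longrightarrow> \<forall>\<^sub>F y in at x. \<bar>f y - f x\<bar> \<le> (c + e) * dist y x" and c: "0 \<le> c"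
  shows "lip f x \<le> ennreal c"
proof (rule ennreal_le_epsilon)
  fix e :: real assume e: "0 < e"
  have "lip f x \<le> ennreal (c + e)"
    unfolding lip_def
  proof (rule Limsup_bounded)
    have "\<forall>\<^sub>F y in at x. y \<noteq> x" by (simp add: eventually_at_filter)
    with assms(1)[OF e] show "\<forall>\<^sub>F y in at x. ennreal (\<bar>f y - f x\<bar> / dist y x) \<le> ennreal (c + e)"
      by eventually_elim (auto intro!: ennreal_leI simp: pos_divide_le_eq)
  qed
  then show "lip f x \<le> ennreal c + ennreal e" using c e by simp
qed

lemma lip_leD:
  assumes "lip f x \<le> ennreal c" "0 \<le> c" "0 < e"
  shows "\<forall>\<^sub>F y in at x. \<bar>f y - f x\<bar> \<le> (c + e) * dist y x"
proof -
  have "lip f x < ennreal (c + e)"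
    using assms by (intro order_le_less_trans[OF assms(1)]) (auto simp: ennreal_less_iff)
  then have "\<forall>\<^sub>F y in at x. ennreal (\<bar>f y - f x\<bar> / dist y x) < ennreal (c + e)"
    unfolding lip_def by (rule Limsup_lessD)
  moreover have "\<forall>\<^sub>F y in at x. y \<noteq> x" by (simp add: eventually_at_filter)
  ultimately show ?thesis
  proof eventually_elim
    case (elim y)
    then have "\<bar>f y - f x\<bar> / dist y x < c + e" by (simp add: ennreal_less_iff)
    then show ?case using elim(2) by (simp add: pos_divide_less_eq)
  qed
qed

lemma lip_le_ev:
  assumes "\<forall>\<^sub>F y in at x. \<bar>f y - f x\<bar> \<le> c * dist y x" "0 \<le> c"
  shows "lip f x \<le> ennreal c"
proof (rule lip_leI[OF _ assms(2)])
  fix e :: real assume "0 < e"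
  then have "c * dist y x \<le> (c + e) * dist y x" for y by (simp add: mult_right_mono)
  with assms(1) show "\<forall>\<^sub>F y in at x. \<bar>f y - f x\<bar> \<le> (c + e) * dist y x"
    by (auto elim!: eventually_mono intro: order_trans)
qed

lemma lip_le_lipschitz:
  assumes "\<And>x y. \<bar>f x - f y\<bar> \<le> L * dist x y" "0 \<le> L"
  shows "lip f x \<le> ennreal L"
  using assms by (intro lip_le_ev) auto

lemma lip_mono_ev:
  assumes "\<forall>\<^sub>F y in at x. \<bar>f y - f x\<bar> \<le> \<bar>g y - g x\<bar>"
  shows "lip f x \<le> lip g x"
  unfolding lip_def using assms
  by (intro Limsup_mono) (auto elim!: eventually_mono intro!: ennreal_leI divide_right_mono)

lemma lip_mono: "(\<And>x y. \<bar>f x - f y\<bar> \<le> \<bar>g x - g y\<bar>) \<Longrightarrow> lip f x \<le> lip g x"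
  by (intro lip_mono_ev always_eventually) auto

lemma lip_eq_0_near:
  assumes "open A" "x \<in> A" "\<And>y. y \<in> A \<Longrightarrow> f y = f x"
  shows "lip f x = 0"
proof -
  have "\<forall>\<^sub>F y in at x. y \<in> A" using assms(1,2) by (auto simp: eventually_at_topological)
  then have "lip f x \<le> ennreal 0"
    by (intro lip_le_ev) (auto elim!: eventually_mono simp: assms(3))
  then show ?thesis by simp
qed

lemma lip_const [simp]: "lip (\<lambda>_. c) x = 0"
  by (rule lip_eq_0_near[of UNIV]) auto

lemma lip_add: "lip (\<lambda>x. f x + g x) x \<le> lip f x + lip g x"
proof (cases "lip f x = \<infinity> \<or> lip g x = \<infinity>")
  case True
  then show ?thesis by auto
next
  case False
  define a b where "a = enn2real (lip f x)" and "b = enn2real (lip g x)"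
  have ab: "lip f x = ennreal a" "lip g x = ennreal b" "0 \<le> a" "0 \<le> b"
    using False by (auto simp: a_def b_def less_top)
  have "lip (\<lambda>x. f x + g x) x \<le> ennreal (a + b)"
  proof (rule lip_leI)
    fix e :: real assume e: "0 < e"
    have "\<forall>\<^sub>F y in at x. \<bar>f y - f x\<bar> \<le> (a + e / 2) * dist y x" "\<forall>\<^sub>F y in at x. \<bar>g y - g x\<bar> \<le> (b + e / 2) * dist y x"
      using ab e by (auto intro!: lip_leD)
    then show "\<forall>\<^sub>F y in at x. \<bar>f y + g y - (f x + g x)\<bar> \<le> (a + b + e) * dist y x"
      by eventually_elim (auto simp: algebra_simps)
  qed (use ab in auto)
  then show ?thesis using ab by simp
qed

lemma lip_cmult: "lip (\<lambda>x. c * f x) x \<le> ennreal \<bar>c\<bar> * lip f x"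
proof (cases "lip f x = \<infinity>")
  case True
  then show ?thesis by (cases "c = 0") (auto simp: ennreal_mult_eq_top_iff ennreal_top_mult ennreal_mult_top)
next
  case False
  define a where "a = enn2real (lip f x)"
  have a: "lip f x = ennreal a" "0 \<le> a" using False by (auto simp: a_def less_top)
  have "lip (\<lambda>x. c * f x) x \<le> ennreal (\<bar>c\<bar> * a)"
  proof (rule lip_leI)
    fix e :: real assume e: "0 < e"
    define d where "d = e / (\<bar>c\<bar> + 1)"
    have d: "0 < d" "\<bar>c\<bar> * d \<le> e" using e by (auto simp: d_def field_simps add_pos_nonneg)
    have "\<forall>\<^sub>F y in at x. \<bar>f y - f x\<bar> \<le> (a + d) * dist y x" using a d by (auto intro!: lip_leD)
    then show "\<forall>\<^sub>F y in at x. \<bar>c * f y - c * f x\<bar> \<le> (\<bar>c\<bar> * a + e) * dist y x"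
    proof eventually_elim
      case (elim y)
      have "\<bar>c * f y - c * f x\<bar> = \<bar>c\<bar> * \<bar>f y - f x\<bar>" by (simp add: abs_mult[symmetric] algebra_simps)
      also have "\<dots> \<le> \<bar>c\<bar> * ((a + d) * dist y x)" using elim by (intro mult_left_mono) auto
      also have "\<dots> = (\<bar>c\<bar> * a + \<bar>c\<bar> * d) * dist y x" by (simp add: algebra_simps)
      also have "\<dots> \<le> (\<bar>c\<bar> * a + e) * dist y x" using d by (intro mult_right_mono) auto
      finally show ?case .
    qed
  qed (use a in auto)
  then show ?thesis using a by (simp add: ennreal_mult)
qed

lemma lip_shift: "lip (\<lambda>x. f x - c) x = lip f x" "lip (\<lambda>x. f x + c) x = lip f x"
  by (simp_all add: lip_def)

lemma lip_mult:
  assumes "isCont f x" "isCont g x" "lip f x < \<infinity>" "lip g x < \<infinity>"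
  shows "lip (\<lambda>x. f x * g x) x \<le> ennreal \<bar>f x\<bar> * lip g x + ennreal \<bar>g x\<bar> * lip f x"
proof -
  define a b where "a = enn2real (lip f x)" and "b = enn2real (lip g x)"
  have ab: "lip f x = ennreal a" "lip g x = ennreal b" "0 \<le> a" "0 \<le> b"
    using assms(3,4) by (auto simp: a_def b_def less_top)
  have "lip (\<lambda>x. f x * g x) x \<le> ennreal (\<bar>f x\<bar> * b + \<bar>g x\<bar> * a)"
  proof (rule lip_leI)
    fix e :: real assume e: "0 < e"
    \<comment> \<open>The three perturbations are all taken equal to \<open>d\<close>; continuity of
      this polynomial at 0 yields one \<open>d\<close> for which their joint effect stays below
      \<open>e\<close>.\<close>
    have "((\<lambda>d. (\<bar>f x\<bar> + d) * (b + d) + \<bar>g x\<bar> * (a + d)) \<longlongrightarrow> (\<bar>f x\<bar> + 0) * (b + 0) + \<bar>g x\<bar> * (a + 0)) (at_right 0)"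
      by (intro tendsto_intros)
    then have "\<forall>\<^sub>F d in at_right 0. (\<bar>f x\<bar> + d) * (b + d) + \<bar>g x\<bar> * (a + d) < \<bar>f x\<bar> * b + \<bar>g x\<bar> * a + e"
      using e by (intro order_tendstoD(2)) auto
    moreover have "\<forall>\<^sub>F d in at_right 0. (0::real) < d" by (simp add: eventually_at_filter)
    ultimately have "\<forall>\<^sub>F d in at_right (0::real). (\<bar>f x\<bar> + d) * (b + d) + \<bar>g x\<bar> * (a + d) < \<bar>f x\<bar> * b + \<bar>g x\<bar> * a + e \<and> 0 < d"
      by eventually_elim simp
    then obtain d where d: "(\<bar>f x\<bar> + d) * (b + d) + \<bar>g x\<bar> * (a + d) < \<bar>f x\<bar> * b + \<bar>g x\<bar> * a + e" "0 < d"
      using eventually_happens'[OF trivial_limit_at_right_real] by blast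
    have "\<forall>\<^sub>F y in at x. dist (f y) (f x) < d"
      using assms(1) d(2) by (auto simp: isCont_def intro: tendstoD)
    moreover have "\<forall>\<^sub>F y in at x. \<bar>f y - f x\<bar> \<le> (a + d) * dist y x" "\<forall>\<^sub>F y in at x. \<bar>g y - g x\<bar> \<le> (b + d) * dist y x"
      using ab d(2) by (auto intro!: lip_leD)
    ultimately show "\<forall>\<^sub>F y in at x. \<bar>f y * g y - f x * g x\<bar> \<le> (\<bar>f x\<bar> * b + \<bar>g x\<bar> * a + e) * dist y x"
    proof eventually_elim
      case (elim y)
      have "f y * g y - f x * g x = f y * (g y - g x) + g x * (f y - f x)" by (simp add: algebra_simps)
      then have "\<bar>f y * g y - f x * g x\<bar> \<le> \<bar>f y\<bar> * \<bar>g y - g x\<bar> + \<bar>g x\<bar> * \<bar>f y - f x\<bar>"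
        using abs_triangle_ineq[of "f y * (g y - g x)" "g x * (f y - f x)"] by (simp add: abs_mult)
      also have "\<dots> \<le> (\<bar>f x\<bar> + d) * ((b + d) * dist y x) + \<bar>g x\<bar> * ((a + d) * dist y x)"
        using elim d(2) by (intro add_mono mult_mono) (auto simp: dist_real_def)
      also have "\<dots> = ((\<bar>f x\<bar> + d) * (b + d) + \<bar>g x\<bar> * (a + d)) * dist y x" by (simp add: algebra_simps)
      also have "\<dots> \<le> (\<bar>f x\<bar> * b + \<bar>g x\<bar> * a + e) * dist y x" using d(1) by (intro mult_right_mono) auto
      finally show ?case .
    qed
  qed (use ab in auto)
  then show ?thesis using ab by (simp add: ennreal_mult)
qed

lemma lip_compose:
  assumes "\<And>s t. \<bar>\<phi> s - \<phi> t\<bar> \<le> L * \<bar>s - t\<bar>" "0 \<le> L"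
  shows "lip (\<lambda>x. \<phi> (f x)) x \<le> ennreal L * lip f x"
proof -
  have "lip (\<lambda>x. \<phi> (f x)) x \<le> lip (\<lambda>x. L * f x) x"
    using assms by (intro lip_mono) (simp add: abs_mult flip: right_diff_distrib)
  also have "\<dots> \<le> ennreal L * lip f x" using lip_cmult[of L f x] assms(2) by simp
  finally show ?thesis .
qed

text \<open>For continuous \<open>f\<close> the supremum of the difference quotients over a
  punctured ball is lower semicontinuous in the centre: a point \<open>y\<close> that beats
  \<open>t\<close> for \<open>x\<close> still lies in the punctured ball and beats \<open>t\<close>
  for nearby centres. The upper limit is the infimum of these suprema over the radii
  \<open>1 / Suc n\<close>.\<close>

lemma borel_measurable_lip:
  fixes f :: "'a::metric_space \<Rightarrow> real"
  assumes cont: "continuous_on UNIV f"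
  shows "lip f \<in> borel_measurable borel"
proof -
  define g where "g n x = (SUP y\<in>ball x (inverse (real (Suc n))) - {x}. ennreal (\<bar>f y - f x\<bar> / dist y x))" for n x
  have "g n \<in> borel_measurable borel" for n
  proof (rule borel_measurableI_greater)
    fix t
    have "open {x. t < g n x}"
    proof (rule openI)
      fix x assume "x \<in> {x. t < g n x}"
      then obtain y where "y \<in> ball x (inverse (real (Suc n))) - {x}" and yt: "t < ennreal (\<bar>f y - f x\<bar> / dist y x)"
        unfolding mem_Collect_eq g_def less_SUP_iff by blast
      then have y: "dist x y < inverse (real (Suc n))" "y \<noteq> x" by auto
      let ?F = "\<lambda>z. ennreal (\<bar>f y - f z\<bar> / dist y z)"
      have "isCont f x" using cont by (simp add: continuous_on_eq_continuous_at)
      then have "(?F \<longlongrightarrow> ?F x) (nhds x)"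
        using y(2) by (intro tendsto_ennrealI tendsto_intros filterlim_ident) (auto simp: isCont_def tendsto_at_iff_tendsto_nhds)
      then have "\<forall>\<^sub>F z in nhds x. t < ?F z" by (rule order_tendstoD) (rule yt)
      moreover have "\<forall>\<^sub>F z in nhds x. dist z y < inverse (real (Suc n))"
        by (rule order_tendstoD(2)[OF tendsto_dist[OF filterlim_ident tendsto_const] y(1)])
      moreover have "\<forall>\<^sub>F z in nhds x. z \<noteq> y" using y(2) by (auto intro: t1_space_nhds)
      ultimately have "\<forall>\<^sub>F z in nhds x. t < g n z"
      proof eventually_elim
        case (elim z)
        then show ?case unfolding g_def less_SUP_iff by (intro bexI[of _ y]) auto
      qed
      then show "\<exists>e>0. ball x e \<subseteq> {x. t < g n x}"
        unfolding eventually_nhds_metric by (auto simp: dist_commute ball_def subset_eq)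
    qed
    then show "{x \<in> space borel. t < g n x} \<in> sets borel" by (simp add: borel_open)
  qed
  moreover have "lip f x = (INF n. g n x)" for x
  proof -
    have "(INF e\<in>{0<..}. SUP y\<in>(ball x e - {x}). ennreal (\<bar>f y - f x\<bar> / dist y x)) = (INF n. g n x)"
    proof (rule antisym)
      show "(INF e\<in>{0<..}. SUP y\<in>(ball x e - {x}). ennreal (\<bar>f y - f x\<bar> / dist y x)) \<le> (INF n. g n x)"
        unfolding g_def by (intro INF_greatest INF_lower) auto
      show "(INF n. g n x) \<le> (INF e\<in>{0<..}. SUP y\<in>(ball x e - {x}). ennreal (\<bar>f y - f x\<bar> / dist y x))"
      proof (rule INF_greatest)
        fix e :: real assume "e \<in> {0<..}"
        then obtain n where n: "inverse (real (Suc n)) < e" using reals_Archimedean by auto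
        have "(INF n. g n x) \<le> g n x" by (rule INF_lower) simp
        also have "\<dots> \<le> (SUP y\<in>(ball x e - {x}). ennreal (\<bar>f y - f x\<bar> / dist y x))"
          unfolding g_def using n by (intro SUP_subset_mono) auto
        finally show "(INF n. g n x) \<le> (SUP y\<in>(ball x e - {x}). ennreal (\<bar>f y - f x\<bar> / dist y x))" .
      qed
    qed
    then show ?thesis by (simp add: lip_def Limsup_at)
  qed
  ultimately show ?thesis by (simp cong: measurable_cong)
qed

section \<open>Bounded Lipschitz and locally Lipschitz functions\<close>

lemma LIPbI:
  assumes "\<And>x. \<bar>f x\<bar> \<le> C" "\<And>x y. \<bar>f x - f y\<bar> \<le> L * dist x y"
  shows "f \<in> LIPb"
proof -
  have "\<bar>f x - f y\<bar> \<le> max L 0 * dist x y" for x y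
    using assms(2)[of x y] by (rule order_trans) (simp add: mult_right_mono)
  then have "(max L 0)-lipschitz_on UNIV f" by (auto simp: lipschitz_on_def dist_real_def)
  moreover have "bounded (range f)" using assms(1) by (auto simp: bounded_iff)
  ultimately show ?thesis unfolding LIPb_def by blast
qed

lemma LIPbE:
  assumes "f \<in> LIPb"
  obtains C L where "0 \<le> C" "0 \<le> L" "\<And>x. \<bar>f x\<bar> \<le> C" "\<And>x y. \<bar>f x - f y\<bar> \<le> L * dist x y"
proof -
  obtain L where L: "L-lipschitz_on UNIV f" using assms by (auto simp: LIPb_def)
  obtain C where C: "\<And>x. \<bar>f x\<bar> \<le> C" using assms by (auto simp: LIPb_def bounded_iff)
  have "0 \<le> C" using C[of undefined] by linarith
  moreover have "\<bar>f x - f y\<bar> \<le> L * dist x y" for x y using lipschitz_onD[OF L] by (simp add: dist_real_def)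
  ultimately show ?thesis using that lipschitz_on_nonneg[OF L] C by blast
qed

lemma LIPb_continuous: "f \<in> LIPb \<Longrightarrow> continuous_on UNIV f"
  by (auto simp: LIPb_def intro: lipschitz_on_continuous_on)

lemma LIPb_bcontfun: "f \<in> LIPb \<Longrightarrow> f \<in> bcontfun"
  using LIPb_continuous[of f] by (auto simp: bcontfun_def LIPb_def)

lemma LIPb_lip_finite: "f \<in> LIPb \<Longrightarrow> lip f x < \<infinity>"
proof -
  assume "f \<in> LIPb"
  then obtain L where "0 \<le> L" "\<And>x y. \<bar>f x - f y\<bar> \<le> L * dist x y" by (elim LIPbE) blast
  then have "lip f x \<le> ennreal L" by (intro lip_le_lipschitz)
  then show "lip f x < \<infinity>" by (rule order_le_less_trans) simp
qed

lemma LIPb_const: "(\<lambda>_. c) \<in> LIPb"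
  by (rule LIPbI[of _ "\<bar>c\<bar>" 0]) auto

lemma LIPb_add: "f \<in> LIPb \<Longrightarrow> g \<in> LIPb \<Longrightarrow> (\<lambda>x. f x + g x) \<in> LIPb"
proof -
  assume "f \<in> LIPb" "g \<in> LIPb"
  then obtain C L C' L' where *: "\<And>x. \<bar>f x\<bar> \<le> C" "\<And>x y. \<bar>f x - f y\<bar> \<le> L * dist x y"
    "\<And>x. \<bar>g x\<bar> \<le> C'" "\<And>x y. \<bar>g x - g y\<bar> \<le> L' * dist x y"
    by (elim LIPbE) blast
  show ?thesis
  proof (rule LIPbI)
    show "\<bar>f x + g x\<bar> \<le> C + C'" for x using *(1)[of x] *(3)[of x] by linarith
    show "\<bar>f x + g x - (f y + g y)\<bar> \<le> (L + L') * dist x y" for x y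
      using *(2)[of x y] *(4)[of x y] unfolding distrib_right by linarith
  qed
qed

lemma LIPb_mult: "f \<in> LIPb \<Longrightarrow> g \<in> LIPb \<Longrightarrow> (\<lambda>x. f x * g x) \<in> LIPb"
proof -
  assume "f \<in> LIPb" "g \<in> LIPb"
  then obtain C L C' L' where *: "\<And>x. \<bar>f x\<bar> \<le> C" "\<And>x y. \<bar>f x - f y\<bar> \<le> L * dist x y"
    "\<And>x. \<bar>g x\<bar> \<le> C'" "\<And>x y. \<bar>g x - g y\<bar> \<le> L' * dist x y" "0 \<le> C" "0 \<le> C'" "0 \<le> L" "0 \<le> L'"
    by (elim LIPbE) blast
  show ?thesis
  proof (rule LIPbI)
    show "\<bar>f x * g x\<bar> \<le> C * C'" for x using * by (simp add: abs_mult mult_mono)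
    show "\<bar>f x * g x - f y * g y\<bar> \<le> (C * L' + C' * L) * dist x y" for x y
    proof -
      have "f x * g x - f y * g y = f x * (g x - g y) + g y * (f x - f y)" by (simp add: algebra_simps)
      then have "\<bar>f x * g x - f y * g y\<bar> \<le> \<bar>f x\<bar> * \<bar>g x - g y\<bar> + \<bar>g y\<bar> * \<bar>f x - f y\<bar>"
        using abs_triangle_ineq[of "f x * (g x - g y)" "g y * (f x - f y)"] by (simp add: abs_mult)
      also have "\<dots> \<le> C * (L' * dist x y) + C' * (L * dist x y)" using * by (intro add_mono mult_mono) auto
      finally show ?thesis by (simp add: algebra_simps)
    qed
  qed
qed

lemma LIPb_cmult: "f \<in> LIPb \<Longrightarrow> (\<lambda>x. c * f x) \<in> LIPb"
  using LIPb_mult[OF LIPb_const] .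

lemma LIPlocI:
  assumes "\<And>x. \<exists>r>0. \<exists>L. \<forall>y\<in>ball x r. \<forall>z\<in>ball x r. \<bar>f y - f z\<bar> \<le> L * dist y z"
  shows "f \<in> LIPloc UNIV"
proof -
  have *: "\<exists>r>0. \<exists>L. L-lipschitz_on (ball x r) f" for x
  proof -
    obtain r L where r: "0 < r" "\<forall>y\<in>ball x r. \<forall>z\<in>ball x r. \<bar>f y - f z\<bar> \<le> L * dist y z" using assms by blast
    have "(max L 0)-lipschitz_on (ball x r) f"
      unfolding lipschitz_on_def dist_real_def
    proof (intro conjI ballI)
      fix y z assume "y \<in> ball x r" "z \<in> ball x r"
      then have "\<bar>f y - f z\<bar> \<le> L * dist y z" using r by blast
      also have "\<dots> \<le> max L 0 * dist y z" by (simp add: mult_right_mono)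
      finally show "\<bar>f y - f z\<bar> \<le> max L 0 * dist y z" .
    qed simp
    then show ?thesis using r(1) by blast
  qed
  have "isCont f x" for x
  proof -
    obtain r L where r: "0 < r" "L-lipschitz_on (ball x r) f" using * by blast
    then show ?thesis
      using lipschitz_on_continuous_on[OF r(2)] by (simp add: continuous_on_eq_continuous_at)
  qed
  then have "f \<in> borel_measurable borel"
    by (intro borel_measurable_continuous_onI) (simp add: continuous_on_eq_continuous_at)
  then show ?thesis using * by (simp add: LIPloc_def)
qed

lemma LIPlocE:
  assumes "f \<in> LIPloc UNIV"
  obtains r L where "0 < r" "0 \<le> L" "\<And>y z. y \<in> ball x r \<Longrightarrow> z \<in> ball x r \<Longrightarrow> \<bar>f y - f z\<bar> \<le> L * dist y z"
proof -
  obtain r L where "0 < r" "L-lipschitz_on (ball x r) f" using assms unfolding LIPloc_def by blast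
  moreover from this have "\<bar>f y - f z\<bar> \<le> L * dist y z" if "y \<in> ball x r" "z \<in> ball x r" for y z
    using lipschitz_onD[of L "ball x r" f y z] that by (simp add: dist_real_def)
  ultimately show ?thesis using that[of r L] lipschitz_on_nonneg by blast
qed

lemma LIPloc_isCont: assumes "f \<in> LIPloc UNIV" shows "isCont f x"
proof -
  obtain r L where r: "0 < r" "L-lipschitz_on (ball x r) f" using assms unfolding LIPloc_def by blast
  then show ?thesis
    using lipschitz_on_continuous_on[OF r(2)] by (simp add: continuous_on_eq_continuous_at)
qed

lemma LIPloc_continuous: "f \<in> LIPloc UNIV \<Longrightarrow> continuous_on UNIV f"
  by (simp add: continuous_on_eq_continuous_at LIPloc_isCont)

lemma LIPb_isCont: "f \<in> LIPb \<Longrightarrow> isCont f x"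
  using LIPb_continuous[of f] by (simp add: continuous_on_eq_continuous_at)

lemma LIPloc_lip_finite: assumes "f \<in> LIPloc UNIV" shows "lip f x < \<infinity>"
proof -
  obtain r L where r: "0 < r" "0 \<le> L" "\<And>y z. y \<in> ball x r \<Longrightarrow> z \<in> ball x r \<Longrightarrow> \<bar>f y - f z\<bar> \<le> L * dist y z"
    using LIPlocE[OF assms] by blast
  have "\<forall>\<^sub>F y in at x. y \<in> ball x r" using r(1) by (auto simp: eventually_at_topological intro!: exI[of _ "ball x r"])
  then have "lip f x \<le> ennreal L" using r by (intro lip_le_ev) (auto elim!: eventually_mono)
  then show ?thesis by (rule order_le_less_trans) simp
qed

lemma LIPb_imp_LIPloc: "f \<in> LIPb \<Longrightarrow> f \<in> LIPloc UNIV"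
  by (erule LIPbE, rule LIPlocI) (metis zero_less_one)

lemma LIPloc_compose:
  assumes f: "f \<in> LIPloc UNIV" and \<phi>: "\<And>s t. \<bar>\<phi> s - \<phi> t\<bar> \<le> K * \<bar>s - t\<bar>" "0 \<le> K"
  shows "(\<lambda>x. \<phi> (f x)) \<in> LIPloc UNIV"
proof (rule LIPlocI)
  fix x
  obtain r L where r: "0 < r" "0 \<le> L" "\<And>y z. y \<in> ball x r \<Longrightarrow> z \<in> ball x r \<Longrightarrow> \<bar>f y - f z\<bar> \<le> L * dist y z"
    using LIPlocE[OF f] by blast
  have "\<bar>\<phi> (f y) - \<phi> (f z)\<bar> \<le> (K * L) * dist y z" if "y \<in> ball x r" "z \<in> ball x r" for y z
    using \<phi>(1)[of "f y" "f z"] mult_left_mono[OF r(3)[OF that] \<phi>(2)] by (simp add: mult.assoc)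
  then show "\<exists>r>0. \<exists>L. \<forall>y\<in>ball x r. \<forall>z\<in>ball x r. \<bar>\<phi> (f y) - \<phi> (f z)\<bar> \<le> L * dist y z"
    using r(1) by blast
qed

lemma LIPloc_add:
  assumes f: "f \<in> LIPloc UNIV" and g: "g \<in> LIPloc UNIV"
  shows "(\<lambda>x. f x + g x) \<in> LIPloc UNIV"
proof (rule LIPlocI)
  fix x
  obtain r L where r: "0 < r" "0 \<le> L" "\<And>y z. y \<in> ball x r \<Longrightarrow> z \<in> ball x r \<Longrightarrow> \<bar>f y - f z\<bar> \<le> L * dist y z"
    using LIPlocE[OF f] by blast
  obtain s M where s: "0 < s" "0 \<le> M" "\<And>y z. y \<in> ball x s \<Longrightarrow> z \<in> ball x s \<Longrightarrow> \<bar>g y - g z\<bar> \<le> M * dist y z"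
    using LIPlocE[OF g] by blast
  have "\<bar>f y + g y - (f z + g z)\<bar> \<le> (L + M) * dist y z" if "y \<in> ball x (min r s)" "z \<in> ball x (min r s)" for y z
    using r(3)[of y z] s(3)[of y z] that unfolding distrib_right by simp
  then show "\<exists>r>0. \<exists>L. \<forall>y\<in>ball x r. \<forall>z\<in>ball x r. \<bar>f y + g y - (f z + g z)\<bar> \<le> L * dist y z"
    by (rule_tac exI[of _ "min r s"], intro conjI exI ballI) (use r(1) s(1) in simp, blast)
qed

lemma LIPloc_mult_bounded:
  assumes f: "f \<in> LIPloc UNIV" and g: "g \<in> LIPloc UNIV"
    and C: "\<And>x. \<bar>f x\<bar> \<le> C" "\<And>x. \<bar>g x\<bar> \<le> C'"
  shows "(\<lambda>x. f x * g x) \<in> LIPloc UNIV"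
proof (rule LIPlocI)
  fix x
  obtain r L where r: "0 < r" "0 \<le> L" "\<And>y z. y \<in> ball x r \<Longrightarrow> z \<in> ball x r \<Longrightarrow> \<bar>f y - f z\<bar> \<le> L * dist y z"
    using LIPlocE[OF f] by blast
  obtain s M where s: "0 < s" "0 \<le> M" "\<And>y z. y \<in> ball x s \<Longrightarrow> z \<in> ball x s \<Longrightarrow> \<bar>g y - g z\<bar> \<le> M * dist y z"
    using LIPlocE[OF g] by blast
  have C0: "0 \<le> C" "0 \<le> C'" using order_trans[OF abs_ge_zero C(1)] order_trans[OF abs_ge_zero C(2)] by auto
  have "\<bar>f y * g y - f z * g z\<bar> \<le> (C * M + C' * L) * dist y z" if "y \<in> ball x (min r s)" "z \<in> ball x (min r s)" for y z
  proof -
    have "f y * g y - f z * g z = f y * (g y - g z) + g z * (f y - f z)" by (simp add: algebra_simps)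
    then have "\<bar>f y * g y - f z * g z\<bar> \<le> \<bar>f y\<bar> * \<bar>g y - g z\<bar> + \<bar>g z\<bar> * \<bar>f y - f z\<bar>"
      using abs_triangle_ineq[of "f y * (g y - g z)" "g z * (f y - f z)"] by (simp add: abs_mult)
    also have "\<dots> \<le> C * (M * dist y z) + C' * (L * dist y z)"
      using that C C0 r(3)[of y z] s(3)[of y z] by (intro add_mono mult_mono) auto
    finally show ?thesis by (simp add: algebra_simps)
  qed
  then show "\<exists>r>0. \<exists>L. \<forall>y\<in>ball x r. \<forall>z\<in>ball x r. \<bar>f y * g y - f z * g z\<bar> \<le> L * dist y z"
    by (rule_tac exI[of _ "min r s"], intro conjI exI ballI) (use r(1) s(1) in simp, blast)
qed

section \<open>Weak limits of slopes\<close>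

definition sq_norm :: "'a measure \<Rightarrow> ('a \<Rightarrow> real) \<Rightarrow> real" where
  "sq_norm m f = (\<integral>x. (f x)\<^sup>2 \<partial>m)"

lemma sq_norm_nonneg: "0 \<le> sq_norm m f"
  by (simp add: sq_norm_def)

lemma L2_measurable: "f \<in> L2 m \<Longrightarrow> f \<in> borel_measurable m"
  and L2_integrable_sq: "f \<in> L2 m \<Longrightarrow> integrable m (\<lambda>x. (f x)\<^sup>2)"
  by (auto simp: L2_def)

lemma L2_integrable_mult:
  assumes "f \<in> L2 m" "g \<in> L2 m"
  shows "integrable m (\<lambda>x. f x * g x)"
proof (rule Bochner_Integration.integrable_bound)
  show "integrable m (\<lambda>x. (f x)\<^sup>2 + (g x)\<^sup>2)" using assms by (auto intro: L2_integrable_sq)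
  show "(\<lambda>x. f x * g x) \<in> borel_measurable m" using assms by (auto dest!: L2_measurable)
  have "\<bar>a * b\<bar> \<le> a\<^sup>2 + b\<^sup>2" for a b :: real
  proof -
    have "2 * (\<bar>a\<bar> * \<bar>b\<bar>) \<le> a\<^sup>2 + b\<^sup>2"
      using sum_squares_bound[of "\<bar>a\<bar>" "\<bar>b\<bar>"] by (simp add: mult.assoc)
    moreover have "0 \<le> \<bar>a\<bar> * \<bar>b\<bar>" by simp
    ultimately show ?thesis unfolding abs_mult by linarith
  qed
  then show "AE x in m. norm (f x * g x) \<le> norm ((f x)\<^sup>2 + (g x)\<^sup>2)"
    by (intro AE_I2) (auto intro: order_trans)
qed

lemma L2_cmult: "f \<in> L2 m \<Longrightarrow> (\<lambda>x. c * f x) \<in> L2 m"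
  by (auto simp: L2_def power_mult_distrib)

lemma L2_add:
  assumes "f \<in> L2 m" "g \<in> L2 m"
  shows "(\<lambda>x. f x + g x) \<in> L2 m"
proof -
  have "integrable m (\<lambda>x. (f x)\<^sup>2 + 2 * (f x * g x) + (g x)\<^sup>2)"
    by (intro Bochner_Integration.integrable_add integrable_mult_right L2_integrable_sq L2_integrable_mult assms)
  moreover have "(\<lambda>x. (f x)\<^sup>2 + 2 * (f x * g x) + (g x)\<^sup>2) = (\<lambda>x. (f x + g x)\<^sup>2)"
    by (simp add: power2_sum algebra_simps)
  moreover have "(\<lambda>x. f x + g x) \<in> borel_measurable m"
    using assms by (auto dest!: L2_measurable)
  ultimately show ?thesis by (simp add: L2_def)
qed

lemma L2_diff: "f \<in> L2 m \<Longrightarrow> g \<in> L2 m \<Longrightarrow> (\<lambda>x. f x - g x) \<in> L2 m"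
  using L2_add[of f m "\<lambda>x. (-1) * g x"] L2_cmult[of g m "-1"] by simp

lemma L2_comb: "f \<in> L2 m \<Longrightarrow> g \<in> L2 m \<Longrightarrow> (\<lambda>x. a * f x + b * g x) \<in> L2 m"
  by (intro L2_add L2_cmult)

lemma L2_bounded:
  assumes "g \<in> L2 m" "f \<in> borel_measurable m" "AE x in m. \<bar>f x\<bar> \<le> \<bar>g x\<bar>"
  shows "f \<in> L2 m"
proof -
  have "integrable m (\<lambda>x. (f x)\<^sup>2)"
  proof (rule Bochner_Integration.integrable_bound[OF L2_integrable_sq[OF assms(1)]])
    show "AE x in m. norm ((f x)\<^sup>2) \<le> norm ((g x)\<^sup>2)"
      using assms(3) by eventually_elim (simp add: abs_le_square_iff)
  qed (use assms(2) in measurable)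
  then show ?thesis using assms(2) by (simp add: L2_def)
qed

lemma sq_norm_mono:
  assumes "g \<in> L2 m" "f \<in> borel_measurable m" "AE x in m. \<bar>f x\<bar> \<le> \<bar>g x\<bar>"
  shows "sq_norm m f \<le> sq_norm m g"
  unfolding sq_norm_def
  using L2_integrable_sq[OF L2_bounded[OF assms]] L2_integrable_sq[OF assms(1)] assms(3)
  by (intro integral_mono_AE) (auto simp: abs_le_square_iff elim: eventually_mono)

lemma sq_norm_comb:
  assumes "f \<in> L2 m" "g \<in> L2 m"
  shows "sq_norm m (\<lambda>x. a * f x + b * g x) =
    a\<^sup>2 * sq_norm m f + 2 * a * b * (\<integral>x. f x * g x \<partial>m) + b\<^sup>2 * sq_norm m g"
proof -
  have "sq_norm m (\<lambda>x. a * f x + b * g x) =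
      (\<integral>x. a\<^sup>2 * (f x)\<^sup>2 + 2 * a * b * (f x * g x) + b\<^sup>2 * (g x)\<^sup>2 \<partial>m)"
    unfolding sq_norm_def by (intro Bochner_Integration.integral_cong) (auto simp: power2_eq_square algebra_simps)
  also have "\<dots> = a\<^sup>2 * sq_norm m f + 2 * a * b * (\<integral>x. f x * g x \<partial>m) + b\<^sup>2 * sq_norm m g"
    unfolding sq_norm_def using assms L2_integrable_mult[OF assms] by (simp add: L2_integrable_sq)
  finally show ?thesis .
qed

lemma sq_norm_cmult: "sq_norm m (\<lambda>x. c * f x) = c\<^sup>2 * sq_norm m f"
  unfolding sq_norm_def by (simp add: power_mult_distrib)

lemma sq_norm_minus_commute: "sq_norm m (\<lambda>x. f x - g x) = sq_norm m (\<lambda>x. g x - f x)"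
  unfolding sq_norm_def by (simp add: power2_commute)

lemma sq_norm_add_le:
  assumes "f \<in> L2 m" "g \<in> L2 m"
  shows "sq_norm m (\<lambda>x. f x + g x) \<le> 2 * sq_norm m f + 2 * sq_norm m g"
  using sq_norm_comb[OF assms, of 1 1] sq_norm_comb[OF assms, of 1 "- 1"]
    sq_norm_nonneg[of m "\<lambda>x. 1 * f x + - 1 * g x"] by simp

lemma parallelogram:
  assumes "f \<in> L2 m" "g \<in> L2 m"
  shows "sq_norm m (\<lambda>x. f x - g x) = 2 * sq_norm m f + 2 * sq_norm m g - 4 * sq_norm m (\<lambda>x. (f x + g x) / 2)"
  using sq_norm_comb[OF assms, of 1 "- 1"] sq_norm_comb[OF assms, of "1/2" "1/2"]
  by (simp add: add_divide_distrib power2_eq_square)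

lemma sq_norm_convex:
  assumes "f \<in> L2 m" "g \<in> L2 m" "0 \<le> t" "t \<le> 1"
  shows "sq_norm m (\<lambda>x. (1 - t) * f x + t * g x) \<le> (1 - t) * sq_norm m f + t * sq_norm m g"
proof -
  have "0 \<le> (1 - t) * t * sq_norm m (\<lambda>x. 1 * f x + - 1 * g x)"
    using assms by (intro mult_nonneg_nonneg sq_norm_nonneg) auto
  then show ?thesis
    unfolding sq_norm_comb[OF assms(1,2)] by (simp add: power2_eq_square algebra_simps)
qed

lemma L2_Cauchy_Schwarz:
  assumes "f \<in> L2 m" "g \<in> L2 m"
  shows "\<bar>\<integral>x. f x * g x \<partial>m\<bar> \<le> sqrt (sq_norm m f) * sqrt (sq_norm m g)"
proof (cases "sq_norm m f = 0")
  case True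
  have "(\<integral>x. f x * g x \<partial>m) = 0"
  proof -
    have "AE x in m. (f x)\<^sup>2 = 0"
      using True integral_nonneg_eq_0_iff_AE[OF L2_integrable_sq[OF assms(1)]] by (simp add: sq_norm_def)
    then have "AE x in m. f x * g x = 0" by eventually_elim auto
    then show ?thesis by (rule integral_eq_zero_AE)
  qed
  then show ?thesis by (simp add: sq_norm_nonneg)
next
  case False
  let ?I = "\<integral>x. f x * g x \<partial>m" and ?q = "sq_norm m f"
  have q: "0 < ?q" using False sq_norm_nonneg[of m f] by simp
  \<comment> \<open>The coefficients are chosen such that the expanded square factors as
    \<open>?q\<close> times the desired difference.\<close>
  have "0 \<le> sq_norm m (\<lambda>x. (- ?I) * f x + ?q * g x)" by (rule sq_norm_nonneg)
  also have "\<dots> = ?q * (?q * sq_norm m g - ?I\<^sup>2)"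
    unfolding sq_norm_comb[OF assms] by (simp add: power2_eq_square algebra_simps)
  finally have "?I\<^sup>2 \<le> ?q * sq_norm m g" using q by (simp add: zero_le_mult_iff)
  then have "sqrt (?I\<^sup>2) \<le> sqrt (?q * sq_norm m g)" by (rule real_sqrt_le_mono)
  then show ?thesis by (simp add: real_sqrt_mult)
qed

lemma L2_inner_tendsto:
  assumes "\<And>n. p n \<in> L2 m" "P \<in> L2 m" "h \<in> L2 m" "(\<lambda>n. sq_norm m (\<lambda>x. p n x - P x)) \<longlonglongrightarrow> 0"
  shows "(\<lambda>n. \<integral>x. p n x * h x \<partial>m) \<longlonglongrightarrow> (\<integral>x. P x * h x \<partial>m)"
proof -
  have "(\<lambda>n. sqrt (sq_norm m (\<lambda>x. p n x - P x)) * sqrt (sq_norm m h)) \<longlonglongrightarrow> sqrt 0 * sqrt (sq_norm m h)"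
    by (intro tendsto_intros assms)
  then have lim: "(\<lambda>n. sqrt (sq_norm m (\<lambda>x. p n x - P x)) * sqrt (sq_norm m h)) \<longlonglongrightarrow> 0" by simp
  have "(\<lambda>n. (\<integral>x. p n x * h x \<partial>m) - (\<integral>x. P x * h x \<partial>m)) \<longlonglongrightarrow> 0"
  proof (rule Lim_null_comparison[OF always_eventually lim], rule allI)
    fix n
    have "(\<integral>x. p n x * h x \<partial>m) - (\<integral>x. P x * h x \<partial>m) = (\<integral>x. (p n x - P x) * h x \<partial>m)"
      using assms(1-3) by (simp add: left_diff_distrib L2_integrable_mult)
    then show "norm ((\<integral>x. p n x * h x \<partial>m) - (\<integral>x. P x * h x \<partial>m)) \<le> sqrt (sq_norm m (\<lambda>x. p n x - P x)) * sqrt (sq_norm m h)"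
      using L2_Cauchy_Schwarz[OF L2_diff[OF assms(1,2)] assms(3)] by simp
  qed
  then show ?thesis by (rule LIM_zero_cancel)
qed

lemma sq_norm_tendsto:
  assumes "\<And>n. p n \<in> L2 m" "P \<in> L2 m" "(\<lambda>n. sq_norm m (\<lambda>x. p n x - P x)) \<longlonglongrightarrow> 0"
  shows "(\<lambda>n. sq_norm m (p n)) \<longlonglongrightarrow> sq_norm m P"
proof -
  have "sq_norm m (p n) = sq_norm m (\<lambda>x. p n x - P x) + 2 * (\<integral>x. p n x * P x \<partial>m) - sq_norm m P" for n
    using sq_norm_comb[OF assms(1)[of n] assms(2), of 1 "- 1"] by simp
  moreover have "(\<lambda>n. sq_norm m (\<lambda>x. p n x - P x) + 2 * (\<integral>x. p n x * P x \<partial>m) - sq_norm m P) \<longlonglongrightarrow>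
      0 + 2 * (\<integral>x. P x * P x \<partial>m) - sq_norm m P"
    by (intro tendsto_intros assms L2_inner_tendsto)
  moreover have "(\<integral>x. P x * P x \<partial>m) = sq_norm m P" by (simp add: sq_norm_def power2_eq_square)
  ultimately show ?thesis by simp
qed

lemma nn_integral_sq: "f \<in> L2 m \<Longrightarrow> (\<integral>\<^sup>+x. ennreal ((f x)\<^sup>2) \<partial>m) = ennreal (sq_norm m f)"
  unfolding sq_norm_def by (intro nn_integral_eq_integral) (auto simp: L2_integrable_sq)

lemma L2_tendsto_iff:
  assumes "\<And>k. u k \<in> L2 m" "f \<in> L2 m"
  shows "L2_tendsto m u f \<longleftrightarrow> (\<lambda>k. sq_norm m (\<lambda>x. u k x - f x)) \<longlonglongrightarrow> 0"
  unfolding L2_tendsto_def nn_integral_sq[OF L2_diff[OF assms]]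
  using tendsto_ennreal_iff[of "\<lambda>k. sq_norm m (\<lambda>x. u k x - f x)" sequentially 0] sq_norm_nonneg[of m]
  by (simp add: always_eventually)

text \<open>Riesz-Fischer: a subsequence with geometrically small increments converges almost
  everywhere, and Fatou's lemma transfers the Cauchy bounds to the limit.\<close>

lemma L2_complete:
  assumes p: "\<And>n. p n \<in> L2 m"
    and cauchy: "\<And>e. 0 < e \<Longrightarrow> \<exists>N. \<forall>n\<ge>N. \<forall>k\<ge>N. sq_norm m (\<lambda>x. p n x - p k x) < e"
  obtains P where "P \<in> L2 m" "(\<lambda>n. sq_norm m (\<lambda>x. p n x - P x)) \<longlonglongrightarrow> 0"
proof -
  have "\<exists>r. \<forall>n::nat. (\<forall>k\<ge>r n. \<forall>j\<ge>r n. sq_norm m (\<lambda>x. p k x - p j x) < (1/4)^n) \<and> r n < r (Suc n)"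
  proof (rule dependent_nat_choice)
    show "\<exists>x. \<forall>k\<ge>x. \<forall>j\<ge>x. sq_norm m (\<lambda>x. p k x - p j x) < (1/4)^0" using cauchy[of 1] by simp
  next
    fix y :: nat and n :: nat
    obtain N where "\<forall>k\<ge>N. \<forall>j\<ge>N. sq_norm m (\<lambda>x. p k x - p j x) < (1/4)^Suc n" using cauchy[of "(1/4)^Suc n"] by auto
    then show "\<exists>z. (\<forall>k\<ge>z. \<forall>j\<ge>z. sq_norm m (\<lambda>x. p k x - p j x) < (1/4)^Suc n) \<and> y < z"
      by (intro exI[of _ "max N (Suc y)"]) auto
  qed
  then obtain r where r: "\<And>n k j. k \<ge> r n \<Longrightarrow> j \<ge> r n \<Longrightarrow> sq_norm m (\<lambda>x. p k x - p j x) < (1/4)^n"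
    and rmono: "\<And>n. r n < r (Suc n)" by blast
  have sm: "strict_mono r" using rmono by (simp add: strict_mono_Suc_iff)
  define D where "D k x = p (r (Suc k)) x - p (r k) x" for k x
  have D: "D k \<in> L2 m" for k unfolding D_def by (intro L2_diff p)
  have [measurable]: "p n \<in> borel_measurable m" "D n \<in> borel_measurable m" for n
    using p D by (auto dest: L2_measurable)
  have Dq: "sq_norm m (D k) \<le> (1/4)^k" for k
    unfolding D_def using r[of k "r (Suc k)" "r k"] rmono[of k] by (simp add: less_imp_le)
  \<comment> \<open>The squared increments are at most \<open>(1/4)^k\<close>. The weight
    \<open>2^k\<close> leaves a convergent series, and finiteness of the weighted sum at a point
    bounds the increments there by a multiple of \<open>(1 / sqrt 2)^k\<close>, which is
    summable.\<close>
  have "(\<integral>\<^sup>+x. (\<Sum>k. ennreal (2^k * (D k x)\<^sup>2)) \<partial>m) = (\<Sum>k. \<integral>\<^sup>+x. ennreal (2^k * (D k x)\<^sup>2) \<partial>m)"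
    by (intro nn_integral_suminf) measurable
  also have "\<dots> \<le> (\<Sum>k. ennreal ((1/2)^k))"
  proof (rule suminf_le)
    fix k
    have "(\<integral>\<^sup>+x. ennreal (2^k * (D k x)\<^sup>2) \<partial>m) = ennreal (2^k) * ennreal (sq_norm m (D k))"
      by (simp add: ennreal_mult nn_integral_cmult nn_integral_sq[OF D])
    also have "\<dots> \<le> ennreal (2^k) * ennreal ((1/4)^k)" using Dq by (intro mult_left_mono ennreal_leI) auto
    also have "\<dots> = ennreal ((1/2)^k)" by (simp add: ennreal_mult[symmetric] power_mult_distrib[symmetric])
    finally show "(\<integral>\<^sup>+x. ennreal (2^k * (D k x)\<^sup>2) \<partial>m) \<le> ennreal ((1/2)^k)" .
  qed auto
  also have "\<dots> < \<infinity>"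
    by (subst suminf_ennreal2) (auto intro: summable_geometric)
  finally have "AE x in m. (\<Sum>k. ennreal (2^k * (D k x)\<^sup>2)) \<noteq> \<infinity>"
    by (intro nn_integral_PInf_AE) auto
  then have conv: "AE x in m. convergent (\<lambda>k. p (r k) x)"
  proof eventually_elim
    case (elim x)
    define K where "K = enn2real (\<Sum>k. ennreal (2^k * (D k x)\<^sup>2))"
    have K: "2^k * (D k x)\<^sup>2 \<le> K" for k
    proof -
      have "ennreal (2^k * (D k x)\<^sup>2) \<le> (\<Sum>k. ennreal (2^k * (D k x)\<^sup>2))"
        by (rule order_trans[OF _ sum_le_suminf[where I = "{k}"]]) (auto simp only: sum.insert sum.empty finite.intros
            summableI zero_le add_0_right empty_iff not_False_eq_True order_refl)
      also have "\<dots> = ennreal K" using elim by (simp add: K_def less_top)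
      finally show ?thesis by (simp add: K_def ennreal_le_iff enn2real_nonneg)
    qed
    have "summable (\<lambda>k. D k x)"
    proof (rule summable_comparison_test')
      show "summable (\<lambda>k. sqrt K * (1 / sqrt 2)^k)" by (intro summable_mult summable_geometric) simp
      show "norm (D k x) \<le> sqrt K * (1 / sqrt 2)^k" if "k \<ge> 0" for k
      proof -
        have "(D k x)\<^sup>2 \<le> K / 2^k" using K[of k] by (simp add: field_simps)
        then have "sqrt ((D k x)\<^sup>2) \<le> sqrt (K / 2^k)" by (rule real_sqrt_le_mono)
        moreover have "sqrt (K / 2^k) = sqrt K * (1 / sqrt 2)^k"
          by (simp add: real_sqrt_divide real_sqrt_power power_divide)
        ultimately show ?thesis by simp
      qed
    qed
    then have "(\<lambda>n. \<Sum>k<n. D k x) \<longlonglongrightarrow> (\<Sum>k. D k x)" by (rule summable_LIMSEQ)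
    moreover have "(\<Sum>k<n. D k x) = p (r n) x - p (r 0) x" for n
      unfolding D_def by (rule sum_lessThan_telescope)
    ultimately have "(\<lambda>n. (p (r n) x - p (r 0) x) + p (r 0) x) \<longlonglongrightarrow> (\<Sum>k. D k x) + p (r 0) x"
      by (intro tendsto_intros) simp
    then show ?case by (auto simp: convergent_def)
  qed
  define P where "P x = lim (\<lambda>k. p (r k) x)" for x
  have [measurable]: "P \<in> borel_measurable m" unfolding P_def by measurable
  have lim: "AE x in m. (\<lambda>k. p (r k) x) \<longlonglongrightarrow> P x"
    using conv by eventually_elim (simp add: P_def convergent_LIMSEQ_iff)
  have close: "(\<integral>\<^sup>+x. ennreal ((p n x - P x)\<^sup>2) \<partial>m) \<le> ennreal ((1/4)^k)" if n: "n \<ge> r k" for n k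
  proof -
    have "(\<integral>\<^sup>+x. ennreal ((p n x - P x)\<^sup>2) \<partial>m) = (\<integral>\<^sup>+x. liminf (\<lambda>j. ennreal ((p n x - p (r j) x)\<^sup>2)) \<partial>m)"
    proof (rule nn_integral_cong_AE)
      show "AE x in m. ennreal ((p n x - P x)\<^sup>2) = liminf (\<lambda>j. ennreal ((p n x - p (r j) x)\<^sup>2))"
        using lim
      proof eventually_elim
        case (elim x)
        have "(\<lambda>j. ennreal ((p n x - p (r j) x)\<^sup>2)) \<longlonglongrightarrow> ennreal ((p n x - P x)\<^sup>2)"
          by (intro tendsto_intros elim)
        then show ?case by (intro lim_imp_Liminf[symmetric]) auto
      qed
    qed
    also have "\<dots> \<le> liminf (\<lambda>j. \<integral>\<^sup>+x. ennreal ((p n x - p (r j) x)\<^sup>2) \<partial>m)"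
      by (intro nn_integral_liminf) measurable
    also have "\<dots> \<le> ennreal ((1/4)^k)"
    proof (rule Liminf_le)
      have "(\<integral>\<^sup>+x. ennreal ((p n x - p (r j) x)\<^sup>2) \<partial>m) \<le> ennreal ((1/4)^k)" if "j \<ge> k" for j
        using r[OF n, of "r j"] strict_mono_mono[OF sm, THEN monoD, OF that]
        by (simp add: nn_integral_sq[OF L2_diff[OF p p]] ennreal_leI less_imp_le)
      then show "\<forall>\<^sub>F j in sequentially. (\<integral>\<^sup>+x. ennreal ((p n x - p (r j) x)\<^sup>2) \<partial>m) \<le> ennreal ((1/4)^k)"
        unfolding eventually_sequentially by blast
    qed simp
    finally show ?thesis .
  qed
  \<comment> \<open>Square integrability of the limit is also a consequence of Fatou, through the
    bound for \<open>k = 0\<close>.\<close>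
  have dL2: "(\<lambda>x. p n x - P x) \<in> L2 m" if "n \<ge> r 0" for n
    using close[OF that] unfolding L2_def by (auto intro!: integrableI_bounded simp: order_le_less_trans)
  have P2: "P \<in> L2 m" using L2_diff[OF p[of "r 0"] dL2[of "r 0"]] by simp
  have "(\<lambda>n. sq_norm m (\<lambda>x. p n x - P x)) \<longlonglongrightarrow> 0"
  proof (rule LIMSEQ_I)
    fix e :: real assume "0 < e"
    then obtain k where k: "(1/4)^k < e" using real_arch_pow_inv[of e "1/4"] by auto
    have "norm (sq_norm m (\<lambda>x. p n x - P x) - 0) < e" if "n \<ge> r k" for n
      using close[OF that] k sq_norm_nonneg[of m]
      by (simp add: nn_integral_sq[OF L2_diff[OF p P2]] ennreal_le_iff)
    then show "\<exists>N. \<forall>n\<ge>N. norm (sq_norm m (\<lambda>x. p n x - P x) - 0) < e" by blast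
  qed
  with P2 show ?thesis by (rule that)
qed

section \<open>Elements of minimal norm and Mazur's lemma\<close>

lemma L2_midpoint: "f \<in> L2 m \<Longrightarrow> g \<in> L2 m \<Longrightarrow> (\<lambda>x. (f x + g x) / 2) \<in> L2 m"
  using L2_comb[of f m g "1/2" "1/2"] by (simp add: add_divide_distrib)

text \<open>Near-minimisers of the norm form a Cauchy sequence by the parallelogram law.\<close>
lemma minimizing_sequence:
  fixes C :: "nat \<Rightarrow> ('a \<Rightarrow> real) set"
  assumes C: "\<And>n. C n \<subseteq> L2 m" and dec: "\<And>n k. n \<le> k \<Longrightarrow> C k \<subseteq> C n"
    and mid: "\<And>n a b. a \<in> C n \<Longrightarrow> b \<in> C n \<Longrightarrow> \<exists>c\<in>C n. sq_norm m c \<le> sq_norm m (\<lambda>x. (a x + b x) / 2)"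
    and bdd: "\<And>n. \<exists>a\<in>C n. sq_norm m a \<le> B"
  obtains p P where "\<And>n. p n \<in> C n" "P \<in> L2 m" "(\<lambda>n. sq_norm m (\<lambda>x. p n x - P x)) \<longlonglongrightarrow> 0"
    "\<And>n c. (\<And>k. c \<in> C k) \<Longrightarrow> sq_norm m P \<le> sq_norm m c"
proof -
  define J where "J n = Inf (sq_norm m ` C n)" for n
  have ne: "C n \<noteq> {}" for n using bdd[of n] by auto
  have bb: "bdd_below (sq_norm m ` C n)" for n by (intro bdd_belowI[of _ 0]) (auto simp: sq_norm_nonneg)
  have Jle: "J n \<le> sq_norm m c" if "c \<in> C n" for n c unfolding J_def using that bb by (intro cINF_lower) auto
  have JB: "J n \<le> B" for n using bdd[of n] Jle by (meson order_trans)
  have Jinc: "incseq J"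
    unfolding J_def using dec ne bb by (intro monoI cInf_superset_mono) auto
  have "\<exists>p\<in>C n. sq_norm m p < J n + 1 / real (Suc n)" for n
    using cInf_lessD[of "sq_norm m ` C n" "J n + 1 / real (Suc n)"] ne[of n] by (auto simp: J_def)
  then obtain p where p: "\<And>n. p n \<in> C n" "\<And>n. sq_norm m (p n) < J n + 1 / real (Suc n)" by metis
  have p2: "p n \<in> L2 m" for n using p(1) C by auto
  \<comment> \<open>Both near-minimisers lie in \<open>C n\<close>, so the squared norm of their
    midpoint is at least \<open>J n\<close>. The sets shrink, hence the infima \<open>J\<close>
    increase; being bounded by \<open>B\<close> they converge, which makes this estimate
    small.\<close>
  have est: "sq_norm m (\<lambda>x. p n x - p k x) \<le> 2 * (J k - J n) + 4 / real (Suc n)" if nk: "n \<le> k" for n k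
  proof -
    have "p k \<in> C n" using p(1) dec[OF nk] by auto
    then obtain c where c: "c \<in> C n" "sq_norm m c \<le> sq_norm m (\<lambda>x. (p n x + p k x) / 2)"
      using mid[OF p(1)[of n]] by blast
    have "1 / real (Suc k) \<le> 1 / real (Suc n)" using nk by (simp add: field_simps)
    then show ?thesis
      using parallelogram[OF p2[of n] p2[of k]] Jle[OF c(1)] c(2) p(2)[of n] p(2)[of k] by simp
  qed
  have Jlim: "J \<longlonglongrightarrow> (SUP n. J n)"
    by (rule LIMSEQ_incseq_SUP[OF _ Jinc]) (use JB in \<open>auto simp: bdd_above_def\<close>)
  have "\<exists>N. \<forall>n\<ge>N. \<forall>k\<ge>N. sq_norm m (\<lambda>x. p n x - p k x) < e" if e: "0 < e" for e
  proof -
    have "Cauchy J" using Jlim by (rule LIMSEQ_imp_Cauchy)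
    then obtain N1 where N1: "\<And>n k. n \<ge> N1 \<Longrightarrow> k \<ge> N1 \<Longrightarrow> \<bar>J n - J k\<bar> < e / 4"
      unfolding Cauchy_def dist_real_def using e by (meson divide_pos_pos zero_less_numeral)
    obtain N2 where N2: "inverse (real (Suc N2)) < e / 8" using reals_Archimedean[of "e / 8"] e by auto
    have small: "sq_norm m (\<lambda>x. p n x - p k x) < e" if nk: "n \<ge> max N1 N2" "n \<le> k" for n k
    proof -
      have "1 / real (Suc n) \<le> inverse (real (Suc N2))" using nk by (simp add: field_simps)
      then have "4 / real (Suc n) < e / 2" using N2 by simp
      moreover have "\<bar>J k - J n\<bar> < e / 4" using nk by (intro N1) auto
      then have "J k - J n < e / 4" by (rule order_le_less_trans[OF abs_ge_self])
      then have "2 * (J k - J n) < e / 2" by simp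
      ultimately show ?thesis using est[OF nk(2)] by linarith
    qed
    show ?thesis
    proof (intro exI allI impI)
      fix n k assume "n \<ge> max N1 N2" "k \<ge> max N1 N2"
      then show "sq_norm m (\<lambda>x. p n x - p k x) < e"
        using small[of n k] small[of k n] sq_norm_minus_commute[of m "p n" "p k"] by (cases "n \<le> k") auto
    qed
  qed
  from L2_complete[OF p2 this] obtain P where P: "P \<in> L2 m" "(\<lambda>n. sq_norm m (\<lambda>x. p n x - P x)) \<longlonglongrightarrow> 0"
    by blast
  have "sq_norm m P \<le> sq_norm m c" if c: "\<And>k. c \<in> C k" for c
  proof (rule LIMSEQ_le)
    show "(\<lambda>n. sq_norm m (p n)) \<longlonglongrightarrow> sq_norm m P" using p2 P by (rule sq_norm_tendsto)
    have "(\<lambda>n. sq_norm m c + inverse (real (Suc n))) \<longlonglongrightarrow> sq_norm m c + 0"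
      by (intro tendsto_intros LIMSEQ_inverse_real_of_nat)
    then show "(\<lambda>n. sq_norm m c + inverse (real (Suc n))) \<longlonglongrightarrow> sq_norm m c" by simp
    have "sq_norm m (p n) \<le> sq_norm m c + inverse (real (Suc n))" for n
      using p(2)[of n] Jle[OF c[of n]] by (simp add: inverse_eq_divide)
    then show "\<exists>N. \<forall>n\<ge>N. sq_norm m (p n) \<le> sq_norm m c + inverse (real (Suc n))" by blast
  qed
  then show ?thesis using that p(1) P by blast
qed

text \<open>Mazur's lemma: the element \<open>P\<close> of minimal norm in the closure of \<open>C\<close> satisfies
  \<open>\<integral> P * c \<ge> \<integral> P\<^sup>2\<close> for all \<open>c\<close> in \<open>C\<close>, so it vanishes if \<open>C\<close> contains a weak null sequence.\<close>
lemma weak_null_imp_small_norm: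
  assumes C: "C \<subseteq> L2 m"
    and conv: "\<And>a b t. a \<in> C \<Longrightarrow> b \<in> C \<Longrightarrow> 0 \<le> t \<Longrightarrow> t \<le> 1 \<Longrightarrow> (\<lambda>x. (1 - t) * a x + t * b x) \<in> C"
    and d: "\<And>k::nat. d k \<in> C" and weak: "\<And>h. h \<in> L2 m \<Longrightarrow> (\<lambda>k. \<integral>x. d k x * h x \<partial>m) \<longlonglongrightarrow> 0"
    and e: "0 < e"
  obtains a where "a \<in> C" "sq_norm m a < e"
proof -
  obtain p P where p: "\<And>n::nat. p n \<in> C" and P: "P \<in> L2 m"
    and lim: "(\<lambda>n. sq_norm m (\<lambda>x. p n x - P x)) \<longlonglongrightarrow> 0"
    and min: "\<And>c. c \<in> C \<Longrightarrow> sq_norm m P \<le> sq_norm m c"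
  proof (rule minimizing_sequence[of "\<lambda>_. C" m "sq_norm m (d 0)"])
    show "\<exists>c\<in>C. sq_norm m c \<le> sq_norm m (\<lambda>x. (a x + b x) / 2)" if "a \<in> C" "b \<in> C" for a b
      using conv[OF that, of "1/2"] by (intro bexI[of _ "\<lambda>x. (a x + b x) / 2"]) (auto simp: add_divide_distrib)
  qed (use C d in auto)
  have p2: "p n \<in> L2 m" for n using p C by auto
  have ineq: "sq_norm m P \<le> (\<integral>x. P x * c x \<partial>m)" if c: "c \<in> C" for c
  proof -
    have c2: "c \<in> L2 m" using c C by auto
    \<comment> \<open>This is the first variation of the squared norm along the segment from
      \<open>P\<close> to \<open>c\<close>. \<open>P\<close> is only a limit of elements of
      \<open>C\<close>, so minimality is applied to segments starting at \<open>p n\<close>.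
      Division by \<open>t\<close> prepares the limit as \<open>t\<close> tends to 0.\<close>
    have t: "2 * (sq_norm m P - (\<integral>x. P x * c x \<partial>m)) \<le> t * sq_norm m (\<lambda>x. 1 * P x + - 1 * c x)" if t: "0 < t" "t \<le> 1" for t
    proof -
      have "sq_norm m P \<le> sq_norm m (\<lambda>x. (1 - t) * P x + t * c x)"
      proof (rule LIMSEQ_le_const)
        show "(\<lambda>n. sq_norm m (\<lambda>x. (1 - t) * p n x + t * c x)) \<longlonglongrightarrow> sq_norm m (\<lambda>x. (1 - t) * P x + t * c x)"
        proof (rule sq_norm_tendsto)
          have "(\<lambda>n. (1 - t)\<^sup>2 * sq_norm m (\<lambda>x. p n x - P x)) \<longlonglongrightarrow> (1 - t)\<^sup>2 * 0" by (intro tendsto_intros lim)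
          moreover have "(\<lambda>x. (1 - t) * p n x + t * c x - ((1 - t) * P x + t * c x)) = (\<lambda>x. (1 - t) * (p n x - P x))" for n
            by (simp add: algebra_simps)
          ultimately show "(\<lambda>n. sq_norm m (\<lambda>x. (1 - t) * p n x + t * c x - ((1 - t) * P x + t * c x))) \<longlonglongrightarrow> 0"
            by (simp add: sq_norm_cmult)
        qed (use p2 P c2 in \<open>auto intro: L2_comb\<close>)
        show "\<exists>N. \<forall>n\<ge>N. sq_norm m P \<le> sq_norm m (\<lambda>x. (1 - t) * p n x + t * c x)"
          using t by (auto intro!: min conv p c)
      qed
      also have "\<dots> = (1 - t)\<^sup>2 * sq_norm m P + 2 * (1 - t) * t * (\<integral>x. P x * c x \<partial>m) + t\<^sup>2 * sq_norm m c"
        by (rule sq_norm_comb[OF P c2])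
      finally have "t * (2 * (sq_norm m P - (\<integral>x. P x * c x \<partial>m))) \<le> t * (t * (sq_norm m P - 2 * (\<integral>x. P x * c x \<partial>m) + sq_norm m c))"
        by (simp add: power2_eq_square algebra_simps)
      then have "2 * (sq_norm m P - (\<integral>x. P x * c x \<partial>m)) \<le> t * (sq_norm m P - 2 * (\<integral>x. P x * c x \<partial>m) + sq_norm m c)"
        using t(1) by (rule mult_left_le_imp_le)
      then show ?thesis unfolding sq_norm_comb[OF P c2] by simp
    qed
    have "2 * (sq_norm m P - (\<integral>x. P x * c x \<partial>m)) \<le> 0"
    proof (rule tendsto_lowerbound)
      show "((\<lambda>t. t * sq_norm m (\<lambda>x. 1 * P x + - 1 * c x)) \<longlongrightarrow> 0) (at_right 0)"
        by (rule tendsto_eq_intros refl)+ simp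
      show "\<forall>\<^sub>F t in at_right 0. 2 * (sq_norm m P - (\<integral>x. P x * c x \<partial>m)) \<le> t * sq_norm m (\<lambda>x. 1 * P x + - 1 * c x)"
        using t by (auto simp: eventually_at_right[of 0 1] intro!: exI[of _ 1])
    qed simp
    then show ?thesis by simp
  qed
  have "(\<lambda>k. \<integral>x. d k x * P x \<partial>m) \<longlonglongrightarrow> 0" by (rule weak[OF P])
  then have "sq_norm m P \<le> 0"
    by (rule LIMSEQ_le_const) (use ineq[OF d] in \<open>auto simp: mult.commute[of "P _"]\<close>)
  then have "sq_norm m P = 0" using sq_norm_nonneg[of m P] by simp
  then have "(\<lambda>n. sq_norm m (p n)) \<longlonglongrightarrow> 0" using sq_norm_tendsto[OF p2 P lim] by simp
  then have "\<forall>\<^sub>F n in sequentially. sq_norm m (p n) < e" using e by (rule order_tendstoD)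
  then obtain n where "sq_norm m (p n) < e" by (auto simp: eventually_sequentially)
  then show ?thesis using that p by blast
qed

text \<open>Pairs of convex combinations of \<open>u\<close> and of \<open>s\<close> from index
  \<open>n\<close> on, formed with the same weights. Keeping both sides in one relation lets an
  inequality between slopes of the \<open>u k\<close> and the \<open>s k\<close> survive every
  combination.\<close>

inductive convex_tail :: "(nat \<Rightarrow> 'a \<Rightarrow> real) \<Rightarrow> (nat \<Rightarrow> 'a \<Rightarrow> real) \<Rightarrow> nat \<Rightarrow> ('a \<Rightarrow> real) \<Rightarrow> ('a \<Rightarrow> real) \<Rightarrow> bool"
  for u s n where
  base: "n \<le> k \<Longrightarrow> convex_tail u s n (u k) (s k)"
| comb: "convex_tail u s n a A \<Longrightarrow> convex_tail u s n b B \<Longrightarrow> 0 \<le> t \<Longrightarrow> t \<le> 1 \<Longrightarrow>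
    convex_tail u s n (\<lambda>x. (1 - t) * a x + t * b x) (\<lambda>x. (1 - t) * A x + t * B x)"

lemma convex_tail_mono: "convex_tail u s k a A \<Longrightarrow> n \<le> k \<Longrightarrow> convex_tail u s n a A"
  by (induction rule: convex_tail.induct) (auto intro: convex_tail.intros)

abbreviation rlip :: "('a::metric_space \<Rightarrow> real) \<Rightarrow> 'a \<Rightarrow> real" where
  "rlip f x \<equiv> enn2real (lip f x)"

lemma LIPb_lip_eq: "f \<in> LIPb \<Longrightarrow> lip f x = ennreal (rlip f x)"
  using LIPb_lip_finite[of f x] by simp

lemma rlip_le: "lip f x \<le> ennreal c \<Longrightarrow> 0 \<le> c \<Longrightarrow> rlip f x \<le> c"
  by (metis enn2real_ennreal enn2real_mono ennreal_less_top)

lemma rlip_comb_le: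
  assumes "f \<in> LIPb" "g \<in> LIPb" "0 \<le> a" "0 \<le> b"
  shows "rlip (\<lambda>x. a * f x + b * g x) x \<le> a * rlip f x + b * rlip g x"
proof (rule rlip_le)
  have "lip (\<lambda>x. a * f x + b * g x) x \<le> ennreal a * lip f x + ennreal b * lip g x"
    using lip_cmult[of a f x] lip_cmult[of b g x] assms(3,4)
    by (intro order_trans[OF lip_add add_mono]) auto
  then show "lip (\<lambda>x. a * f x + b * g x) x \<le> ennreal (a * rlip f x + b * rlip g x)"
    using assms LIPb_lip_finite[of f x] LIPb_lip_finite[of g x] by (simp add: ennreal_mult)
qed (use assms in auto)

lemma rlip_measurable:
  assumes "f \<in> LIPb" "sets m = sets borel"
  shows "rlip f \<in> borel_measurable m"
proof -
  have "lip f \<in> borel_measurable m"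
    using borel_measurable_lip[OF LIPb_continuous[OF assms(1)]] measurable_cong_sets[OF assms(2) refl] by auto
  then show ?thesis by measurable
qed

text \<open>Convex combinations of the \<open>u k\<close> may be chosen such that the slopes converge strongly; this
  replaces weak compactness.\<close>
theorem minimal_slope_le_weak_limit:
  fixes m :: "'a::metric_space measure"
  assumes m: "sets m = sets borel" and u: "\<And>k. u k \<in> LIPb \<inter> L2 m" and w: "w \<in> L2 m" and lim: "L2_tendsto m u w"
    and s: "\<And>k. s k \<in> L2 m" "\<And>k x. rlip (u k) x \<le> s k x" and S: "S \<in> L2 m"
    and weak: "\<And>h. h \<in> L2 m \<Longrightarrow> (\<lambda>k. \<integral>x. s k x * h x \<partial>m) \<longlonglongrightarrow> (\<integral>x. S x * h x \<partial>m)"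
    and G: "minimal_relaxed_slope m w G"
  shows "AE x in m. G x \<le> S x"
proof -
  note meas = rlip_measurable[OF _ m]
  have ct: "a \<in> LIPb \<inter> L2 m \<and> A \<in> L2 m \<and> (\<forall>x. rlip a x \<le> A x)" if "convex_tail u s n a A" for n a A
    using that
  proof induction
    case (comb a A b B t)
    have "rlip (\<lambda>x. (1 - t) * a x + t * b x) x \<le> (1 - t) * A x + t * B x" for x
      using rlip_comb_le[of a b "1 - t" t x] comb
      by (intro order_trans[OF rlip_comb_le add_mono] mult_left_mono) auto
    then show ?case using comb by (auto intro!: LIPb_add LIPb_cmult L2_comb)
  qed (use u s in auto)
  have r2: "rlip a \<in> L2 m" if "convex_tail u s n a A" for n a A
  proof (rule L2_bounded)
    show "A \<in> L2 m" "rlip a \<in> borel_measurable m" using ct[OF that] by (auto intro: meas)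
    show "AE x in m. \<bar>rlip a x\<bar> \<le> \<bar>A x\<bar>"
      using ct[OF that] by (intro AE_I2) (auto intro: order_trans[OF _ abs_ge_self])
  qed
  have bounded: "\<exists>a A. convex_tail u s n a A \<and> sq_norm m (rlip a) \<le> 2 + 2 * sq_norm m S" for n
  proof -
    \<comment> \<open>The functions \<open>s k - S\<close> are weakly null, so in each tail some
      combination \<open>A\<close> has squared distance less than 1 from \<open>S\<close>. It
      dominates the slope of the accompanying \<open>a\<close>, which gives a bound on slopes common
      to all tails.\<close>
    let ?C = "{\<lambda>x. A x - S x | A. \<exists>a. convex_tail u s n a A}"
    obtain c where c: "c \<in> ?C" "sq_norm m c < 1"
    proof (rule weak_null_imp_small_norm[of ?C m "\<lambda>k x. s (n + k) x - S x" 1])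
      show "?C \<subseteq> L2 m" using ct S by (auto intro: L2_diff)
      show "(\<lambda>x. (1 - t) * a x + t * b x) \<in> ?C" if ab: "a \<in> ?C" "b \<in> ?C" "0 \<le> t" "t \<le> 1" for a b t
      proof -
        obtain a' A b' B where AB: "convex_tail u s n a' A" "a = (\<lambda>x. A x - S x)"
          "convex_tail u s n b' B" "b = (\<lambda>x. B x - S x)" using ab by auto
        have "(\<lambda>x. (1 - t) * a x + t * b x) = (\<lambda>x. ((1 - t) * A x + t * B x) - S x)"
          by (simp add: AB algebra_simps)
        then show ?thesis using convex_tail.comb[OF AB(1,3) ab(3,4)] by auto
      qed
      show "(\<lambda>x. s (n + k) x - S x) \<in> ?C" for k using convex_tail.base[of n "n + k" u s] by auto
      show "(\<lambda>k. \<integral>x. (s (n + k) x - S x) * h x \<partial>m) \<longlonglongrightarrow> 0" if h: "h \<in> L2 m" for h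
      proof -
        have "(\<lambda>k. (\<integral>x. s (k + n) x * h x \<partial>m) - (\<integral>x. S x * h x \<partial>m)) \<longlonglongrightarrow> (\<integral>x. S x * h x \<partial>m) - (\<integral>x. S x * h x \<partial>m)"
          by (intro tendsto_intros LIMSEQ_ignore_initial_segment weak h)
        then show ?thesis
          using s(1) S h by (simp add: left_diff_distrib L2_integrable_mult add.commute)
      qed
    qed (auto)
    then obtain a A where aA: "convex_tail u s n a A" "c = (\<lambda>x. A x - S x)" by auto
    have "sq_norm m (rlip a) \<le> sq_norm m A"
      using ct[OF aA(1)] by (intro sq_norm_mono meas AE_I2) (auto intro: order_trans[OF _ abs_ge_self])
    also have "\<dots> = sq_norm m (\<lambda>x. c x + S x)" by (simp add: aA)
    also have "\<dots> \<le> 2 * sq_norm m c + 2 * sq_norm m S"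
      using ct[OF aA(1)] S aA(2) by (intro sq_norm_add_le) (auto intro: L2_diff)
    finally show ?thesis using aA(1) c(2) by (intro exI[of _ a] exI[of _ A]) auto
  qed
  \<comment> \<open>Slopes of combinations do not form a convex set. The slope of a midpoint lies
    below the midpoint of the slopes, and \<open>minimizing_sequence\<close> asks for just
    this.\<close>
  let ?D = "\<lambda>n. {rlip a | a. \<exists>A. convex_tail u s n a A}"
  obtain p H where p: "\<And>n. p n \<in> ?D n" and H: "H \<in> L2 m"
    and pH: "(\<lambda>n. sq_norm m (\<lambda>x. p n x - H x)) \<longlonglongrightarrow> 0"
  proof (rule minimizing_sequence[of ?D m "2 + 2 * sq_norm m S"])
    show "?D n \<subseteq> L2 m" for n using r2 by auto
    show "?D k \<subseteq> ?D n" if "n \<le> k" for n k using convex_tail_mono[OF _ that] by blast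
    show "\<exists>a\<in>?D n. sq_norm m a \<le> 2 + 2 * sq_norm m S" for n using bounded[of n] by blast
    show "\<exists>c\<in>?D n. sq_norm m c \<le> sq_norm m (\<lambda>x. (a x + b x) / 2)" if ab: "a \<in> ?D n" "b \<in> ?D n" for n a b
    proof -
      obtain a' A b' B where AB: "convex_tail u s n a' A" "a = rlip a'" "convex_tail u s n b' B" "b = rlip b'"
        using ab by auto
      define c where "c = (\<lambda>x. (1 - 1/2) * a' x + 1/2 * b' x)"
      have c: "convex_tail u s n c (\<lambda>x. (1 - 1/2) * A x + 1/2 * B x)"
        unfolding c_def by (rule convex_tail.comb[OF AB(1,3)]) auto
      have "\<bar>rlip c x\<bar> \<le> \<bar>(a x + b x) / 2\<bar>" for x
        using rlip_comb_le[of a' b' "1 - 1/2" "1/2" x] ct[OF AB(1)] ct[OF AB(3)]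
        by (auto simp: c_def AB(2,4) intro: order_trans[OF _ abs_ge_self])
      then have "sq_norm m (rlip c) \<le> sq_norm m (\<lambda>x. (a x + b x) / 2)"
        using r2[OF AB(1)] r2[OF AB(3)] ct[OF c] AB(2,4)
        by (intro sq_norm_mono L2_midpoint meas AE_I2) auto
      then show ?thesis using c by blast
    qed
  qed blast
  then have "\<forall>n. \<exists>a A. p n = rlip a \<and> convex_tail u s n a A" by blast
  then obtain a A where a: "\<And>n. p n = rlip (a n)" "\<And>n. convex_tail u s n (a n) (A n)" by metis
  have p2: "p n \<in> L2 m" for n using r2[OF a(2)] a(1) by simp
  have pw: "(\<lambda>n. \<integral>x. p n x * h x \<partial>m) \<longlonglongrightarrow> (\<integral>x. H x * h x \<partial>m)" if "h \<in> L2 m" for h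
    using p2 H that pH by (rule L2_inner_tendsto)
  have u2: "u k \<in> L2 m" for k using u by auto
  have a2: "a n \<in> L2 m" "a n \<in> LIPb" for n using ct[OF a(2)] by auto
  \<comment> \<open>The squared distance to \<open>w\<close> is convex, so smallness for all members
    of a tail is inherited by all its combinations. The same pattern gives the weak convergence of
    \<open>A n\<close> below, since an interval around the limit is convex.\<close>
  have aw: "(\<lambda>n. sq_norm m (\<lambda>x. a n x - w x)) \<longlonglongrightarrow> 0"
  proof (rule LIMSEQ_I)
    fix e :: real assume e: "0 < e"
    have "(\<lambda>k. sq_norm m (\<lambda>x. u k x - w x)) \<longlonglongrightarrow> 0" using lim L2_tendsto_iff[OF u2 w] by simp
    then have "\<forall>\<^sub>F k in sequentially. sq_norm m (\<lambda>x. u k x - w x) < e / 2"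
      using e by (intro order_tendstoD(2)) auto
    then obtain N where N: "\<And>k. k \<ge> N \<Longrightarrow> sq_norm m (\<lambda>x. u k x - w x) \<le> e / 2"
      by (auto simp: eventually_sequentially intro: less_imp_le)
    have "sq_norm m (\<lambda>x. b x - w x) \<le> e / 2" if "convex_tail u s N b B" for b B
      using that
    proof induction
      case (comb a A b B t)
      have "sq_norm m (\<lambda>x. (1 - t) * a x + t * b x - w x) = sq_norm m (\<lambda>x. (1 - t) * (a x - w x) + t * (b x - w x))"
        by (simp add: algebra_simps)
      also have "\<dots> \<le> (1 - t) * sq_norm m (\<lambda>x. a x - w x) + t * sq_norm m (\<lambda>x. b x - w x)"
        using comb ct w by (intro sq_norm_convex L2_diff) blast+
      also have "\<dots> \<le> (1 - t) * (e / 2) + t * (e / 2)"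
        using comb by (intro add_mono mult_left_mono) auto
      also have "\<dots> = e / 2" by (simp flip: distrib_right)
      finally show ?case .
    qed (rule N)
    then have "norm (sq_norm m (\<lambda>x. a n x - w x) - 0) < e" if "n \<ge> N" for n
      using convex_tail_mono[OF a(2) that] sq_norm_nonneg[of m] e by fastforce
    then show "\<exists>N. \<forall>n\<ge>N. norm (sq_norm m (\<lambda>x. a n x - w x) - 0) < e" by blast
  qed
  have Aw: "(\<lambda>n. \<integral>x. A n x * h x \<partial>m) \<longlonglongrightarrow> (\<integral>x. S x * h x \<partial>m)" if h: "h \<in> L2 m" for h
  proof (rule LIMSEQ_I)
    fix e :: real assume e: "0 < e"
    obtain N where N: "\<And>k. k \<ge> N \<Longrightarrow> \<bar>(\<integral>x. s k x * h x \<partial>m) - (\<integral>x. S x * h x \<partial>m)\<bar> \<le> e / 2"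
      using LIMSEQ_D[OF weak[OF h], of "e / 2"] e by (auto intro: less_imp_le)
    have "\<bar>(\<integral>x. B x * h x \<partial>m) - (\<integral>x. S x * h x \<partial>m)\<bar> \<le> e / 2" if "convex_tail u s N b B" for b B
      using that
    proof induction
      case (comb a A b B t)
      have i: "integrable m (\<lambda>x. A x * h x)" "integrable m (\<lambda>x. B x * h x)"
        using ct[OF comb(1)] ct[OF comb(2)] h by (auto intro: L2_integrable_mult)
      have "(\<integral>x. ((1 - t) * A x + t * B x) * h x \<partial>m) = (\<integral>x. (1 - t) * (A x * h x) + t * (B x * h x) \<partial>m)"
        by (simp add: algebra_simps)
      also have "\<dots> = (1 - t) * (\<integral>x. A x * h x \<partial>m) + t * (\<integral>x. B x * h x \<partial>m)" using i by simp
      finally have "(\<integral>x. ((1 - t) * A x + t * B x) * h x \<partial>m) - (\<integral>x. S x * h x \<partial>m) =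
          (1 - t) * ((\<integral>x. A x * h x \<partial>m) - (\<integral>x. S x * h x \<partial>m)) + t * ((\<integral>x. B x * h x \<partial>m) - (\<integral>x. S x * h x \<partial>m))"
        by (simp add: algebra_simps)
      also have "\<bar>\<dots>\<bar> \<le> (1 - t) * (e / 2) + t * (e / 2)"
        using mult_left_mono[OF comb.IH(1), of "1 - t"] mult_left_mono[OF comb.IH(2), of t] comb.hyps(3,4)
        by (intro order_trans[OF abs_triangle_ineq] add_mono) (simp_all add: abs_mult)
      also have "\<dots> = e / 2" by (simp flip: distrib_right)
      finally show ?case .
    qed (rule N)
    then have "norm ((\<integral>x. A n x * h x \<partial>m) - (\<integral>x. S x * h x \<partial>m)) < e" if "n \<ge> N" for n
      using convex_tail_mono[OF a(2) that] e by fastforce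
    then show "\<exists>N. \<forall>n\<ge>N. norm ((\<integral>x. A n x * h x \<partial>m) - (\<integral>x. S x * h x \<partial>m)) < e" by blast
  qed
  have HS: "AE x in m. H x \<le> S x"
  proof -
    \<comment> \<open>Testing \<open>p n \<le> A n\<close> with the positive part of
      \<open>H - S\<close> and passing to the limit shows that the square of this positive part has
      integral 0.\<close>
    define h where "h x = max 0 (H x - S x)" for x
    have h0: "0 \<le> h x" for x by (simp add: h_def)
    have d2: "(\<lambda>x. H x - S x) \<in> L2 m" using H S by (rule L2_diff)
    have h: "h \<in> L2 m"
    proof (rule L2_bounded[OF d2])
      show "h \<in> borel_measurable m" using L2_measurable[OF d2] unfolding h_def by measurable
    qed (auto simp: h_def)
    have "(\<integral>x. H x * h x \<partial>m) \<le> (\<integral>x. S x * h x \<partial>m)"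
    proof (rule LIMSEQ_le[OF pw[OF h] Aw[OF h]])
      show "\<exists>N. \<forall>n\<ge>N. (\<integral>x. p n x * h x \<partial>m) \<le> (\<integral>x. A n x * h x \<partial>m)"
        using ct[OF a(2)] p2 h a(1)
        by (intro exI[of _ 0] allI impI integral_mono L2_integrable_mult mult_right_mono) (auto simp: h0)
    qed
    moreover have "(\<integral>x. (h x)\<^sup>2 \<partial>m) = (\<integral>x. H x * h x - S x * h x \<partial>m)"
      by (intro Bochner_Integration.integral_cong) (auto simp: h_def max_def power2_eq_square algebra_simps)
    ultimately have "(\<integral>x. (h x)\<^sup>2 \<partial>m) \<le> 0" using H S h by (simp add: L2_integrable_mult)
    then have "(\<integral>x. (h x)\<^sup>2 \<partial>m) = 0" by (intro antisym) auto
    then have "AE x in m. (h x)\<^sup>2 = 0"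
      using integral_nonneg_eq_0_iff_AE[OF L2_integrable_sq[OF h]] by simp
    then show ?thesis by eventually_elim (auto simp: h_def max_def split: if_splits)
  qed
  \<comment> \<open>The slopes of the \<open>a n\<close> converge strongly to \<open>H\<close>,
    hence weakly, and \<open>H\<close> lies below \<open>S\<close>: so \<open>S\<close> is a
    competitor in the definition of the minimal slope.\<close>
  have "relaxed_slope m w S"
    unfolding relaxed_slope_def
  proof (intro conjI exI allI ballI)
    show "L2_tendsto m a w" using aw L2_tendsto_iff[OF a2(1) w] by simp
    show "(\<lambda>n. \<integral>x. rlip (a n) x * h x \<partial>m) \<longlonglongrightarrow> (\<integral>x. H x * h x \<partial>m)" if "h \<in> L2 m" for h
      using pw[OF that] by (simp add: a(1))
  qed (use S H a2 p2 a(1) HS in auto)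
  then show ?thesis using G by (simp add: minimal_relaxed_slope_def)
qed

section \<open>Pairings and divergence in the tangent module\<close>

lemma LinfE:
  assumes "a \<in> Linf m"
  obtains c where "0 \<le> c" "AE x in m. \<bar>a x\<bar> \<le> c"
proof -
  obtain c where "AE x in m. \<bar>a x\<bar> \<le> c" using assms by (auto simp: Linf_def)
  then show ?thesis by (intro that[of "max c 0"]) (auto elim: eventually_mono)
qed

lemma Linf_const: "(\<lambda>_. c) \<in> Linf m"
  by (auto simp: Linf_def)

lemma Linf_measurable: "a \<in> Linf m \<Longrightarrow> a \<in> borel_measurable m"
  by (simp add: Linf_def)

lemma L2_Linf_mult:
  assumes "a \<in> Linf m" "f \<in> L2 m"
  shows "(\<lambda>x. a x * f x) \<in> L2 m"
proof -
  obtain c where c: "0 \<le> c" "AE x in m. \<bar>a x\<bar> \<le> c" using assms(1) by (rule LinfE)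
  show ?thesis
  proof (rule L2_bounded[OF L2_cmult[OF assms(2), of c]])
    show "(\<lambda>x. a x * f x) \<in> borel_measurable m"
      using assms by (intro borel_measurable_times L2_measurable Linf_measurable)
    show "AE x in m. \<bar>a x * f x\<bar> \<le> \<bar>c * f x\<bar>"
      using c(2) by eventually_elim (simp add: abs_mult c(1) mult_right_mono)
  qed
qed

lemma integrable_Linf_mult:
  assumes "a \<in> Linf m" "integrable m f"
  shows "integrable m (\<lambda>x. a x * f x)"
proof -
  obtain c where c: "0 \<le> c" "AE x in m. \<bar>a x\<bar> \<le> c" using assms(1) by (rule LinfE)
  show ?thesis
  proof (rule Bochner_Integration.integrable_bound)
    show "integrable m (\<lambda>x. c * f x)" using assms(2) by simp
    show "(\<lambda>x. a x * f x) \<in> borel_measurable m"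
      using assms by (auto dest: Linf_measurable)
    show "AE x in m. norm (a x * f x) \<le> norm (c * f x)"
      using c(2) by eventually_elim (simp add: abs_mult c(1) mult_right_mono)
  qed
qed

lemma Linf_mult: "a \<in> Linf m \<Longrightarrow> b \<in> Linf m \<Longrightarrow> (\<lambda>x. a x * b x) \<in> Linf m"
proof -
  assume ab: "a \<in> Linf m" "b \<in> Linf m"
  obtain c where c: "0 \<le> c" "AE x in m. \<bar>a x\<bar> \<le> c" using ab(1) by (rule LinfE)
  obtain e where e: "0 \<le> e" "AE x in m. \<bar>b x\<bar> \<le> e" using ab(2) by (rule LinfE)
  have "AE x in m. \<bar>a x * b x\<bar> \<le> c * e"
    using c(2) e(2) by eventually_elim (auto simp: abs_mult c intro!: mult_mono)
  then show ?thesis using ab by (auto simp: Linf_def)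
qed

lemma Linf_add: "a \<in> Linf m \<Longrightarrow> b \<in> Linf m \<Longrightarrow> (\<lambda>x. a x + b x) \<in> Linf m"
proof -
  assume ab: "a \<in> Linf m" "b \<in> Linf m"
  obtain c where c: "0 \<le> c" "AE x in m. \<bar>a x\<bar> \<le> c" using ab(1) by (rule LinfE)
  obtain e where e: "0 \<le> e" "AE x in m. \<bar>b x\<bar> \<le> e" using ab(2) by (rule LinfE)
  have "AE x in m. \<bar>a x + b x\<bar> \<le> c + e" using c(2) e(2) by eventually_elim auto
  then show ?thesis using ab by (auto simp: Linf_def)
qed

lemma module_dual_add:
  assumes X: "X \<in> module_dual m T" and Y: "Y \<in> module_dual m T"
  shows "(\<lambda>\<omega> x. X \<omega> x + Y \<omega> x) \<in> module_dual m T"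
proof -
  obtain K K' where K: "\<forall>\<omega>\<in>elems T. (\<integral>x. \<bar>X \<omega> x\<bar> \<partial>m) \<le> K * norm \<omega>" "\<forall>\<omega>\<in>elems T. (\<integral>x. \<bar>Y \<omega> x\<bar> \<partial>m) \<le> K' * norm \<omega>"
    using X Y unfolding module_dual_def by blast
  have i: "integrable m (X \<omega>)" "integrable m (Y \<omega>)" if "\<omega> \<in> elems T" for \<omega>
    using X Y that unfolding module_dual_def by auto
  show ?thesis
    unfolding module_dual_def
  proof (intro CollectI conjI ballI)
    show "AE x in m. X (\<omega> + \<eta>) x + Y (\<omega> + \<eta>) x = X \<omega> x + Y \<omega> x + (X \<eta> x + Y \<eta> x)"
      if "\<omega> \<in> elems T" "\<eta> \<in> elems T" for \<omega> \<eta>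
    proof -
      have "AE x in m. X (\<omega> + \<eta>) x = X \<omega> x + X \<eta> x" "AE x in m. Y (\<omega> + \<eta>) x = Y \<omega> x + Y \<eta> x"
        using X Y that unfolding module_dual_def by auto
      then show ?thesis by eventually_elim simp
    qed
    show "AE x in m. X (fmul T a \<omega>) x + Y (fmul T a \<omega>) x = a x * (X \<omega> x + Y \<omega> x)"
      if "a \<in> Linf m" "\<omega> \<in> elems T" for a \<omega>
    proof -
      have "AE x in m. X (fmul T a \<omega>) x = a x * X \<omega> x" "AE x in m. Y (fmul T a \<omega>) x = a x * Y \<omega> x"
        using X Y that unfolding module_dual_def by auto
      then show ?thesis by eventually_elim (simp add: algebra_simps)
    qed
    show "\<exists>K. \<forall>\<omega>\<in>elems T. (\<integral>x. \<bar>X \<omega> x + Y \<omega> x\<bar> \<partial>m) \<le> K * norm \<omega>"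
    proof (intro exI[of _ "K + K'"] ballI)
      fix \<omega> assume \<omega>: "\<omega> \<in> elems T"
      have "(\<integral>x. \<bar>X \<omega> x + Y \<omega> x\<bar> \<partial>m) \<le> (\<integral>x. \<bar>X \<omega> x\<bar> + \<bar>Y \<omega> x\<bar> \<partial>m)"
        using i[OF \<omega>] by (intro integral_mono) auto
      also have "\<dots> \<le> K * norm \<omega> + K' * norm \<omega>" using i[OF \<omega>] K \<omega> by (simp add: add_mono)
      finally show "(\<integral>x. \<bar>X \<omega> x + Y \<omega> x\<bar> \<partial>m) \<le> (K + K') * norm \<omega>" by (simp add: algebra_simps)
    qed
  qed (use i in auto)
qed

lemma module_dual_fmul:
  assumes b: "b \<in> Linf m" and X: "X \<in> module_dual m T"
  shows "(\<lambda>\<omega> x. b x * X \<omega> x) \<in> module_dual m T"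
proof -
  obtain c where c: "0 \<le> c" "AE x in m. \<bar>b x\<bar> \<le> c" using b by (rule LinfE)
  obtain K where K: "\<forall>\<omega>\<in>elems T. (\<integral>x. \<bar>X \<omega> x\<bar> \<partial>m) \<le> K * norm \<omega>"
    using X unfolding module_dual_def by blast
  have i: "integrable m (X \<omega>)" if "\<omega> \<in> elems T" for \<omega>
    using X that unfolding module_dual_def by auto
  show ?thesis
    unfolding module_dual_def
  proof (intro CollectI conjI ballI)
    show "integrable m (\<lambda>x. b x * X \<omega> x)" if "\<omega> \<in> elems T" for \<omega>
      by (rule integrable_Linf_mult[OF b i[OF that]])
    show "AE x in m. b x * X (\<omega> + \<eta>) x = b x * X \<omega> x + b x * X \<eta> x"
      if "\<omega> \<in> elems T" "\<eta> \<in> elems T" for \<omega> \<eta>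
    proof -
      have "AE x in m. X (\<omega> + \<eta>) x = X \<omega> x + X \<eta> x" using X that unfolding module_dual_def by auto
      then show ?thesis by eventually_elim (simp add: algebra_simps)
    qed
    show "AE x in m. b x * X (fmul T a \<omega>) x = a x * (b x * X \<omega> x)" if "a \<in> Linf m" "\<omega> \<in> elems T" for a \<omega>
    proof -
      have "AE x in m. X (fmul T a \<omega>) x = a x * X \<omega> x" using X that unfolding module_dual_def by auto
      then show ?thesis by eventually_elim simp
    qed
    show "\<exists>K. \<forall>\<omega>\<in>elems T. (\<integral>x. \<bar>b x * X \<omega> x\<bar> \<partial>m) \<le> K * norm \<omega>"
    proof (intro exI[of _ "c * K"] ballI)
      fix \<omega> assume \<omega>: "\<omega> \<in> elems T"
      have "(\<integral>x. \<bar>b x * X \<omega> x\<bar> \<partial>m) \<le> (\<integral>x. c * \<bar>X \<omega> x\<bar> \<partial>m)"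
      proof (rule integral_mono_AE)
        show "integrable m (\<lambda>x. \<bar>b x * X \<omega> x\<bar>)" by (intro integrable_abs integrable_Linf_mult[OF b i[OF \<omega>]])
        show "AE x in m. \<bar>b x * X \<omega> x\<bar> \<le> c * \<bar>X \<omega> x\<bar>"
          using c(2) by eventually_elim (simp add: abs_mult mult_right_mono)
      qed (use i[OF \<omega>] in auto)
      also have "\<dots> \<le> c * (K * norm \<omega>)" using K \<omega> c(1) by (simp add: mult_left_mono)
      finally show "(\<integral>x. \<bar>b x * X \<omega> x\<bar> \<partial>m) \<le> c * K * norm \<omega>" by simp
    qed
  qed
qed

section \<open>Convergence in measure\<close>

lemma L0_tendsto_subseq: "L0_tendsto m u f \<Longrightarrow> strict_mono r \<Longrightarrow> L0_tendsto m (\<lambda>n. u (r n)) f"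
  unfolding L0_tendsto_def using LIMSEQ_subseq_LIMSEQ unfolding comp_def by blast

text \<open>The measure may be infinite, so convergence is known only on sets of finite measure. The
  k-th index is chosen for the ball of radius \<open>k\<close> and the tolerance
  \<open>(1/2)^k\<close> at once; Borel-Cantelli then gives one subsequence for the whole space,
  since each point lies in all but finitely many of the balls.\<close>

lemma (in metric_measure_space) L0_tendsto_AE_subseq:
  assumes u: "\<And>n. u n \<in> borel_measurable m" and f: "f \<in> borel_measurable m" and lim: "L0_tendsto m u f"
  obtains r :: "nat \<Rightarrow> nat" where "strict_mono r" "AE x in m. (\<lambda>n. u (r n) x) \<longlonglongrightarrow> f x"
proof -
  define x0 :: 'a where "x0 = undefined"
  define bad where "bad k n = {x \<in> ball x0 (real k). (1/2)^k < \<bar>u n x - f x\<bar>}" for k n :: nat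
  have ball: "ball x0 r \<in> sets m" for r by (simp add: sets_m)
  have bad: "bad k n \<in> sets m" for k n
  proof -
    have "bad k n = ball x0 (real k) \<inter> {x \<in> space m. (1/2)^k < \<bar>u n x - f x\<bar>}"
      using sets.sets_into_space[OF ball[of "real k"]] by (auto simp: bad_def)
    then show ?thesis using ball u f by simp
  qed
  have badlim: "(\<lambda>n. emeasure m (bad k n)) \<longlonglongrightarrow> 0" for k
    using lim[unfolded L0_tendsto_def, rule_format, OF ball finite_on_balls, of "(1/2)^k"]
    by (simp add: bad_def)
  have ex: "\<exists>n>N. emeasure m (bad k n) < ennreal ((1/2)^k)" for N k
  proof -
    have "\<forall>\<^sub>F n in sequentially. emeasure m (bad k n) < ennreal ((1/2)^k)"
      by (rule order_tendstoD(2)[OF badlim]) simp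
    then have "\<forall>\<^sub>F n in sequentially. emeasure m (bad k n) < ennreal ((1/2)^k) \<and> n > N"
      using eventually_gt_at_top[of N] by eventually_elim simp
    then show ?thesis by (auto simp: eventually_sequentially)
  qed
  have "\<exists>r. \<forall>k::nat. emeasure m (bad k (r k)) < ennreal ((1/2)^k) \<and> r k < r (Suc k)"
  proof (rule dependent_nat_choice)
    show "\<exists>x. emeasure m (bad 0 x) < ennreal ((1/2)^0)" using ex[of 0 0] by blast
    show "\<exists>y. emeasure m (bad (Suc n) y) < ennreal ((1/2)^Suc n) \<and> x < y" for x n using ex[of x "Suc n"] by blast
  qed
  then obtain r where r: "\<And>k. emeasure m (bad k (r k)) < ennreal ((1/2)^k)" "\<And>k. r k < r (Suc k)" by blast
  have sm: "strict_mono r" using r(2) by (simp add: strict_mono_Suc_iff)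
  have fin: "emeasure m (bad k (r k)) < \<infinity>" for k using r(1)[of k] by (rule order_less_trans) simp
  have "AE x in m. \<forall>\<^sub>F k in sequentially. x \<in> space m - bad k (r k)"
  proof (rule borel_cantelli_AE1[OF bad fin])
    show "summable (\<lambda>k. measure m (bad k (r k)))"
    proof (rule summable_comparison_test')
      show "summable (\<lambda>k. (1/2)^k :: real)" by (simp add: summable_geometric)
      show "norm (measure m (bad k (r k))) \<le> (1/2)^k" if "k \<ge> 0" for k
        using less_imp_le[OF r(1)[of k]] by (simp add: measure_def enn2real_leI)
    qed
  qed
  then have "AE x in m. (\<lambda>n. u (r n) x) \<longlonglongrightarrow> f x"
  proof eventually_elim
    case (elim x)
    obtain K where K: "dist x0 x < real K" using reals_Archimedean2 by blast
    have "\<forall>\<^sub>F k in sequentially. norm (u (r k) x - f x) \<le> (1/2)^k"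
      using elim eventually_ge_at_top[of K]
    proof eventually_elim
      case (elim k)
      then have "dist x0 x < real k" using K by linarith
      then show ?case using elim by (auto simp: bad_def)
    qed
    then have "(\<lambda>k. u (r k) x - f x) \<longlonglongrightarrow> 0"
      by (rule Lim_null_comparison) (rule LIMSEQ_realpow_zero, auto)
    then show ?case by (rule LIM_zero_cancel)
  qed
  with sm show ?thesis by (rule that)
qed

section \<open>Pairings of forms with vector fields\<close>

locale tangent_calculus = tangent_setting m T L \<iota> + cot: cotangent_module m T d
  for m :: "'a::polish_space measure" and T :: "('a, 'c::real_normed_vector) pn_module"
    and d :: "('a \<Rightarrow> real) \<Rightarrow> 'c" and L :: "('a, 'v::real_vector) pn_module" and \<iota>
begin

lemma elems_diff: "v \<in> elems L \<Longrightarrow> w \<in> elems L \<Longrightarrow> v - w \<in> elems L"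
  using subspace_elems by (rule subspace_diff)

lemma pnorm_diff_le:
  assumes "u \<in> elems L" "v \<in> elems L" "w \<in> elems L"
  shows "AE x in m. pnorm L (u - v) x \<le> pnorm L (u - w) x + pnorm L (v - w) x"
proof -
  have e: "u - w \<in> elems L" "w - v \<in> elems L" "v - w \<in> elems L" using assms by (auto intro: elems_diff)
  have "AE x in m. pnorm L ((u - w) + (w - v)) x \<le> pnorm L (u - w) x + pnorm L (w - v) x"
    by (rule pnorm_triangle[OF e(1,2)])
  moreover have "AE x in m. pnorm L (fmul L (\<lambda>_. - 1) (v - w)) x = \<bar>- 1\<bar> * pnorm L (v - w) x"
    by (rule pnorm_fmul[OF _ e(3)]) simp
  ultimately show ?thesis by eventually_elim (simp add: fmul_const[OF e(3)])
qed

lemma pnorm_le_diff: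
  assumes "u \<in> elems L" "v \<in> elems L"
  shows "AE x in m. pnorm L u x \<le> pnorm L (u - v) x + pnorm L v x"
  using pnorm_triangle[OF elems_diff[OF assms] assms(2)] by simp

lemma module_dual_diff:
  assumes "X \<in> module_dual m T" "Y \<in> module_dual m T"
  shows "(\<lambda>\<omega> x. X \<omega> x - Y \<omega> x) \<in> module_dual m T" "\<iota> (\<lambda>\<omega> x. X \<omega> x - Y \<omega> x) = \<iota> X - \<iota> Y"
proof -
  have Y: "(\<lambda>\<omega> x. - 1 * Y \<omega> x) \<in> module_dual m T" by (rule module_dual_fmul[OF Linf_const assms(2)])
  show "(\<lambda>\<omega> x. X \<omega> x - Y \<omega> x) \<in> module_dual m T" using module_dual_add[OF assms(1) Y] by simp
  have "\<iota> (\<lambda>\<omega> x. X \<omega> x + - 1 * Y \<omega> x) = \<iota> X + fmul L (\<lambda>_. - 1) (\<iota> Y)"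
    using iota_add[OF assms(1) Y] iota_fmul[OF Linf_const assms(2), of "- 1"] by simp
  then show "\<iota> (\<lambda>\<omega> x. X \<omega> x - Y \<omega> x) = \<iota> X - \<iota> Y" by (simp add: fmul_const[OF iota_elems[OF assms(2)]])
qed

lemma module_dual_measurable: "X \<in> module_dual m T \<Longrightarrow> \<omega> \<in> elems T \<Longrightarrow> X \<omega> \<in> borel_measurable m"
  unfolding module_dual_def by auto

lemma module_dual_AE:
  assumes "X \<in> module_dual m T"
  shows "\<omega> \<in> elems T \<Longrightarrow> \<eta> \<in> elems T \<Longrightarrow> AE x in m. X (\<omega> + \<eta>) x = X \<omega> x + X \<eta> x"
    and "a \<in> Linf m \<Longrightarrow> \<omega> \<in> elems T \<Longrightarrow> AE x in m. X (fmul T a \<omega>) x = a x * X \<omega> x"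
  using assms unfolding module_dual_def by auto

lemma module_dual_comb:
  assumes X: "X \<in> module_dual m T" and e: "\<omega> \<in> elems T" "\<eta> \<in> elems T"
  shows "AE x in m. X (a *\<^sub>R \<omega> + b *\<^sub>R \<eta>) x = a * X \<omega> x + b * X \<eta> x"
proof -
  have s: "a *\<^sub>R \<omega> \<in> elems T" "b *\<^sub>R \<eta> \<in> elems T" using e cot.subspace_elems by (auto intro: subspace_scale)
  have "AE x in m. X (a *\<^sub>R \<omega>) x = a * X \<omega> x" "AE x in m. X (b *\<^sub>R \<eta>) x = b * X \<eta> x"
    using module_dual_AE(2)[OF X Linf_const e(1), of a] module_dual_AE(2)[OF X Linf_const e(2), of b]
    by (simp_all add: cot.fmul_const e)
  with module_dual_AE(1)[OF X s] show ?thesis by eventually_elim simp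
qed

text \<open>The dual pointwise norm controls only forms of pointwise norm at most 1. A general form
  is localised to the set where its norm is at most \<open>c\<close> and divided by
  \<open>c\<close>; letting \<open>c\<close> decrease to the norm at each point gives the
  inequality. Rational \<open>c\<close> keep the exceptional set null.\<close>

lemma module_dual_bound:
  assumes X: "X \<in> module_dual m T" and \<omega>: "\<omega> \<in> elems T"
  shows "AE x in m. \<bar>X \<omega> x\<bar> \<le> pnorm L (\<iota> X) x * pnorm T \<omega> x"
proof -
  let ?h = "pnorm L (\<iota> X)" and ?p = "pnorm T \<omega>"
  have [measurable]: "?p \<in> borel_measurable m" by (rule cot.pnorm_measurable[OF \<omega>])
  have ub: "AE x in m. \<bar>X \<eta> x\<bar> \<le> ?h x" if "\<eta> \<in> elems T" "AE x in m. pnorm T \<eta> x \<le> 1" for \<eta>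
    using pnorm_iota[OF X] that unfolding is_dual_pnorm_def Let_def by blast
  have scaled: "AE x in m. ?p x \<le> c \<longrightarrow> \<bar>X \<omega> x\<bar> \<le> c * ?h x" if c: "0 < c" for c :: real
  proof -
    define a where "a x = (if ?p x \<le> c then 1 / c else 0)" for x
    have a: "a \<in> Linf m" unfolding Linf_def a_def using c by (auto intro!: exI[of _ "1 / c"])
    have "AE x in m. pnorm T (fmul T a \<omega>) x \<le> 1"
      using cot.pnorm_fmul[OF a \<omega>] cot.pnorm_nonneg[OF \<omega>] by eventually_elim (use c in \<open>auto simp: a_def\<close>)
    from ub[OF cot.fmul_closed[OF a \<omega>] this] module_dual_AE(2)[OF X a \<omega>]
    show ?thesis by eventually_elim (use c in \<open>auto simp: a_def abs_mult field_simps\<close>)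
  qed
  have "AE x in m. \<forall>c\<in>{c\<in>\<rat>. 0 < c}. ?p x \<le> c \<longrightarrow> \<bar>X \<omega> x\<bar> \<le> c * ?h x"
  proof (rule AE_ball_countable[THEN iffD2])
    show "countable {c\<in>\<rat>. 0 < (c::real)}" by (rule countable_subset[OF _ countable_rat]) auto
  qed (use scaled in auto)
  with cot.pnorm_nonneg[OF \<omega>] pnorm_nonneg[OF iota_elems[OF X]] show ?thesis
  proof eventually_elim
    case (elim x)
    show ?case
    proof (rule ccontr)
      assume neg: "\<not> \<bar>X \<omega> x\<bar> \<le> ?h x * ?p x"
      show False
      \<comment> \<open>A rational number between the norm of the form and a quotient by
        \<open>?h x\<close> is needed, so a vanishing \<open>?h x\<close> is treated apart.\<close>
      proof (cases "?h x = 0")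
        case True
        obtain c where "c \<in> \<rat>" "?p x < c" using Rats_dense_in_real[of "?p x" "?p x + 1"] by auto
        then have "\<bar>X \<omega> x\<bar> \<le> c * ?h x" using elim(1) by (intro elim(3)[rule_format]) auto
        then show False using neg True by simp
      next
        case False
        then have h: "0 < ?h x" using elim(2) by simp
        have "?p x < \<bar>X \<omega> x\<bar> / ?h x" using neg h by (simp add: field_simps)
        then obtain c where c: "c \<in> \<rat>" "?p x < c" "c < \<bar>X \<omega> x\<bar> / ?h x" using Rats_dense_in_real by blast
        then have "\<bar>X \<omega> x\<bar> \<le> c * ?h x" using elim(1) by (intro elim(3)[rule_format]) auto
        then show False using c(3) h by (simp add: field_simps)
      qed
    qed
  qed
qed

text \<open>A pairing refers to some approximating sequence \<open>Y\<close>. Any other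
  approximation \<open>X\<close> of the same \<open>v\<close> has the same limit, because the
  difference of the values at \<omega> is at most the sum of both pointwise distances to
  \<open>v\<close> times the pointwise norm of \<omega>.\<close>

lemma pairing_AE_subseq:
  assumes pair: "is_pairing m T L \<iota> \<omega> v h" and \<omega>: "\<omega> \<in> elems T" and v: "v \<in> elems L"
    and X: "\<And>n. X n \<in> module_dual m T" and Xv: "L0_tendsto m (\<lambda>n. pnorm L (\<iota> (X n) - v)) (\<lambda>_. 0)"
  obtains r :: "nat \<Rightarrow> nat" where "strict_mono r" "AE x in m. (\<lambda>n. X (r n) \<omega> x) \<longlonglongrightarrow> h x"
    "AE x in m. (\<lambda>n. pnorm L (\<iota> (X (r n)) - v) x) \<longlonglongrightarrow> 0"
proof -
  obtain Y where h: "h \<in> borel_measurable m" and Y: "\<And>n. Y n \<in> module_dual m T"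
    and Yv: "L0_tendsto m (\<lambda>n. pnorm L (\<iota> (Y n) - v)) (\<lambda>_. 0)" and Yh: "L0_tendsto m (\<lambda>n. Y n \<omega>) h"
    using pair unfolding is_pairing_def by blast
  have mp: "pnorm L (\<iota> (Z n) - v) \<in> borel_measurable m" if "\<And>n. Z n \<in> module_dual m T" for Z and n :: nat
    using that v by (intro pnorm_measurable elems_diff iota_elems)
  \<comment> \<open>Three successive subsequences turn the three convergences in measure into
    convergence almost everywhere along one common subsequence.\<close>
  obtain r1 where r1: "strict_mono r1" "AE x in m. (\<lambda>n. pnorm L (\<iota> (X (r1 n)) - v) x) \<longlonglongrightarrow> 0"
    by (rule L0_tendsto_AE_subseq[OF mp[of X, OF X] _ Xv]) auto
  obtain r2 where r2: "strict_mono r2" "AE x in m. (\<lambda>n. pnorm L (\<iota> (Y (r1 (r2 n))) - v) x) \<longlonglongrightarrow> 0"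
    by (rule L0_tendsto_AE_subseq[OF _ _ L0_tendsto_subseq[OF Yv r1(1)]]) (use mp[of Y, OF Y] in auto)
  have sm: "strict_mono (\<lambda>n. r1 (r2 n))" using r1(1) r2(1) by (simp add: strict_mono_def)
  obtain r3 where r3: "strict_mono r3" "AE x in m. (\<lambda>n. Y (r1 (r2 (r3 n))) \<omega> x) \<longlonglongrightarrow> h x"
    by (rule L0_tendsto_AE_subseq[OF _ h L0_tendsto_subseq[OF Yh sm]]) (use module_dual_measurable[OF Y \<omega>] in auto)
  define r where "r n = r1 (r2 (r3 n))" for n
  have smr: "strict_mono r" using r1(1) r2(1) r3(1) by (simp add: strict_mono_def r_def)
  have bound: "AE x in m. \<forall>n. \<bar>X (r n) \<omega> x - Y (r n) \<omega> x\<bar> \<le>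
      (pnorm L (\<iota> (X (r n)) - v) x + pnorm L (\<iota> (Y (r n)) - v) x) * pnorm T \<omega> x"
    unfolding AE_all_countable
  proof
    fix n
    have "AE x in m. \<bar>X (r n) \<omega> x - Y (r n) \<omega> x\<bar> \<le> pnorm L (\<iota> (X (r n)) - \<iota> (Y (r n))) x * pnorm T \<omega> x"
      using module_dual_bound[OF module_dual_diff(1)[OF X Y] \<omega>, of "r n" "r n"] module_dual_diff(2)[OF X Y] by simp
    then show "AE x in m. \<bar>X (r n) \<omega> x - Y (r n) \<omega> x\<bar> \<le>
        (pnorm L (\<iota> (X (r n)) - v) x + pnorm L (\<iota> (Y (r n)) - v) x) * pnorm T \<omega> x"
      using pnorm_diff_le[OF iota_elems[OF X] iota_elems[OF Y] v, of "r n" "r n"] cot.pnorm_nonneg[OF \<omega>]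
      by eventually_elim (meson mult_right_mono order_trans)
  qed
  have conv: "AE x in m. (\<lambda>n. pnorm L (\<iota> (X (r n)) - v) x) \<longlonglongrightarrow> 0"
    using r1(2) by eventually_elim
      (use LIMSEQ_subseq_LIMSEQ[of _ _ "\<lambda>n. r2 (r3 n)"] r2(1) r3(1) in \<open>auto simp: r_def comp_def strict_mono_def\<close>)
  have conv': "AE x in m. (\<lambda>n. pnorm L (\<iota> (Y (r n)) - v) x) \<longlonglongrightarrow> 0"
    using r2(2) by eventually_elim (use LIMSEQ_subseq_LIMSEQ[of _ _ r3] r3(1) in \<open>auto simp: r_def comp_def\<close>)
  have "AE x in m. (\<lambda>n. X (r n) \<omega> x) \<longlonglongrightarrow> h x"
    using bound conv conv' r3(2)
  proof eventually_elim
    case (elim x)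
    have "(\<lambda>n. (pnorm L (\<iota> (X (r n)) - v) x + pnorm L (\<iota> (Y (r n)) - v) x) * pnorm T \<omega> x) \<longlonglongrightarrow> (0 + 0) * pnorm T \<omega> x"
      by (intro tendsto_intros elim)
    then have lim: "(\<lambda>n. (pnorm L (\<iota> (X (r n)) - v) x + pnorm L (\<iota> (Y (r n)) - v) x) * pnorm T \<omega> x) \<longlonglongrightarrow> 0" by simp
    have "(\<lambda>n. X (r n) \<omega> x - Y (r n) \<omega> x) \<longlonglongrightarrow> 0"
      by (rule Lim_null_comparison[OF always_eventually lim]) (use elim(1) in simp)
    moreover have "(\<lambda>n. Y (r n) \<omega> x) \<longlonglongrightarrow> h x" using elim(4) by (simp add: r_def)
    ultimately have "(\<lambda>n. (X (r n) \<omega> x - Y (r n) \<omega> x) + Y (r n) \<omega> x) \<longlonglongrightarrow> 0 + h x" by (rule tendsto_add)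
    then show ?case by simp
  qed
  with smr show ?thesis using conv by (rule that)
qed

lemma pairing_bound:
  assumes pair: "is_pairing m T L \<iota> \<omega> v h" and \<omega>: "\<omega> \<in> elems T" and v: "v \<in> elems L"
  shows "AE x in m. \<bar>h x\<bar> \<le> pnorm L v x * pnorm T \<omega> x"
proof -
  obtain X where X: "\<And>n. X n \<in> module_dual m T"
    and Xv: "L0_tendsto m (\<lambda>n. pnorm L (\<iota> (X n) - v)) (\<lambda>_. 0)"
    using pair unfolding is_pairing_def by blast
  obtain r where r: "AE x in m. (\<lambda>n. X (r n) \<omega> x) \<longlonglongrightarrow> h x" "AE x in m. (\<lambda>n. pnorm L (\<iota> (X (r n)) - v) x) \<longlonglongrightarrow> 0"
    using pairing_AE_subseq[OF pair \<omega> v X Xv] by blast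
  have "AE x in m. \<forall>n. \<bar>X (r n) \<omega> x\<bar> \<le> (pnorm L (\<iota> (X (r n)) - v) x + pnorm L v x) * pnorm T \<omega> x"
    unfolding AE_all_countable
  proof
    fix n
    show "AE x in m. \<bar>X (r n) \<omega> x\<bar> \<le> (pnorm L (\<iota> (X (r n)) - v) x + pnorm L v x) * pnorm T \<omega> x"
      using module_dual_bound[OF X \<omega>, of "r n"] pnorm_le_diff[OF iota_elems[OF X] v, of "r n"] cot.pnorm_nonneg[OF \<omega>]
      by eventually_elim (meson mult_right_mono order_trans)
  qed
  with r show ?thesis
  proof eventually_elim
    case (elim x)
    have "(\<lambda>n. (pnorm L (\<iota> (X (r n)) - v) x + pnorm L v x) * pnorm T \<omega> x) \<longlonglongrightarrow> (0 + pnorm L v x) * pnorm T \<omega> x"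
      by (intro tendsto_intros elim)
    then show ?case
      using LIMSEQ_le[OF tendsto_rabs[OF elim(1)]] elim(3) by auto
  qed
qed

text \<open>One approximating sequence of \<open>v\<close> is used for all three forms, so a
  relation that holds for every element of the module dual survives in the limit. The coefficients
  are functions, as the Leibniz rule requires.\<close>

lemma pairing_linear:
  assumes p1: "is_pairing m T L \<iota> \<omega>1 v h1" and p2: "is_pairing m T L \<iota> \<omega>2 v h2"
    and p3: "is_pairing m T L \<iota> \<omega>3 v h3"
    and e: "\<omega>1 \<in> elems T" "\<omega>2 \<in> elems T" "\<omega>3 \<in> elems T" and v: "v \<in> elems L"
    and lin: "\<And>X. X \<in> module_dual m T \<Longrightarrow> AE x in m. X \<omega>3 x = \<alpha> x * X \<omega>1 x + \<beta> x * X \<omega>2 x"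
  shows "AE x in m. h3 x = \<alpha> x * h1 x + \<beta> x * h2 x"
proof -
  obtain X where X: "\<And>n. X n \<in> module_dual m T"
    and Xv: "L0_tendsto m (\<lambda>n. pnorm L (\<iota> (X n) - v)) (\<lambda>_. 0)"
    using p1 unfolding is_pairing_def by blast
  obtain r1 where r1: "strict_mono r1" "AE x in m. (\<lambda>n. X (r1 n) \<omega>1 x) \<longlonglongrightarrow> h1 x"
    using pairing_AE_subseq[OF p1 e(1) v X Xv] by blast
  obtain r2 where r2: "strict_mono r2" "AE x in m. (\<lambda>n. X (r1 (r2 n)) \<omega>2 x) \<longlonglongrightarrow> h2 x"
    using pairing_AE_subseq[OF p2 e(2) v, of "\<lambda>n. X (r1 n)"] X L0_tendsto_subseq[OF Xv r1(1)] by blast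
  have sm: "strict_mono (\<lambda>n. r1 (r2 n))" using r1(1) r2(1) by (simp add: strict_mono_def)
  obtain r3 where r3: "strict_mono r3" "AE x in m. (\<lambda>n. X (r1 (r2 (r3 n))) \<omega>3 x) \<longlonglongrightarrow> h3 x"
    using pairing_AE_subseq[OF p3 e(3) v, of "\<lambda>n. X (r1 (r2 n))"] X L0_tendsto_subseq[OF Xv sm] by blast
  have "AE x in m. \<forall>n. X n \<omega>3 x = \<alpha> x * X n \<omega>1 x + \<beta> x * X n \<omega>2 x"
    unfolding AE_all_countable using lin X by blast
  with r1(2) r2(2) r3(2) show ?thesis
  proof eventually_elim
    case (elim x)
    have 1: "(\<lambda>n. X (r1 (r2 (r3 n))) \<omega>1 x) \<longlonglongrightarrow> h1 x"
      using LIMSEQ_subseq_LIMSEQ[OF elim(1), of "\<lambda>n. r2 (r3 n)"] r2(1) r3(1) by (simp add: comp_def strict_mono_def)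
    have 2: "(\<lambda>n. X (r1 (r2 (r3 n))) \<omega>2 x) \<longlonglongrightarrow> h2 x"
      using LIMSEQ_subseq_LIMSEQ[OF elim(2), of r3] r3(1) by (simp add: comp_def)
    have "(\<lambda>n. \<alpha> x * X (r1 (r2 (r3 n))) \<omega>1 x + \<beta> x * X (r1 (r2 (r3 n))) \<omega>2 x) \<longlonglongrightarrow> \<alpha> x * h1 x + \<beta> x * h2 x"
      by (intro tendsto_intros 1 2)
    then show ?case using elim(3,4) LIMSEQ_unique by force
  qed
qed

lemma pairing_fmul:
  assumes pair: "is_pairing m T L \<iota> \<omega> v h" and \<omega>: "\<omega> \<in> elems T" and v: "v \<in> elems L"
    and a: "a \<in> borel_measurable m" and c: "\<And>x. \<bar>a x\<bar> \<le> c"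
  shows "is_pairing m T L \<iota> \<omega> (fmul L a v) (\<lambda>x. a x * h x)"
proof -
  obtain X where h: "h \<in> borel_measurable m" and X: "\<And>n. X n \<in> module_dual m T"
    and Xv: "L0_tendsto m (\<lambda>n. pnorm L (\<iota> (X n) - v)) (\<lambda>_. 0)" and Xh: "L0_tendsto m (\<lambda>n. X n \<omega>) h"
    using pair unfolding is_pairing_def by blast
  have aL: "a \<in> Linf m" using a c by (auto simp: Linf_def)
  have c0: "0 \<le> c" using c order_trans abs_ge_zero by blast
  have scale: "L0_tendsto m u f" if uf: "L0_tendsto m u' f'" "\<And>n. AE x in m. \<bar>u n x - f x\<bar> \<le> c * \<bar>u' n x - f' x\<bar>"
    and meas: "\<And>n. u n \<in> borel_measurable m" "f \<in> borel_measurable m" "\<And>n. u' n \<in> borel_measurable m" "f' \<in> borel_measurable m"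
    for u f u' f'
    unfolding L0_tendsto_def
  proof (intro ballI impI allI)
    fix E and e :: real assume E: "E \<in> sets m" "emeasure m E < \<infinity>" and e: "0 < e"
    define e' where "e' = e / (c + 1)"
    have e': "0 < e'" "c * e' \<le> e" using e c0 by (auto simp: e'_def field_simps)
    have sub: "{x \<in> E. P x} = E \<inter> {x \<in> space m. P x}" for P using sets.sets_into_space[OF E(1)] by auto
    have lim: "(\<lambda>n. emeasure m {x \<in> E. e' < \<bar>u' n x - f' x\<bar>}) \<longlonglongrightarrow> 0"
      using uf(1) E e'(1) unfolding L0_tendsto_def by blast
    show "(\<lambda>n. emeasure m {x \<in> E. e < \<bar>u n x - f x\<bar>}) \<longlonglongrightarrow> 0"
    proof (rule tendsto_sandwich[OF _ _ tendsto_const lim])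
      show "\<forall>\<^sub>F n in sequentially. emeasure m {x \<in> E. e < \<bar>u n x - f x\<bar>} \<le> emeasure m {x \<in> E. e' < \<bar>u' n x - f' x\<bar>}"
      proof (rule always_eventually, rule allI, rule emeasure_mono_AE)
        fix n
        show "AE x in m. x \<in> {x \<in> E. e < \<bar>u n x - f x\<bar>} \<longrightarrow> x \<in> {x \<in> E. e' < \<bar>u' n x - f' x\<bar>}"
          using uf(2)[of n]
        proof eventually_elim
          case (elim x)
          show ?case
          proof (safe, rule ccontr)
            assume "e < \<bar>u n x - f x\<bar>" "\<not> e' < \<bar>u' n x - f' x\<bar>"
            then have "c * \<bar>u' n x - f' x\<bar> \<le> c * e'" using c0 by (intro mult_left_mono) auto
            then show False using elim e'(2) \<open>e < \<bar>u n x - f x\<bar>\<close> by linarith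
          qed
        qed
        show "{x \<in> E. e' < \<bar>u' n x - f' x\<bar>} \<in> sets m" unfolding sub using E(1) meas by measurable
      qed
    qed simp
  qed
  show ?thesis
    unfolding is_pairing_def
  proof (intro conjI exI[of _ "\<lambda>n \<omega> x. a x * X n \<omega> x"] allI)
    show "(\<lambda>x. a x * h x) \<in> borel_measurable m" using a h by measurable
    show aX: "(\<lambda>\<omega> x. a x * X n \<omega> x) \<in> module_dual m T" for n by (rule module_dual_fmul[OF aL X])
    have iX: "\<iota> (X n) \<in> elems L" for n by (rule iota_elems[OF X])
    have diff: "\<iota> (\<lambda>\<omega> x. a x * X n \<omega> x) - fmul L a v = fmul L a (\<iota> (X n) - v)" for n
    proof -
      have "fmul L a (\<iota> (X n) - v + v) = fmul L a (\<iota> (X n) - v) + fmul L a v"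
        by (rule fmul_add_right[OF a elems_diff[OF iX v] v])
      then show ?thesis by (simp add: iota_fmul[OF aL X])
    qed
    show "L0_tendsto m (\<lambda>n. pnorm L (\<iota> (\<lambda>\<omega> x. a x * X n \<omega> x) - fmul L a v)) (\<lambda>_. 0)"
      unfolding diff
    proof (rule scale[OF Xv])
      fix n
      show "AE x in m. \<bar>pnorm L (fmul L a (\<iota> (X n) - v)) x - 0\<bar> \<le> c * \<bar>pnorm L (\<iota> (X n) - v) x - 0\<bar>"
        using pnorm_fmul[OF a elems_diff[OF iX v], of n]
        by eventually_elim (simp add: abs_mult mult_right_mono c)
    qed (use a iX v in \<open>auto intro!: pnorm_measurable fmul_closed elems_diff\<close>)
  next
    show "L0_tendsto m (\<lambda>n x. a x * X n \<omega> x) (\<lambda>x. a x * h x)"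
    proof (rule scale[OF Xh])
      show "AE x in m. \<bar>a x * X n \<omega> x - a x * h x\<bar> \<le> c * \<bar>X n \<omega> x - h x\<bar>" for n
        using c by (intro AE_I2) (simp add: abs_mult mult_right_mono flip: right_diff_distrib)
    qed (use a h module_dual_measurable[OF X \<omega>] in auto)
  qed
qed

end

text \<open>These functions are Sobolev, since balls have finite measure, and have bounded support:
  they are admissible both as tests for the divergence and as multipliers of vector fields.\<close>

definition LIPbs :: "('a::metric_space \<Rightarrow> real) set" where
  "LIPbs = {\<phi> \<in> LIPb. bounded {x. \<phi> x \<noteq> 0}}"

lemma LIPbs_LIPb: "\<phi> \<in> LIPbs \<Longrightarrow> \<phi> \<in> LIPb"
  by (simp add: LIPbs_def)

lemma LIPbs_mult: "\<phi> \<in> LIPb \<Longrightarrow> \<psi> \<in> LIPbs \<Longrightarrow> (\<lambda>x. \<phi> x * \<psi> x) \<in> LIPbs"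
  unfolding LIPbs_def by (auto intro: LIPb_mult elim: bounded_subset)

lemma LIPbs_add: "\<phi> \<in> LIPbs \<Longrightarrow> \<psi> \<in> LIPbs \<Longrightarrow> (\<lambda>x. \<phi> x + \<psi> x) \<in> LIPbs"
proof -
  assume *: "\<phi> \<in> LIPbs" "\<psi> \<in> LIPbs"
  have "bounded ({x. \<phi> x \<noteq> 0} \<union> {x. \<psi> x \<noteq> 0})" using * by (simp add: LIPbs_def)
  then have "bounded {x. \<phi> x + \<psi> x \<noteq> 0}" by (rule bounded_subset) auto
  then show ?thesis using * LIPb_add[of \<phi> \<psi>] by (simp add: LIPbs_def)
qed

lemma rlip_eq_0_outside:
  assumes "x \<notin> closure {x. \<phi> x \<noteq> 0}"
  shows "lip \<phi> x = 0"
proof (rule lip_eq_0_near[of "- closure {x. \<phi> x \<noteq> 0}"])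
  have z: "\<phi> y = 0" if "y \<notin> closure {x. \<phi> x \<noteq> 0}" for y
    using that closure_subset[of "{x. \<phi> x \<noteq> 0}"] by auto
  show "\<phi> y = \<phi> x" if "y \<in> - closure {x. \<phi> x \<noteq> 0}" for y
    using z[of y] z[OF assms] that by simp
qed (use assms in auto)

lemma LIPb_rlip_bounded:
  assumes "\<phi> \<in> LIPb"
  obtains K where "0 \<le> K" "\<And>x. rlip \<phi> x \<le> K"
proof -
  obtain L where L: "0 \<le> L" "\<And>x y. \<bar>\<phi> x - \<phi> y\<bar> \<le> L * dist x y" using assms by (elim LIPbE) blast
  show ?thesis
  proof (rule that[OF L(1)])
    show "rlip \<phi> x \<le> L" for x by (rule rlip_le[OF lip_le_lipschitz[OF L(2,1)] L(1)])
  qed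
qed

lemma L2_tendsto_subseq: "L2_tendsto m u f \<Longrightarrow> strict_mono r \<Longrightarrow> L2_tendsto m (\<lambda>n. u (r n)) f"
  unfolding L2_tendsto_def using LIMSEQ_subseq_LIMSEQ unfolding comp_def by blast

text \<open>Turns the finiteness of a relaxed energy or variation into one sequence with a bound
  valid for every index.\<close>

lemma liminf_finite_subseq:
  fixes a :: "nat \<Rightarrow> ennreal"
  assumes "liminf a < \<infinity>"
  obtains r :: "nat \<Rightarrow> nat" and C where "strict_mono r" "0 \<le> C" "\<And>n. a (r n) \<le> ennreal C"
proof -
  obtain r :: "nat \<Rightarrow> nat" where r: "strict_mono r" "(a \<circ> r) \<longlonglongrightarrow> liminf a"
    using liminf_subseq_lim[of a] by blast
  define C where "C = enn2real (liminf a) + 1"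
  have "liminf a < ennreal C"
  proof -
    have "liminf a = ennreal (enn2real (liminf a))" using assms by simp
    also have "\<dots> < ennreal C" unfolding C_def by (intro ennreal_lessI) (auto simp: add_nonneg_pos)
    finally show ?thesis .
  qed
  then have "\<forall>\<^sub>F n in sequentially. (a \<circ> r) n < ennreal C" by (rule order_tendstoD(2)[OF r(2)])
  then obtain N where N: "\<And>n. n \<ge> N \<Longrightarrow> a (r n) < ennreal C" by (auto simp: eventually_sequentially)
  show ?thesis
  proof (rule that[of "\<lambda>n. r (n + N)" C])
    show "strict_mono (\<lambda>n. r (n + N))" using r(1) by (simp add: strict_mono_def)
    show "a (r (n + N)) \<le> ennreal C" for n using N[of "n + N"] by (simp add: less_imp_le)
  qed (simp add: C_def)
qed

section \<open>Sobolev functions: sums and Lipschitz multiples\<close>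

context metric_measure_space
begin

lemma LIPb_measurable: "\<phi> \<in> LIPb \<Longrightarrow> \<phi> \<in> borel_measurable m"
  by (intro bcontfun_measurable LIPb_bcontfun)

lemma lip_measurable: "continuous_on UNIV u \<Longrightarrow> lip u \<in> borel_measurable m"
  using borel_measurable_lip measurable_cong_sets[OF sets_m refl] by blast

lemma indicator_ball_L2: "indicator (ball x r) \<in> L2 m"
proof -
  have [measurable]: "ball x r \<in> sets m" by (simp add: sets_m)
  have "(\<lambda>y. (indicator (ball x r) y :: real)\<^sup>2) = indicator (ball x r)" by (auto simp: indicator_def)
  moreover have "integrable m (indicator (ball x r) :: _ \<Rightarrow> real)"
    using finite_on_balls[of x r] by (intro integrable_real_indicator) auto
  ultimately show ?thesis by (simp add: L2_def)
qed

lemma bounded_support_L2: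
  assumes "f \<in> borel_measurable m" "AE x in m. \<bar>f x\<bar> \<le> c" "bounded B" "\<And>x. x \<notin> B \<Longrightarrow> f x = 0"
  shows "f \<in> L2 m"
proof -
  obtain x r where B: "B \<subseteq> ball x r" using bounded_subset_ballD[OF assms(3)] by blast
  show ?thesis
  proof (rule L2_bounded[OF L2_cmult[OF indicator_ball_L2[of x r], of c] assms(1)])
    show "AE y in m. \<bar>f y\<bar> \<le> \<bar>c * indicator (ball x r) y\<bar>"
      using assms(2) by eventually_elim (use B assms(4) in \<open>auto simp: indicator_def subset_eq\<close>)
  qed
qed

lemma LIPbs_L2: "\<phi> \<in> LIPbs \<Longrightarrow> \<phi> \<in> L2 m"
proof -
  assume \<phi>: "\<phi> \<in> LIPbs"
  obtain C where "\<And>x. \<bar>\<phi> x\<bar> \<le> C" using LIPbs_LIPb[OF \<phi>] by (elim LIPbE) blast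
  then show ?thesis
    using \<phi> by (intro bounded_support_L2[of \<phi> C "{x. \<phi> x \<noteq> 0}"] LIPb_measurable LIPbs_LIPb) (auto simp: LIPbs_def)
qed

lemma LIPbs_rlip_L2:
  assumes \<phi>: "\<phi> \<in> LIPbs"
  shows "rlip \<phi> \<in> L2 m"
proof -
  obtain K where "\<And>x. rlip \<phi> x \<le> K" using LIPb_rlip_bounded[OF LIPbs_LIPb[OF \<phi>]] by blast
  then show ?thesis
    using \<phi>
    by (intro bounded_support_L2[of "rlip \<phi>" K "closure {x. \<phi> x \<noteq> 0}"] rlip_measurable sets_m LIPbs_LIPb)
      (auto simp: LIPbs_def rlip_eq_0_outside)
qed

lemma half_mult_finite_iff: "ennreal (1 / 2) * I < \<infinity> \<longleftrightarrow> I < \<infinity>"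
  unfolding infinity_ennreal_def ennreal_mult_less_top
  by (simp only: ennreal_less_top ennreal_eq_0_iff) auto

lemma W12E:
  assumes "w \<in> W12 m"
  obtains u :: "nat \<Rightarrow> 'a \<Rightarrow> real" and C where "\<And>k. u k \<in> LIPb \<inter> L2 m" "L2_tendsto m u w" "0 \<le> C"
    "\<And>k. (\<integral>\<^sup>+x. (lip (u k) x)\<^sup>2 \<partial>m) \<le> ennreal C"
proof -
  let ?S = "{liminf (\<lambda>k. \<integral>\<^sup>+x. (lip (u k) x)\<^sup>2 \<partial>m) | u. (\<forall>k. u k \<in> LIPb \<inter> L2 m) \<and> L2_tendsto m u w}"
  have "Inf ?S < \<infinity>"
    using assms unfolding W12_def Cheeger_def mem_Collect_eq half_mult_finite_iff by (rule conjunct2)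
  then obtain u where u: "\<And>k. u k \<in> LIPb \<inter> L2 m" "L2_tendsto m u w"
    and fin: "liminf (\<lambda>k. \<integral>\<^sup>+x. (lip (u k) x)\<^sup>2 \<partial>m) < \<infinity>"
  proof -
    obtain y where y: "y \<in> ?S" "y < \<infinity>" using \<open>Inf ?S < \<infinity>\<close> unfolding Inf_less_iff by (rule bexE)
    then show thesis using that by blast
  qed
  from liminf_finite_subseq[OF fin] obtain r :: "nat \<Rightarrow> nat" and C where r: "strict_mono r" "0 \<le> C"
    "\<And>n. (\<integral>\<^sup>+x. (lip (u (r n)) x)\<^sup>2 \<partial>m) \<le> ennreal C" by metis
  show ?thesis by (rule that[of "\<lambda>n. u (r n)" C, OF u(1) L2_tendsto_subseq[OF u(2) r(1)] r(2,3)])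
qed

lemma W12I:
  assumes "w \<in> L2 m" "\<And>k. u k \<in> LIPb \<inter> L2 m" "L2_tendsto m u w" "\<And>k. (\<integral>\<^sup>+x. (lip (u k) x)\<^sup>2 \<partial>m) \<le> ennreal C"
  shows "w \<in> W12 m"
proof -
  let ?S = "{liminf (\<lambda>k. \<integral>\<^sup>+x. (lip (u k) x)\<^sup>2 \<partial>m) | u. (\<forall>k. u k \<in> LIPb \<inter> L2 m) \<and> L2_tendsto m u w}"
  have "Inf ?S \<le> liminf (\<lambda>k. \<integral>\<^sup>+x. (lip (u k) x)\<^sup>2 \<partial>m)" using assms(2,3) by (intro Inf_lower) blast
  also have "\<dots> \<le> ennreal C" using assms(4) by (intro Liminf_le always_eventually) auto
  finally have "Inf ?S < \<infinity>" by (rule order_le_less_trans) simp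
  then show ?thesis
    unfolding W12_def Cheeger_def mem_Collect_eq half_mult_finite_iff by (intro conjI assms(1))
qed

lemma W12_L2: "w \<in> W12 m \<Longrightarrow> w \<in> L2 m"
  by (simp add: W12_def)

text \<open>The common scheme for sums and for products: the slopes of new approximants are
  dominated by those of two sequences of bounded energy plus a term \<open>g\<close> bounded in L2.
  In the product rule \<open>g\<close> absorbs the slope of the multiplier. The factors 3 come from
  squaring a sum of three terms.\<close>

lemma W12_transfer:
  assumes w: "w \<in> L2 m" and v: "\<And>k. v k \<in> LIPb \<inter> L2 m" "L2_tendsto m v w"
    and le: "\<And>k x. lip (v k) x \<le> ennreal A * lip (u k) x + ennreal B * lip (u' k) x + ennreal (g k x)"
    and u: "\<And>k. (\<integral>\<^sup>+x. (lip (u k) x)\<^sup>2 \<partial>m) \<le> ennreal C" "\<And>k. u k \<in> LIPb"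
    and u': "\<And>k. (\<integral>\<^sup>+x. (lip (u' k) x)\<^sup>2 \<partial>m) \<le> ennreal C'" "\<And>k. u' k \<in> LIPb"
    and g: "\<And>k. g k \<in> L2 m" "\<And>k. sq_norm m (g k) \<le> D" "\<And>k x. 0 \<le> g k x"
    and nn: "0 \<le> A" "0 \<le> B" "0 \<le> C" "0 \<le> C'"
  shows "w \<in> W12 m"
proof (rule W12I[OF w v])
  fix k
  have [measurable]: "lip (u k) \<in> borel_measurable m" "lip (u' k) \<in> borel_measurable m" "g k \<in> borel_measurable m"
    using u(2) u'(2) g(1) by (auto intro!: lip_measurable LIPb_continuous L2_measurable)
  have D0: "0 \<le> D" using g(2)[of k] sq_norm_nonneg[of m "g k"] by linarith
  have pw: "(lip (v k) x)\<^sup>2 \<le> ennreal (3 * A\<^sup>2) * (lip (u k) x)\<^sup>2 + ennreal (3 * B\<^sup>2) * (lip (u' k) x)\<^sup>2 + 3 * ennreal ((g k x)\<^sup>2)" for x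
  proof -
    define a b where "a = rlip (u k) x" and "b = rlip (u' k) x"
    have ab: "lip (u k) x = ennreal a" "lip (u' k) x = ennreal b" "0 \<le> a" "0 \<le> b"
      using LIPb_lip_finite[OF u(2)] LIPb_lip_finite[OF u'(2)] by (auto simp: a_def b_def)
    have "lip (v k) x \<le> ennreal (A * a + B * b + g k x)"
      using le[of k x] ab nn g(3)[of k x] by (simp add: ennreal_mult)
    then have "(lip (v k) x)\<^sup>2 \<le> (ennreal (A * a + B * b + g k x))\<^sup>2" by (intro power_mono) auto
    also have "\<dots> = ennreal ((A * a + B * b + g k x)\<^sup>2)" using ab nn g(3)[of k x] by (subst ennreal_power) auto
    also have "\<dots> \<le> ennreal (3 * A\<^sup>2 * a\<^sup>2 + 3 * B\<^sup>2 * b\<^sup>2 + 3 * (g k x)\<^sup>2)"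
    proof (rule ennreal_leI)
      have "(p + q + r)\<^sup>2 \<le> 3 * p\<^sup>2 + 3 * q\<^sup>2 + 3 * r\<^sup>2" for p q r :: real
        using zero_le_power2[of "p - q"] zero_le_power2[of "q - r"] zero_le_power2[of "p - r"]
        by (simp add: power2_eq_square algebra_simps)
      from this[of "A * a" "B * b" "g k x"]
      show "(A * a + B * b + g k x)\<^sup>2 \<le> 3 * A\<^sup>2 * a\<^sup>2 + 3 * B\<^sup>2 * b\<^sup>2 + 3 * (g k x)\<^sup>2"
        by (simp add: power_mult_distrib)
    qed
    also have "\<dots> = ennreal (3 * A\<^sup>2) * (lip (u k) x)\<^sup>2 + ennreal (3 * B\<^sup>2) * (lip (u' k) x)\<^sup>2 + 3 * ennreal ((g k x)\<^sup>2)"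
      using ab by (simp add: ennreal_power ennreal_mult[symmetric] ennreal_plus[symmetric] ennreal_numeral[symmetric]
        del: ennreal_plus ennreal_numeral)
    finally show ?thesis .
  qed
  have "(\<integral>\<^sup>+x. (lip (v k) x)\<^sup>2 \<partial>m) \<le> (\<integral>\<^sup>+x. ennreal (3 * A\<^sup>2) * (lip (u k) x)\<^sup>2 + ennreal (3 * B\<^sup>2) * (lip (u' k) x)\<^sup>2 + 3 * ennreal ((g k x)\<^sup>2) \<partial>m)"
    using pw by (intro nn_integral_mono)
  also have "\<dots> = ennreal (3 * A\<^sup>2) * (\<integral>\<^sup>+x. (lip (u k) x)\<^sup>2 \<partial>m) + ennreal (3 * B\<^sup>2) * (\<integral>\<^sup>+x. (lip (u' k) x)\<^sup>2 \<partial>m) + 3 * ennreal (sq_norm m (g k))"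
    by (simp add: nn_integral_add nn_integral_cmult nn_integral_sq[OF g(1)])
  also have "\<dots> \<le> ennreal (3 * A\<^sup>2) * ennreal C + ennreal (3 * B\<^sup>2) * ennreal C' + 3 * ennreal D"
    using u(1) u'(1) g(2) by (intro add_mono mult_left_mono ennreal_leI) auto
  also have "\<dots> = ennreal (3 * A\<^sup>2 * C + 3 * B\<^sup>2 * C' + 3 * D)"
    using nn D0 by (simp add: ennreal_mult[symmetric] ennreal_plus[symmetric] ennreal_numeral[symmetric]
        del: ennreal_plus ennreal_numeral)
  finally show "(\<integral>\<^sup>+x. (lip (v k) x)\<^sup>2 \<partial>m) \<le> ennreal (3 * A\<^sup>2 * C + 3 * B\<^sup>2 * C' + 3 * D)" .
qed

lemma LIPbs_W12:
  assumes "\<phi> \<in> LIPbs"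
  shows "\<phi> \<in> W12 m"
proof (rule W12I[of _ "\<lambda>_. \<phi>"])
  show "\<phi> \<in> LIPb \<inter> L2 m" using assms by (auto intro: LIPbs_LIPb LIPbs_L2)
  show "L2_tendsto m (\<lambda>_. \<phi>) \<phi>" by (simp add: L2_tendsto_def)
  have "(\<integral>\<^sup>+x. (lip \<phi> x)\<^sup>2 \<partial>m) = (\<integral>\<^sup>+x. ennreal ((rlip \<phi> x)\<^sup>2) \<partial>m)"
    using LIPb_lip_finite[OF LIPbs_LIPb[OF assms]] by (intro nn_integral_cong) (simp add: ennreal_power[symmetric])
  then show "(\<integral>\<^sup>+x. (lip \<phi> x)\<^sup>2 \<partial>m) \<le> ennreal (sq_norm m (rlip \<phi>))"
    by (simp add: nn_integral_sq[OF LIPbs_rlip_L2[OF assms]])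
qed (rule LIPbs_L2[OF assms])

lemma W12_comb:
  assumes f: "f \<in> W12 m" and g: "g \<in> W12 m"
  shows "(\<lambda>x. a * f x + b * g x) \<in> W12 m"
proof -
  obtain u :: "nat \<Rightarrow> 'a \<Rightarrow> real" and C where u: "\<And>k. u k \<in> LIPb \<inter> L2 m" "L2_tendsto m u f" "0 \<le> C"
    "\<And>k. (\<integral>\<^sup>+x. (lip (u k) x)\<^sup>2 \<partial>m) \<le> ennreal C" using W12E[OF f] by metis
  obtain u' :: "nat \<Rightarrow> 'a \<Rightarrow> real" and C' where u': "\<And>k. u' k \<in> LIPb \<inter> L2 m" "L2_tendsto m u' g" "0 \<le> C'"
    "\<And>k. (\<integral>\<^sup>+x. (lip (u' k) x)\<^sup>2 \<partial>m) \<le> ennreal C'" using W12E[OF g] by metis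
  have f2: "f \<in> L2 m" "g \<in> L2 m" using f g by (auto intro: W12_L2)
  have v: "(\<lambda>x. a * u k x + b * u' k x) \<in> LIPb \<inter> L2 m" for k
    using u(1) u'(1) by (auto intro!: LIPb_add LIPb_cmult L2_comb)
  have lim: "L2_tendsto m (\<lambda>k x. a * u k x + b * u' k x) (\<lambda>x. a * f x + b * g x)"
  proof (subst L2_tendsto_iff)
    have "(\<lambda>k. sq_norm m (\<lambda>x. u k x - f x)) \<longlonglongrightarrow> 0" "(\<lambda>k. sq_norm m (\<lambda>x. u' k x - g x)) \<longlonglongrightarrow> 0"
      using u(1,2) u'(1,2) f2 L2_tendsto_iff by blast+
    then have "(\<lambda>k. 2 * (a\<^sup>2 * sq_norm m (\<lambda>x. u k x - f x)) + 2 * (b\<^sup>2 * sq_norm m (\<lambda>x. u' k x - g x))) \<longlonglongrightarrow> 2 * (a\<^sup>2 * 0) + 2 * (b\<^sup>2 * 0)"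
      by (intro tendsto_intros)
    then have z: "(\<lambda>k. 2 * (a\<^sup>2 * sq_norm m (\<lambda>x. u k x - f x)) + 2 * (b\<^sup>2 * sq_norm m (\<lambda>x. u' k x - g x))) \<longlonglongrightarrow> 0" by simp
    show "(\<lambda>k. sq_norm m (\<lambda>x. a * u k x + b * u' k x - (a * f x + b * g x))) \<longlonglongrightarrow> 0"
    proof (rule tendsto_sandwich[OF _ _ tendsto_const z])
      have "sq_norm m (\<lambda>x. a * u k x + b * u' k x - (a * f x + b * g x)) \<le>
          2 * (a\<^sup>2 * sq_norm m (\<lambda>x. u k x - f x)) + 2 * (b\<^sup>2 * sq_norm m (\<lambda>x. u' k x - g x))" for k
        using sq_norm_add_le[OF L2_cmult[OF L2_diff[OF _ f2(1)], of "u k" a] L2_cmult[OF L2_diff[OF _ f2(2)], of "u' k" b]]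
          u(1) u'(1) unfolding sq_norm_cmult by (simp add: algebra_simps)
      then show "\<forall>\<^sub>F k in sequentially. sq_norm m (\<lambda>x. a * u k x + b * u' k x - (a * f x + b * g x)) \<le>
          2 * (a\<^sup>2 * sq_norm m (\<lambda>x. u k x - f x)) + 2 * (b\<^sup>2 * sq_norm m (\<lambda>x. u' k x - g x))" by simp
    qed (simp add: sq_norm_nonneg)
  qed (use v f2 in \<open>auto intro: L2_comb\<close>)
  show ?thesis
  proof (rule W12_transfer[OF L2_comb[OF f2] v lim, where u = u and u' = u' and C = C and C' = C' and g = "\<lambda>_ _. 0" and D = 0])
    show "lip (\<lambda>x. a * u k x + b * u' k x) x \<le> ennreal \<bar>a\<bar> * lip (u k) x + ennreal \<bar>b\<bar> * lip (u' k) x + ennreal 0" for k x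
      using lip_cmult[of a "u k" x] lip_cmult[of b "u' k" x] by (auto intro: order_trans[OF lip_add add_mono])
  qed (use u u' in \<open>auto simp: L2_def sq_norm_def\<close>)
qed

lemma W12_mult:
  assumes \<phi>: "\<phi> \<in> LIPb" and w: "w \<in> W12 m"
  shows "(\<lambda>x. \<phi> x * w x) \<in> W12 m"
proof -
  obtain u :: "nat \<Rightarrow> 'a \<Rightarrow> real" and C where u: "\<And>k. u k \<in> LIPb \<inter> L2 m" "L2_tendsto m u w" "0 \<le> C"
    "\<And>k. (\<integral>\<^sup>+x. (lip (u k) x)\<^sup>2 \<partial>m) \<le> ennreal C" using W12E[OF w] by metis
  have w2: "w \<in> L2 m" by (rule W12_L2[OF w])
  obtain A where A: "0 \<le> A" "\<And>x. \<bar>\<phi> x\<bar> \<le> A" using \<phi> by (elim LIPbE) blast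
  obtain K where K: "0 \<le> K" "\<And>x. rlip \<phi> x \<le> K" using LIPb_rlip_bounded[OF \<phi>] by blast
  have \<phi>L: "\<phi> \<in> Linf m" using A LIPb_measurable[OF \<phi>] by (auto simp: Linf_def)
  have v: "(\<lambda>x. \<phi> x * u k x) \<in> LIPb \<inter> L2 m" for k
    using u(1) \<phi> by (auto intro!: LIPb_mult L2_Linf_mult[OF \<phi>L])
  have uw: "(\<lambda>k. sq_norm m (\<lambda>x. u k x - w x)) \<longlonglongrightarrow> 0" using u(1,2) w2 L2_tendsto_iff by blast
  have lim: "L2_tendsto m (\<lambda>k x. \<phi> x * u k x) (\<lambda>x. \<phi> x * w x)"
  proof (subst L2_tendsto_iff)
    have "(\<lambda>k. A\<^sup>2 * sq_norm m (\<lambda>x. u k x - w x)) \<longlonglongrightarrow> A\<^sup>2 * 0" by (intro tendsto_intros uw)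
    then have z: "(\<lambda>k. A\<^sup>2 * sq_norm m (\<lambda>x. u k x - w x)) \<longlonglongrightarrow> 0" by simp
    show "(\<lambda>k. sq_norm m (\<lambda>x. \<phi> x * u k x - \<phi> x * w x)) \<longlonglongrightarrow> 0"
    proof (rule tendsto_sandwich[OF _ _ tendsto_const z])
      have "sq_norm m (\<lambda>x. \<phi> x * u k x - \<phi> x * w x) \<le> sq_norm m (\<lambda>x. A * (u k x - w x))" for k
        using u(1)[of k] w2 A L2_measurable[OF w2] L2_measurable[of "u k" m] LIPb_measurable[OF \<phi>]
        by (intro sq_norm_mono L2_cmult L2_diff AE_I2) (auto simp: abs_mult mult_right_mono simp flip: right_diff_distrib)
      then show "\<forall>\<^sub>F k in sequentially. sq_norm m (\<lambda>x. \<phi> x * u k x - \<phi> x * w x) \<le> A\<^sup>2 * sq_norm m (\<lambda>x. u k x - w x)"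
        by (simp add: sq_norm_cmult)
    qed (simp add: sq_norm_nonneg)
  qed (use v w2 \<phi>L in \<open>auto intro: L2_Linf_mult\<close>)
  \<comment> \<open>Convergence in L2 bounds the norms of the \<open>u k\<close>, which is the bound
    needed for the term \<open>K * |u k|\<close> of the product rule.\<close>
  have "(\<lambda>k. sq_norm m (u k)) \<longlonglongrightarrow> sq_norm m w" using u(1) w2 uw by (intro sq_norm_tendsto) auto
  then have "Bseq (\<lambda>k. sq_norm m (u k))" by (rule convergent_imp_Bseq[OF convergentI])
  then obtain D where D: "\<And>k. sq_norm m (u k) \<le> D" unfolding Bseq_def by (force simp: abs_le_iff)
  show ?thesis
  proof (rule W12_transfer[OF L2_Linf_mult[OF \<phi>L w2] v lim, where u = u and u' = u and A = A and B = 0 and g = "\<lambda>k x. K * \<bar>u k x\<bar>" and D = "K\<^sup>2 * D" and C = C and C' = C])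
    fix k x
    have "lip (\<lambda>x. \<phi> x * u k x) x \<le> ennreal \<bar>\<phi> x\<bar> * lip (u k) x + ennreal \<bar>u k x\<bar> * lip \<phi> x"
      using u(1)[of k] \<phi> by (intro lip_mult LIPb_isCont LIPb_lip_finite) auto
    also have "\<dots> \<le> ennreal A * lip (u k) x + ennreal \<bar>u k x\<bar> * ennreal K"
      using A(2)[of x] K(2)[of x] LIPb_lip_eq[OF \<phi>, of x]
      by (intro add_mono mult_right_mono mult_left_mono ennreal_leI) (metis ennreal_leI zero_le)+
    finally show "lip (\<lambda>x. \<phi> x * u k x) x \<le> ennreal A * lip (u k) x + ennreal 0 * lip (u k) x + ennreal (K * \<bar>u k x\<bar>)"
      using K(1) by (simp add: ennreal_mult mult.commute)
  next
    fix k
    have "(\<lambda>x. \<bar>u k x\<bar>) \<in> L2 m"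
      using u(1)[of k] L2_measurable[of "u k" m] by (auto intro: L2_bounded[of "u k"])
    then show "(\<lambda>x. K * \<bar>u k x\<bar>) \<in> L2 m" by (rule L2_cmult)
    have "sq_norm m (\<lambda>x. K * \<bar>u k x\<bar>) = K\<^sup>2 * sq_norm m (u k)"
      by (simp add: sq_norm_cmult) (simp add: sq_norm_def)
    then show "sq_norm m (\<lambda>x. K * \<bar>u k x\<bar>) \<le> K\<^sup>2 * D" using D[of k] by (simp add: mult_left_mono)
  qed (use u A K in auto)
qed

end

section \<open>Leibniz rules for the differential and the divergence\<close>

context tangent_calculus
begin

text \<open>The constant sequence \<open>\<phi>\<close> with its own slope is admissible in
  \<open>minimal_slope_le_weak_limit\<close>.\<close>

lemma pnorm_d_le_rlip:
  assumes \<phi>: "\<phi> \<in> LIPbs"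
  shows "AE x in m. pnorm T (d \<phi>) x \<le> rlip \<phi> x"
proof (rule minimal_slope_le_weak_limit[OF sets_m])
  show "\<phi> \<in> LIPb \<inter> L2 m" "\<phi> \<in> L2 m" using \<phi> by (auto intro: LIPbs_LIPb LIPbs_L2)
  show "L2_tendsto m (\<lambda>_. \<phi>) \<phi>" by (simp add: L2_tendsto_def)
  show "minimal_relaxed_slope m \<phi> (pnorm T (d \<phi>))" by (rule cot.pnorm_d[OF LIPbs_W12[OF \<phi>]])
qed (use LIPbs_rlip_L2[OF \<phi>] in auto)

text \<open>The constants \<open>a\<close> and \<open>b\<close> freeze the values of the factors: up to a constant the left-hand
  side is the differential of \<open>(\<phi> - a) * (w - b)\<close>.\<close>
lemma pnorm_d_frozen_product:
  assumes \<phi>: "\<phi> \<in> LIPbs" and w: "w \<in> W12 m"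
  shows "AE x in m. pnorm T (d (\<lambda>x. \<phi> x * w x) + (- a *\<^sub>R d w + - b *\<^sub>R d \<phi>)) x \<le>
      \<bar>\<phi> x - a\<bar> * pnorm T (d w) x + \<bar>w x - b\<bar> * rlip \<phi> x"
proof -
  note \<phi>b = LIPbs_LIPb[OF \<phi>]
  have \<phi>2: "\<phi> \<in> L2 m" by (rule LIPbs_L2[OF \<phi>])
  have w2: "w \<in> L2 m" by (rule W12_L2[OF w])
  have \<phi>w: "(\<lambda>x. \<phi> x * w x) \<in> W12 m" by (rule W12_mult[OF \<phi>b w])
  \<comment> \<open>\<open>F\<close> is \<open>(\<phi> - a) * (w - b)\<close> without the constant
    \<open>a * b\<close>, which need not be square integrable. Slopes do not see the constant, so
    the estimate of the approximants may use the full product.\<close>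
  define F where "F x = 1 * (\<phi> x * w x) + 1 * (- a * w x + - b * \<phi> x)" for x
  have c2: "(\<lambda>x. - a * w x + - b * \<phi> x) \<in> W12 m" by (rule W12_comb[OF w LIPbs_W12[OF \<phi>]])
  have F: "F \<in> W12 m" unfolding F_def by (rule W12_comb[OF \<phi>w c2])
  have dF: "d F = d (\<lambda>x. \<phi> x * w x) + (- a *\<^sub>R d w + - b *\<^sub>R d \<phi>)"
    unfolding F_def cot.d_linear[OF \<phi>w c2] cot.d_linear[OF w LIPbs_W12[OF \<phi>]] by simp
  have "relaxed_slope m w (pnorm T (d w))"
    using cot.pnorm_d[OF w] by (simp add: minimal_relaxed_slope_def)
  then obtain u G' where u: "\<And>k. u k \<in> LIPb \<inter> L2 m" and ru: "\<And>k. rlip (u k) \<in> L2 m"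
    and uw: "L2_tendsto m u w" and G'2: "G' \<in> L2 m"
    and weak: "\<And>h. h \<in> L2 m \<Longrightarrow> (\<lambda>k. \<integral>x. rlip (u k) x * h x \<partial>m) \<longlonglongrightarrow> (\<integral>x. G' x * h x \<partial>m)"
    and G': "AE x in m. G' x \<le> pnorm T (d w) x"
    unfolding relaxed_slope_def by blast
  have u2: "u k \<in> L2 m" and ub: "u k \<in> LIPb" for k using u by auto
  obtain A where A: "0 \<le> A" "\<And>x. \<bar>\<phi> x\<bar> \<le> A" using \<phi>b by (elim LIPbE) blast
  obtain K where K: "0 \<le> K" "\<And>x. rlip \<phi> x \<le> K" using LIPb_rlip_bounded[OF \<phi>b] by blast
  have [measurable]: "\<phi> \<in> borel_measurable m" "w \<in> borel_measurable m" "\<And>k. u k \<in> borel_measurable m"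
    "rlip \<phi> \<in> borel_measurable m"
    using \<phi>2 w2 u2 LIPbs_rlip_L2[OF \<phi>] by (auto intro: L2_measurable)
  have \<phi>a: "(\<lambda>x. \<bar>\<phi> x - a\<bar>) \<in> Linf m"
  proof -
    have "\<bar>\<bar>\<phi> x - a\<bar>\<bar> \<le> A + \<bar>a\<bar>" for x using A(2)[of x] by simp
    then show ?thesis by (auto simp: Linf_def)
  qed
  have rL: "rlip \<phi> \<in> Linf m" using K by (auto simp: Linf_def)
  have abs2: "(\<lambda>x. \<bar>f x - b\<bar> * rlip \<phi> x) \<in> L2 m" if f: "f \<in> L2 m" for f
  proof (rule L2_bounded)
    show "(\<lambda>x. rlip \<phi> x * f x - b * rlip \<phi> x) \<in> L2 m"
      by (intro L2_diff L2_cmult L2_Linf_mult[OF rL f] LIPbs_rlip_L2[OF \<phi>])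
    show "(\<lambda>x. \<bar>f x - b\<bar> * rlip \<phi> x) \<in> borel_measurable m"
      using L2_measurable[OF f] by measurable
    have "rlip \<phi> x * f x - b * rlip \<phi> x = (f x - b) * rlip \<phi> x" for x by (simp add: algebra_simps)
    then show "AE x in m. \<bar>\<bar>f x - b\<bar> * rlip \<phi> x\<bar> \<le> \<bar>rlip \<phi> x * f x - b * rlip \<phi> x\<bar>"
      by (simp add: abs_mult)
  qed
  define v where "v k x = 1 * (\<phi> x * u k x) + 1 * (- a * u k x + - b * \<phi> x)" for k x
  define s where "s k x = \<bar>\<phi> x - a\<bar> * rlip (u k) x + \<bar>u k x - b\<bar> * rlip \<phi> x" for k x
  define S where "S x = \<bar>\<phi> x - a\<bar> * G' x + \<bar>w x - b\<bar> * rlip \<phi> x" for x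
  have uw': "(\<lambda>k. sq_norm m (\<lambda>x. u k x - w x)) \<longlonglongrightarrow> 0" using uw L2_tendsto_iff[OF u2 w2] by simp
  have v2: "v k \<in> L2 m" and vb: "v k \<in> LIPb" for k
  proof -
    have "\<phi> \<in> Linf m" using A by (auto simp: Linf_def)
    then show "v k \<in> L2 m" unfolding v_def by (intro L2_comb L2_Linf_mult u2 \<phi>2)
    show "v k \<in> LIPb" unfolding v_def by (intro LIPb_add LIPb_cmult LIPb_mult ub \<phi>b)
  qed
  have "AE x in m. pnorm T (d F) x \<le> S x"
  proof (rule minimal_slope_le_weak_limit[OF sets_m, of v F s S])
    show "v k \<in> LIPb \<inter> L2 m" for k using v2 vb by simp
    show "F \<in> L2 m" by (rule W12_L2[OF F])
    show "L2_tendsto m v F"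
    proof (subst L2_tendsto_iff[OF v2 W12_L2[OF F]])
      have "(\<lambda>k. (A + \<bar>a\<bar>)\<^sup>2 * sq_norm m (\<lambda>x. u k x - w x)) \<longlonglongrightarrow> (A + \<bar>a\<bar>)\<^sup>2 * 0" by (intro tendsto_intros uw')
      then have z: "(\<lambda>k. (A + \<bar>a\<bar>)\<^sup>2 * sq_norm m (\<lambda>x. u k x - w x)) \<longlonglongrightarrow> 0" by simp
      show "(\<lambda>k. sq_norm m (\<lambda>x. v k x - F x)) \<longlonglongrightarrow> 0"
      proof (rule tendsto_sandwich[OF _ _ tendsto_const z])
        have "sq_norm m (\<lambda>x. v k x - F x) \<le> sq_norm m (\<lambda>x. (A + \<bar>a\<bar>) * (u k x - w x))" for k
        proof (rule sq_norm_mono)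
          show "(\<lambda>x. (A + \<bar>a\<bar>) * (u k x - w x)) \<in> L2 m" by (intro L2_cmult L2_diff u2 w2)
          show "(\<lambda>x. v k x - F x) \<in> borel_measurable m" unfolding v_def F_def by measurable
          have "\<bar>v k x - F x\<bar> \<le> \<bar>(A + \<bar>a\<bar>) * (u k x - w x)\<bar>" for x
          proof -
            have "v k x - F x = (\<phi> x - a) * (u k x - w x)" by (simp add: v_def F_def algebra_simps)
            moreover have "\<bar>\<phi> x - a\<bar> \<le> \<bar>A + \<bar>a\<bar>\<bar>" using A(2)[of x] A(1) by linarith
            ultimately show ?thesis unfolding abs_mult by (simp only: abs_mult mult_right_mono abs_ge_zero)
          qed
          then show "AE x in m. \<bar>v k x - F x\<bar> \<le> \<bar>(A + \<bar>a\<bar>) * (u k x - w x)\<bar>" by simp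
        qed
        then show "\<forall>\<^sub>F k in sequentially. sq_norm m (\<lambda>x. v k x - F x) \<le> (A + \<bar>a\<bar>)\<^sup>2 * sq_norm m (\<lambda>x. u k x - w x)"
          by (simp add: sq_norm_cmult)
      qed (simp add: sq_norm_nonneg)
    qed
    show "s k \<in> L2 m" for k unfolding s_def by (intro L2_add L2_Linf_mult[OF \<phi>a] ru abs2 u2)
    show "S \<in> L2 m" unfolding S_def by (intro L2_add L2_Linf_mult[OF \<phi>a] G'2 abs2 w2)
    show "rlip (v k) x \<le> s k x" for k x
    proof (rule rlip_le)
      have "v k = (\<lambda>x. (\<phi> x - a) * (u k x - b) - a * b)" by (auto simp: v_def algebra_simps)
      then have "lip (v k) x = lip (\<lambda>x. (\<phi> x - a) * (u k x - b)) x" by (simp only: lip_shift)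
      also have "\<dots> \<le> ennreal \<bar>\<phi> x - a\<bar> * lip (\<lambda>x. u k x - b) x + ennreal \<bar>u k x - b\<bar> * lip (\<lambda>x. \<phi> x - a) x"
        using LIPb_isCont[OF \<phi>b] LIPb_isCont[OF ub] LIPb_lip_finite[OF \<phi>b] LIPb_lip_finite[OF ub]
        by (intro lip_mult continuous_intros) (simp_all add: lip_shift)
      also have "\<dots> = ennreal (s k x)"
        using LIPb_lip_finite[OF \<phi>b, of x] LIPb_lip_finite[OF ub, of k x] by (simp add: lip_shift s_def ennreal_mult)
      finally show "lip (v k) x \<le> ennreal (s k x)" .
      show "0 \<le> s k x" by (simp add: s_def)
    qed
    show "minimal_relaxed_slope m F (pnorm T (d F))" by (rule cot.pnorm_d[OF F])
    \<comment> \<open>The slopes of the \<open>u k\<close> converge only weakly and are paired with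
      the fixed function \<open>|\<phi> - a| * h\<close>. The second term converges strongly because
      the slope of \<phi> is bounded.\<close>
    show "(\<lambda>k. \<integral>x. s k x * h x \<partial>m) \<longlonglongrightarrow> (\<integral>x. S x * h x \<partial>m)" if h: "h \<in> L2 m" for h
    proof -
      have h': "(\<lambda>x. \<bar>\<phi> x - a\<bar> * h x) \<in> L2 m" by (rule L2_Linf_mult[OF \<phi>a h])
      have split: "(\<integral>x. (\<bar>\<phi> x - a\<bar> * p x + \<bar>q x - b\<bar> * rlip \<phi> x) * h x \<partial>m) =
          (\<integral>x. p x * (\<bar>\<phi> x - a\<bar> * h x) \<partial>m) + (\<integral>x. (\<bar>q x - b\<bar> * rlip \<phi> x) * h x \<partial>m)"
        if "p \<in> L2 m" "q \<in> L2 m" for p q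
      proof -
        have "(\<integral>x. (\<bar>\<phi> x - a\<bar> * p x + \<bar>q x - b\<bar> * rlip \<phi> x) * h x \<partial>m) =
          (\<integral>x. p x * (\<bar>\<phi> x - a\<bar> * h x) + (\<bar>q x - b\<bar> * rlip \<phi> x) * h x \<partial>m)" by (simp add: algebra_simps)
        also have "\<dots> = (\<integral>x. p x * (\<bar>\<phi> x - a\<bar> * h x) \<partial>m) + (\<integral>x. (\<bar>q x - b\<bar> * rlip \<phi> x) * h x \<partial>m)"
          by (intro Bochner_Integration.integral_add L2_integrable_mult that h' abs2 h)
        finally show ?thesis .
      qed
      have strong: "(\<lambda>k. \<integral>x. (\<bar>u k x - b\<bar> * rlip \<phi> x) * h x \<partial>m) \<longlonglongrightarrow> (\<integral>x. (\<bar>w x - b\<bar> * rlip \<phi> x) * h x \<partial>m)"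
      proof (rule L2_inner_tendsto[OF abs2[OF u2] abs2[OF w2] h])
        have "(\<lambda>k. K\<^sup>2 * sq_norm m (\<lambda>x. u k x - w x)) \<longlonglongrightarrow> K\<^sup>2 * 0" by (intro tendsto_intros uw')
        then have z: "(\<lambda>k. K\<^sup>2 * sq_norm m (\<lambda>x. u k x - w x)) \<longlonglongrightarrow> 0" by simp
        show "(\<lambda>k. sq_norm m (\<lambda>x. \<bar>u k x - b\<bar> * rlip \<phi> x - \<bar>w x - b\<bar> * rlip \<phi> x)) \<longlonglongrightarrow> 0"
        proof (rule tendsto_sandwich[OF _ _ tendsto_const z])
          have "sq_norm m (\<lambda>x. \<bar>u k x - b\<bar> * rlip \<phi> x - \<bar>w x - b\<bar> * rlip \<phi> x) \<le> sq_norm m (\<lambda>x. K * (u k x - w x))" for k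
          proof (rule sq_norm_mono)
            show "(\<lambda>x. K * (u k x - w x)) \<in> L2 m" by (intro L2_cmult L2_diff u2 w2)
            show "(\<lambda>x. \<bar>u k x - b\<bar> * rlip \<phi> x - \<bar>w x - b\<bar> * rlip \<phi> x) \<in> borel_measurable m" by measurable
            have "\<bar>\<bar>u k x - b\<bar> * rlip \<phi> x - \<bar>w x - b\<bar> * rlip \<phi> x\<bar> \<le> \<bar>K * (u k x - w x)\<bar>" for x
            proof -
              have "\<bar>\<bar>u k x - b\<bar> * rlip \<phi> x - \<bar>w x - b\<bar> * rlip \<phi> x\<bar> = \<bar>\<bar>u k x - b\<bar> - \<bar>w x - b\<bar>\<bar> * rlip \<phi> x"
                by (simp add: abs_mult flip: left_diff_distrib)
              also have "\<dots> \<le> \<bar>u k x - w x\<bar> * K" using K by (intro mult_mono) auto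
              finally show ?thesis using K(1) by (simp add: abs_mult mult.commute)
            qed
            then show "AE x in m. \<bar>\<bar>u k x - b\<bar> * rlip \<phi> x - \<bar>w x - b\<bar> * rlip \<phi> x\<bar> \<le> \<bar>K * (u k x - w x)\<bar>" by simp
          qed
          then show "\<forall>\<^sub>F k in sequentially. sq_norm m (\<lambda>x. \<bar>u k x - b\<bar> * rlip \<phi> x - \<bar>w x - b\<bar> * rlip \<phi> x) \<le> K\<^sup>2 * sq_norm m (\<lambda>x. u k x - w x)"
            by (simp add: sq_norm_cmult)
        qed (simp add: sq_norm_nonneg)
      qed
      show ?thesis
        unfolding s_def S_def split[OF ru u2] split[OF G'2 w2] by (intro tendsto_add weak[OF h'] strong)
    qed
  qed
  then show ?thesis
    using G' unfolding dF
  proof eventually_elim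
    case (elim x)
    have "\<bar>\<phi> x - a\<bar> * G' x \<le> \<bar>\<phi> x - a\<bar> * pnorm T (d w) x" using elim(2) by (intro mult_left_mono) auto
    then show ?case using elim(1) by (simp add: S_def)
  qed
qed

lemma dual_leibniz:
  assumes X: "X \<in> module_dual m T" and \<phi>: "\<phi> \<in> LIPbs" and w: "w \<in> W12 m"
  shows "AE x in m. X (d (\<lambda>x. \<phi> x * w x)) x = \<phi> x * X (d w) x + w x * X (d \<phi>) x"
proof -
  have e: "d (\<lambda>x. \<phi> x * w x) \<in> elems T" "d w \<in> elems T" "d \<phi> \<in> elems T"
    using cot.d_elems W12_mult[OF LIPbs_LIPb[OF \<phi>] w] w LIPbs_W12[OF \<phi>] by auto
  let ?P = "pnorm L (\<iota> X)"
  have frozen: "AE x in m. \<bar>X (d (\<lambda>x. \<phi> x * w x)) x - a * X (d w) x - b * X (d \<phi>) x\<bar> \<le>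
      ?P x * (\<bar>\<phi> x - a\<bar> * pnorm T (d w) x + \<bar>w x - b\<bar> * rlip \<phi> x)" for a b
  proof -
    let ?c = "- a *\<^sub>R d w + - b *\<^sub>R d \<phi>"
    have c: "?c \<in> elems T"
      by (intro subspace_add[OF cot.subspace_elems] subspace_scale[OF cot.subspace_elems] e)
    have sum: "d (\<lambda>x. \<phi> x * w x) + ?c \<in> elems T" using e(1) c cot.subspace_elems by (rule subspace_add[rotated])
    have "AE x in m. X (d (\<lambda>x. \<phi> x * w x) + ?c) x = X (d (\<lambda>x. \<phi> x * w x)) x + X ?c x"
      by (rule module_dual_AE(1)[OF X e(1) c])
    moreover have "AE x in m. X ?c x = - a * X (d w) x + - b * X (d \<phi>) x"
      by (rule module_dual_comb[OF X e(2,3)])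
    moreover note module_dual_bound[OF X sum] pnorm_d_frozen_product[OF \<phi> w, of a b] pnorm_nonneg[OF iota_elems[OF X]]
    ultimately show ?thesis
    proof eventually_elim
      case (elim x)
      have "?P x * pnorm T (d (\<lambda>x. \<phi> x * w x) + ?c) x \<le> ?P x * (\<bar>\<phi> x - a\<bar> * pnorm T (d w) x + \<bar>w x - b\<bar> * rlip \<phi> x)"
        using elim(4,5) by (rule mult_left_mono)
      then show ?case using elim(1,2,3) by simp
    qed
  qed
  have "AE x in m. \<forall>p\<in>\<rat> \<times> \<rat>. \<bar>X (d (\<lambda>x. \<phi> x * w x)) x - fst p * X (d w) x - snd p * X (d \<phi>) x\<bar> \<le>
      ?P x * (\<bar>\<phi> x - fst p\<bar> * pnorm T (d w) x + \<bar>w x - snd p\<bar> * rlip \<phi> x)"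
    using frozen by (subst AE_ball_countable) (auto intro: countable_rat)
  then show ?thesis
  proof eventually_elim
    case (elim x)
    have ab: "(\<lambda>n. round_down n f x) \<longlonglongrightarrow> f x" "round_down n f x \<in> \<rat>" for f :: "'a \<Rightarrow> real" and n
    proof -
      show "(\<lambda>n. round_down n f x) \<longlonglongrightarrow> f x"
        using uniform_limit_round_down[of f] by (rule tendsto_uniform_limitI) simp
      show "round_down n f x \<in> \<rat>" unfolding round_down_def by (intro Rats_divide) auto
    qed
    have "(\<lambda>n. \<bar>X (d (\<lambda>x. \<phi> x * w x)) x - round_down n \<phi> x * X (d w) x - round_down n w x * X (d \<phi>) x\<bar>) \<longlonglongrightarrow>
        \<bar>X (d (\<lambda>x. \<phi> x * w x)) x - \<phi> x * X (d w) x - w x * X (d \<phi>) x\<bar>"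
      by (intro tendsto_intros ab)
    moreover have "(\<lambda>n. ?P x * (\<bar>\<phi> x - round_down n \<phi> x\<bar> * pnorm T (d w) x + \<bar>w x - round_down n w x\<bar> * rlip \<phi> x)) \<longlonglongrightarrow>
        ?P x * (\<bar>\<phi> x - \<phi> x\<bar> * pnorm T (d w) x + \<bar>w x - w x\<bar> * rlip \<phi> x)"
      by (intro tendsto_intros ab)
    moreover have "\<bar>X (d (\<lambda>x. \<phi> x * w x)) x - round_down n \<phi> x * X (d w) x - round_down n w x * X (d \<phi>) x\<bar> \<le>
      ?P x * (\<bar>\<phi> x - round_down n \<phi> x\<bar> * pnorm T (d w) x + \<bar>w x - round_down n w x\<bar> * rlip \<phi> x)" for n
      using elim[rule_format, of "(round_down n \<phi> x, round_down n w x)"] ab(2) by simp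
    ultimately have "\<bar>X (d (\<lambda>x. \<phi> x * w x)) x - \<phi> x * X (d w) x - w x * X (d \<phi>) x\<bar> \<le>
        ?P x * (\<bar>\<phi> x - \<phi> x\<bar> * pnorm T (d w) x + \<bar>w x - w x\<bar> * rlip \<phi> x)"
      by (intro LIMSEQ_le) auto
    then show ?case by simp
  qed
qed

lemma Ddiv_elems: "v \<in> Ddiv m T d L \<iota> \<Longrightarrow> v \<in> elems L"
  using Ddiv_LinfTX by (auto simp: LinfTX_def)

lemma pairing_LIPbs_bound:
  assumes w: "w \<in> LIPbs" and v: "v \<in> LinfTX m L" and pair: "is_pairing m T L \<iota> (d w) v h"
  shows "AE x in m. \<bar>h x\<bar> \<le> LinfTX_norm m L v * rlip w x"
proof -
  have e: "v \<in> elems L" "d w \<in> elems T" using v cot.d_elems[OF LIPbs_W12[OF w]] by (auto simp: LinfTX_def)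
  show ?thesis
    using pairing_bound[OF pair e(2,1)] LinfTX_norm_AE(2)[OF v] pnorm_d_le_rlip[OF w] cot.pnorm_nonneg[OF e(2)]
  proof eventually_elim
    case (elim x)
    have "pnorm L v x * pnorm T (d w) x \<le> LinfTX_norm m L v * rlip w x"
      using elim LinfTX_norm_AE(1)[OF v] by (intro mult_mono) auto
    then show ?case using elim(1) by simp
  qed
qed

lemma divergence_pairing:
  assumes "is_divergence m T d L \<iota> v \<gamma>" "w \<in> W12 m" "bounded B" "AE x in m. x \<notin> B \<longrightarrow> w x = 0"
  obtains h where "is_pairing m T L \<iota> (d w) v h" "integrable m h" "(\<integral>x. h x \<partial>m) = - (\<integral>x. w x * \<gamma> x \<partial>m)"
  using assms unfolding is_divergence_def by blast

lemma divergence_pairing_LIPbs: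
  assumes "is_divergence m T d L \<iota> v \<gamma>" "w \<in> LIPbs"
  obtains h where "is_pairing m T L \<iota> (d w) v h" "integrable m h" "(\<integral>x. h x \<partial>m) = - (\<integral>x. w x * \<gamma> x \<partial>m)"
  using assms divergence_pairing[OF assms(1) LIPbs_W12[OF assms(2)], of "{x. w x \<noteq> 0}"] by (auto simp: LIPbs_def)

text \<open>The divergence of \<open>v\<close> is tested with \<open>\<phi> * w\<close>. Its
  differential splits by the Leibniz rule into \<open>\<phi>\<close> times that of \<open>w\<close>,
  which is the pairing of \<open>d w\<close> with the field \<open>fmul L \<phi> v\<close>, and
  \<open>w\<close> times that of \<open>\<phi>\<close>, which becomes the new summand
  \<open>h\<close>.\<close>

theorem is_divergence_fmul:
  assumes \<phi>: "\<phi> \<in> LIPbs" and v: "v \<in> LinfTX m L" and div: "is_divergence m T d L \<iota> v \<gamma>"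
    and pair: "is_pairing m T L \<iota> (d \<phi>) v h"
  shows "is_divergence m T d L \<iota> (fmul L \<phi> v) (\<lambda>x. \<phi> x * \<gamma> x + h x)"
  unfolding is_divergence_def
proof (intro conjI ballI impI)
  note \<phi>b = LIPbs_LIPb[OF \<phi>]
  have el: "v \<in> elems L" using v by (simp add: LinfTX_def)
  have hm: "h \<in> borel_measurable m" using pair by (simp add: is_pairing_def)
  have \<gamma>: "\<gamma> \<in> Linf m" using div by (simp add: is_divergence_def)
  obtain A where A: "\<And>x. \<bar>\<phi> x\<bar> \<le> A" using \<phi>b by (elim LIPbE) blast
  have \<phi>L: "\<phi> \<in> Linf m" using A LIPb_measurable[OF \<phi>b] by (auto simp: Linf_def)
  note hb = pairing_LIPbs_bound[OF \<phi> v pair]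
  obtain K where K: "\<And>x. rlip \<phi> x \<le> K" using LIPb_rlip_bounded[OF \<phi>b] by blast
  have hL: "h \<in> Linf m"
  proof -
    have "AE x in m. \<bar>h x\<bar> \<le> LinfTX_norm m L v * K"
      using hb by eventually_elim (meson K LinfTX_norm_AE(1)[OF v] mult_left_mono order_trans)
    then show ?thesis using hm by (auto simp: Linf_def)
  qed
  have h2: "h \<in> L2 m"
  proof (rule L2_bounded[OF L2_cmult[OF LIPbs_rlip_L2[OF \<phi>]] hm])
    show "AE x in m. \<bar>h x\<bar> \<le> \<bar>LinfTX_norm m L v * rlip \<phi> x\<bar>"
      using hb by eventually_elim (rule order_trans[OF _ abs_ge_self])
  qed
  show "(\<lambda>x. \<phi> x * \<gamma> x + h x) \<in> Linf m" by (intro Linf_add Linf_mult \<phi>L \<gamma> hL)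
  fix w assume w: "w \<in> W12 m" and "\<exists>B. bounded B \<and> (AE x in m. x \<notin> B \<longrightarrow> w x = 0)"
  then obtain B where B: "bounded B" "AE x in m. x \<notin> B \<longrightarrow> w x = 0" by blast
  have w2: "w \<in> L2 m" by (rule W12_L2[OF w])
  have \<phi>w: "(\<lambda>x. \<phi> x * w x) \<in> W12 m" by (rule W12_mult[OF \<phi>b w])
  obtain h1 where h1: "is_pairing m T L \<iota> (d w) v h1" "integrable m h1"
    using divergence_pairing[OF div w B] by blast
  obtain h3 where h3: "is_pairing m T L \<iota> (d (\<lambda>x. \<phi> x * w x)) v h3" "integrable m h3"
    "(\<integral>x. h3 x \<partial>m) = - (\<integral>x. (\<phi> x * w x) * \<gamma> x \<partial>m)"
  proof -
    have "AE x in m. x \<notin> B \<longrightarrow> \<phi> x * w x = 0" using B(2) by eventually_elim simp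
    then show thesis using divergence_pairing[OF div \<phi>w B(1)] that by blast
  qed
  have leib: "AE x in m. h3 x = \<phi> x * h1 x + w x * h x"
    using cot.d_elems[OF w] cot.d_elems[OF LIPbs_W12[OF \<phi>]] cot.d_elems[OF \<phi>w]
    by (rule pairing_linear[OF h1(1) pair h3(1) _ _ _ el dual_leibniz[OF _ \<phi> w]])
  have i1: "integrable m (\<lambda>x. \<phi> x * h1 x)" by (rule integrable_Linf_mult[OF \<phi>L h1(2)])
  have i2: "integrable m (\<lambda>x. w x * h x)" by (rule L2_integrable_mult[OF w2 h2])
  have i3: "integrable m (\<lambda>x. w x * (\<gamma> x * \<phi> x))" by (intro L2_integrable_mult[OF w2] L2_Linf_mult[OF \<gamma>] LIPbs_L2[OF \<phi>])
  have "(\<integral>x. h3 x \<partial>m) = (\<integral>x. \<phi> x * h1 x + w x * h x \<partial>m)"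
    using leib h3(2) i1 i2 by (intro integral_cong_AE) auto
  also have "\<dots> = (\<integral>x. \<phi> x * h1 x \<partial>m) + (\<integral>x. w x * h x \<partial>m)" using i1 i2 by simp
  finally have "(\<integral>x. \<phi> x * h1 x \<partial>m) = - (\<integral>x. w x * (\<gamma> x * \<phi> x) \<partial>m) - (\<integral>x. w x * h x \<partial>m)"
    using h3(3) by (simp add: mult_ac)
  also have "\<dots> = - (\<integral>x. w x * (\<gamma> x * \<phi> x) + w x * h x \<partial>m)" using i2 i3 by simp
  also have "\<dots> = - (\<integral>x. w x * (\<phi> x * \<gamma> x + h x) \<partial>m)" by (simp add: algebra_simps)
  finally show "\<exists>h'. is_pairing m T L \<iota> (d w) (fmul L \<phi> v) h' \<and> integrable m h' \<and>
      (\<integral>x. h' x \<partial>m) = - (\<integral>x. w x * (\<phi> x * \<gamma> x + h x) \<partial>m)"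
    using pairing_fmul[OF h1(1) cot.d_elems[OF w] el LIPb_measurable[OF \<phi>b] A] i1 by blast
qed

lemma fmul_Ddiv:
  assumes "\<phi> \<in> LIPbs" "v \<in> Ddiv m T d L \<iota>"
  shows "fmul L \<phi> v \<in> Ddiv m T d L \<iota>"
proof -
  obtain \<gamma> where \<gamma>: "is_divergence m T d L \<iota> v \<gamma>" "v \<in> LinfTX m L" using assms(2) by (auto simp: Ddiv_def)
  obtain h where h: "is_pairing m T L \<iota> (d \<phi>) v h" using divergence_pairing_LIPbs[OF \<gamma>(1) assms(1)] by blast
  show ?thesis
    using is_divergence_fmul[OF assms(1) \<gamma>(2,1) h] fmul_LinfTX[OF LIPb_bcontfun[OF LIPbs_LIPb[OF assms(1)]] \<gamma>(2)]
    unfolding Ddiv_def by blast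
qed

end

section \<open>The chain rule for squares\<close>

lemma infdist_less_ex:
  assumes "A \<noteq> {}" "infdist x A < r"
  obtains a where "a \<in> A" "dist x a < r"
  using assms by (auto simp: infdist_def cINF_less_iff)

text \<open>The range is totally bounded: a finite net of one \<open>K j\<close> with
  \<open>(1/2)^j < e / 8\<close> serves all members from index \<open>j\<close> on, and the finitely
  many earlier members are added to the net.\<close>

lemma sequence_near_compacts_convergent:
  fixes x :: "nat \<Rightarrow> 'a::complete_space"
  assumes K: "\<And>j::nat. compact (K j)" "\<And>j. K j \<noteq> {}"
    and near: "\<And>j N. j \<le> N \<Longrightarrow> infdist (x N) (K j) < 2 * (1/2)^j"
  obtains l r where "strict_mono (r :: nat \<Rightarrow> nat)" "(\<lambda>n. x (r n)) \<longlonglongrightarrow> l"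
proof -
  have "compact (closure (range x))"
    unfolding compact_eq_totally_bounded
  proof (intro conjI allI impI)
    show "complete (closure (range x))" by (simp add: complete_eq_closed)
    fix e :: real assume e: "0 < e"
    obtain j where j: "(1/2)^j < e / 8" using real_arch_pow_inv[of "e/8" "1/2::real"] e by auto
    obtain C where C: "finite C" "K j \<subseteq> (\<Union>c\<in>C. ball c (e / 4))"
      using K(1)[of j] e unfolding compact_eq_totally_bounded by (metis zero_less_divide_iff zero_less_numeral)
    let ?D = "C \<union> x ` {..<j}"
    have "range x \<subseteq> (\<Union>c\<in>?D. cball c (e / 2))"
    proof
      fix y assume "y \<in> range x"
      then obtain N where y: "y = x N" by auto
      show "y \<in> (\<Union>c\<in>?D. cball c (e / 2))"
      proof (cases "N < j")
        case True
        then have "x N \<in> ?D" by auto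
        then show ?thesis using e unfolding y by (intro UN_I[of "x N"]) auto
      next
        case False
        then have "infdist (x N) (K j) < 2 * (1/2)^j" by (intro near) simp
        then obtain a where a: "a \<in> K j" "dist (x N) a < 2 * (1/2)^j" by (rule infdist_less_ex[OF K(2)])
        obtain c where c: "c \<in> C" "dist c a < e / 4" using C(2) a(1) by auto
        have "dist c (x N) \<le> e / 2" using dist_triangle2[of c "x N" a] a(2) c(2) j by linarith
        then show ?thesis using c(1) y by auto
      qed
    qed
    then have "closure (range x) \<subseteq> (\<Union>c\<in>?D. cball c (e / 2))"
      using C(1) by (intro closure_minimal closed_UN) auto
    also have "\<dots> \<subseteq> (\<Union>c\<in>?D. ball c e)" using e by fastforce
    finally show "\<exists>D. finite D \<and> closure (range x) \<subseteq> (\<Union>c\<in>D. ball c e)" using C(1) by (intro exI[of _ ?D]) auto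
  qed
  then obtain l r where "strict_mono (r :: nat \<Rightarrow> nat)" "(x \<circ> r) \<longlonglongrightarrow> l"
    unfolding compact_def by (metis closure_subset rangeI subsetD)
  then show ?thesis by (intro that[of r l]) (simp_all add: comp_def)
qed

text \<open>The space need not be locally compact. By inner regularity there are compact sets \<open>K j\<close> of nearly
  full measure, and the cut-off is \<open>1 - (\<Sum>j\<le>N. 2^j * max 0 (infdist x (K j) - 1 / 2^j))\<close>, truncated at 0: its
  support is close to all of the \<open>K j\<close>, hence good when \<open>N\<close> is large.\<close>
theorem compact_cutoff:
  fixes F :: "'a::polish_space measure set"
  assumes F: "finite F" "\<And>\<nu>. \<nu> \<in> F \<Longrightarrow> finite_measure \<nu>" "\<And>\<nu>. \<nu> \<in> F \<Longrightarrow> sets \<nu> = sets borel"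
    and good: "\<And>r s x. good s x \<Longrightarrow> 0 < r \<Longrightarrow> r \<le> s \<Longrightarrow> good r x" "\<And>x::'a. \<exists>s>0::real. \<forall>y\<in>ball x s. good s y"
    and e: "0 < e"
  obtains \<eta> r where "\<eta> \<in> LIPbs" "\<And>x. 0 \<le> \<eta> x" "\<And>x. \<eta> x \<le> 1" "0 < r" "\<And>x. \<eta> x \<noteq> 0 \<Longrightarrow> good r x"
    "\<And>\<nu>. \<nu> \<in> F \<Longrightarrow> measure \<nu> {x. \<eta> x < 1} \<le> e" "\<And>\<nu>. \<nu> \<in> F \<Longrightarrow> (\<integral>\<^sup>+x. lip \<eta> x \<partial>\<nu>) \<le> ennreal e"
proof -
  define x0 :: 'a where "x0 = undefined"
  \<comment> \<open>The j-th term of the cut-off has slope at most \<open>2^j\<close> off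
    \<open>K j\<close>. Complements of mass \<open>e * (1/4)^(Suc j)\<close> keep the integral of
    the slope summable with total at most \<open>e\<close>.\<close>
  have "\<exists>K. compact K \<and> K \<noteq> {} \<and> (\<forall>\<nu>\<in>F. measure \<nu> (- K) \<le> e * (1/4)^(Suc j))" for j
  proof -
    have "\<exists>K. compact K \<and> measure \<nu> (- K) \<le> e * (1/4)^(Suc j)" if \<nu>: "\<nu> \<in> F" for \<nu>
    proof -
      have pos: "0 < e * (1/4)^(Suc j)" using e by simp
      obtain K where "compact K" "K \<subseteq> UNIV" "measure \<nu> (UNIV - K) < e * (1/4)^(Suc j)"
        using compact_inner_approximation[OF F(2)[OF \<nu>] F(3)[OF \<nu>] _ pos, of UNIV] by auto
      then show ?thesis by (intro exI[of _ K]) (auto simp: Compl_eq_Diff_UNIV)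
    qed
    then obtain K where K: "\<And>\<nu>. \<nu> \<in> F \<Longrightarrow> compact (K \<nu>)" "\<And>\<nu>. \<nu> \<in> F \<Longrightarrow> measure \<nu> (- K \<nu>) \<le> e * (1/4)^(Suc j)"
      by metis
    \<comment> \<open>Adding a point guarantees a nonempty compact set; the distance to the empty
      set would be 0 by convention.\<close>
    have "measure \<nu> (- insert x0 (\<Union>\<nu>\<in>F. K \<nu>)) \<le> e * (1/4)^(Suc j)" if \<nu>: "\<nu> \<in> F" for \<nu>
    proof -
      interpret finite_measure \<nu> by (rule F(2)[OF \<nu>])
      have "measure \<nu> (- insert x0 (\<Union>\<nu>\<in>F. K \<nu>)) \<le> measure \<nu> (- K \<nu>)"
        using \<nu> K(1) F(3)[OF \<nu>] by (intro finite_measure_mono) (auto simp: compact_imp_closed open_Compl intro: borel_open)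
      then show ?thesis using K(2)[OF \<nu>] by linarith
    qed
    moreover have "compact (insert x0 (\<Union>\<nu>\<in>F. K \<nu>))" by (rule compact_insert[OF compact_UN[OF F(1) K(1)]])
    ultimately show ?thesis by (intro exI[of _ "insert x0 (\<Union>\<nu>\<in>F. K \<nu>)"]) auto
  qed
  then obtain K where K: "\<And>j. compact (K j)" "\<And>j. K j \<noteq> {}"
    "\<And>j \<nu>. \<nu> \<in> F \<Longrightarrow> measure \<nu> (- K j) \<le> e * (1/4)^(Suc j)"
    by metis
  define p where "p j x = max 0 (infdist x (K j) - (1/2)^j)" for j x
  define \<eta> where "\<eta> N x = max 0 (1 - (\<Sum>j\<le>N. 2^j * p j x))" for N :: nat and x
  have p0: "0 \<le> p j x" for j x by (simp add: p_def)
  have p1: "\<bar>p j x - p j y\<bar> \<le> dist x y" for j x y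
    using infdist_triangle_abs[of x "K j" y] by (auto simp: p_def max_def abs_le_iff split: if_splits)
  have sumle: "2^j * p j x \<le> (\<Sum>j\<le>N. 2^j * p j x)" if "j \<le> N" for j N x
    using that p0 by (intro member_le_sum) auto
  have near: "infdist x (K j) < 2 * (1/2)^j" if "\<eta> N x \<noteq> 0" "j \<le> N" for N x j
  proof -
    have "2^j * p j x < 1" using that sumle[OF that(2), of x] by (auto simp: \<eta>_def max_def split: if_splits)
    then have "p j x < (1/2)^j" by (simp add: field_simps power_divide)
    then show ?thesis by (simp add: p_def)
  qed
  have lip_eta: "\<bar>\<eta> N x - \<eta> N y\<bar> \<le> (\<Sum>j\<in>J. 2^j) * dist x y"
    if J: "J \<subseteq> {..N}" "\<And>j. j \<in> {..N} - J \<Longrightarrow> p j x = 0 \<and> p j y = 0" for N J x y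
  proof -
    have "\<bar>\<eta> N x - \<eta> N y\<bar> \<le> \<bar>(\<Sum>j\<le>N. 2^j * p j x) - (\<Sum>j\<le>N. 2^j * p j y)\<bar>" by (auto simp: \<eta>_def)
    also have "\<dots> = \<bar>\<Sum>j\<le>N. 2^j * (p j x - p j y)\<bar>" by (simp add: sum_subtractf right_diff_distrib)
    also have "(\<Sum>j\<le>N. 2^j * (p j x - p j y)) = (\<Sum>j\<in>J. 2^j * (p j x - p j y))"
      using J by (intro sum.mono_neutral_right) auto
    also have "\<bar>\<dots>\<bar> \<le> (\<Sum>j\<in>J. 2^j * dist x y)"
      using p1 by (intro order_trans[OF sum_abs] sum_mono) (auto simp: abs_mult intro!: mult_left_mono)
    finally show ?thesis by (simp add: sum_distrib_right)
  qed
  have \<eta>01: "0 \<le> \<eta> N x" "\<eta> N x \<le> 1" for N x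
    using p0 by (auto simp: \<eta>_def intro!: sum_nonneg)
  have \<eta>bs: "\<eta> N \<in> LIPbs" for N
  proof -
    have "\<eta> N \<in> LIPb" using lip_eta[of "{..N}" N] \<eta>01 by (intro LIPbI[of _ 1 "\<Sum>j\<le>N. 2^j"]) auto
    moreover have "bounded {x. \<eta> N x \<noteq> 0}"
    proof -
      obtain R where R: "\<And>a. a \<in> K 0 \<Longrightarrow> dist x0 a \<le> R"
        using compact_imp_bounded[OF K(1)[of 0]] unfolding bounded_any_center[where a = x0] by auto
      have "dist x0 x \<le> R + 2" if "\<eta> N x \<noteq> 0" for x
      proof -
        have "infdist x (K 0) < 2" using near[OF that, of 0] by simp
        then obtain a where "a \<in> K 0" "dist x a < 2" by (rule infdist_less_ex[OF K(2)])
        then show ?thesis using R[of a] dist_triangle2[of x0 x a] by linarith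
      qed
      then show ?thesis unfolding bounded_any_center[where a = x0] by auto
    qed
    ultimately show ?thesis by (simp add: LIPbs_def)
  qed
  have geo: "(\<Sum>j\<le>N. e * (1/4)^(Suc j)) \<le> e" "(\<Sum>j\<le>N. 2^j * (e * (1/4)^(Suc j))) \<le> e" for N :: nat
  proof -
    have "(\<Sum>j\<le>N. (1/2)^(Suc j)) = 1 - (1/2 :: real)^(Suc N)" by (induction N) simp_all
    then have *: "(\<Sum>j\<le>N. (1/2)^(Suc j)) \<le> (1::real)" by simp
    have "(\<Sum>j\<le>N. 2^j * (e * (1/4)^(Suc j))) \<le> (\<Sum>j\<le>N. e * (1/2)^(Suc j))"
    proof (rule sum_mono)
      fix j :: nat
      have "(2::real)^j * (1/4)^(Suc j) \<le> (1/2)^(Suc j)" by (simp add: field_simps power_mult_distrib[symmetric])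
      then show "2^j * (e * (1/4)^(Suc j)) \<le> e * (1/2)^(Suc j)"
        using e mult_left_mono[of "2^j * (1/4)^(Suc j)" "(1/2)^(Suc j)" e] by (simp add: mult.left_commute)
    qed
    also have "\<dots> = e * (\<Sum>j\<le>N. (1/2)^(Suc j))" by (simp add: sum_distrib_left)
    also have "\<dots> \<le> e * 1" using * e by (intro mult_left_mono) auto
    finally show 2: "(\<Sum>j\<le>N. 2^j * (e * (1/4)^(Suc j))) \<le> e" by simp
    have "(\<Sum>j\<le>N. e * (1/4)^(Suc j)) \<le> (\<Sum>j\<le>N. 2^j * (e * (1/4)^(Suc j)))"
    proof (rule sum_mono)
      fix j :: nat
      show "e * (1/4)^(Suc j) \<le> 2^j * (e * (1/4)^(Suc j))"
        using e mult_right_mono[of 1 "2^j" "e * (1/4)^(Suc j)"] by (simp del: power_Suc)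
    qed
    with 2 show "(\<Sum>j\<le>N. e * (1/4)^(Suc j)) \<le> e" by linarith
  qed
  have Kb: "- K j \<in> sets borel" for j using K(1) by (intro borel_open open_Compl compact_imp_closed)
  have m1: "measure \<nu> {x. \<eta> N x < 1} \<le> e" if \<nu>: "\<nu> \<in> F" for \<nu> N
  proof -
    interpret finite_measure \<nu> by (rule F(2)[OF \<nu>])
    have "{x. \<eta> N x < 1} \<subseteq> (\<Union>j\<le>N. - K j)"
    proof (rule ccontr)
      assume "\<not> ?thesis"
      then obtain x where x: "\<eta> N x < 1" "\<And>j. j \<le> N \<Longrightarrow> x \<in> K j" by auto
      then have "p j x = 0" if "j \<le> N" for j using that by (simp add: p_def)
      then have "\<eta> N x = 1" by (simp add: \<eta>_def)
      with x show False by simp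
    qed
    then have "measure \<nu> {x. \<eta> N x < 1} \<le> measure \<nu> (\<Union>j\<le>N. - K j)"
      using Kb F(3)[OF \<nu>] by (intro finite_measure_mono) auto
    also have "\<dots> \<le> (\<Sum>j\<le>N. measure \<nu> (- K j))"
      using Kb F(3)[OF \<nu>] by (intro finite_measure_subadditive_finite) auto
    also have "\<dots> \<le> (\<Sum>j\<le>N. e * (1/4)^(Suc j))" using K(3)[OF \<nu>] by (rule sum_mono)
    finally show ?thesis using geo(1)[of N] by linarith
  qed
  have m2: "(\<integral>\<^sup>+x. lip (\<eta> N) x \<partial>\<nu>) \<le> ennreal e" if \<nu>: "\<nu> \<in> F" for \<nu> N
  proof -
    interpret finite_measure \<nu> by (rule F(2)[OF \<nu>])
    have pw: "lip (\<eta> N) x \<le> (\<Sum>j\<le>N. ennreal (2^j) * indicator (- K j) x)" for x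
    proof -
      \<comment> \<open>Terms with \<open>infdist x (K j) < (1/2)^j\<close> vanish in a
        neighbourhood of \<open>x\<close> and do not contribute to the slope. For the remaining ones
        \<open>x\<close> lies outside \<open>K j\<close>.\<close>
      define J where "J = {j\<in>{..N}. (1/2)^j \<le> infdist x (K j)}"
      have ev: "\<forall>\<^sub>F y in at x. \<forall>j\<in>{..N} - J. infdist y (K j) < (1/2)^j"
      proof (intro eventually_ball_finite ballI)
        fix j assume "j \<in> {..N} - J"
        then have "infdist x (K j) < (1/2)^j" by (auto simp: J_def)
        then show "\<forall>\<^sub>F y in at x. infdist y (K j) < (1/2)^j"
          by (intro order_tendstoD(2)[of _ "infdist x (K j)"] tendsto_intros)
      qed simp
      have "lip (\<eta> N) x \<le> ennreal (\<Sum>j\<in>J. 2^j)"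
      proof (rule lip_le_ev)
        show "\<forall>\<^sub>F y in at x. \<bar>\<eta> N y - \<eta> N x\<bar> \<le> (\<Sum>j\<in>J. 2^j) * dist y x"
          using ev
        proof eventually_elim
          case (elim y)
          show ?case
          proof (rule lip_eta)
            show "p j y = 0 \<and> p j x = 0" if "j \<in> {..N} - J" for j
              using elim that by (force simp: p_def J_def)
          qed (auto simp: J_def)
        qed
      qed (simp add: sum_nonneg)
      also have "\<dots> = (\<Sum>j\<in>J. ennreal (2^j) * indicator (- K j) x)"
      proof (subst sum_ennreal[symmetric])
        have "x \<notin> K j" if "j \<in> J" for j
        proof
          assume "x \<in> K j"
          then have "infdist x (K j) = 0" by simp
          then have "(1/2 :: real)^j \<le> 0" using that by (simp add: J_def)
          moreover have "(0 :: real) < (1/2)^j" by simp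
          ultimately show False by linarith
        qed
        then show "(\<Sum>j\<in>J. ennreal (2^j)) = (\<Sum>j\<in>J. ennreal (2^j) * indicator (- K j) x)"
          by (intro sum.cong) auto
      qed simp
      also have "\<dots> \<le> (\<Sum>j\<le>N. ennreal (2^j) * indicator (- K j) x)" by (intro sum_mono2) (auto simp: J_def)
      finally show ?thesis .
    qed
    have "(\<integral>\<^sup>+x. lip (\<eta> N) x \<partial>\<nu>) \<le> (\<integral>\<^sup>+x. (\<Sum>j\<le>N. ennreal (2^j) * indicator (- K j) x) \<partial>\<nu>)"
      using pw by (rule nn_integral_mono)
    also have "\<dots> = (\<Sum>j\<le>N. ennreal (2^j) * emeasure \<nu> (- K j))"
      using Kb F(3)[OF \<nu>] by (subst nn_integral_sum) (auto simp: nn_integral_cmult_indicator)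
    also have "\<dots> \<le> (\<Sum>j\<le>N. ennreal (2^j) * ennreal (e * (1/4)^(Suc j)))"
      unfolding emeasure_eq_measure by (intro sum_mono mult_left_mono ennreal_leI K(3)[OF \<nu>]) simp
    also have "\<dots> = ennreal (\<Sum>j\<le>N. 2^j * (e * (1/4)^(Suc j)))"
      using e by (simp add: ennreal_mult[symmetric] del: power_Suc)
    also have "\<dots> \<le> ennreal e" using geo(2)[of N] by (rule ennreal_leI)
    finally show ?thesis .
  qed
  \<comment> \<open>If every \<open>N\<close> failed with the scale \<open>1 / Suc N\<close>, points
    violating goodness would accumulate, since the N-th one is close to \<open>K 0\<close> up to
    \<open>K N\<close>. Near an accumulation point goodness holds at a fixed scale, and it passes to
    smaller scales.\<close>
  have "\<exists>N r. 0 < r \<and> (\<forall>x. \<eta> N x \<noteq> 0 \<longrightarrow> good r x)"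
  proof (rule ccontr)
    assume neg: "\<not> ?thesis"
    have "\<exists>x. \<eta> N x \<noteq> 0 \<and> \<not> good (inverse (real (Suc N))) x" for N
      using neg by (metis inverse_positive_iff_positive of_nat_0_less_iff zero_less_Suc)
    then obtain x where x: "\<And>N. \<eta> N (x N) \<noteq> 0" "\<And>N. \<not> good (inverse (real (Suc N))) (x N)" by metis
    have near': "infdist (x N) (K j) < 2 * (1/2)^j" if "j \<le> N" for j N
      using near[OF x(1) that] .
    obtain l r where r: "strict_mono (r :: nat \<Rightarrow> nat)" "(\<lambda>n. x (r n)) \<longlonglongrightarrow> l"
      by (rule sequence_near_compacts_convergent[of K x, OF K(1,2) near'])
    obtain s where s: "0 < s" "\<And>y. y \<in> ball l s \<Longrightarrow> good s y" using good(2) by blast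
    have "\<forall>\<^sub>F n in sequentially. dist (x (r n)) l < s" using r(2) s(1) by (intro tendstoD) auto
    moreover have "\<forall>\<^sub>F n in sequentially. inverse (real (Suc (r n))) < s"
      using LIMSEQ_subseq_LIMSEQ[OF LIMSEQ_inverse_real_of_nat r(1)] s(1)
      by (intro order_tendstoD(2)) (auto simp: comp_def)
    ultimately have "\<forall>\<^sub>F n in sequentially. good (inverse (real (Suc (r n)))) (x (r n))"
    proof eventually_elim
      case (elim n)
      have "good s (x (r n))" using elim(1) by (intro s(2)) (simp add: dist_commute)
      then show ?case by (rule good(1)) (use elim(2) in simp_all)
    qed
    then show False using x(2) by (auto simp: eventually_sequentially)
  qed
  then obtain N r where "0 < r" "\<And>x. \<eta> N x \<noteq> 0 \<Longrightarrow> good r x" by blast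
  then show ?thesis using that[of "\<eta> N" r] \<eta>bs \<eta>01 m1 m2 by blast
qed

section \<open>Divergence tested with locally Lipschitz functions\<close>

context tangent_calculus
begin

lemma space_m: "space m = UNIV"
  using sets_eq_imp_space_eq[OF sets_m] by simp

lemma LIPbs_support:
  assumes "\<phi> \<in> LIPbs"
  obtains x :: 'a and r where "closure {x. \<phi> x \<noteq> 0} \<subseteq> ball x r"
proof -
  have "bounded (closure {x. \<phi> x \<noteq> 0})" using assms by (intro bounded_closure) (simp add: LIPbs_def)
  from bounded_subset_ballD[OF this, of undefined] that show ?thesis by blast
qed

lemma pairing_LIPbs_zero:
  assumes "\<phi> \<in> LIPbs" "v \<in> LinfTX m L" "is_pairing m T L \<iota> (d \<phi>) v h"
  shows "AE x in m. x \<notin> closure {x. \<phi> x \<noteq> 0} \<longrightarrow> h x = 0"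
  using pairing_LIPbs_bound[OF assms] by eventually_elim (auto simp: rlip_eq_0_outside)

lemma pairing_LIPbs_Linf:
  assumes \<phi>: "\<phi> \<in> LIPbs" and v: "v \<in> LinfTX m L" and pair: "is_pairing m T L \<iota> (d \<phi>) v h"
  shows "h \<in> Linf m"
proof -
  obtain K where K: "\<And>x. rlip \<phi> x \<le> K" using LIPb_rlip_bounded[OF LIPbs_LIPb[OF \<phi>]] by blast
  have "AE x in m. \<bar>h x\<bar> \<le> LinfTX_norm m L v * K"
    using pairing_LIPbs_bound[OF assms] by eventually_elim (meson K LinfTX_norm_AE(1)[OF v] mult_left_mono order_trans)
  then show ?thesis using pair by (auto simp: Linf_def is_pairing_def)
qed

text \<open>The function is the divergence of the field \<open>fmul L \<phi> v\<close>. It is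
  bounded and vanishes almost everywhere outside a ball, which makes it integrable even if
  \<open>m\<close> is infinite.\<close>

lemma integrable_cutoff_divergence:
  assumes \<phi>: "\<phi> \<in> LIPbs" and v: "v \<in> LinfTX m L" and \<gamma>: "\<gamma> \<in> Linf m" and pair: "is_pairing m T L \<iota> (d \<phi>) v h"
  shows "integrable m (\<lambda>x. \<phi> x * \<gamma> x + h x)" "(\<lambda>x. \<phi> x * \<gamma> x + h x) \<in> Linf m"
    "AE x in m. x \<notin> closure {x. \<phi> x \<noteq> 0} \<longrightarrow> \<phi> x * \<gamma> x + h x = 0"
proof -
  obtain A where A: "\<And>x. \<bar>\<phi> x\<bar> \<le> A" using LIPbs_LIPb[OF \<phi>] by (elim LIPbE) blast
  then have \<phi>L: "\<phi> \<in> Linf m" using LIPb_measurable[OF LIPbs_LIPb[OF \<phi>]] by (auto simp: Linf_def)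
  show L: "(\<lambda>x. \<phi> x * \<gamma> x + h x) \<in> Linf m"
    by (intro Linf_add Linf_mult \<phi>L \<gamma> pairing_LIPbs_Linf[OF \<phi> v pair])
  have z: "\<phi> x = 0" if "x \<notin> closure {x. \<phi> x \<noteq> 0}" for x
    using that closure_subset[of "{x. \<phi> x \<noteq> 0}"] by auto
  show AE0: "AE x in m. x \<notin> closure {x. \<phi> x \<noteq> 0} \<longrightarrow> \<phi> x * \<gamma> x + h x = 0"
    using pairing_LIPbs_zero[OF \<phi> v pair]
  proof eventually_elim
    case (elim x)
    show ?case
    proof
      assume n: "x \<notin> closure {x. \<phi> x \<noteq> 0}"
      show "\<phi> x * \<gamma> x + h x = 0" using z[OF n] elim n by simp
    qed
  qed
  obtain x r where B: "closure {x. \<phi> x \<noteq> 0} \<subseteq> ball x r"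
    using LIPbs_support[OF \<phi>] .
  have [measurable]: "ball x r \<in> sets m" by (simp add: sets_m)
  have "integrable m (\<lambda>y. (\<phi> y * \<gamma> y + h y) * indicator (ball x r) y)"
    using finite_on_balls[of x r] by (intro integrable_Linf_mult[OF L] integrable_real_indicator) auto
  then show "integrable m (\<lambda>x. \<phi> x * \<gamma> x + h x)"
  proof (rule integrable_cong_AE[THEN iffD1, rotated -1])
    show "AE y in m. (\<phi> y * \<gamma> y + h y) * indicator (ball x r) y = \<phi> y * \<gamma> y + h y"
      using AE0 by eventually_elim (use B in \<open>auto simp: indicator_def\<close>)
  qed (use Linf_measurable[OF L] in auto)
qed

text \<open>For locally Lipschitz \<open>u\<close> the formula is obtained by testing with \<open>u * \<eta>\<close>, for cut-offs \<open>\<eta>\<close>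
  supported where \<open>u\<close> is uniformly Lipschitz.\<close>
lemma divergence_LIPloc_bound:
  assumes v: "v \<in> LinfTX m L" and div: "is_divergence m T d L \<iota> v \<gamma>"
    and \<phi>: "\<phi> \<in> LIPbs" "\<And>x. 0 \<le> \<phi> x" and pair: "is_pairing m T L \<iota> (d \<phi>) v h"
    and u: "u \<in> LIPloc UNIV" "\<And>x. \<bar>u x\<bar> \<le> C"
  shows "ennreal \<bar>\<integral>x. u x * (\<phi> x * \<gamma> x + h x) \<partial>m\<bar> \<le>
    ennreal (LinfTX_norm m L v) * (\<integral>\<^sup>+x. ennreal (\<phi> x) * lip u x \<partial>m)"
proof (rule ennreal_le_epsilon)
  fix \<delta> :: real assume \<delta>: "0 < \<delta>"
  define \<Gamma> where "\<Gamma> x = \<phi> x * \<gamma> x + h x" for x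
  let ?V = "LinfTX_norm m L v"
  have V0: "0 \<le> ?V" by (rule LinfTX_norm_AE(1)[OF v])
  have el: "v \<in> elems L" using v by (simp add: LinfTX_def)
  note \<phi>b = LIPbs_LIPb[OF \<phi>(1)]
  have \<gamma>: "\<gamma> \<in> Linf m" using div by (simp add: is_divergence_def)
  have \<Gamma>: "integrable m \<Gamma>" "\<Gamma> \<in> Linf m" "AE x in m. x \<notin> closure {x. \<phi> x \<noteq> 0} \<longrightarrow> \<Gamma> x = 0"
    using integrable_cutoff_divergence[OF \<phi>(1) v \<gamma> pair] unfolding \<Gamma>_def by auto
  obtain G where G: "0 \<le> G" "AE x in m. \<bar>\<Gamma> x\<bar> \<le> G" using \<Gamma>(2) by (rule LinfE)
  obtain A where A: "0 \<le> A" "\<And>x. \<bar>\<phi> x\<bar> \<le> A" using \<phi>b by (elim LIPbE) blast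
  have C0: "0 \<le> C" using order_trans[OF abs_ge_zero u(2)] .
  obtain x0 R where B: "closure {x. \<phi> x \<noteq> 0} \<subseteq> ball x0 R"
    using LIPbs_support[OF \<phi>(1)] .
  let ?B = "ball x0 R"
  have Bm [measurable]: "?B \<in> sets m" by (simp add: sets_m)
  have \<phi>B: "\<phi> x \<le> A * indicator ?B x" for x
  proof (cases "x \<in> ?B")
    case True
    then show ?thesis using A(2)[of x] by simp
  next
    case False
    then have "x \<notin> {x. \<phi> x \<noteq> 0}" using B closure_subset[of "{x. \<phi> x \<noteq> 0}"] by blast
    then show ?thesis using False by simp
  qed
  \<comment> \<open>\<open>compact_cutoff\<close> requires finite measures; \<open>m\<close> is
    restricted to a ball that contains the support of \<phi>.\<close>
  define \<nu> where "\<nu> = density m (indicator ?B)"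
  have \<nu>: "finite_measure \<nu>" "sets \<nu> = sets borel"
  proof -
    show "finite_measure \<nu>"
      using finite_on_balls[of x0 R]
      by (intro finite_measureI) (auto simp: \<nu>_def emeasure_density nn_integral_cmult_indicator[of _ m 1, simplified]
          intro!: order.strict_implies_not_eq cong: nn_integral_cong)
    show "sets \<nu> = sets borel" by (simp add: \<nu>_def sets_m)
  qed
  interpret \<nu>: finite_measure \<nu> by (rule \<nu>(1))
  \<comment> \<open>Two errors have to fit into \<delta>: \<open>?V * C * A * e\<close> from the
    slope of the cut-off, and \<open>C * G * e\<close> from the set where the cut-off is less than
    1.\<close>
  define e where "e = \<delta> / (?V * C * A + C * G + 1)"
  have e: "0 < e" "(?V * C * A + C * G) * e \<le> \<delta>"
  proof -
    have D: "0 \<le> ?V * C * A + C * G" using V0 C0 A(1) G(1) by simp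
    then show "0 < e" using \<delta> unfolding e_def by (intro divide_pos_pos) auto
    show "(?V * C * A + C * G) * e \<le> \<delta>" using D \<delta> unfolding e_def by (simp add: field_simps)
  qed
  \<comment> \<open>One parameter is both the radius and the inverse Lipschitz constant. The
    property thus becomes weaker as \<open>r\<close> decreases, as \<open>compact_cutoff\<close>
    demands.\<close>
  define good where "good r x \<longleftrightarrow> (\<forall>y\<in>ball x r. \<forall>z\<in>ball x r. \<bar>u y - u z\<bar> \<le> dist y z / r)" for r and x :: 'a
  obtain \<eta> r where \<eta>: "\<eta> \<in> LIPbs" "\<And>x. 0 \<le> \<eta> x" "\<And>x. \<eta> x \<le> 1" and r: "0 < r" "\<And>x. \<eta> x \<noteq> 0 \<Longrightarrow> good r x"
    and \<eta>m: "measure \<nu> {x. \<eta> x < 1} \<le> e" and \<eta>l: "(\<integral>\<^sup>+x. lip \<eta> x \<partial>\<nu>) \<le> ennreal e"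
  proof (rule compact_cutoff[of "{\<nu>}" good e])
    show "good r x" if "good s x" "0 < r" "r \<le> s" for r s x
      unfolding good_def
    proof (intro ballI)
      fix y z assume "y \<in> ball x r" "z \<in> ball x r"
      then have "\<bar>u y - u z\<bar> \<le> dist y z / s" using that unfolding good_def by (metis mem_ball order_less_le_trans)
      also have "\<dots> \<le> dist y z / r" using that by (intro divide_left_mono) auto
      finally show "\<bar>u y - u z\<bar> \<le> dist y z / r" .
    qed
    show "\<exists>s>0. \<forall>y\<in>ball x s. good s y" for x
    proof -
      obtain \<rho> K where \<rho>: "0 < \<rho>" "0 \<le> K" "\<And>y z. y \<in> ball x \<rho> \<Longrightarrow> z \<in> ball x \<rho> \<Longrightarrow> \<bar>u y - u z\<bar> \<le> K * dist y z"
        using LIPlocE[OF u(1)] by metis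
      \<comment> \<open>Half of \<rho> keeps the balls around nearby centres inside
        \<open>ball x \<rho>\<close>; the second bound makes \<open>1 / s\<close> at least
        \<open>K + 1\<close>.\<close>
      define s where "s = min (\<rho> / 2) (1 / (K + 1))"
      have s: "0 < s" "s \<le> \<rho> / 2" "s \<le> 1 / (K + 1)" using \<rho>(1,2) by (auto simp: s_def)
      have "good s y" if y: "y \<in> ball x s" for y
        unfolding good_def
      proof (intro ballI)
        fix p q assume pq: "p \<in> ball y s" "q \<in> ball y s"
        have "ball y s \<subseteq> ball x \<rho>"
        proof
          fix t assume "t \<in> ball y s"
          then show "t \<in> ball x \<rho>" using y s(2) dist_triangle[of x t y] by simp
        qed
        then have "\<bar>u p - u q\<bar> \<le> K * dist p q" using \<rho>(3) pq by blast
        also have "\<dots> \<le> (K + 1) * dist p q" by (intro mult_right_mono) auto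
        also have "\<dots> \<le> (1 / s) * dist p q"
        proof (rule mult_right_mono)
          have "s * (K + 1) \<le> 1" using s(3) \<rho>(2) by (simp add: field_simps)
          then show "K + 1 \<le> 1 / s" using s(1) by (simp add: field_simps)
        qed simp
        finally show "\<bar>u p - u q\<bar> \<le> dist p q / s" by simp
      qed
      then show ?thesis using s(1) by blast
    qed
  qed (use \<nu> e in auto)
  have [measurable]: "u \<in> borel_measurable m" "\<eta> \<in> borel_measurable m" "\<phi> \<in> borel_measurable m" "\<Gamma> \<in> borel_measurable m"
    using LIPloc_continuous[OF u(1)] LIPb_measurable[OF LIPbs_LIPb[OF \<eta>(1)]] LIPb_measurable[OF \<phi>b] Linf_measurable[OF \<Gamma>(2)]
      borel_measurable_continuous_onI[of u] measurable_cong_sets[OF sets_m refl] by blast+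
  have lm [measurable]: "lip u \<in> borel_measurable m" "lip \<eta> \<in> borel_measurable m"
    using lip_measurable[OF LIPloc_continuous[OF u(1)]] lip_measurable[OF LIPb_continuous[OF LIPbs_LIPb[OF \<eta>(1)]]] by auto
  define w where "w x = u x * \<eta> x" for x
  have w: "w \<in> LIPbs"
  proof -
    obtain K where K: "0 \<le> K" "\<And>x y. \<bar>\<eta> x - \<eta> y\<bar> \<le> K * dist x y" using LIPbs_LIPb[OF \<eta>(1)] by (elim LIPbE) blast
    have wC: "\<bar>w x\<bar> \<le> C" for x
      using u(2)[of x] \<eta>(2,3)[of x] mult_mono[of "\<bar>u x\<bar>" C "\<bar>\<eta> x\<bar>" 1] C0 by (simp add: w_def abs_mult)
    \<comment> \<open>Close points are compared by the product rule, with the constant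
      \<open>1 / r\<close> for \<open>u\<close> near \<open>x\<close>. Points at distance at least
      \<open>r\<close> are compared by the bound \<open>C\<close> on \<open>w\<close>, which is the
      origin of the summand \<open>2 * C / r\<close>.\<close>
    have est: "\<bar>w x - w y\<bar> \<le> (1 / r + C * K + 2 * C / r) * dist x y" if "\<eta> x \<noteq> 0" for x y
    proof (cases "dist x y < r")
      case True
      have "\<bar>u x - u y\<bar> \<le> dist x y / r"
        using r(2)[OF that] True r(1) unfolding good_def by auto
      then have 1: "\<bar>(u x - u y) * \<eta> x\<bar> \<le> dist x y / r"
        using \<eta>(2,3)[of x] mult_mono[of "\<bar>u x - u y\<bar>" "dist x y / r" "\<bar>\<eta> x\<bar>" 1] r(1) by (simp add: abs_mult)
      have 2: "\<bar>u y * (\<eta> x - \<eta> y)\<bar> \<le> C * (K * dist x y)"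
        using u(2)[of y] K(2)[of x y] C0 unfolding abs_mult by (intro mult_mono) auto
      have "w x - w y = (u x - u y) * \<eta> x + u y * (\<eta> x - \<eta> y)" by (simp add: w_def algebra_simps)
      then have "\<bar>w x - w y\<bar> \<le> dist x y / r + C * (K * dist x y)" using 1 2 by linarith
      also have "\<dots> \<le> (1 / r + C * K + 2 * C / r) * dist x y" using C0 r(1) by (simp add: distrib_right)
      finally show ?thesis .
    next
      case False
      have "\<bar>w x - w y\<bar> \<le> 2 * C" using wC[of x] wC[of y] by linarith
      also have "\<dots> = 2 * C * 1" by simp
      also have "\<dots> \<le> 2 * C * (dist x y / r)" using False r(1) C0 by (intro mult_left_mono) auto
      also have "\<dots> \<le> (1 / r + C * K + 2 * C / r) * dist x y"
        using C0 K(1) r(1) by (simp add: distrib_right)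
      finally show ?thesis .
    qed
    have "\<bar>w x - w y\<bar> \<le> (1 / r + C * K + 2 * C / r) * dist x y" for x y
    proof (cases "\<eta> x = 0 \<and> \<eta> y = 0")
      case True
      then show ?thesis using C0 K(1) r(1) by (simp add: w_def)
    next
      case False
      then show ?thesis using est[of x y] est[of y x] by (auto simp: dist_commute abs_minus_commute)
    qed
    then have "w \<in> LIPb" using wC by (intro LIPbI)
    moreover have "bounded {x. w x \<noteq> 0}"
      using \<eta>(1) by (auto simp: LIPbs_def w_def elim: bounded_subset)
    ultimately show ?thesis by (simp add: LIPbs_def)
  qed
  have lipw: "lip w x \<le> lip u x + ennreal C * lip \<eta> x" for x
  proof -
    have "lip w x \<le> ennreal \<bar>u x\<bar> * lip \<eta> x + ennreal \<bar>\<eta> x\<bar> * lip u x"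
      unfolding w_def using LIPbs_LIPb[OF \<eta>(1)]
      by (intro lip_mult LIPloc_isCont u LIPb_isCont LIPloc_lip_finite LIPb_lip_finite)
    also have "\<dots> \<le> ennreal C * lip \<eta> x + 1 * lip u x"
      using u(2)[of x] \<eta>(2,3)[of x] by (intro add_mono mult_right_mono) (auto intro: ennreal_leI)
    finally show ?thesis by (simp add: add.commute)
  qed
  \<comment> \<open>By the Leibniz rule \<open>\<Gamma>\<close> is the divergence of
    \<open>fmul L \<phi> v\<close>, and \<open>w\<close> is admissible as a test function, which
    \<open>u\<close> in general is not.\<close>
  obtain h' where h': "is_pairing m T L \<iota> (d w) (fmul L \<phi> v) h'" "integrable m h'" "(\<integral>x. h' x \<partial>m) = - (\<integral>x. w x * \<Gamma> x \<partial>m)"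
    using divergence_pairing_LIPbs[OF is_divergence_fmul[OF \<phi>(1) v div pair] w] unfolding \<Gamma>_def by blast
  have h'b: "AE x in m. ennreal \<bar>h' x\<bar> \<le> ennreal ?V * (ennreal (\<phi> x) * lip w x)"
  proof -
    have e2: "fmul L \<phi> v \<in> elems L" using LIPb_measurable[OF \<phi>b] el by (rule fmul_closed)
    have e1: "d w \<in> elems T" by (rule cot.d_elems[OF LIPbs_W12[OF w]])
    show ?thesis
      using pairing_bound[OF h'(1) e1 e2] pnorm_fmul[OF LIPb_measurable[OF \<phi>b] el] LinfTX_norm_AE(2)[OF v]
        pnorm_d_le_rlip[OF w] cot.pnorm_nonneg[OF e1]
    proof eventually_elim
      case (elim x)
      have "\<bar>h' x\<bar> \<le> (\<phi> x * ?V) * rlip w x"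
        using elim \<phi>(2)[of x] V0 by (auto intro!: order_trans[OF elim(1)] mult_mono mult_left_mono)
      then have "ennreal \<bar>h' x\<bar> \<le> ennreal ((\<phi> x * ?V) * rlip w x)" by (rule ennreal_leI)
      also have "\<dots> = ennreal ?V * (ennreal (\<phi> x) * lip w x)"
        using \<phi>(2)[of x] V0 LIPb_lip_finite[OF LIPbs_LIPb[OF w], of x] by (simp add: ennreal_mult mult_ac)
      finally show ?case .
    qed
  qed
  have "ennreal \<bar>\<integral>x. w x * \<Gamma> x \<partial>m\<bar> = ennreal \<bar>\<integral>x. h' x \<partial>m\<bar>" using h'(3) by simp
  also have "\<dots> \<le> ennreal (\<integral>x. \<bar>h' x\<bar> \<partial>m)" by (intro ennreal_leI integral_abs_bound)
  also have "\<dots> = (\<integral>\<^sup>+x. ennreal \<bar>h' x\<bar> \<partial>m)" using h'(2) by (intro nn_integral_eq_integral[symmetric]) auto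
  also have "\<dots> \<le> (\<integral>\<^sup>+x. ennreal ?V * (ennreal (\<phi> x) * lip w x) \<partial>m)" using h'b by (rule nn_integral_mono_AE)
  also have "\<dots> \<le> (\<integral>\<^sup>+x. ennreal ?V * (ennreal (\<phi> x) * lip u x) + ennreal (?V * C * A) * (lip \<eta> x * indicator ?B x) \<partial>m)"
  proof (rule nn_integral_mono)
    fix x
    have "ennreal (\<phi> x) * lip w x \<le> ennreal (\<phi> x) * (lip u x + ennreal C * lip \<eta> x)" using lipw by (intro mult_left_mono) auto
    also have "\<dots> = ennreal (\<phi> x) * lip u x + ennreal (\<phi> x) * (ennreal C * lip \<eta> x)" by (simp add: distrib_left)
    also have "\<dots> \<le> ennreal (\<phi> x) * lip u x + ennreal (A * indicator ?B x) * (ennreal C * lip \<eta> x)"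
      using \<phi>B[of x] by (intro add_left_mono mult_right_mono ennreal_leI) auto
    also have "ennreal (A * indicator ?B x) * (ennreal C * lip \<eta> x) = ennreal (C * A) * (lip \<eta> x * indicator ?B x)"
      using A(1) C0 by (auto simp: indicator_def ennreal_mult mult_ac)
    finally have "ennreal ?V * (ennreal (\<phi> x) * lip w x) \<le> ennreal ?V * (ennreal (\<phi> x) * lip u x + ennreal (C * A) * (lip \<eta> x * indicator ?B x))"
      by (intro mult_left_mono) auto
    then show "ennreal ?V * (ennreal (\<phi> x) * lip w x) \<le> ennreal ?V * (ennreal (\<phi> x) * lip u x) + ennreal (?V * C * A) * (lip \<eta> x * indicator ?B x)"
      using V0 A(1) C0 by (simp add: distrib_left ennreal_mult mult_ac)
  qed
  also have "\<dots> = ennreal ?V * (\<integral>\<^sup>+x. ennreal (\<phi> x) * lip u x \<partial>m) + ennreal (?V * C * A) * (\<integral>\<^sup>+x. lip \<eta> x * indicator ?B x \<partial>m)"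
    by (simp add: nn_integral_add nn_integral_cmult)
  also have "(\<integral>\<^sup>+x. lip \<eta> x * indicator ?B x \<partial>m) = (\<integral>\<^sup>+x. lip \<eta> x \<partial>\<nu>)"
    unfolding \<nu>_def by (simp add: nn_integral_density mult.commute)
  also have "ennreal (?V * C * A) * (\<integral>\<^sup>+x. lip \<eta> x \<partial>\<nu>) \<le> ennreal (?V * C * A) * ennreal e" using \<eta>l by (rule mult_left_mono) simp
  finally have first: "ennreal \<bar>\<integral>x. w x * \<Gamma> x \<partial>m\<bar> \<le> ennreal ?V * (\<integral>\<^sup>+x. ennreal (\<phi> x) * lip u x \<partial>m) + ennreal (?V * C * A * e)"
    using V0 C0 A(1) e(1) by (simp add: ennreal_mult add_left_mono)
  have uL: "u \<in> Linf m" using u(2) by (auto simp: Linf_def)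
  have wL: "w \<in> Linf m" using LIPbs_LIPb[OF w] LIPb_measurable[OF LIPbs_LIPb[OF w]] by (elim LIPbE) (auto simp: Linf_def)
  have i: "integrable m (\<lambda>x. u x * \<Gamma> x)" "integrable m (\<lambda>x. w x * \<Gamma> x)"
    by (intro integrable_Linf_mult uL wL \<Gamma>(1))+
  have "\<bar>(\<integral>x. u x * \<Gamma> x \<partial>m) - (\<integral>x. w x * \<Gamma> x \<partial>m)\<bar> = \<bar>\<integral>x. u x * \<Gamma> x - w x * \<Gamma> x \<partial>m\<bar>" using i by simp
  also have "\<dots> \<le> (\<integral>x. \<bar>u x * \<Gamma> x - w x * \<Gamma> x\<bar> \<partial>m)" by (rule integral_abs_bound)
  also have "\<dots> \<le> (\<integral>x. (C * G) * indicator ({x. \<eta> x < 1} \<inter> ?B) x \<partial>m)"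
  proof (rule integral_mono_AE)
    have S: "{x. \<eta> x < 1} \<inter> ?B \<in> sets m"
    proof -
      have "{x. \<eta> x < 1} \<inter> ?B = {x\<in>space m. \<eta> x < 1} \<inter> ?B" using sets_eq_imp_space_eq[OF sets_m] by auto
      then show ?thesis by simp
    qed
    have "emeasure m ({x. \<eta> x < 1} \<inter> ?B) \<le> emeasure m ?B" by (intro emeasure_mono) auto
    then have "emeasure m ({x. \<eta> x < 1} \<inter> ?B) < \<infinity>" using finite_on_balls[of x0 R] by (rule order_le_less_trans)
    with S show "integrable m (\<lambda>x. (C * G) * indicator ({x. \<eta> x < 1} \<inter> ?B) x)"
      by (intro integrable_mult_right integrable_real_indicator)
    show "AE x in m. \<bar>u x * \<Gamma> x - w x * \<Gamma> x\<bar> \<le> (C * G) * indicator ({x. \<eta> x < 1} \<inter> ?B) x"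
      using G(2) \<Gamma>(3)
    proof eventually_elim
      case (elim x)
      show ?case
      proof (cases "x \<in> {x. \<eta> x < 1} \<inter> ?B")
        case True
        have "\<bar>1 - \<eta> x\<bar> \<le> 1" using \<eta>(2,3)[of x] by simp
        then have "\<bar>u x\<bar> * \<bar>1 - \<eta> x\<bar> * \<bar>\<Gamma> x\<bar> \<le> C * 1 * G" using u(2)[of x] elim(1) C0 G(1) by (intro mult_mono) auto
        moreover have "u x * \<Gamma> x - w x * \<Gamma> x = u x * (1 - \<eta> x) * \<Gamma> x" by (simp add: w_def algebra_simps)
        ultimately show ?thesis using True by (simp add: abs_mult)
      next
        case False
        then have "\<eta> x = 1 \<or> x \<notin> closure {x. \<phi> x \<noteq> 0}" using \<eta>(3)[of x] B by force
        then have "u x * \<Gamma> x - w x * \<Gamma> x = 0" using elim(2) by (auto simp: w_def)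
        then show ?thesis using False by simp
      qed
    qed
  qed (use i in auto)
  also have "\<dots> = C * G * measure m ({x. \<eta> x < 1} \<inter> ?B)" by (simp add: space_m)
  also have "measure m ({x. \<eta> x < 1} \<inter> ?B) = measure \<nu> {x. \<eta> x < 1}"
  proof -
    have "{x. \<eta> x < 1} = {x\<in>space m. \<eta> x < 1}" using sets_eq_imp_space_eq[OF sets_m] by auto
    then have S: "{x. \<eta> x < 1} \<in> sets m" by simp
    have "emeasure \<nu> {x. \<eta> x < 1} = (\<integral>\<^sup>+x. indicator ?B x * indicator {x. \<eta> x < 1} x \<partial>m)"
      unfolding \<nu>_def by (rule emeasure_density) (use S in auto)
    also have "\<dots> = (\<integral>\<^sup>+x. indicator ({x. \<eta> x < 1} \<inter> ?B) x \<partial>m)"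
      by (rule nn_integral_cong) (auto simp: indicator_def)
    also have "\<dots> = emeasure m ({x. \<eta> x < 1} \<inter> ?B)" using S by (intro nn_integral_indicator sets.Int Bm)
    finally show ?thesis by (simp add: measure_def)
  qed
  also have "C * G * measure \<nu> {x. \<eta> x < 1} \<le> C * G * e" using \<eta>m C0 G(1) by (intro mult_left_mono) auto
  finally have "\<bar>\<integral>x. u x * \<Gamma> x \<partial>m\<bar> \<le> \<bar>\<integral>x. w x * \<Gamma> x \<partial>m\<bar> + C * G * e" by linarith
  then have "ennreal \<bar>\<integral>x. u x * \<Gamma> x \<partial>m\<bar> \<le> ennreal \<bar>\<integral>x. w x * \<Gamma> x \<partial>m\<bar> + ennreal (C * G * e)"
    using C0 G(1) e(1) by (simp add: ennreal_plus[symmetric] ennreal_leI del: ennreal_plus)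
  also have "\<dots> \<le> ennreal ?V * (\<integral>\<^sup>+x. ennreal (\<phi> x) * lip u x \<partial>m) + ennreal (?V * C * A * e) + ennreal (C * G * e)"
    using first by (rule add_right_mono)
  also have "\<dots> = ennreal ?V * (\<integral>\<^sup>+x. ennreal (\<phi> x) * lip u x \<partial>m) + ennreal ((?V * C * A + C * G) * e)"
    using V0 C0 A(1) G(1) e(1) by (simp add: add.assoc ennreal_plus[symmetric] distrib_right del: ennreal_plus)
  also have "\<dots> \<le> ennreal ?V * (\<integral>\<^sup>+x. ennreal (\<phi> x) * lip u x \<partial>m) + ennreal \<delta>"
    using e(2) by (intro add_left_mono ennreal_leI)
  finally show "ennreal \<bar>\<integral>x. u x * (\<phi> x * \<gamma> x + h x) \<partial>m\<bar> \<le> ennreal ?V * (\<integral>\<^sup>+x. ennreal (\<phi> x) * lip u x \<partial>m) + ennreal \<delta>"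
    by (simp add: \<Gamma>_def)
qed

end

lemma clamp_lipschitz: "\<bar>max a (min b s) - max a (min b t)\<bar> \<le> \<bar>s - t\<bar>" for a b s t :: real
  by (auto simp: max_def min_def abs_if)

lemma clamp_abs_le: "\<bar>max (- a) (min a s)\<bar> \<le> a" if "0 \<le> a" for a s :: real
proof -
  have "- a \<le> max (- a) (min a s)" by (rule max.cobounded1)
  moreover have "max (- a) (min a s) \<le> a" using that by (intro max.boundedI) auto
  ultimately show ?thesis by (simp add: abs_le_iff)
qed

lemma clamp_square_lipschitz:
  fixes a s t :: real
  assumes "0 \<le> a"
  shows "\<bar>(max (- a) (min a s))\<^sup>2 - (max (- a) (min a t))\<^sup>2\<bar> \<le> 2 * a * \<bar>s - t\<bar>"
proof -
  define c where "c u = max (- a) (min a u)" for u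
  have 1: "\<bar>c s + c t\<bar> \<le> 2 * a"
    using clamp_abs_le[OF assms, of s] clamp_abs_le[OF assms, of t] unfolding c_def[symmetric] by linarith
  have 2: "\<bar>c s - c t\<bar> \<le> \<bar>s - t\<bar>" unfolding c_def by (rule clamp_lipschitz)
  have "(c s)\<^sup>2 - (c t)\<^sup>2 = (c s + c t) * (c s - c t)" by (simp add: power2_eq_square algebra_simps)
  then have "\<bar>(c s)\<^sup>2 - (c t)\<^sup>2\<bar> \<le> 2 * a * \<bar>s - t\<bar>"
    using mult_mono[OF 1 2] assms by (simp add: abs_mult)
  then show ?thesis unfolding c_def .
qed

lemma real_le_zero_from_small:
  fixes x K :: real
  assumes "\<And>e. 0 < e \<Longrightarrow> x \<le> K * e" "0 \<le> K"
  shows "x \<le> 0"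
proof (rule ccontr)
  assume "\<not> x \<le> 0"
  then have x: "0 < x" by simp
  define e where "e = x / (2 * (K + 1))"
  have e: "0 < e" using x assms(2) by (simp add: e_def)
  have "K * e < x"
  proof -
    have "K * e \<le> (K + 1) * e" using e by simp
    also have "\<dots> = x / 2" using assms(2) by (simp add: e_def field_simps)
    finally show ?thesis using x by simp
  qed
  then show False using assms(1)[OF e] by simp
qed

section \<open>Partition of unity and the chain rule\<close>

context tangent_calculus
begin

lemma pairing_add:
  assumes \<phi>: "\<phi> \<in> LIPbs" "\<psi> \<in> LIPbs" and v: "v \<in> elems L"
    and p: "is_pairing m T L \<iota> (d \<phi>) v h1" "is_pairing m T L \<iota> (d \<psi>) v h2"
      "is_pairing m T L \<iota> (d (\<lambda>x. \<phi> x + \<psi> x)) v h3"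
  shows "AE x in m. h3 x = h1 x + h2 x"
proof -
  have W: "\<phi> \<in> W12 m" "\<psi> \<in> W12 m" "(\<lambda>x. \<phi> x + \<psi> x) \<in> W12 m"
    using \<phi> LIPbs_add[OF \<phi>] by (auto intro: LIPbs_W12)
  have "AE x in m. h3 x = 1 * h1 x + 1 * h2 x"
  proof (rule pairing_linear[OF p cot.d_elems[OF W(1)] cot.d_elems[OF W(2)] cot.d_elems[OF W(3)] v])
    fix X assume X: "X \<in> module_dual m T"
    have "d (\<lambda>x. \<phi> x + \<psi> x) = 1 *\<^sub>R d \<phi> + 1 *\<^sub>R d \<psi>" using cot.d_linear[OF W(1,2), of 1 1] by simp
    then show "AE x in m. X (d (\<lambda>x. \<phi> x + \<psi> x)) x = 1 * X (d \<phi>) x + 1 * X (d \<psi>) x"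
      using module_dual_comb[OF X cot.d_elems[OF W(1)] cot.d_elems[OF W(2)], of 1 1] by simp
  qed
  then show ?thesis by simp
qed

lemma LIPbs_zero: "(\<lambda>_. 0) \<in> LIPbs"
  by (simp add: LIPbs_def LIPb_const)

lemma LIPbs_sum: "(\<And>k. k < n \<Longrightarrow> \<theta> k \<in> LIPbs) \<Longrightarrow> (\<lambda>x. \<Sum>k<n. \<theta> k x) \<in> LIPbs" for n :: nat
  by (induction n) (auto intro: LIPbs_zero LIPbs_add)

text \<open>The pairing with each partial sum is supplied by the divergence of \<open>v\<close>. For
  the empty sum the pairing is 0 because the zero function has slope 0.\<close>

lemma pairing_sum:
  fixes n :: nat
  assumes \<theta>: "\<And>k. k < n \<Longrightarrow> \<theta> k \<in> LIPbs" and v: "v \<in> LinfTX m L" and div: "is_divergence m T d L \<iota> v \<gamma>"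
    and h: "\<And>k. k < n \<Longrightarrow> is_pairing m T L \<iota> (d (\<theta> k)) v (h k)"
    and h': "is_pairing m T L \<iota> (d (\<lambda>x. \<Sum>k<n. \<theta> k x)) v h'"
  shows "AE x in m. h' x = (\<Sum>k<n. h k x)"
  using \<theta> h h'
proof (induction n arbitrary: h')
  case 0
  have "AE x in m. \<bar>h' x\<bar> \<le> LinfTX_norm m L v * rlip (\<lambda>_. 0) x"
    using 0 by (intro pairing_LIPbs_bound[OF LIPbs_zero v]) simp
  then show ?case by simp
next
  case (Suc n)
  have S: "(\<lambda>x. \<Sum>k<n. \<theta> k x) \<in> LIPbs" using Suc.prems(1) by (intro LIPbs_sum) simp
  obtain g where g: "is_pairing m T L \<iota> (d (\<lambda>x. \<Sum>k<n. \<theta> k x)) v g"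
    using divergence_pairing_LIPbs[OF div S] by blast
  have "AE x in m. g x = (\<Sum>k<n. h k x)" using Suc.prems(1,2) g by (intro Suc.IH) auto
  moreover have "AE x in m. h' x = g x + h n x"
    using Suc.prems v by (intro pairing_add[OF S _ _ g]) (auto simp: LinfTX_def)
  ultimately show ?case by eventually_elim simp
qed

lemma Ddiv_test_module: "v \<in> Ddiv m T d L \<iota> \<Longrightarrow> v \<in> test_module m T d L \<iota>"
  using fmul_const[OF Ddiv_elems, of v 1] unfolding test_module_def
  by (intro CollectI exI[of _ "1::nat"] exI[of _ "\<lambda>_ _. 1"] exI[of _ "\<lambda>_. v"]) (auto intro: const_bcontfun)

lemma test_module_measure:
  assumes "is_BV_differential m T d L \<iota> f N"
  shows "local_vector_measure_on (test_module m T d L \<iota>) (LinfTX_norm m L) (fmul L) N"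
  using assms normed_Cb_module_test_module
  by (intro local_vector_measure_on.intro local_vector_measure_on_axioms.intro) (auto simp: is_BV_differential_def)

text \<open>The proof localises with a partition of unity \<open>\<theta> k\<close> on whose supports \<open>f\<close> is within
  \<open>2 * \<epsilon>\<close> of a constant \<open>c k\<close>, and writes \<open>f\<^sup>2 = 2 * c k * f - (c k)\<^sup>2 + (f - c k)\<^sup>2\<close> there. The last term,
  truncated, is \<open>4 * \<epsilon>\<close>-Lipschitz in \<open>f\<close>. For the supports to be small in this sense \<open>\<theta> k\<close> is a
  function of the Lipschitz regularisation \<open>F\<close> of \<open>f\<close>.\<close>
theorem chain_rule_square:
  assumes f: "f \<in> bcontfun" "integrable m f"
    and u: "\<And>n. u n \<in> LIPloc UNIV" "\<And>n. integrable m (u n)" "(\<lambda>n. \<integral>\<^sup>+x. ennreal \<bar>u n x - f x\<bar> \<partial>m) \<longlonglongrightarrow> 0"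
      "\<And>n. (\<integral>\<^sup>+x. lip (u n) x \<partial>m) \<le> ennreal C" and C: "0 \<le> C"
    and N: "is_BV_differential m T d L \<iota> f N" and v: "v \<in> Ddiv m T d L \<iota>" and div: "is_divergence m T d L \<iota> v \<gamma>"
  shows "(\<integral>x. (f x)\<^sup>2 * \<gamma> x \<partial>m) = - 2 * signed_measure.integral_signed (\<lambda>A. N A v) f"
proof -
  interpret lv: local_vector_measure_on "test_module m T d L \<iota>" "LinfTX_norm m L" "fmul L" N
    by (rule test_module_measure[OF N])
  let ?V = "LinfTX_norm m L v" and ?I = "lv.sm.integral_signed v" and ?Q = "lv.sm.var.variation_measure v"
  have vL: "v \<in> LinfTX m L" using v Ddiv_LinfTX by blast
  have el: "v \<in> elems L" using vL by (simp add: LinfTX_def)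
  have V0: "0 \<le> ?V" by (rule LinfTX_norm_AE(1)[OF vL])
  have \<gamma>: "\<gamma> \<in> Linf m" using div by (simp add: is_divergence_def)
  obtain G where G: "0 \<le> G" "AE x in m. \<bar>\<gamma> x\<bar> \<le> G" using \<gamma> by (rule LinfE)
  define M where "M = sup_norm f"
  have M: "0 \<le> M" "\<And>x. \<bar>f x\<bar> \<le> M" using abs_le_sup_norm[OF f(1)] sup_norm_nonneg[OF f(1)] by (auto simp: M_def)
  have fcont: "continuous_on UNIV f" using f(1) by (simp add: bcontfun_def)
  have fb [measurable]: "f \<in> borel_measurable borel" by (rule borel_measurable_continuous_onI[OF fcont])
  have fm [measurable]: "f \<in> borel_measurable m" by (rule bcontfun_measurable[OF f(1)])
  have fL: "f \<in> Linf m" using M(2) by (auto simp: Linf_def)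
  have f2: "integrable m (\<lambda>x. (f x)\<^sup>2)" using integrable_Linf_mult[OF fL f(2)] by (simp add: power2_eq_square)
  have [measurable]: "\<gamma> \<in> borel_measurable m" by (rule Linf_measurable[OF \<gamma>])
  define q where "q = measure ?Q UNIV"
  have q0: "0 \<le> q" by (simp add: q_def)
  \<comment> \<open>The summand \<open>G + ?V\<close> accounts for the cut-off in the volume
    integral, \<open>4 * ?V * C\<close> for the quadratic remainders, and
    \<open>4 * q + 2 * M\<close> for twice the error of the Riemann sum.\<close>
  have main: "\<bar>(\<integral>x. (f x)\<^sup>2 * \<gamma> x \<partial>m) + 2 * ?I f\<bar> \<le> ((G + ?V) + 4 * ?V * C + 4 * q + 2 * M) * \<epsilon>" if \<epsilon>: "0 < \<epsilon>" for \<epsilon>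
  proof -
    \<comment> \<open>The measure \<open>m\<close> may be infinite, but the volume integral carries
      the weight \<open>f\<^sup>2\<close>, which is integrable. The cut-off is adapted to this
      weighted measure and to the variation \<open>?Q\<close>, which controls the integrals against
      \<open>N\<close>.\<close>
    define \<nu> where "\<nu> = density m (\<lambda>x. ennreal ((f x)\<^sup>2))"
    have \<nu>: "finite_measure \<nu>" "sets \<nu> = sets borel"
    proof -
      have "(\<integral>\<^sup>+x. ennreal ((f x)\<^sup>2) \<partial>m) = ennreal (\<integral>x. (f x)\<^sup>2 \<partial>m)" using f2 by (intro nn_integral_eq_integral) auto
      then have "emeasure \<nu> (space \<nu>) \<noteq> \<infinity>"
        unfolding \<nu>_def by (subst emeasure_density) (auto cong: nn_integral_cong simp: space_m sets_m)
      then show "finite_measure \<nu>" by (rule finite_measureI)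
      show "sets \<nu> = sets borel" by (simp add: \<nu>_def sets_m)
    qed
    define good where "good r x \<longleftrightarrow> (\<forall>z\<in>ball x r. \<bar>f z - f x\<bar> \<le> \<epsilon>)" for r and x :: 'a
    obtain \<eta> r where \<eta>: "\<eta> \<in> LIPbs" "\<And>x. 0 \<le> \<eta> x" "\<And>x. \<eta> x \<le> 1" and r: "0 < r" "\<And>x. \<eta> x \<noteq> 0 \<Longrightarrow> good r x"
      and \<eta>m: "measure \<nu> {x. \<eta> x < 1} \<le> \<epsilon>" "measure ?Q {x. \<eta> x < 1} \<le> \<epsilon>" and \<eta>l: "(\<integral>\<^sup>+x. lip \<eta> x \<partial>\<nu>) \<le> ennreal \<epsilon>"
    proof (rule compact_cutoff[of "{\<nu>, ?Q}" good \<epsilon>])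
      show "finite_measure \<nu>'" if "\<nu>' \<in> {\<nu>, ?Q}" for \<nu>'
        using that \<nu>(1) lv.sm.var_measure.finite_measure_axioms[of v] by blast
      show "sets \<nu>' = sets borel" if "\<nu>' \<in> {\<nu>, ?Q}" for \<nu>'
        using that \<nu>(2) lv.sm.var.sets_variation_measure[of v] by blast
      show "good r x" if "good s x" "0 < r" "r \<le> s" for r s x
        using that unfolding good_def by (metis mem_ball order_less_le_trans)
      show "\<exists>s>0. \<forall>y\<in>ball x s. good s y" for x
      proof -
        have "isCont f x" using fcont by (simp add: continuous_on_eq_continuous_at)
        then obtain s where s: "0 < s" "\<And>z. dist z x < s \<Longrightarrow> \<bar>f z - f x\<bar> < \<epsilon> / 2"
          unfolding continuous_at_eps_delta dist_real_def using \<epsilon> by (meson half_gt_zero)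
        have "good (s / 2) y" if y: "y \<in> ball x (s / 2)" for y
          unfolding good_def
        proof
          fix z assume z: "z \<in> ball y (s / 2)"
          have "dist y x < s" "dist z x < s"
            using y z s(1) dist_triangle2[of z x y] by (auto simp: dist_commute)
          then show "\<bar>f z - f y\<bar> \<le> \<epsilon>" using s(2)[of y] s(2)[of z] by linarith
        qed
        then show ?thesis using s(1) by (intro exI[of _ "s / 2"]) auto
      qed
    qed (use \<epsilon> in auto)
    note \<eta>b = LIPbs_LIPb[OF \<eta>(1)]
    have [measurable]: "\<eta> \<in> borel_measurable m" "\<eta> \<in> borel_measurable borel"
      using LIPb_measurable[OF \<eta>b] borel_measurable_continuous_onI[OF LIPb_continuous[OF \<eta>b]] by auto
    \<comment> \<open>\<open>F\<close> is the largest minorant of \<open>f\<close> with Lipschitz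
      constant \<open>c\<close>. With this \<open>c\<close> a point at distance at least
      \<open>r\<close> pays a penalty of at least \<open>2 * M\<close>, so it cannot lower the value
      below \<open>f x\<close>; nearer points differ from \<open>f x\<close> by at most \<epsilon>
      where the cut-off is nonzero.\<close>
    define c where "c = 2 * M / r"
    have c0: "0 \<le> c" using M(1) r(1) by (simp add: c_def)
    define F where "F x = (INF y. f y + c * dist x y)" for x
    have bb: "bdd_below (range (\<lambda>y. f y + c * dist x y))" for x
    proof (rule bdd_belowI)
      fix t assume "t \<in> range (\<lambda>y. f y + c * dist x y)"
      then obtain y where "t = f y + c * dist x y" by auto
      then show "- M \<le> t" using M(2)[of y] mult_nonneg_nonneg[OF c0 zero_le_dist[of x y]] by (simp add: abs_le_iff)
    qed
    have Fle: "F x \<le> f y + c * dist x y" for x y unfolding F_def by (intro cINF_lower bb) simp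
    have Fge: "a \<le> F x" if "\<And>y. a \<le> f y + c * dist x y" for a x unfolding F_def using that by (intro cINF_greatest) auto
    have FM: "- M \<le> F x" "F x \<le> M" for x
    proof -
      show "- M \<le> F x"
      proof (rule Fge)
        show "- M \<le> f y + c * dist x y" for y
          using M(2)[of y] mult_nonneg_nonneg[OF c0 zero_le_dist[of x y]] by (simp add: abs_le_iff)
      qed
      show "F x \<le> M" using Fle[of x x] M(2)[of x] by (simp add: abs_le_iff)
    qed
    have Flip: "\<bar>F x - F y\<bar> \<le> c * dist x y" for x y
    proof -
      have "F x - c * dist x y \<le> F y" for x y
      proof (rule Fge)
        fix z
        have "c * dist x z \<le> c * (dist x y + dist y z)" using c0 by (intro mult_left_mono dist_triangle)
        then show "F x - c * dist x y \<le> f z + c * dist y z" using Fle[of x z] by (simp add: algebra_simps)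
      qed
      from this[of x y] this[of y x] show ?thesis by (simp add: dist_commute abs_le_iff)
    qed
    have Fclose: "\<bar>F x - f x\<bar> \<le> \<epsilon>" if "\<eta> x \<noteq> 0" for x
    proof -
      have "f x - \<epsilon> \<le> F x"
      proof (rule Fge)
        fix y
        show "f x - \<epsilon> \<le> f y + c * dist x y"
        proof (cases "dist x y < r")
          case True
          then have "\<bar>f y - f x\<bar> \<le> \<epsilon>" using r(2)[OF that] by (simp add: good_def)
          then show ?thesis using mult_nonneg_nonneg[OF c0 zero_le_dist[of x y]] by (simp add: abs_le_iff)
        next
          case False
          have "c * r \<le> c * dist x y" using False c0 by (intro mult_left_mono) auto
          moreover have "c * r = 2 * M" using r(1) by (simp add: c_def)
          ultimately show ?thesis using M(2)[of x] M(2)[of y] \<epsilon> by (simp add: abs_le_iff)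
        qed
      qed
      then show ?thesis using Fle[of x x] \<epsilon> by (simp add: abs_le_iff)
    qed
    obtain n :: nat where n: "2 * M / \<epsilon> + 1 \<le> real n" using real_arch_simple by blast
    \<comment> \<open>The \<open>\<tau> k\<close> are ramps in the height
      \<open>(F + M) / \<epsilon>\<close>. The difference of consecutive ramps is a hat function of
      \<open>F\<close> centred at \<open>ck k\<close> and vanishing unless \<open>F\<close> is
      within \<epsilon> of it. The sum telescopes from \<open>\<tau> 0 = 1\<close> to
      \<open>\<tau> n = 0\<close>, which is what the choice of \<open>n\<close> guarantees.\<close>
    define \<tau> where "\<tau> k x = max 0 (min 1 ((F x + M) / \<epsilon> + 1 - real k))" for k x
    define \<psi> where "\<psi> k x = \<tau> k x - \<tau> (Suc k) x" for k x
    define ck where "ck k = real k * \<epsilon> - M" for k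
    have \<psi>0: "0 \<le> \<psi> k x" for k x by (auto simp: \<psi>_def \<tau>_def)
    have \<psi>sum: "(\<Sum>k<n. \<psi> k x) = 1" for x
    proof -
      have "(\<Sum>k<n. \<psi> k x) = \<tau> 0 x - \<tau> n x" unfolding \<psi>_def by (rule sum_lessThan_telescope')
      moreover have "\<tau> 0 x = 1" using FM(1)[of x] \<epsilon> by (simp add: \<tau>_def field_simps)
      moreover have "(F x + M) / \<epsilon> \<le> 2 * M / \<epsilon>" using FM(2)[of x] \<epsilon> by (intro divide_right_mono) auto
      then have "\<tau> n x = 0" using n by (simp add: \<tau>_def)
      ultimately show ?thesis by simp
    qed
    have \<psi>supp: "\<bar>F x - ck k\<bar> \<le> \<epsilon>" if "\<psi> k x \<noteq> 0" for k x
    proof -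
      define t where "t = (F x + M) / \<epsilon> + 1 - real k"
      have "max 0 (min 1 t) \<noteq> max 0 (min 1 (t - 1))" using that by (simp add: \<psi>_def \<tau>_def t_def)
      then have "0 < t" "t < 2" by (auto simp: max_def min_def split: if_splits)
      then have "0 < t * \<epsilon>" "t * \<epsilon> < 2 * \<epsilon>" using \<epsilon> by auto
      moreover have "t * \<epsilon> = F x - ck k + \<epsilon>" using \<epsilon> by (simp add: t_def ck_def field_simps)
      ultimately show ?thesis by (simp add: abs_le_iff)
    qed
    have \<psi>b: "\<psi> k \<in> LIPb" for k
    proof (rule LIPbI)
      show "\<bar>\<psi> k x\<bar> \<le> 1" for x by (auto simp: \<psi>_def \<tau>_def)
      have \<tau>l: "\<bar>\<tau> j x - \<tau> j y\<bar> \<le> c / \<epsilon> * dist x y" for j x y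
      proof -
        have "\<bar>\<tau> j x - \<tau> j y\<bar> \<le> \<bar>((F x + M) / \<epsilon> + 1 - real j) - ((F y + M) / \<epsilon> + 1 - real j)\<bar>"
          unfolding \<tau>_def by (rule clamp_lipschitz)
        also have "\<dots> = \<bar>F x - F y\<bar> / \<epsilon>" using \<epsilon> by (simp add: abs_divide flip: diff_divide_distrib)
        also have "\<dots> \<le> c * dist x y / \<epsilon>" using Flip \<epsilon> by (intro divide_right_mono) auto
        finally show ?thesis by simp
      qed
      show "\<bar>\<psi> k x - \<psi> k y\<bar> \<le> (2 * (c / \<epsilon>)) * dist x y" for x y
        using \<tau>l[of k x y] \<tau>l[of "Suc k" x y] unfolding \<psi>_def mult.assoc by linarith
    qed
    define \<theta> where "\<theta> k x = \<psi> k x * \<eta> x" for k x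
    have \<theta>: "\<theta> k \<in> LIPbs" for k unfolding \<theta>_def by (rule LIPbs_mult[OF \<psi>b \<eta>(1)])
    have \<theta>0: "0 \<le> \<theta> k x" for k x unfolding \<theta>_def using \<psi>0 \<eta>(2) by simp
    have \<theta>sum: "(\<Sum>k<n. \<theta> k x) = \<eta> x" for x unfolding \<theta>_def using \<psi>sum by (simp flip: sum_distrib_right)
    have \<theta>supp: "\<bar>f x - ck k\<bar> \<le> 2 * \<epsilon>" if "\<theta> k x \<noteq> 0" for k x
    proof -
      have "\<psi> k x \<noteq> 0" "\<eta> x \<noteq> 0" using that by (auto simp: \<theta>_def)
      then show ?thesis using \<psi>supp[of k x] Fclose[of x] by linarith
    qed
    \<comment> \<open>\<open>\<Gamma> k\<close> is known to vanish only outside the closure of the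
      set where \<open>\<theta> k\<close> is nonzero, so the estimate on \<open>f\<close> is
      extended to the closure by continuity.\<close>
    have \<theta>cl: "\<bar>f x - ck k\<bar> \<le> 2 * \<epsilon>" if "x \<in> closure {x. \<theta> k x \<noteq> 0}" for k x
    proof -
      have "closure {x. \<theta> k x \<noteq> 0} \<subseteq> {x. \<bar>f x - ck k\<bar> \<le> 2 * \<epsilon>}"
        by (intro closure_minimal closed_Collect_le continuous_intros fcont) (use \<theta>supp in auto)
      then show ?thesis using that by auto
    qed
    have "\<exists>h. is_pairing m T L \<iota> (d (\<theta> k)) v h" for k using divergence_pairing_LIPbs[OF div \<theta>] by blast
    then obtain h where h: "\<And>k. is_pairing m T L \<iota> (d (\<theta> k)) v (h k)" by metis
    obtain h\<eta> where h\<eta>: "is_pairing m T L \<iota> (d \<eta>) v h\<eta>" using divergence_pairing_LIPbs[OF div \<eta>(1)] by blast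
    have hsum: "AE x in m. h\<eta> x = (\<Sum>k<n. h k x)"
      using pairing_sum[OF \<theta> vL div h, where n = n and h' = h\<eta>] h\<eta> by (simp add: \<theta>sum)
    define \<Gamma> where "\<Gamma> k x = \<theta> k x * \<gamma> x + h k x" for k x
    define \<Gamma>\<eta> where "\<Gamma>\<eta> x = \<eta> x * \<gamma> x + h\<eta> x" for x
    have \<Gamma>: "integrable m (\<Gamma> k)" "\<Gamma> k \<in> Linf m" "AE x in m. x \<notin> closure {x. \<theta> k x \<noteq> 0} \<longrightarrow> \<Gamma> k x = 0" for k
      using integrable_cutoff_divergence[OF \<theta> vL \<gamma> h] unfolding \<Gamma>_def by auto
    have \<Gamma>\<eta>: "integrable m \<Gamma>\<eta>" "\<Gamma>\<eta> \<in> Linf m"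
      using integrable_cutoff_divergence[OF \<eta>(1) vL \<gamma> h\<eta>] unfolding \<Gamma>\<eta>_def by auto
    have \<Gamma>sum: "AE x in m. \<Gamma>\<eta> x = (\<Sum>k<n. \<Gamma> k x)"
      using hsum by eventually_elim (simp add: \<Gamma>\<eta>_def \<Gamma>_def sum.distrib \<theta>sum flip: sum_distrib_right)
    \<comment> \<open>On the support of \<open>\<theta> k\<close> this is
      \<open>(f - ck k)\<^sup>2\<close>. The truncation makes it bounded and Lipschitz with constant
      \<open>4 * \<epsilon>\<close> on the whole line, as needed when \<open>f\<close> is replaced
      by \<open>u j\<close>, whose values need not be close to \<open>ck k\<close>.\<close>
    define T' where "T' k t = (max (- (2 * \<epsilon>)) (min (2 * \<epsilon>) (t - ck k)))\<^sup>2" for k t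
    have T'lip: "\<bar>T' k s - T' k t\<bar> \<le> 4 * \<epsilon> * \<bar>s - t\<bar>" for k s t
    proof -
      have *: "2 * (2 * \<epsilon>) * \<bar>s - ck k - (t - ck k)\<bar> = 4 * \<epsilon> * \<bar>s - t\<bar>" by simp
      show ?thesis using clamp_square_lipschitz[of "2 * \<epsilon>" "s - ck k" "t - ck k"] \<epsilon> unfolding T'_def * by linarith
    qed
    have T'b: "\<bar>T' k t\<bar> \<le> (2 * \<epsilon>)\<^sup>2" for k t
    proof -
      have "\<bar>max (- (2 * \<epsilon>)) (min (2 * \<epsilon>) (t - ck k))\<bar> \<le> \<bar>2 * \<epsilon>\<bar>"
        using clamp_abs_le[of "2 * \<epsilon>" "t - ck k"] \<epsilon> by simp
      then show ?thesis unfolding T'_def abs_power2 by (rule abs_le_square_iff[THEN iffD1])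
    qed
    have T'm [measurable]: "T' k \<in> borel_measurable borel" for k unfolding T'_def by measurable
    have T'L: "(\<lambda>x. T' k (g x)) \<in> Linf m" if "g \<in> borel_measurable m" for k g
      using that T'b by (auto simp: Linf_def)
    have um [measurable]: "u j \<in> borel_measurable m" for j using u(2) by auto
    define J where "J k = (\<integral>x. T' k (f x) * \<Gamma> k x \<partial>m)" for k
    have stepA: "(\<integral>x. (f x)\<^sup>2 * \<Gamma> k x \<partial>m) = - 2 * (ck k * ?I (\<theta> k)) + J k" for k
    proof -
      have i: "integrable m (\<lambda>x. f x * \<Gamma> k x)" "integrable m (\<lambda>x. T' k (f x) * \<Gamma> k x)"
        by (intro integrable_Linf_mult fL T'L fm \<Gamma>)+
      have "(\<integral>x. (f x)\<^sup>2 * \<Gamma> k x \<partial>m) = (\<integral>x. 2 * ck k * (f x * \<Gamma> k x) - (ck k)\<^sup>2 * \<Gamma> k x + T' k (f x) * \<Gamma> k x \<partial>m)"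
      proof (rule integral_cong_AE)
        show "AE x in m. (f x)\<^sup>2 * \<Gamma> k x = 2 * ck k * (f x * \<Gamma> k x) - (ck k)\<^sup>2 * \<Gamma> k x + T' k (f x) * \<Gamma> k x"
          using \<Gamma>(3)[of k]
        proof eventually_elim
          case (elim x)
          show ?case
          proof (cases "x \<in> closure {x. \<theta> k x \<noteq> 0}")
            case True
            then have "\<bar>f x - ck k\<bar> \<le> 2 * \<epsilon>" by (rule \<theta>cl)
            then have "T' k (f x) = (f x - ck k)\<^sup>2" by (auto simp: T'_def max_def min_def abs_le_iff)
            then show ?thesis by (simp only: power2_eq_square) (simp add: algebra_simps)
          next
            case False
            then show ?thesis using elim by simp
          qed
        qed
      qed (use \<Gamma>(1)[of k] in measurable)
      also have "\<dots> = 2 * ck k * (\<integral>x. f x * \<Gamma> k x \<partial>m) - (ck k)\<^sup>2 * (\<integral>x. \<Gamma> k x \<partial>m) + J k"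
        using i \<Gamma>(1)[of k] by (simp add: J_def)
      \<comment> \<open>The bound for locally Lipschitz functions is applied to the constant 1,
        whose slope is 0.\<close>
      also have "(\<integral>x. \<Gamma> k x \<partial>m) = 0"
      proof -
        have "(\<lambda>_. 1) \<in> LIPloc UNIV" by (intro LIPb_imp_LIPloc LIPb_const)
        from divergence_LIPloc_bound[OF vL div \<theta>[of k] \<theta>0 h this, of 1]
        have "ennreal \<bar>\<integral>x. \<Gamma> k x \<partial>m\<bar> \<le> 0" by (simp add: \<Gamma>_def)
        then show ?thesis by simp
      qed
      \<comment> \<open>This is the defining property of the differential at the field
        \<open>fmul L (\<theta> k) v\<close>, whose divergence is \<open>\<Gamma> k\<close>;
        \<open>N_act\<close> rewrites the value of \<open>N\<close> as an integral of
        \<open>\<theta> k\<close>.\<close>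
      also have "(\<integral>x. f x * \<Gamma> k x \<partial>m) = - ?I (\<theta> k)"
      proof -
        have "N UNIV (fmul L (\<theta> k) v) = - (\<integral>x. f x * \<Gamma> k x \<partial>m)"
          using N fmul_Ddiv[OF \<theta> v] is_divergence_fmul[OF \<theta> vL div h] unfolding is_BV_differential_def \<Gamma>_def by blast
        moreover have "N UNIV (fmul L (\<theta> k) v) = ?I (\<lambda>x. indicator UNIV x * \<theta> k x)"
          by (intro lv.N_act LIPb_bcontfun LIPbs_LIPb \<theta> Ddiv_test_module v) simp
        ultimately show ?thesis by simp
      qed
      finally show ?thesis by simp
    qed
    \<comment> \<open>Each remainder is a limit of integrals of \<open>T' k (u j)\<close>, since
      \<open>T' k\<close> is Lipschitz and \<open>\<Gamma> k\<close> is bounded. The slopes enter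
      with the weights \<open>\<theta> k\<close>, whose sum is \<eta> and at most 1, so the number
      \<open>n\<close> of pieces does not appear in the bound.\<close>
    have stepB: "(\<Sum>k<n. \<bar>J k\<bar>) \<le> 4 * \<epsilon> * ?V * C"
    proof (rule LIMSEQ_le_const2)
      show "(\<lambda>j. \<Sum>k<n. \<bar>\<integral>x. T' k (u j x) * \<Gamma> k x \<partial>m\<bar>) \<longlonglongrightarrow> (\<Sum>k<n. \<bar>J k\<bar>)"
      proof (intro tendsto_sum tendsto_rabs)
        fix k
        obtain g where g: "0 \<le> g" "AE x in m. \<bar>\<Gamma> k x\<bar> \<le> g" using \<Gamma>(2)[of k] by (rule LinfE)
        define \<delta> where "\<delta> j = (\<integral>x. \<bar>u j x - f x\<bar> \<partial>m)" for j
        have uf: "integrable m (\<lambda>x. \<bar>u j x - f x\<bar>)" for j using u(2) f(2) by auto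
        have "(\<lambda>j. ennreal (\<delta> j)) \<longlonglongrightarrow> ennreal 0"
          using u(3) uf unfolding \<delta>_def by (simp add: nn_integral_eq_integral)
        then have "\<delta> \<longlonglongrightarrow> 0" by (subst (asm) tendsto_ennreal_iff) (auto simp: \<delta>_def)
        then have "(\<lambda>j. 4 * \<epsilon> * g * \<delta> j) \<longlonglongrightarrow> 4 * \<epsilon> * g * 0" by (intro tendsto_intros)
        then have lim: "(\<lambda>j. 4 * \<epsilon> * g * \<delta> j) \<longlonglongrightarrow> 0" by simp
        have "(\<lambda>j. (\<integral>x. T' k (u j x) * \<Gamma> k x \<partial>m) - J k) \<longlonglongrightarrow> 0"
        proof (rule Lim_null_comparison[OF always_eventually lim], rule allI)
          fix j
          have i: "integrable m (\<lambda>x. T' k (u j x) * \<Gamma> k x)" "integrable m (\<lambda>x. T' k (f x) * \<Gamma> k x)"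
            by (intro integrable_Linf_mult T'L fm um \<Gamma>)+
          have "\<bar>(\<integral>x. T' k (u j x) * \<Gamma> k x \<partial>m) - J k\<bar> = \<bar>\<integral>x. T' k (u j x) * \<Gamma> k x - T' k (f x) * \<Gamma> k x \<partial>m\<bar>"
            using i by (simp add: J_def)
          also have "\<dots> \<le> (\<integral>x. \<bar>T' k (u j x) * \<Gamma> k x - T' k (f x) * \<Gamma> k x\<bar> \<partial>m)" by (rule integral_abs_bound)
          also have "\<dots> \<le> (\<integral>x. 4 * \<epsilon> * g * \<bar>u j x - f x\<bar> \<partial>m)"
          proof (rule integral_mono_AE)
            show "AE x in m. \<bar>T' k (u j x) * \<Gamma> k x - T' k (f x) * \<Gamma> k x\<bar> \<le> 4 * \<epsilon> * g * \<bar>u j x - f x\<bar>"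
              using g(2)
            proof eventually_elim
              case (elim x)
              have "\<bar>T' k (u j x) * \<Gamma> k x - T' k (f x) * \<Gamma> k x\<bar> = \<bar>T' k (u j x) - T' k (f x)\<bar> * \<bar>\<Gamma> k x\<bar>"
                by (simp add: abs_mult flip: left_diff_distrib)
              also have "\<dots> \<le> (4 * \<epsilon> * \<bar>u j x - f x\<bar>) * g" using T'lip elim \<epsilon> by (intro mult_mono) auto
              finally show ?case by (simp add: mult_ac)
            qed
          qed (use i uf in auto)
          also have "\<dots> = 4 * \<epsilon> * g * \<delta> j" by (simp add: \<delta>_def)
          finally show "norm ((\<integral>x. T' k (u j x) * \<Gamma> k x \<partial>m) - J k) \<le> 4 * \<epsilon> * g * \<delta> j" by simp
        qed
        then show "(\<lambda>j. \<integral>x. T' k (u j x) * \<Gamma> k x \<partial>m) \<longlonglongrightarrow> J k" by (rule LIM_zero_cancel)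
      qed
      have "(\<Sum>k<n. \<bar>\<integral>x. T' k (u j x) * \<Gamma> k x \<partial>m\<bar>) \<le> 4 * \<epsilon> * ?V * C" for j
      proof -
        have lu [measurable]: "lip (u j) \<in> borel_measurable m" by (rule lip_measurable[OF LIPloc_continuous[OF u(1)]])
        have [measurable]: "\<theta> k \<in> borel_measurable m" for k by (rule LIPb_measurable[OF LIPbs_LIPb[OF \<theta>]])
        have "ennreal (\<Sum>k<n. \<bar>\<integral>x. T' k (u j x) * \<Gamma> k x \<partial>m\<bar>) = (\<Sum>k<n. ennreal \<bar>\<integral>x. T' k (u j x) * \<Gamma> k x \<partial>m\<bar>)"
          by (rule sum_ennreal[symmetric]) simp
        also have "\<dots> \<le> (\<Sum>k<n. ennreal ?V * (\<integral>\<^sup>+x. ennreal (4 * \<epsilon>) * (ennreal (\<theta> k x) * lip (u j) x) \<partial>m))"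
        proof (rule sum_mono)
          fix k
          have Tu: "(\<lambda>x. T' k (u j x)) \<in> LIPloc UNIV"
            by (rule LIPloc_compose[OF u(1) T'lip]) (use \<epsilon> in auto)
          have "ennreal \<bar>\<integral>x. T' k (u j x) * \<Gamma> k x \<partial>m\<bar> \<le> ennreal ?V * (\<integral>\<^sup>+x. ennreal (\<theta> k x) * lip (\<lambda>x. T' k (u j x)) x \<partial>m)"
            unfolding \<Gamma>_def by (rule divergence_LIPloc_bound[OF vL div \<theta> \<theta>0 h Tu T'b])
          also have "\<dots> \<le> ennreal ?V * (\<integral>\<^sup>+x. ennreal (4 * \<epsilon>) * (ennreal (\<theta> k x) * lip (u j) x) \<partial>m)"
          proof (intro mult_left_mono nn_integral_mono)
            fix x
            have "lip (\<lambda>x. T' k (u j x)) x \<le> ennreal (4 * \<epsilon>) * lip (u j) x" by (rule lip_compose[OF T'lip]) (use \<epsilon> in auto)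
            then show "ennreal (\<theta> k x) * lip (\<lambda>x. T' k (u j x)) x \<le> ennreal (4 * \<epsilon>) * (ennreal (\<theta> k x) * lip (u j) x)"
              using mult_left_mono[of _ _ "ennreal (\<theta> k x)"] by (simp add: mult.left_commute)
          qed simp
          finally show "ennreal \<bar>\<integral>x. T' k (u j x) * \<Gamma> k x \<partial>m\<bar> \<le> ennreal ?V * (\<integral>\<^sup>+x. ennreal (4 * \<epsilon>) * (ennreal (\<theta> k x) * lip (u j) x) \<partial>m)" .
        qed
        also have "\<dots> = ennreal ?V * (ennreal (4 * \<epsilon>) * (\<Sum>k<n. \<integral>\<^sup>+x. ennreal (\<theta> k x) * lip (u j) x \<partial>m))"
          by (simp add: nn_integral_cmult sum_distrib_left)
        also have "(\<Sum>k<n. \<integral>\<^sup>+x. ennreal (\<theta> k x) * lip (u j) x \<partial>m) = (\<integral>\<^sup>+x. (\<Sum>k<n. ennreal (\<theta> k x) * lip (u j) x) \<partial>m)"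
          by (rule nn_integral_sum[symmetric]) measurable
        also have "\<dots> \<le> (\<integral>\<^sup>+x. lip (u j) x \<partial>m)"
        proof (rule nn_integral_mono)
          fix x
          have "(\<Sum>k<n. ennreal (\<theta> k x) * lip (u j) x) = ennreal (\<eta> x) * lip (u j) x"
            using \<theta>0 by (simp add: sum_distrib_right[symmetric] sum_ennreal \<theta>sum)
          also have "\<dots> \<le> 1 * lip (u j) x" using \<eta>(3)[of x] by (intro mult_right_mono) auto
          finally show "(\<Sum>k<n. ennreal (\<theta> k x) * lip (u j) x) \<le> lip (u j) x" by simp
        qed
        also have "\<dots> \<le> ennreal C" by (rule u(4))
        finally have "ennreal (\<Sum>k<n. \<bar>\<integral>x. T' k (u j x) * \<Gamma> k x \<partial>m\<bar>) \<le> ennreal ?V * (ennreal (4 * \<epsilon>) * ennreal C)"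
          by (simp add: mult_left_mono)
        also have "\<dots> = ennreal (4 * \<epsilon> * ?V * C)" using V0 \<epsilon> C by (simp add: ennreal_mult[symmetric] mult_ac)
        finally show ?thesis using V0 \<epsilon> C by (subst (asm) ennreal_le_iff) auto
      qed
      then show "\<exists>N. \<forall>j\<ge>N. (\<Sum>k<n. \<bar>\<integral>x. T' k (u j x) * \<Gamma> k x \<partial>m\<bar>) \<le> 4 * \<epsilon> * ?V * C" by blast
    qed
    have \<theta>m: "\<theta> k \<in> borel_measurable borel" for k
      by (rule borel_measurable_continuous_onI[OF LIPb_continuous[OF LIPbs_LIPb[OF \<theta>]]])
    have \<theta>1: "\<bar>\<theta> k x\<bar> \<le> 1" for k x
    proof -
      have "\<bar>\<psi> k x\<bar> \<le> 1" by (auto simp: \<psi>_def \<tau>_def)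
      then have "\<bar>\<psi> k x\<bar> * \<bar>\<eta> x\<bar> \<le> 1 * 1" using \<eta>(2,3)[of x] by (intro mult_mono) auto
      then show ?thesis by (simp add: \<theta>_def abs_mult)
    qed
    define E where "E x = (\<Sum>k<n. ck k * \<theta> k x)" for x
    have IE: "?I E = (\<Sum>k<n. ck k * ?I (\<theta> k))"
    proof -
      have "?I E = (\<Sum>k<n. ?I (\<lambda>x. ck k * \<theta> k x))"
        unfolding E_def
        using \<theta>m \<theta>1 by (intro lv.sm.integral_signed_sum[where c = "\<lambda>k. \<bar>ck k\<bar>"])
          (auto simp: abs_mult intro!: mult_left_le)
      then show ?thesis by (simp add: lv.sm.integral_signed_cmult)
    qed
    \<comment> \<open>\<open>f * \<eta> - E\<close> is the sum of the deviations
      \<open>f - ck k\<close> weighted by \<open>\<theta> k\<close>, hence at most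
      \<open>2 * \<epsilon>\<close>. The loss \<open>f * (1 - \<eta>)\<close> lives where the
      cut-off is less than 1, a set of mass at most \<epsilon> for \<open>?Q\<close>.\<close>
    have Ef: "\<bar>f x - E x\<bar> \<le> M * indicator {x. \<eta> x < 1} x + 2 * \<epsilon>" for x
    proof -
      have "f x * \<eta> x - E x = (\<Sum>k<n. (f x - ck k) * \<theta> k x)"
        unfolding E_def by (simp add: \<theta>sum[symmetric] sum_distrib_left sum_subtractf left_diff_distrib)
      also have "\<bar>\<dots>\<bar> \<le> (\<Sum>k<n. (2 * \<epsilon>) * \<theta> k x)"
      proof (intro order_trans[OF sum_abs] sum_mono)
        fix k
        show "\<bar>(f x - ck k) * \<theta> k x\<bar> \<le> (2 * \<epsilon>) * \<theta> k x"
          using \<theta>supp[of k x] \<theta>0[of k x] by (cases "\<theta> k x = 0") (auto simp: abs_mult intro!: mult_right_mono)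
      qed
      also have "\<dots> = 2 * \<epsilon> * \<eta> x" by (simp add: \<theta>sum flip: sum_distrib_left)
      also have "\<dots> \<le> 2 * \<epsilon>" using \<eta>(3)[of x] \<epsilon> by simp
      finally have 1: "\<bar>f x * \<eta> x - E x\<bar> \<le> 2 * \<epsilon>" .
      have 2: "\<bar>f x - f x * \<eta> x\<bar> \<le> M * indicator {x. \<eta> x < 1} x"
      proof (cases "\<eta> x < 1")
        case True
        have "\<bar>f x\<bar> * \<bar>1 - \<eta> x\<bar> \<le> M * 1" using M(2)[of x] M(1) \<eta>(2)[of x] True by (intro mult_mono) auto
        then show ?thesis using True by (simp only: abs_mult[symmetric]) (simp add: right_diff_distrib)
      next
        case False
        then have "\<eta> x = 1" using \<eta>(3)[of x] by simp
        then show ?thesis by simp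
      qed
      show ?thesis using 1 2 by linarith
    qed
    have Em: "E \<in> borel_measurable borel" unfolding E_def using \<theta>m by (intro borel_measurable_sum borel_measurable_times borel_measurable_const)
    have Eb: "\<bar>E x\<bar> \<le> 2 * M + 2 * \<epsilon>" for x
    proof -
      have "M * indicator {x. \<eta> x < 1} x \<le> M" using M(1) by (simp add: indicator_def)
      then show ?thesis using Ef[of x] M(2)[of x] by linarith
    qed
    have S1: "{x. \<eta> x < 1} \<in> sets borel" by (intro borel_open open_Collect_less LIPb_continuous \<eta>b continuous_intros)
    have stepC: "\<bar>?I f - ?I E\<bar> \<le> M * \<epsilon> + 2 * \<epsilon> * q"
    proof -
      have Qi: "integrable ?Q (indicat_real {x. \<eta> x < 1})" "integrable ?Q (\<lambda>_. t)" for t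
        using S1 lv.sm.var_measure.emeasure_finite[of v] by (auto simp: less_top[symmetric] intro!: integrable_real_indicator)
      have "\<bar>?I f - ?I E\<bar> = \<bar>?I (\<lambda>x. f x - E x)\<bar>"
        by (subst lv.sm.integral_signed_diff[OF fb M(2) Em Eb]) simp
      also have "\<dots> \<le> 1 * (\<integral>x. \<bar>f x - E x\<bar> \<partial>?Q)"
      proof (rule lv.sm.abs_integral_signed_le)
        show "(\<lambda>x. f x - E x) \<in> borel_measurable borel" using fb Em by measurable
        show "\<bar>f x - E x\<bar> \<le> M + (2 * M + 2 * \<epsilon>)" for x using M(2)[of x] Eb[of x] by linarith
        show "\<bar>N A v\<bar> \<le> 1 * measure ?Q A" if "A \<in> sets borel" for A using lv.sm.abs_le_variation[OF that, of v] by simp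
      qed (use lv.sm.var_measure.finite_measure_axioms lv.sm.var.sets_variation_measure in auto)
      also have "\<dots> \<le> (\<integral>x. M * indicator {x. \<eta> x < 1} x + 2 * \<epsilon> \<partial>?Q)"
      proof (simp only: mult_1, rule integral_mono)
        show "integrable ?Q (\<lambda>x. \<bar>f x - E x\<bar>)"
          using lv.sm.bounded_integrable(2)[OF fb M(2)] lv.sm.bounded_integrable(2)[OF Em Eb] by auto
        show "integrable ?Q (\<lambda>x. M * indicator {x. \<eta> x < 1} x + 2 * \<epsilon>)" using Qi by simp
      qed (rule Ef)
      also have "\<dots> = M * measure ?Q {x. \<eta> x < 1} + 2 * \<epsilon> * q" using Qi by (simp add: q_def)
      also have "\<dots> \<le> M * \<epsilon> + 2 * \<epsilon> * q" using \<eta>m(2) M(1) by (simp add: mult_left_mono)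
      finally show ?thesis .
    qed
    have i\<eta>: "integrable m (\<lambda>x. (f x)\<^sup>2 * \<Gamma>\<eta> x)" "integrable m (\<lambda>x. (f x)\<^sup>2 * \<gamma> x)"
      using integrable_Linf_mult[OF \<Gamma>\<eta>(2) f2] integrable_Linf_mult[OF \<gamma> f2] by (simp_all add: mult.commute)
    \<comment> \<open>The difference \<open>\<gamma> - \<Gamma>\<eta>\<close> is
      \<open>\<gamma> * (1 - \<eta>) - h\<eta>\<close>. The first term lives where the cut-off is
      less than 1, the second is bounded by \<open>?V\<close> times its slope; both are small in the
      measure \<nu>.\<close>
    have stepD: "\<bar>(\<integral>x. (f x)\<^sup>2 * \<gamma> x \<partial>m) - (\<integral>x. (f x)\<^sup>2 * \<Gamma>\<eta> x \<partial>m)\<bar> \<le> (G + ?V) * \<epsilon>"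
    proof -
      have lm [measurable]: "lip \<eta> \<in> borel_measurable m" by (rule lip_measurable[OF LIPb_continuous[OF \<eta>b]])
      have "ennreal \<bar>(\<integral>x. (f x)\<^sup>2 * \<gamma> x \<partial>m) - (\<integral>x. (f x)\<^sup>2 * \<Gamma>\<eta> x \<partial>m)\<bar> = ennreal \<bar>\<integral>x. (f x)\<^sup>2 * \<gamma> x - (f x)\<^sup>2 * \<Gamma>\<eta> x \<partial>m\<bar>"
        using i\<eta> by simp
      also have "\<dots> \<le> ennreal (\<integral>x. \<bar>(f x)\<^sup>2 * \<gamma> x - (f x)\<^sup>2 * \<Gamma>\<eta> x\<bar> \<partial>m)" by (intro ennreal_leI integral_abs_bound)
      also have "\<dots> = (\<integral>\<^sup>+x. ennreal \<bar>(f x)\<^sup>2 * \<gamma> x - (f x)\<^sup>2 * \<Gamma>\<eta> x\<bar> \<partial>m)"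
        using i\<eta> by (intro nn_integral_eq_integral[symmetric]) auto
      also have "\<dots> \<le> (\<integral>\<^sup>+x. ennreal ((f x)\<^sup>2) * (ennreal G * indicator {x. \<eta> x < 1} x + ennreal ?V * lip \<eta> x) \<partial>m)"
      proof (rule nn_integral_mono_AE)
        show "AE x in m. ennreal \<bar>(f x)\<^sup>2 * \<gamma> x - (f x)\<^sup>2 * \<Gamma>\<eta> x\<bar> \<le>
            ennreal ((f x)\<^sup>2) * (ennreal G * indicator {x. \<eta> x < 1} x + ennreal ?V * lip \<eta> x)"
          using G(2) pairing_LIPbs_bound[OF \<eta>(1) vL h\<eta>]
        proof eventually_elim
          case (elim x)
          have "\<bar>\<gamma> x - \<Gamma>\<eta> x\<bar> \<le> \<bar>\<gamma> x * (1 - \<eta> x)\<bar> + \<bar>h\<eta> x\<bar>" by (simp add: \<Gamma>\<eta>_def algebra_simps)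
          also have "\<bar>\<gamma> x * (1 - \<eta> x)\<bar> \<le> G * indicator {x. \<eta> x < 1} x"
          proof (cases "\<eta> x < 1")
            case True
            have "\<bar>\<gamma> x\<bar> * \<bar>1 - \<eta> x\<bar> \<le> G * 1" using elim(1) G(1) \<eta>(2)[of x] True by (intro mult_mono) auto
            then show ?thesis using True by (simp add: abs_mult)
          next
            case False
            then have "\<eta> x = 1" using \<eta>(3)[of x] by simp
            then show ?thesis by simp
          qed
          finally have "\<bar>\<gamma> x - \<Gamma>\<eta> x\<bar> \<le> G * indicator {x. \<eta> x < 1} x + ?V * rlip \<eta> x" using elim(2) by linarith
          then have "\<bar>(f x)\<^sup>2 * \<gamma> x - (f x)\<^sup>2 * \<Gamma>\<eta> x\<bar> \<le> (f x)\<^sup>2 * (G * indicator {x. \<eta> x < 1} x + ?V * rlip \<eta> x)"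
            by (simp add: abs_mult mult_left_mono flip: right_diff_distrib)
          then have "ennreal \<bar>(f x)\<^sup>2 * \<gamma> x - (f x)\<^sup>2 * \<Gamma>\<eta> x\<bar> \<le> ennreal ((f x)\<^sup>2 * (G * indicator {x. \<eta> x < 1} x + ?V * rlip \<eta> x))"
            by (rule ennreal_leI)
          also have "\<dots> = ennreal ((f x)\<^sup>2) * (ennreal G * indicator {x. \<eta> x < 1} x + ennreal ?V * lip \<eta> x)"
            using G(1) V0 LIPb_lip_finite[OF \<eta>b, of x] by (auto simp: ennreal_mult indicator_def)
          finally show ?case .
        qed
      qed
      also have "\<dots> = (\<integral>\<^sup>+x. ennreal G * indicator {x. \<eta> x < 1} x + ennreal ?V * lip \<eta> x \<partial>\<nu>)"
        using S1 sets_m unfolding \<nu>_def by (subst nn_integral_density) auto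
      also have "\<dots> = ennreal G * emeasure \<nu> {x. \<eta> x < 1} + ennreal ?V * (\<integral>\<^sup>+x. lip \<eta> x \<partial>\<nu>)"
      proof -
        have l\<nu>: "lip \<eta> \<in> borel_measurable \<nu>" using lm by (simp add: \<nu>_def)
        have s\<nu>: "{x. \<eta> x < 1} \<in> sets \<nu>" using S1 \<nu>(2) by simp
        show ?thesis using l\<nu> s\<nu> by (simp add: nn_integral_add nn_integral_cmult nn_integral_cmult_indicator)
      qed
      also have "\<dots> \<le> ennreal G * ennreal \<epsilon> + ennreal ?V * ennreal \<epsilon>"
        using \<eta>m(1) \<eta>l finite_measure.emeasure_eq_measure[OF \<nu>(1)] by (intro add_mono mult_left_mono) (auto intro: ennreal_leI)
      also have "\<dots> = ennreal ((G + ?V) * \<epsilon>)" using G(1) V0 \<epsilon> by (simp add: ennreal_mult distrib_right)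
      finally show ?thesis using G(1) V0 \<epsilon> by (subst (asm) ennreal_le_iff) auto
    qed
    have "(\<integral>x. (f x)\<^sup>2 * \<Gamma>\<eta> x \<partial>m) = (\<integral>x. (\<Sum>k<n. (f x)\<^sup>2 * \<Gamma> k x) \<partial>m)"
    proof (rule integral_cong_AE)
      show "AE x in m. (f x)\<^sup>2 * \<Gamma>\<eta> x = (\<Sum>k<n. (f x)\<^sup>2 * \<Gamma> k x)"
        using \<Gamma>sum by eventually_elim (simp add: sum_distrib_left)
    qed (use \<Gamma>(1) \<Gamma>\<eta>(1) in auto)
    also have "\<dots> = (\<Sum>k<n. \<integral>x. (f x)\<^sup>2 * \<Gamma> k x \<partial>m)"
      using integrable_Linf_mult[OF \<Gamma>(2) f2] by (intro Bochner_Integration.integral_sum) (simp add: mult.commute)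
    also have "\<dots> = - 2 * ?I E + (\<Sum>k<n. J k)"
      unfolding stepA IE sum_distrib_left by (rule sum.distrib)
    finally have eq: "(\<integral>x. (f x)\<^sup>2 * \<Gamma>\<eta> x \<partial>m) + 2 * ?I E = (\<Sum>k<n. J k)" by simp
    have "\<bar>\<Sum>k<n. J k\<bar> \<le> 4 * \<epsilon> * ?V * C" using order_trans[OF sum_abs stepB] .
    then have "\<bar>(\<integral>x. (f x)\<^sup>2 * \<gamma> x \<partial>m) + 2 * ?I f\<bar> \<le> (G + ?V) * \<epsilon> + 4 * \<epsilon> * ?V * C + 2 * (M * \<epsilon> + 2 * \<epsilon> * q)"
      using eq stepC stepD unfolding abs_le_iff by (simp add: algebra_simps)
    also have "\<dots> = ((G + ?V) + 4 * ?V * C + 4 * q + 2 * M) * \<epsilon>" by (simp add: algebra_simps)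
    finally show ?thesis .
  qed
  have "\<bar>(\<integral>x. (f x)\<^sup>2 * \<gamma> x \<partial>m) + 2 * ?I f\<bar> \<le> 0"
    using V0 C G(1) q0 M(1) by (intro real_le_zero_from_small[OF main]) auto
  then show ?thesis by simp
qed

end

section \<open>The Leibniz rule\<close>

context metric_measure_space
begin

lemma BV_E:
  assumes "f \<in> BV m"
  obtains u :: "nat \<Rightarrow> 'a \<Rightarrow> real" and C where
    "\<And>n. u n \<in> LIPloc UNIV" "\<And>n. integrable m (u n)" "(\<lambda>n. \<integral>\<^sup>+x. ennreal \<bar>u n x - f x\<bar> \<partial>m) \<longlonglongrightarrow> 0"
    "\<And>n. (\<integral>\<^sup>+x. lip (u n) x \<partial>m) \<le> ennreal C" "0 \<le> C"
proof -
  have "BV_var m f UNIV < \<infinity>" using assms by (simp add: BV_def)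
  then obtain u where u: "\<And>k. u k \<in> LIPloc UNIV" "\<And>k. set_integrable m UNIV (u k)"
    "(\<lambda>k. \<integral>\<^sup>+x\<in>UNIV. ennreal \<bar>u k x - f x\<bar> \<partial>m) \<longlonglongrightarrow> 0" "liminf (\<lambda>k. \<integral>\<^sup>+x\<in>UNIV. lip (u k) x \<partial>m) < \<infinity>"
    unfolding BV_var_def Inf_less_iff by blast
  obtain r :: "nat \<Rightarrow> nat" and C where r: "strict_mono r" "0 \<le> C" "\<And>n. (\<integral>\<^sup>+x\<in>UNIV. lip (u (r n)) x \<partial>m) \<le> ennreal C"
    using liminf_finite_subseq[OF u(4)] by blast
  show ?thesis
  proof (rule that[of "\<lambda>n. u (r n)" C])
    show "(\<lambda>n. \<integral>\<^sup>+x. ennreal \<bar>u (r n) x - f x\<bar> \<partial>m) \<longlonglongrightarrow> 0"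
      using LIMSEQ_subseq_LIMSEQ[OF u(3) r(1)] by (simp add: comp_def)
    show "integrable m (u (r n))" for n using u(2)[of "r n"] by (simp add: set_integrable_def)
    show "(\<integral>\<^sup>+x. lip (u (r n)) x \<partial>m) \<le> ennreal C" for n using r(3)[of n] by simp
  qed (use u(1) r(2) in auto)
qed

lemma BV_I:
  assumes f: "integrable m f" and u: "\<And>n. u n \<in> LIPloc UNIV" "\<And>n. integrable m (u n)"
      "(\<lambda>n. \<integral>\<^sup>+x. ennreal \<bar>u n x - f x\<bar> \<partial>m) \<longlonglongrightarrow> 0" "\<And>n. (\<integral>\<^sup>+x. lip (u n) x \<partial>m) \<le> ennreal C"
  shows "f \<in> BV m"
proof -
  have "BV_var m f UNIV \<le> liminf (\<lambda>k. \<integral>\<^sup>+x\<in>UNIV. lip (u k) x \<partial>m)"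
    unfolding BV_var_def using u(1-3)
    by (intro Inf_lower CollectI exI[of _ u]) (auto simp: set_integrable_def)
  also have "\<dots> \<le> liminf (\<lambda>k. ennreal C)" using u(4) by (intro Liminf_mono always_eventually) simp
  also have "\<dots> < \<infinity>" by (simp add: Liminf_const)
  finally show ?thesis using f by (simp add: BV_def)
qed

text \<open>Truncating the approximants at height \<open>M\<close> leaves \<open>f\<close>
  unchanged. The truncation is 1-Lipschitz, so neither the L1 distances nor the slopes grow.\<close>

lemma BV_bounded_E:
  assumes f: "f \<in> BV m" and M: "\<And>x. \<bar>f x\<bar> \<le> M"
  obtains u :: "nat \<Rightarrow> 'a \<Rightarrow> real" and C where
    "\<And>n. u n \<in> LIPloc UNIV" "\<And>n. integrable m (u n)" "\<And>n x. \<bar>u n x\<bar> \<le> M"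
    "(\<lambda>n. \<integral>\<^sup>+x. ennreal \<bar>u n x - f x\<bar> \<partial>m) \<longlonglongrightarrow> 0" "\<And>n. (\<integral>\<^sup>+x. lip (u n) x \<partial>m) \<le> ennreal C" "0 \<le> C"
proof -
  obtain u C where u: "\<And>n. u n \<in> LIPloc UNIV" "\<And>n. integrable m (u n)"
    "(\<lambda>n. \<integral>\<^sup>+x. ennreal \<bar>u n x - f x\<bar> \<partial>m) \<longlonglongrightarrow> 0" "\<And>n. (\<integral>\<^sup>+x. lip (u n) x \<partial>m) \<le> ennreal C" "0 \<le> C"
    using BV_E[OF f] by blast
  define c where "c t = max (- M) (min M t)" for t
  have M0: "0 \<le> M" using M[of undefined] by linarith
  have cl: "\<bar>c s - c t\<bar> \<le> \<bar>s - t\<bar>" for s t unfolding c_def by (rule clamp_lipschitz)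
  have cl1: "\<bar>c s - c t\<bar> \<le> 1 * \<bar>s - t\<bar>" for s t using cl by simp
  have cM: "\<bar>c t\<bar> \<le> M" for t unfolding c_def by (rule clamp_abs_le[OF M0])
  have cf: "c (f x) = f x" for x using M[of x] by (simp add: c_def abs_le_iff max_def min_def)
  have c0: "c 0 = 0" using M0 by (simp add: c_def)
  have [measurable]: "c \<in> borel_measurable borel" unfolding c_def by measurable
  have [measurable]: "u n \<in> borel_measurable m" for n using u(2) by auto
  show ?thesis
  proof (rule that[of "\<lambda>n x. c (u n x)" C])
    show "(\<lambda>x. c (u n x)) \<in> LIPloc UNIV" for n by (rule LIPloc_compose[OF u(1) cl1]) simp
    show "integrable m (\<lambda>x. c (u n x))" for n
      using cl[of "u n _" 0] c0 by (intro Bochner_Integration.integrable_bound[OF u(2)[of n]]) auto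
    show "(\<lambda>n. \<integral>\<^sup>+x. ennreal \<bar>c (u n x) - f x\<bar> \<partial>m) \<longlonglongrightarrow> 0"
    proof (rule tendsto_sandwich[OF _ _ tendsto_const u(3)])
      show "\<forall>\<^sub>F n in sequentially. (\<integral>\<^sup>+x. ennreal \<bar>c (u n x) - f x\<bar> \<partial>m) \<le> (\<integral>\<^sup>+x. ennreal \<bar>u n x - f x\<bar> \<partial>m)"
        using cl[of "u _ _" "f _"] cf by (intro always_eventually allI nn_integral_mono ennreal_leI) simp
    qed simp
    show "(\<integral>\<^sup>+x. lip (\<lambda>x. c (u n x)) x \<partial>m) \<le> ennreal C" for n
    proof (rule order_trans[OF nn_integral_mono u(4)])
      show "lip (\<lambda>x. c (u n x)) x \<le> lip (u n) x" for x using lip_compose[OF cl1, of "u n" x] by simp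
    qed
  qed (use cM u(5) in auto)
qed

lemma BV_add:
  assumes "f \<in> BV m" "g \<in> BV m"
  shows "(\<lambda>x. f x + g x) \<in> BV m"
proof -
  obtain u C where u: "\<And>n. u n \<in> LIPloc UNIV" "\<And>n. integrable m (u n)"
    "(\<lambda>n. \<integral>\<^sup>+x. ennreal \<bar>u n x - f x\<bar> \<partial>m) \<longlonglongrightarrow> 0" "\<And>n. (\<integral>\<^sup>+x. lip (u n) x \<partial>m) \<le> ennreal C" "0 \<le> C"
    using BV_E[OF assms(1)] by blast
  obtain w D where w: "\<And>n. w n \<in> LIPloc UNIV" "\<And>n. integrable m (w n)"
    "(\<lambda>n. \<integral>\<^sup>+x. ennreal \<bar>w n x - g x\<bar> \<partial>m) \<longlonglongrightarrow> 0" "\<And>n. (\<integral>\<^sup>+x. lip (w n) x \<partial>m) \<le> ennreal D" "0 \<le> D"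
    using BV_E[OF assms(2)] by blast
  have fg: "integrable m f" "integrable m g" using assms by (auto simp: BV_def)
  have [measurable]: "u n \<in> borel_measurable m" "w n \<in> borel_measurable m" "f \<in> borel_measurable m" "g \<in> borel_measurable m" for n
    using u(2) w(2) fg by auto
  have [measurable]: "lip (u n) \<in> borel_measurable m" "lip (w n) \<in> borel_measurable m" for n
    using u(1) w(1) by (auto intro!: lip_measurable LIPloc_continuous)
  show ?thesis
  proof (rule BV_I[where u = "\<lambda>n x. u n x + w n x" and C = "C + D"])
    show "(\<lambda>n. \<integral>\<^sup>+x. ennreal \<bar>u n x + w n x - (f x + g x)\<bar> \<partial>m) \<longlonglongrightarrow> 0"
    proof (rule tendsto_sandwich[OF _ _ tendsto_const])
      show "(\<lambda>n. (\<integral>\<^sup>+x. ennreal \<bar>u n x - f x\<bar> \<partial>m) + (\<integral>\<^sup>+x. ennreal \<bar>w n x - g x\<bar> \<partial>m)) \<longlonglongrightarrow> 0"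
        using tendsto_add[OF u(3) w(3)] by simp
      show "\<forall>\<^sub>F n in sequentially. (\<integral>\<^sup>+x. ennreal \<bar>u n x + w n x - (f x + g x)\<bar> \<partial>m) \<le>
          (\<integral>\<^sup>+x. ennreal \<bar>u n x - f x\<bar> \<partial>m) + (\<integral>\<^sup>+x. ennreal \<bar>w n x - g x\<bar> \<partial>m)"
      proof (intro always_eventually allI)
        fix n
        have "(\<integral>\<^sup>+x. ennreal \<bar>u n x + w n x - (f x + g x)\<bar> \<partial>m) \<le> (\<integral>\<^sup>+x. ennreal \<bar>u n x - f x\<bar> + ennreal \<bar>w n x - g x\<bar> \<partial>m)"
        proof (rule nn_integral_mono)
          fix x
          have "\<bar>u n x + w n x - (f x + g x)\<bar> \<le> \<bar>u n x - f x\<bar> + \<bar>w n x - g x\<bar>" by linarith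
          then show "ennreal \<bar>u n x + w n x - (f x + g x)\<bar> \<le> ennreal \<bar>u n x - f x\<bar> + ennreal \<bar>w n x - g x\<bar>"
            by (simp add: ennreal_leI flip: ennreal_plus)
        qed
        then show "(\<integral>\<^sup>+x. ennreal \<bar>u n x + w n x - (f x + g x)\<bar> \<partial>m) \<le>
            (\<integral>\<^sup>+x. ennreal \<bar>u n x - f x\<bar> \<partial>m) + (\<integral>\<^sup>+x. ennreal \<bar>w n x - g x\<bar> \<partial>m)"
          by (simp add: nn_integral_add)
      qed
    qed simp
    show "(\<integral>\<^sup>+x. lip (\<lambda>x. u n x + w n x) x \<partial>m) \<le> ennreal (C + D)" for n
    proof -
      have "(\<integral>\<^sup>+x. lip (\<lambda>x. u n x + w n x) x \<partial>m) \<le> (\<integral>\<^sup>+x. lip (u n) x + lip (w n) x \<partial>m)"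
        by (intro nn_integral_mono lip_add)
      also have "\<dots> = (\<integral>\<^sup>+x. lip (u n) x \<partial>m) + (\<integral>\<^sup>+x. lip (w n) x \<partial>m)" by (simp add: nn_integral_add)
      also have "\<dots> \<le> ennreal C + ennreal D" using u(4) w(4) by (rule add_mono)
      finally show ?thesis using u(5) w(5) by simp
    qed
  qed (use u(2) w(2) fg LIPloc_add[OF u(1) w(1)] in auto)
qed

text \<open>Products of truncated approximants converge because
  \<open>u w - f g = u (w - g) + g (u - f)\<close> with bounded factors \<open>u\<close> and
  \<open>g\<close>; their slopes obey the pointwise product rule.\<close>

lemma BV_mult:
  assumes f: "f \<in> BV m" "f \<in> bcontfun" and g: "g \<in> BV m" "g \<in> bcontfun"
  shows "(\<lambda>x. f x * g x) \<in> BV m"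
proof -
  define M where "M = max (sup_norm f) (sup_norm g)"
  have M: "\<bar>f x\<bar> \<le> M" "\<bar>g x\<bar> \<le> M" for x
    using abs_le_sup_norm[OF f(2), of x] abs_le_sup_norm[OF g(2), of x] by (auto simp: M_def)
  have M0: "0 \<le> M" using M(1)[of undefined] by linarith
  obtain u C where u: "\<And>n. u n \<in> LIPloc UNIV" "\<And>n. integrable m (u n)" "\<And>n x. \<bar>u n x\<bar> \<le> M"
    "(\<lambda>n. \<integral>\<^sup>+x. ennreal \<bar>u n x - f x\<bar> \<partial>m) \<longlonglongrightarrow> 0" "\<And>n. (\<integral>\<^sup>+x. lip (u n) x \<partial>m) \<le> ennreal C" "0 \<le> C"
    using BV_bounded_E[OF f(1) M(1)] by blast
  obtain w D where w: "\<And>n. w n \<in> LIPloc UNIV" "\<And>n. integrable m (w n)" "\<And>n x. \<bar>w n x\<bar> \<le> M"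
    "(\<lambda>n. \<integral>\<^sup>+x. ennreal \<bar>w n x - g x\<bar> \<partial>m) \<longlonglongrightarrow> 0" "\<And>n. (\<integral>\<^sup>+x. lip (w n) x \<partial>m) \<le> ennreal D" "0 \<le> D"
    using BV_bounded_E[OF g(1) M(2)] by blast
  have fg: "integrable m f" "integrable m g" using f g by (auto simp: BV_def)
  have [measurable]: "u n \<in> borel_measurable m" "w n \<in> borel_measurable m" "f \<in> borel_measurable m" "g \<in> borel_measurable m" for n
    using u(2) w(2) fg by auto
  have [measurable]: "lip (u n) \<in> borel_measurable m" "lip (w n) \<in> borel_measurable m" for n
    using u(1) w(1) by (auto intro!: lip_measurable LIPloc_continuous)
  have Linf: "f \<in> Linf m" "u n \<in> Linf m" for n using M u(3)[of n] by (auto simp: Linf_def intro!: exI[of _ M])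
  show ?thesis
  proof (rule BV_I[where u = "\<lambda>n x. u n x * w n x" and C = "M * D + M * C"])
    show "(\<lambda>x. u n x * w n x) \<in> LIPloc UNIV" for n by (rule LIPloc_mult_bounded[OF u(1) w(1) u(3) w(3)])
    show "integrable m (\<lambda>x. f x * g x)" "integrable m (\<lambda>x. u n x * w n x)" for n
      by (intro integrable_Linf_mult Linf fg w(2))+
    show "(\<lambda>n. \<integral>\<^sup>+x. ennreal \<bar>u n x * w n x - f x * g x\<bar> \<partial>m) \<longlonglongrightarrow> 0"
    proof (rule tendsto_sandwich[OF _ _ tendsto_const])
      have "(\<lambda>n. ennreal M * (\<integral>\<^sup>+x. ennreal \<bar>w n x - g x\<bar> \<partial>m) + ennreal M * (\<integral>\<^sup>+x. ennreal \<bar>u n x - f x\<bar> \<partial>m)) \<longlonglongrightarrow> ennreal M * 0 + ennreal M * 0"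
        by (intro tendsto_add ennreal_tendsto_cmult u(4) w(4)) auto
      then show "(\<lambda>n. ennreal M * (\<integral>\<^sup>+x. ennreal \<bar>w n x - g x\<bar> \<partial>m) + ennreal M * (\<integral>\<^sup>+x. ennreal \<bar>u n x - f x\<bar> \<partial>m)) \<longlonglongrightarrow> 0"
        by simp
      show "\<forall>\<^sub>F n in sequentially. (\<integral>\<^sup>+x. ennreal \<bar>u n x * w n x - f x * g x\<bar> \<partial>m) \<le>
          ennreal M * (\<integral>\<^sup>+x. ennreal \<bar>w n x - g x\<bar> \<partial>m) + ennreal M * (\<integral>\<^sup>+x. ennreal \<bar>u n x - f x\<bar> \<partial>m)"
      proof (intro always_eventually allI)
        fix n
        have "(\<integral>\<^sup>+x. ennreal \<bar>u n x * w n x - f x * g x\<bar> \<partial>m) \<le>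
            (\<integral>\<^sup>+x. ennreal M * ennreal \<bar>w n x - g x\<bar> + ennreal M * ennreal \<bar>u n x - f x\<bar> \<partial>m)"
        proof (rule nn_integral_mono)
          fix x
          have "u n x * w n x - f x * g x = u n x * (w n x - g x) + g x * (u n x - f x)" by (simp add: algebra_simps)
          then have "\<bar>u n x * w n x - f x * g x\<bar> \<le> \<bar>u n x\<bar> * \<bar>w n x - g x\<bar> + \<bar>g x\<bar> * \<bar>u n x - f x\<bar>"
            by (simp add: abs_mult[symmetric])
          also have "\<dots> \<le> M * \<bar>w n x - g x\<bar> + M * \<bar>u n x - f x\<bar>"
            using u(3) M(2) by (intro add_mono mult_right_mono) auto
          finally show "ennreal \<bar>u n x * w n x - f x * g x\<bar> \<le> ennreal M * ennreal \<bar>w n x - g x\<bar> + ennreal M * ennreal \<bar>u n x - f x\<bar>"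
            using M0 by (simp add: ennreal_leI flip: ennreal_plus ennreal_mult)
        qed
        then show "(\<integral>\<^sup>+x. ennreal \<bar>u n x * w n x - f x * g x\<bar> \<partial>m) \<le>
          ennreal M * (\<integral>\<^sup>+x. ennreal \<bar>w n x - g x\<bar> \<partial>m) + ennreal M * (\<integral>\<^sup>+x. ennreal \<bar>u n x - f x\<bar> \<partial>m)"
          by (simp add: nn_integral_add nn_integral_cmult)
      qed
    qed simp
    show "(\<integral>\<^sup>+x. lip (\<lambda>x. u n x * w n x) x \<partial>m) \<le> ennreal (M * D + M * C)" for n
    proof -
      have "(\<integral>\<^sup>+x. lip (\<lambda>x. u n x * w n x) x \<partial>m) \<le> (\<integral>\<^sup>+x. ennreal M * lip (w n) x + ennreal M * lip (u n) x \<partial>m)"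
      proof (rule nn_integral_mono)
        fix x
        have "lip (\<lambda>x. u n x * w n x) x \<le> ennreal \<bar>u n x\<bar> * lip (w n) x + ennreal \<bar>w n x\<bar> * lip (u n) x"
          by (intro lip_mult LIPloc_isCont LIPloc_lip_finite u(1) w(1))
        also have "\<dots> \<le> ennreal M * lip (w n) x + ennreal M * lip (u n) x"
          using u(3) w(3) by (intro add_mono mult_right_mono ennreal_leI) auto
        finally show "lip (\<lambda>x. u n x * w n x) x \<le> ennreal M * lip (w n) x + ennreal M * lip (u n) x" .
      qed
      also have "\<dots> = ennreal M * (\<integral>\<^sup>+x. lip (w n) x \<partial>m) + ennreal M * (\<integral>\<^sup>+x. lip (u n) x \<partial>m)"
        by (simp add: nn_integral_add nn_integral_cmult)
      also have "\<dots> \<le> ennreal M * ennreal D + ennreal M * ennreal C" using u(5) w(5) by (intro add_mono mult_left_mono) auto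
      also have "\<dots> = ennreal (M * D + M * C)" using M0 u(6) w(6) by (simp add: ennreal_mult)
      finally show ?thesis .
    qed
  qed
qed

end

section \<open>Linear combinations of local vector measures\<close>

context normed_Cb_module
begin

lemma dual_norm_comb_le:
  "dual_norm V nrm (\<lambda>v. a * \<phi> v + b * \<psi> v) \<le> ennreal \<bar>a\<bar> * dual_norm V nrm \<phi> + ennreal \<bar>b\<bar> * dual_norm V nrm \<psi>"
  unfolding dual_norm_def[of V nrm "\<lambda>v. a * \<phi> v + b * \<psi> v"]
proof (rule SUP_least)
  fix v assume v: "v \<in> {v \<in> V. nrm v \<le> 1}"
  have "\<bar>a * \<phi> v + b * \<psi> v\<bar> \<le> \<bar>a\<bar> * \<bar>\<phi> v\<bar> + \<bar>b\<bar> * \<bar>\<psi> v\<bar>" by (simp add: abs_mult[symmetric])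
  then have "ennreal \<bar>a * \<phi> v + b * \<psi> v\<bar> \<le> ennreal \<bar>a\<bar> * ennreal \<bar>\<phi> v\<bar> + ennreal \<bar>b\<bar> * ennreal \<bar>\<psi> v\<bar>"
    by (simp add: ennreal_leI flip: ennreal_plus ennreal_mult)
  also have "\<dots> \<le> ennreal \<bar>a\<bar> * dual_norm V nrm \<phi> + ennreal \<bar>b\<bar> * dual_norm V nrm \<psi>"
    unfolding dual_norm_def using v by (intro add_mono mult_left_mono SUP_upper) auto
  finally show "ennreal \<bar>a * \<phi> v + b * \<psi> v\<bar> \<le> ennreal \<bar>a\<bar> * dual_norm V nrm \<phi> + ennreal \<bar>b\<bar> * dual_norm V nrm \<psi>" .
qed

lemma local_vector_measure_comb:
  assumes N: "local_vector_measure V nrm act N" and N': "local_vector_measure V nrm act N'"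
  shows "local_vector_measure V nrm act (\<lambda>A v. a * N A v + b * N' A v)"
  unfolding local_vector_measure_def
proof (intro conjI ballI allI impI)
  fix A :: "'a set" assume A: "A \<in> sets borel"
  have d: "N A \<in> dual_space V nrm" "N' A \<in> dual_space V nrm"
    using A N N' by (auto simp: local_vector_measure_def)
  then have fin: "dual_norm V nrm (N A) < \<infinity>" "dual_norm V nrm (N' A) < \<infinity>" by (auto simp: dual_space_def)
  have "dual_norm V nrm (\<lambda>v. a * N A v + b * N' A v) < \<infinity>"
    using fin by (intro le_less_trans[OF dual_norm_comb_le]) (auto simp: ennreal_mult_less_top less_top)
  then show "(\<lambda>v. a * N A v + b * N' A v) \<in> dual_space V nrm"
    using d unfolding dual_space_def by (auto simp: algebra_simps)
next
  fix A :: "nat \<Rightarrow> 'a set" assume A: "range A \<subseteq> sets borel" "disjoint_family A"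
  let ?p = "\<lambda>N n v. N (\<Union>i. A i) v - (\<Sum>i<n. N (A i) v)"
  have l: "(\<lambda>n. dual_norm V nrm (?p N n)) \<longlonglongrightarrow> 0" "(\<lambda>n. dual_norm V nrm (?p N' n)) \<longlonglongrightarrow> 0"
    using N N' A by (auto simp: local_vector_measure_def)
  have "(\<lambda>n. ennreal \<bar>a\<bar> * dual_norm V nrm (?p N n) + ennreal \<bar>b\<bar> * dual_norm V nrm (?p N' n)) \<longlonglongrightarrow>
      ennreal \<bar>a\<bar> * 0 + ennreal \<bar>b\<bar> * 0"
    by (intro tendsto_add ennreal_tendsto_cmult l) auto
  then have lim: "(\<lambda>n. ennreal \<bar>a\<bar> * dual_norm V nrm (?p N n) + ennreal \<bar>b\<bar> * dual_norm V nrm (?p N' n)) \<longlonglongrightarrow> 0"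
    by simp
  have "?p (\<lambda>A v. a * N A v + b * N' A v) n = (\<lambda>v. a * ?p N n v + b * ?p N' n v)" for n
    by (simp add: fun_eq_iff right_diff_distrib sum.distrib sum_distrib_left)
  then show "(\<lambda>n. dual_norm V nrm (?p (\<lambda>A v. a * N A v + b * N' A v) n)) \<longlonglongrightarrow> 0"
    using dual_norm_comb_le by (intro tendsto_sandwich[OF _ _ tendsto_const lim] always_eventually) auto
qed (use N N' in \<open>auto simp: local_vector_measure_def\<close>)

lemma local_vector_measure_add:
  "local_vector_measure V nrm act N \<Longrightarrow> local_vector_measure V nrm act N' \<Longrightarrow>
    local_vector_measure V nrm act (add_lvm N N')"
  using local_vector_measure_comb[of N N' 1 1] by (simp add: add_lvm_def[abs_def])

end

text \<open>The three integrals are defined through three separate decompositions into positive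
  measures. They are compared on the level sets of one common simple approximation.\<close>

lemma signed_integral_add_measure:
  assumes "signed_measure \<mu>" "signed_measure \<mu>'" "signed_measure (\<lambda>A. \<mu> A + \<mu>' A)"
    and h: "h \<in> borel_measurable borel" "\<And>x. \<bar>h x\<bar> \<le> c"
  shows "signed_measure.integral_signed (\<lambda>A. \<mu> A + \<mu>' A) h =
    signed_measure.integral_signed \<mu> h + signed_measure.integral_signed \<mu>' h"
proof (rule LIMSEQ_unique)
  let ?s = "\<lambda>n. round_down n h"
  have lim: "(\<lambda>n. \<Sum>c\<in>range (?s n). c * \<nu> (?s n -` {c})) \<longlonglongrightarrow> signed_measure.integral_signed \<nu> h"
    if "signed_measure \<nu>" for \<nu>
    using signed_measure.integral_signed_simple_limit[OF that simple_function_round_down[OF h] uniform_limit_round_down h, of UNIV]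
    by simp
  show "(\<lambda>n. \<Sum>c\<in>range (?s n). c * (\<mu> (?s n -` {c}) + \<mu>' (?s n -` {c}))) \<longlonglongrightarrow>
      signed_measure.integral_signed (\<lambda>A. \<mu> A + \<mu>' A) h" by (rule lim[OF assms(3)])
  show "(\<lambda>n. \<Sum>c\<in>range (?s n). c * (\<mu> (?s n -` {c}) + \<mu>' (?s n -` {c}))) \<longlonglongrightarrow>
      signed_measure.integral_signed \<mu> h + signed_measure.integral_signed \<mu>' h"
    using tendsto_add[OF lim[OF assms(1)] lim[OF assms(2)]] by (simp add: distrib_left sum.distrib)
qed

text \<open>The factor \<open>p n\<close> is the distance to the complement, scaled by
  \<open>n\<close> and capped at 1; \<open>q n\<close> cuts off outside growing balls to make the
  supports bounded.\<close>

lemma indicator_open_limit_LIPbs: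
  fixes B :: "'a::metric_space set"
  assumes "open B"
  obtains \<phi> :: "nat \<Rightarrow> 'a \<Rightarrow> real" where "\<And>n. \<phi> n \<in> LIPbs" "\<And>n x. \<bar>\<phi> n x\<bar> \<le> 1"
    "\<And>x. (\<lambda>n. \<phi> n x) \<longlonglongrightarrow> indicator B x"
proof -
  fix x0 :: 'a
  \<comment> \<open>The whole space is treated apart: its complement is empty, and the conventional
    distance 0 would give the zero function.\<close>
  define p where "p n x = (if B = UNIV then 1 else max 0 (min 1 (real n * infdist x (- B))))" for n x
  define q where "q n x = max 0 (min 1 (real n - dist x x0))" for n x
  have p1: "\<bar>p n x\<bar> \<le> 1" and q1: "\<bar>q n x\<bar> \<le> 1" for n x by (auto simp: p_def q_def)
  have pL: "p n \<in> LIPb" for n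
  proof (rule LIPbI[OF p1])
    fix x y
    have "\<bar>max 0 (min 1 (real n * infdist x (- B))) - max 0 (min 1 (real n * infdist y (- B)))\<bar> \<le>
        \<bar>real n * infdist x (- B) - real n * infdist y (- B)\<bar>" by (rule clamp_lipschitz)
    also have "\<dots> = real n * \<bar>infdist x (- B) - infdist y (- B)\<bar>" by (simp add: abs_mult flip: right_diff_distrib)
    also have "\<dots> \<le> real n * dist x y" by (intro mult_left_mono infdist_triangle_abs) simp
    finally show "\<bar>p n x - p n y\<bar> \<le> real n * dist x y" by (simp add: p_def)
  qed
  have qL: "q n \<in> LIPbs" for n
  proof -
    have "q n \<in> LIPb"
    proof (rule LIPbI[OF q1])
      fix x y
      have "\<bar>q n x - q n y\<bar> \<le> \<bar>(real n - dist x x0) - (real n - dist y x0)\<bar>" unfolding q_def by (rule clamp_lipschitz)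
      also have "\<dots> \<le> 1 * dist x y" using dist_triangle[of x x0 y] dist_triangle[of y x0 x] by (simp add: abs_le_iff dist_commute)
      finally show "\<bar>q n x - q n y\<bar> \<le> 1 * dist x y" .
    qed
    moreover have "bounded {x. q n x \<noteq> 0}"
      by (rule bounded_subset[OF bounded_ball[of x0 "real n"]]) (auto simp: q_def dist_commute not_less)
    ultimately show ?thesis by (simp add: LIPbs_def)
  qed
  show ?thesis
  proof (rule that[of "\<lambda>n x. p n x * q n x"])
    show "(\<lambda>x. p n x * q n x) \<in> LIPbs" for n by (rule LIPbs_mult[OF pL qL])
    show "\<bar>p n x * q n x\<bar> \<le> 1" for n x
      using mult_mono[OF p1[of n x] q1[of n x]] by (simp add: abs_mult)
    have "(\<lambda>n. p n x) \<longlonglongrightarrow> indicator B x" for x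
    proof (cases "B = UNIV \<or> x \<notin> B")
      case True
      then have "p n x = indicator B x" for n by (auto simp: p_def infdist_zero)
      then show ?thesis by simp
    next
      case False
      then have "0 < infdist x (- B)"
        using assms in_closed_iff_infdist_zero[of "- B" x] infdist_nonneg[of x "- B"] by (auto simp: less_le)
      then obtain k :: nat where k: "1 \<le> real k * infdist x (- B)"
        using ex_less_of_nat_mult[of "infdist x (- B)" 1] by (auto intro: less_imp_le)
      have "p n x = 1" if "k \<le> n" for n
      proof -
        have "real k * infdist x (- B) \<le> real n * infdist x (- B)" using that by (intro mult_right_mono infdist_nonneg) auto
        then show ?thesis using k by (simp add: p_def)
      qed
      then have "\<forall>\<^sub>F n in sequentially. p n x = 1" by (auto simp: eventually_sequentially)
      then show ?thesis using False by (simp add: tendsto_eventually)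
    qed
    moreover have "(\<lambda>n. q n x) \<longlonglongrightarrow> 1" for x
    proof (rule tendsto_eventually)
      obtain k :: nat where "1 + dist x x0 \<le> real k" using real_arch_simple by blast
      then have "q n x = 1" if "k \<le> n" for n using that unfolding q_def by simp
      then show "\<forall>\<^sub>F n in sequentially. q n x = 1" by (auto simp: eventually_sequentially)
    qed
    ultimately show "(\<lambda>n. p n x * q n x) \<longlonglongrightarrow> indicator B x" for x
      using tendsto_mult[of "\<lambda>n. p n x" "indicator B x" sequentially "\<lambda>n. q n x" 1] by simp
  qed
qed

section \<open>Uniqueness of the differential and the product formula\<close>

context tangent_calculus
begin

text \<open>Multiples of \<open>v\<close> by functions in \<open>LIPbs\<close> again have a bounded
  divergence, so the integral of each such function against \<open>\<lambda>A. M A v\<close> is 0.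
  Approximating indicators gives 0 on open sets, then on Borel sets, and \<open>N_act\<close>
  reaches the combinations with coefficients in \<open>bcontfun\<close>.\<close>

lemma lvm_eq_0:
  assumes M: "local_vector_measure (test_module m T d L \<iota>) (LinfTX_norm m L) (fmul L) M"
    and z: "\<And>v. v \<in> Ddiv m T d L \<iota> \<Longrightarrow> M UNIV v = 0"
  shows "M A w = 0"
proof -
  interpret lv: local_vector_measure_on "test_module m T d L \<iota>" "LinfTX_norm m L" "fmul L" M
    using M normed_Cb_module_test_module
    by (intro local_vector_measure_on.intro local_vector_measure_on_axioms.intro)
  have op: "M B v = 0" if v: "v \<in> Ddiv m T d L \<iota>" and B: "open B" for B v
  proof -
    obtain \<phi> :: "nat \<Rightarrow> 'a \<Rightarrow> real" where \<phi>: "\<And>n. \<phi> n \<in> LIPbs" "\<And>n x. \<bar>\<phi> n x\<bar> \<le> 1" "\<And>x. (\<lambda>n. \<phi> n x) \<longlonglongrightarrow> indicator B x"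
      using indicator_open_limit_LIPbs[OF B] by blast
    have "(\<lambda>n. lv.sm.integral_signed v (\<phi> n)) \<longlonglongrightarrow> lv.sm.integral_signed v (indicator B)"
    proof (rule lv.sm.integral_signed_dominated[OF _ \<phi>(2) _ \<phi>(3)])
      show "\<phi> n \<in> borel_measurable borel" for n
        by (rule borel_measurable_continuous_onI[OF LIPb_continuous[OF LIPbs_LIPb[OF \<phi>(1)]]])
    qed (use B in simp)
    moreover have "lv.sm.integral_signed v (\<phi> n) = 0" for n
      using lv.N_act[OF LIPb_bcontfun[OF LIPbs_LIPb[OF \<phi>(1)]] Ddiv_test_module[OF v], of UNIV n]
        z[OF fmul_Ddiv[OF \<phi>(1) v]] by simp
    ultimately have "lv.sm.integral_signed v (indicator B) = 0" by (simp add: LIMSEQ_const_iff)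
    then show ?thesis using B by (simp add: lv.sm.integral_signed_indicator)
  qed
  have all: "M B v = 0" if "v \<in> Ddiv m T d L \<iota>" for B v
  proof (cases "B \<in> sets borel")
    case True
    show ?thesis by (rule lv.sm.zero_on_open_imp_zero[of UNIV, OF _ op[OF that] True]) auto
  qed (rule lv.N_not_borel)
  show ?thesis
  proof (cases "A \<in> sets borel \<and> w \<in> test_module m T d L \<iota>")
    case True
    then obtain n h v where w: "\<And>i. i < n \<Longrightarrow> h i \<in> bcontfun" "\<And>i. i < n \<Longrightarrow> v i \<in> Ddiv m T d L \<iota>"
      "w = (\<Sum>i<n::nat. fmul L (h i) (v i))"
      unfolding test_module_def by blast
    have "M A (fmul L (h i) (v i)) = 0" if i: "i < n" for i
    proof -
      have "M A (fmul L (h i) (v i)) = lv.sm.integral_signed (v i) (\<lambda>x. indicator A x * h i x)"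
        using True w i by (intro lv.N_act Ddiv_test_module) auto
      also have "\<dots> = 0"
      proof (rule lv.integral_N_zero)
        show "h i \<in> borel_measurable borel" using w(1)[OF i] by (auto simp: bcontfun_def intro: borel_measurable_continuous_onI)
        show "\<bar>h i x\<bar> \<le> sup_norm (h i)" for x by (rule abs_le_sup_norm[OF w(1)[OF i]])
      qed (use True all[OF w(2)[OF i]] in auto)
      finally show ?thesis .
    qed
    moreover have "M A w = (\<Sum>i<n. M A (fmul L (h i) (v i)))"
      unfolding w(3) using w by (intro lv.N_sum lv.act_closed Ddiv_test_module) auto
    ultimately show ?thesis by simp
  qed (use lv.N_not_borel lv.N_not_V in auto)
qed

lemma BV_differential_unique:
  assumes N: "is_BV_differential m T d L \<iota> f N" and N': "is_BV_differential m T d L \<iota> f N'"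
  shows "N = N'"
proof -
  interpret normed_Cb_module "test_module m T d L \<iota>" "LinfTX_norm m L" "fmul L"
    by (rule normed_Cb_module_test_module)
  have "1 * N A v + (- 1) * N' A v = 0" for A v
  proof (rule lvm_eq_0)
    show "local_vector_measure (test_module m T d L \<iota>) (LinfTX_norm m L) (fmul L) (\<lambda>A v. 1 * N A v + (- 1) * N' A v)"
      using N N' by (intro local_vector_measure_comb) (auto simp: is_BV_differential_def)
    show "1 * N UNIV v + (- 1) * N' UNIV v = 0" if v: "v \<in> Ddiv m T d L \<iota>" for v
    proof -
      obtain \<gamma> where "is_divergence m T d L \<iota> v \<gamma>" using v by (auto simp: Ddiv_def)
      then show ?thesis using N N' v by (simp add: is_BV_differential_def)
    qed
  qed
  then show ?thesis by (simp add: fun_eq_iff)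
qed

lemma BV_differential_add:
  assumes f: "integrable m f" and g: "integrable m g"
    and Df: "is_BV_differential m T d L \<iota> f Df" and Dg: "is_BV_differential m T d L \<iota> g Dg"
  shows "is_BV_differential m T d L \<iota> (\<lambda>x. f x + g x) (add_lvm Df Dg)"
proof -
  interpret normed_Cb_module "test_module m T d L \<iota>" "LinfTX_norm m L" "fmul L"
    by (rule normed_Cb_module_test_module)
  have "add_lvm Df Dg UNIV v = - (\<integral>x. (f x + g x) * \<gamma> x \<partial>m)"
    if v: "v \<in> Ddiv m T d L \<iota>" and \<gamma>: "is_divergence m T d L \<iota> v \<gamma>" for v \<gamma>
  proof -
    have "\<gamma> \<in> Linf m" using \<gamma> by (simp add: is_divergence_def)
    then have "integrable m (\<lambda>x. f x * \<gamma> x)" "integrable m (\<lambda>x. g x * \<gamma> x)"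
      using integrable_Linf_mult[OF _ f] integrable_Linf_mult[OF _ g] by (simp_all add: mult.commute)
    then have "(\<integral>x. (f x + g x) * \<gamma> x \<partial>m) = (\<integral>x. f x * \<gamma> x \<partial>m) + (\<integral>x. g x * \<gamma> x \<partial>m)"
      by (simp add: distrib_right)
    then show ?thesis using Df Dg v \<gamma> by (simp add: is_BV_differential_def add_lvm_def)
  qed
  then show ?thesis using Df Dg local_vector_measure_add by (auto simp: is_BV_differential_def)
qed

lemma BV_chain_rule_square:
  assumes "f \<in> BV m" "f \<in> bcontfun" "is_BV_differential m T d L \<iota> f N"
    and "v \<in> Ddiv m T d L \<iota>" "is_divergence m T d L \<iota> v \<gamma>"
  shows "(\<integral>x. (f x)\<^sup>2 * \<gamma> x \<partial>m) = - 2 * signed_measure.integral_signed (\<lambda>A. N A v) f"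
proof -
  obtain u C where "\<And>n. u n \<in> LIPloc UNIV" "\<And>n. integrable m (u n)"
    "(\<lambda>n. \<integral>\<^sup>+x. ennreal \<bar>u n x - f x\<bar> \<partial>m) \<longlonglongrightarrow> 0" "\<And>n. (\<integral>\<^sup>+x. lip (u n) x \<partial>m) \<le> ennreal C" "0 \<le> C"
    using BV_E[OF assms(1)] by blast
  moreover have "integrable m f" using assms(1) by (simp add: BV_def)
  ultimately show ?thesis using assms(2-5) by (intro chain_rule_square)
qed

text \<open>Polarisation of the chain rule for squares.\<close>
lemma BV_integration_by_parts:
  assumes f: "f \<in> BV m" "f \<in> bcontfun" and g: "g \<in> BV m" "g \<in> bcontfun"
    and Df: "is_BV_differential m T d L \<iota> f Df" and Dg: "is_BV_differential m T d L \<iota> g Dg"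
    and v: "v \<in> Ddiv m T d L \<iota>" and div: "is_divergence m T d L \<iota> v \<gamma>"
  shows "signed_measure.integral_signed (\<lambda>A. Dg A v) f + signed_measure.integral_signed (\<lambda>A. Df A v) g =
    - (\<integral>x. (f x * g x) * \<gamma> x \<partial>m)"
proof -
  interpret lf: local_vector_measure_on "test_module m T d L \<iota>" "LinfTX_norm m L" "fmul L" Df
    by (rule test_module_measure[OF Df])
  interpret lg: local_vector_measure_on "test_module m T d L \<iota>" "LinfTX_norm m L" "fmul L" Dg
    by (rule test_module_measure[OF Dg])
  have i: "integrable m f" "integrable m g" using f g by (auto simp: BV_def)
  let ?s = "\<lambda>x. f x + g x"
  have Ds: "is_BV_differential m T d L \<iota> ?s (add_lvm Df Dg)" by (rule BV_differential_add[OF i Df Dg])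
  interpret ls: local_vector_measure_on "test_module m T d L \<iota>" "LinfTX_norm m L" "fmul L" "add_lvm Df Dg"
    by (rule test_module_measure[OF Ds])
  have s: "?s \<in> BV m" "?s \<in> bcontfun"
    using BV_add[OF f(1) g(1)] plus_cont[OF f(2) g(2)] by auto
  have fb: "f \<in> borel_measurable borel" "g \<in> borel_measurable borel"
    using f(2) g(2) by (auto simp: bcontfun_def intro: borel_measurable_continuous_onI)
  note b = abs_le_sup_norm[OF f(2)] abs_le_sup_norm[OF g(2)]
  have sp: "ls.sm.integral_signed v h = lf.sm.integral_signed v h + lg.sm.integral_signed v h"
    if "h \<in> borel_measurable borel" "\<And>x. \<bar>h x\<bar> \<le> c" for h c
    using signed_integral_add_measure[OF lf.signed_measure_N lg.signed_measure_N _ that, of v v] ls.signed_measure_N[of v]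
    by (simp add: add_lvm_def)
  have "ls.sm.integral_signed v ?s = ls.sm.integral_signed v f + ls.sm.integral_signed v g"
    by (rule ls.sm.integral_signed_add[OF fb(1) b(1) fb(2) b(2)])
  then have I: "ls.sm.integral_signed v ?s = lf.sm.integral_signed v f + lg.sm.integral_signed v f +
      (lf.sm.integral_signed v g + lg.sm.integral_signed v g)"
    using sp[OF fb(1) b(1)] sp[OF fb(2) b(2)] by simp
  have \<gamma>: "\<gamma> \<in> Linf m" using div by (simp add: is_divergence_def)
  have L: "f \<in> Linf m" "g \<in> Linf m"
    using b bcontfun_measurable f(2) g(2) by (auto simp: Linf_def)
  have "integrable m (\<lambda>x. \<gamma> x * (f x * f x))" "integrable m (\<lambda>x. \<gamma> x * (f x * g x))" "integrable m (\<lambda>x. \<gamma> x * (g x * g x))"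
    by (intro integrable_Linf_mult \<gamma> L i)+
  then have ii: "integrable m (\<lambda>x. (f x)\<^sup>2 * \<gamma> x)" "integrable m (\<lambda>x. (f x * g x) * \<gamma> x)" "integrable m (\<lambda>x. (g x)\<^sup>2 * \<gamma> x)"
    by (simp_all add: power2_eq_square mult.commute)
  have "(\<integral>x. (?s x)\<^sup>2 * \<gamma> x \<partial>m) = (\<integral>x. (f x)\<^sup>2 * \<gamma> x + 2 * ((f x * g x) * \<gamma> x) + (g x)\<^sup>2 * \<gamma> x \<partial>m)"
    by (intro Bochner_Integration.integral_cong) (auto simp: power2_eq_square algebra_simps)
  also have "\<dots> = (\<integral>x. (f x)\<^sup>2 * \<gamma> x \<partial>m) + 2 * (\<integral>x. (f x * g x) * \<gamma> x \<partial>m) + (\<integral>x. (g x)\<^sup>2 * \<gamma> x \<partial>m)"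
    using ii by simp
  finally have S: "(\<integral>x. (?s x)\<^sup>2 * \<gamma> x \<partial>m) =
    (\<integral>x. (f x)\<^sup>2 * \<gamma> x \<partial>m) + 2 * (\<integral>x. (f x * g x) * \<gamma> x \<partial>m) + (\<integral>x. (g x)\<^sup>2 * \<gamma> x \<partial>m)" .
  show ?thesis
    using S I BV_chain_rule_square[OF s Ds v div] BV_chain_rule_square[OF f Df v div] BV_chain_rule_square[OF g Dg v div]
    by linarith
qed

lemma BV_differential_mult:
  assumes f: "f \<in> BV m" "f \<in> bcontfun" and g: "g \<in> BV m" "g \<in> bcontfun"
    and Df: "is_BV_differential m T d L \<iota> f Df" and Dg: "is_BV_differential m T d L \<iota> g Dg"
  shows "is_BV_differential m T d L \<iota> (\<lambda>x. f x * g x) (add_lvm (scale_lvm f Dg) (scale_lvm g Df))"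
proof -
  interpret lf: local_vector_measure_on "test_module m T d L \<iota>" "LinfTX_norm m L" "fmul L" Df
    by (rule test_module_measure[OF Df])
  interpret lg: local_vector_measure_on "test_module m T d L \<iota>" "LinfTX_norm m L" "fmul L" Dg
    by (rule test_module_measure[OF Dg])
  have fb: "f \<in> borel_measurable borel" "g \<in> borel_measurable borel"
    using f(2) g(2) by (auto simp: bcontfun_def intro: borel_measurable_continuous_onI)
  note b = abs_le_sup_norm[OF f(2)] abs_le_sup_norm[OF g(2)]
  have "add_lvm (scale_lvm f Dg) (scale_lvm g Df) UNIV v = - (\<integral>x. (f x * g x) * \<gamma> x \<partial>m)"
    if "v \<in> Ddiv m T d L \<iota>" "is_divergence m T d L \<iota> v \<gamma>" for v \<gamma>
    using BV_integration_by_parts[OF assms that] lg.scale_lvm_eq[OF fb(1) b(1), of UNIV v] lf.scale_lvm_eq[OF fb(2) b(2), of UNIV v]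
    by (simp add: add_lvm_def)
  moreover have "local_vector_measure (test_module m T d L \<iota>) (LinfTX_norm m L) (fmul L) (add_lvm (scale_lvm f Dg) (scale_lvm g Df))"
    by (intro lf.local_vector_measure_add lg.local_vector_measure_scale[OF fb(1) b(1)] lf.local_vector_measure_scale[OF fb(2) b(2)])
  ultimately show ?thesis by (simp add: is_BV_differential_def)
qed

lemma total_variation_BV_differential_mult_le:
  assumes f: "f \<in> BV m" "f \<in> bcontfun" and g: "g \<in> BV m" "g \<in> bcontfun"
    and Df: "is_BV_differential m T d L \<iota> f Df" and Dg: "is_BV_differential m T d L \<iota> g Dg"
    and E: "E \<in> sets borel"
  defines "V \<equiv> test_module m T d L \<iota>" and "nrm \<equiv> LinfTX_norm m L"
  shows "total_variation V nrm (add_lvm (scale_lvm f Dg) (scale_lvm g Df)) E \<le>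
    (\<integral>\<^sup>+x\<in>E. ennreal \<bar>f x\<bar> \<partial>total_variation_measure V nrm Dg) +
    (\<integral>\<^sup>+x\<in>E. ennreal \<bar>g x\<bar> \<partial>total_variation_measure V nrm Df)"
proof -
  let ?P = "add_lvm (scale_lvm f Dg) (scale_lvm g Df)"
  interpret lf: local_vector_measure_on V nrm "fmul L" Df
    unfolding V_def nrm_def by (rule test_module_measure[OF Df])
  interpret lg: local_vector_measure_on V nrm "fmul L" Dg
    unfolding V_def nrm_def by (rule test_module_measure[OF Dg])
  interpret lp: local_vector_measure_on V nrm "fmul L" ?P
    unfolding V_def nrm_def by (rule test_module_measure[OF BV_differential_mult[OF f g Df Dg]])
  have fb: "f \<in> borel_measurable borel" "g \<in> borel_measurable borel"
    using f(2) g(2) by (auto simp: bcontfun_def intro: borel_measurable_continuous_onI)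
  note b = abs_le_sup_norm[OF f(2)] abs_le_sup_norm[OF g(2)]
  have "total_variation V nrm ?P E = dual_norm V nrm (?P E)" by (simp add: lp.total_variation_N[OF E] lp.dual_norm_N)
  also have "\<dots> \<le> dual_norm V nrm (scale_lvm f Dg E) + dual_norm V nrm (scale_lvm g Df E)"
    using lf.dual_norm_comb_le[of 1 "scale_lvm f Dg E" 1 "scale_lvm g Df E"] by (simp add: add_lvm_def[abs_def])
  also have "\<dots> \<le> (\<integral>\<^sup>+x\<in>E. ennreal \<bar>f x\<bar> \<partial>total_variation_measure V nrm Dg) +
    (\<integral>\<^sup>+x\<in>E. ennreal \<bar>g x\<bar> \<partial>total_variation_measure V nrm Df)"
    by (intro add_mono lg.dual_norm_scale_lvm_le[OF fb(1) b(1) E] lf.dual_norm_scale_lvm_le[OF fb(2) b(2) E])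
  finally show ?thesis .
qed

end

text \<open>The equivalence in the second conjunct contains the product formula together with
  existence and uniqueness of the differential of \<open>f * g\<close>. Comparing the two sides on
  every Borel set expresses the inequality between measures.\<close>

theorem proposition1p49:
  fixes m :: "'a::polish_space measure"
    and T :: "('a, 'c::real_normed_vector) pn_module" and d :: "('a \<Rightarrow> real) \<Rightarrow> 'c"
    and L :: "('a, 'v::real_vector) pn_module" and \<iota> :: "('c \<Rightarrow> 'a \<Rightarrow> real) \<Rightarrow> 'v"
    and f g :: "'a \<Rightarrow> real" and Df Dg :: "'a set \<Rightarrow> 'v \<Rightarrow> real"
  assumes "metric_measure_space m"
    and "cotangent_module m T d"
    and "L0_tangent_module m T L \<iota>"
    and "f \<in> BV m \<inter> bcontfun" and "g \<in> BV m \<inter> bcontfun"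
    and "is_BV_differential m T d L \<iota> f Df"
    and "is_BV_differential m T d L \<iota> g Dg"
  shows "(\<lambda>x. f x * g x) \<in> BV m \<and>
    (\<forall>Dfg. is_BV_differential m T d L \<iota> (\<lambda>x. f x * g x) Dfg \<longleftrightarrow>
       Dfg = add_lvm (scale_lvm f Dg) (scale_lvm g Df)) \<and>
    (\<forall>Dfg. is_BV_differential m T d L \<iota> (\<lambda>x. f x * g x) Dfg \<longrightarrow>
       (\<forall>E\<in>sets borel. total_variation (test_module m T d L \<iota>) (LinfTX_norm m L) Dfg E \<le>
          (\<integral>\<^sup>+x\<in>E. ennreal \<bar>f x\<bar> \<partial>total_variation_measure (test_module m T d L \<iota>) (LinfTX_norm m L) Dg) +
          (\<integral>\<^sup>+x\<in>E. ennreal \<bar>g x\<bar> \<partial>total_variation_measure (test_module m T d L \<iota>) (LinfTX_norm m L) Df)))"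
proof -
  interpret tangent_calculus m T d L \<iota>
    using assms(1-3) by (intro tangent_calculus.intro tangent_setting.intro)
  have f: "f \<in> BV m" "f \<in> bcontfun" and g: "g \<in> BV m" "g \<in> bcontfun" using assms(4,5) by auto
  have D: "is_BV_differential m T d L \<iota> (\<lambda>x. f x * g x) Dfg \<longleftrightarrow>
      Dfg = add_lvm (scale_lvm f Dg) (scale_lvm g Df)" for Dfg
    using BV_differential_mult[OF f g assms(6,7)] BV_differential_unique by blast
  show ?thesis
    using BV_mult[OF f g] total_variation_BV_differential_mult_le[OF f g assms(6,7)] unfolding D by simp
qed

end
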